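(* Let $n\ge2$, let $S\subseteq\{1,\dots,n-1\}$ be nonempty with $m:=|S|$, and let $\mathfrak p:=\sum_{i\in S}\mathfrak p_i'$ (a nonzero idempotent prime ideal of $\mathbb S_{n-1}$ of height $m$). For $i,j\in S$ with $i>j$ put $\theta_{ij}:=\theta_{ij}(\{i,j,n\})$. Then: (1) The group $\mathrm{GL}_\infty(\mathbb S_{n-1},\mathfrak p)$ is generated by the elements $\theta_{ij}$ ($i>j$, $i,j\in S$), the groups $U_{\{k,n\}}(K)$ ($k\in S$) and $E_\infty(\mathbb S_{n-1},\mathfrak p)$. (2) Every $a\in\mathrm{GL}_\infty(\mathbb S_{n-1},\mathfrak p)$ is a unique product (with a fixed, arbitrary order of the factors) $$a=\prod_{i>j,\ i,j\in S}\theta_{ij}^{n_{ij}}\cdot\prod_{k\in S}\mu_{\{k,n\}}(\lambda_k)\cdot e,\qquad n_{ij}\in\mathbb Z,\ \lambda_k\in K^*,\ e\in E_\infty(\mathbb S_{n-1},\mathfrak p).$$ (3) $\mathrm{K}_1(\mathbb S_{n-1},\mathfrak p)\simeq\prod_{i>j,\,i,j\in S}\langle\theta_{ij}\rangle\times\prod_{k\in S}U_{\{k,n\}}(K)\simeq\begin{cases}K^*,& m=1,\\ \mathbb Z^{\binom m2}\times (K^* )^m,& m>1.\end{cases}$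
   Context: $K$ is a field, $\mathbb N=\{0,1,\dots\}$. For $n\ge1$, $\mathbb S_n$ is the $K$-algebra generated by $x_1,\dots,x_n,y_1,\dots,y_n$ subject to $y_ix_i=1$ and $[x_i,y_j]=[x_i,x_j]=[y_i,y_j]=0$ for $i\ne j$; $\mathbb S_0:=K$. Put $E_{st}(i):=x_i^sy_i^t-x_i^{s+1}y_i^{t+1}$ ($s,t\in\mathbb N$), $e_i:=E_{00}(i)=1-x_iy_i$, $e_I:=\prod_{i\in I}e_i$. For $J$ with $|J|\ge2$ and distinct $i,j\in J$, $\theta_{ij}(J):=(1+(y_i-1)e_{J\setminus\{i\}})(1+(x_j-1)e_{J\setminus\{j\}})$. For $I\subseteq\{1,\dots,n\}$ and $\lambda\in K^*$, $\mu_I(\lambda):=\lambda e_I+1-e_I$ and $U_I(K):=\{\mu_I(\lambda):\lambda\in K^*\}$. $\mathbb S_{n-1}$ is the subalgebra of $\mathbb S_n$ generated by $x_1,\dots,x_{n-1},y_1,\dots,y_{n-1}$; $\mathfrak p_i'$ is the ideal of $\mathbb S_{n-1}$ generated by $e_i$ ($i\le n-1$), while $\mathfrak p_i$ is the ideal of $\mathbb S_n$ generated by $e_i$. (The nonzero idempotent prime ideals of $\mathbb S_{n-1}$ are exactly the ideals $\sum_{i\in S}\mathfrak p_i'$, $\emptyset\ne S\subseteq\{1,\dots,n-1\}$, of height $|S|$.) For a ring $A$ and ideal $\mathfrak a$: $\mathrm{GL}_\infty(A,\mathfrak a):=\ker(\mathrm{GL}_\infty(A)\to\mathrm{GL}_\infty(A/\mathfrak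 a))$; $E_\infty(A,\mathfrak a)$ is the relative elementary group, the normal subgroup of $E_\infty(A)$ generated by the $\mathfrak a$-elementary matrices $1+aE_{kl}$ ($a\in\mathfrak a$, $k\ne l$); $\mathrm{K}_1(A,\mathfrak a):=\mathrm{GL}_\infty(A,\mathfrak a)/E_\infty(A,\mathfrak a)$. The group $\mathrm{GL}_\infty(\mathbb S_{n-1})$ is identified with the group $(1+\mathfrak p_n)^*$ of units of $\mathbb S_n$ in $1+\mathfrak p_n$ via $(a_{kl})\mapsto1+\sum_{k,l}(a_{kl}-\delta_{kl})E_{kl}(n)$; under it $\mathrm{GL}_\infty(\mathbb S_{n-1},\mathfrak p)$ corresponds to $(1+\mathfrak p\mathfrak p_n)^*$, where $\mathfrak p\mathfrak p_n:=\sum_{i\in S}\mathfrak p_i\mathfrak p_n$, and the elements $\theta_{ij}$, $\mu_{\{k,n\}}(\lambda)$ lie in it. *)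

theory Defs
  imports "HOL-Library.Poly_Mapping" "HOL-Algebra.Elementary_Groups" "HOL-Algebra.Product_Groups"
begin

text \<open>The bicyclic product on exponent pairs: (a,b) stands for x^a y^b, and
 x^a y^b x^c y^d = x^(a + (c - b)) y^((b - c) + d), using the relation y x = 1.\<close>

definition bic :: "nat \<times> nat \<Rightarrow> nat \<times> nat \<Rightarrow> nat \<times> nat" where
  "bic p q = (fst p + (fst q - snd p), (snd p - fst q) + snd q)"

lemma bic_assoc: "bic (bic p q) r = bic p (bic q r)"
  by (cases p; cases q; cases r) (auto simp: bic_def)

text \<open>Monomials of the Jacobson algebras: finitely supported families
 i \<mapsto> (a_i, b_i), standing for the product over i of x_i^(a_i) y_i^(b_i).\<close>

typedef bmono = "{f :: nat \<Rightarrow> nat \<times> nat. finite {i. f i \<noteq> (0,0)}}"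
  by (rule exI[of _ "\<lambda>_. (0,0)"]) simp

setup_lifting type_definition_bmono

instantiation bmono :: monoid_add
begin

lift_definition zero_bmono :: bmono is "\<lambda>_. (0,0)" by simp

lift_definition plus_bmono :: "bmono \<Rightarrow> bmono \<Rightarrow> bmono" is "\<lambda>f g i. bic (f i) (g i)"
proof -
  fix f g :: "nat \<Rightarrow> nat \<times> nat"
  assume "finite {i. f i \<noteq> (0,0)}" "finite {i. g i \<noteq> (0,0)}"
  moreover have "{i. bic (f i) (g i) \<noteq> (0,0)} \<subseteq> {i. f i \<noteq> (0,0)} \<union> {i. g i \<noteq> (0,0)}"
    by (auto simp: bic_def)
  ultimately show "finite {i. bic (f i) (g i) \<noteq> (0,0)}"
    by (meson finite_UnI finite_subset)
qed

instance
proof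
  fix a b c :: bmono
  show "a + b + c = a + (b + c)" by transfer (simp add: bic_assoc)
  show "0 + a = a" by transfer (auto simp: bic_def)
  show "a + 0 = a" by transfer (auto simp: bic_def)
qed

end

text \<open>The ambient algebra: the semigroup algebra over K of the monoid bmono
 (written additively, but noncommutative).  Every S_n is a subalgebra of it.\<close>

type_synonym 'k jac = "bmono \<Rightarrow>\<^sub>0 'k"

lift_definition mono_at :: "nat \<Rightarrow> nat \<times> nat \<Rightarrow> bmono" is
  "\<lambda>i p j. if j = i then p else (0,0)"
  by (rule finite_subset[of _ "{i}" for i]) auto

definition scal :: "'k::field \<Rightarrow> 'k jac" where
  "scal c = Poly_Mapping.single 0 c"

definition X :: "nat \<Rightarrow> 'k::field jac" where
  "X i = Poly_Mapping.single (mono_at i (1,0)) 1"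

definition Y :: "nat \<Rightarrow> 'k::field jac" where
  "Y i = Poly_Mapping.single (mono_at i (0,1)) 1"

inductive_set subalg :: "'k::field jac set \<Rightarrow> 'k jac set" for G where
  gen: "g \<in> G \<Longrightarrow> g \<in> subalg G"
| scal: "scal c \<in> subalg G"
| add: "u \<in> subalg G \<Longrightarrow> v \<in> subalg G \<Longrightarrow> u + v \<in> subalg G"
| mult: "u \<in> subalg G \<Longrightarrow> v \<in> subalg G \<Longrightarrow> u * v \<in> subalg G"

definition Salg :: "nat \<Rightarrow> 'k::field jac set" where
  "Salg n = subalg (X ` {1..n} \<union> Y ` {1..n})"

inductive_set ideal_gen :: "'k::field jac set \<Rightarrow> 'k jac set \<Rightarrow> 'k jac set" for R G where
  zero: "0 \<in> ideal_gen R G"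
| gen: "g \<in> G \<Longrightarrow> a \<in> R \<Longrightarrow> b \<in> R \<Longrightarrow> a * g * b \<in> ideal_gen R G"
| add: "u \<in> ideal_gen R G \<Longrightarrow> v \<in> ideal_gen R G \<Longrightarrow> u + v \<in> ideal_gen R G"

definition Est :: "nat \<Rightarrow> nat \<Rightarrow> nat \<Rightarrow> 'k::field jac" where
  "Est s t i = X i ^ s * Y i ^ t - X i ^ (s + 1) * Y i ^ (t + 1)"

definition ee :: "nat \<Rightarrow> 'k::field jac" where
  "ee i = 1 - X i * Y i"

text \<open>e_I = product of e_i over i in I (the e_i commute; we multiply in increasing order).\<close>

definition eI :: "nat set \<Rightarrow> 'k::field jac" where
  "eI I = prod_list (map ee (sorted_list_of_set I))"

definition theta :: "nat \<Rightarrow> nat \<Rightarrow> nat set \<Rightarrow> 'k::field jac" where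
  "theta i j J = (1 + (Y i - 1) * eI (J - {i})) * (1 + (X j - 1) * eI (J - {j}))"

definition mu :: "nat set \<Rightarrow> 'k::field \<Rightarrow> 'k jac" where
  "mu I c = scal c * eI I + 1 - eI I"

definition UI :: "nat set \<Rightarrow> 'k::field jac set" where
  "UI I = {mu I c | c. c \<noteq> 0}"

type_synonym 'k mat = "nat \<Rightarrow> nat \<Rightarrow> 'k jac"

definition idm :: "'k::field mat" where
  "idm k l = (if k = l then 1 else 0)"

definition fin_dev :: "'k::field mat \<Rightarrow> bool" where
  "fin_dev M \<longleftrightarrow> finite {(k,l). M k l \<noteq> idm k l}"

definition mmult :: "'k::field mat \<Rightarrow> 'k mat \<Rightarrow> 'k mat" where
  "mmult M N k l = (\<Sum>j\<in>{j. M k j \<noteq> 0}. M k j * N j l)"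

definition GLset :: "'k::field jac set \<Rightarrow> 'k mat set" where
  "GLset A = {M. fin_dev M \<and> (\<forall>k l. M k l \<in> A) \<and>
      (\<exists>N. fin_dev N \<and> (\<forall>k l. N k l \<in> A) \<and> mmult M N = idm \<and> mmult N M = idm)}"

definition GLinf :: "'k::field jac set \<Rightarrow> 'k mat monoid" where
  "GLinf A = \<lparr>carrier = GLset A, mult = mmult, one = idm\<rparr>"

text \<open>GL_infinity(A, a) = kernel of GL_infinity(A) \<rightarrow> GL_infinity(A/a).\<close>

definition GLrel :: "'k::field jac set \<Rightarrow> 'k jac set \<Rightarrow> 'k mat set" where
  "GLrel A a = {M \<in> GLset A. \<forall>k l. M k l - idm k l \<in> a}"

definition GLrel_grp :: "'k::field jac set \<Rightarrow> 'k jac set \<Rightarrow> 'k mat monoid" where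
  "GLrel_grp A a = (GLinf A)\<lparr>carrier := GLrel A a\<rparr>"

definition elem :: "nat \<Rightarrow> nat \<Rightarrow> 'k::field jac \<Rightarrow> 'k mat" where
  "elem k l c = (\<lambda>i j. idm i j + (if i = k \<and> j = l then c else 0))"

definition Einf :: "'k::field jac set \<Rightarrow> 'k mat set" where
  "Einf A = generate (GLinf A) {elem k l c | k l c. k \<noteq> l \<and> c \<in> A}"

definition Erel :: "'k::field jac set \<Rightarrow> 'k jac set \<Rightarrow> 'k mat set" where
  "Erel A a = generate (GLinf A)
     {g \<otimes>\<^bsub>GLinf A\<^esub> elem k l c \<otimes>\<^bsub>GLinf A\<^esub> inv\<^bsub>GLinf A\<^esub> g | g k l c.
        g \<in> Einf A \<and> k \<noteq> l \<and> c \<in> a}"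

definition K1rel :: "'k::field jac set \<Rightarrow> 'k jac set \<Rightarrow> 'k mat set monoid" where
  "K1rel A a = GLrel_grp A a Mod Erel A a"

text \<open>The identification GL_infinity(S_{n-1}) = (1 + p_n)^* inside S_n.\<close>

definition iota :: "nat \<Rightarrow> 'k::field mat \<Rightarrow> 'k jac" where
  "iota n M = 1 + (\<Sum>(k,l)\<in>{(k,l). M k l \<noteq> idm k l}. (M k l - idm k l) * Est k l n)"

definition pre :: "nat \<Rightarrow> 'k::field jac \<Rightarrow> 'k mat" where
  "pre n u = inv_into (GLset (Salg (n - 1))) (iota n) u"

definition Kstar :: "'k::field monoid" where
  "Kstar = \<lparr>carrier = {c. c \<noteq> 0}, mult = (*), one = 1\<rparr>"

end

theory Submission
  imports "Jordan_Normal_Form.Determinant" "HOL-Computational_Algebra.Fraction_Field" Defs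
begin

text \<open>For a finite set J of indices let x_i and y_i act as shifts if i is in J, and send x_i to an
  invertible variable t_i otherwise. This is a representation rho_J of S_n by row and column finite
  matrices. It is faithful for J = {1..n}, and if u is killed by rho_(J - i) for every i in J,
  then rho_J u has finitely many nonzero entries, which are Laurent polynomials in the t_i.

  Generation: let a be a unit in 1 + p p_n and let J be minimal with rho_J a different from 1. Since the
  special Whitehead group of a Laurent polynomial ring over a field is trivial, rho_J a is elementary up
  to its determinant, a scalar times a monomial in the t_l. The elementary part lifts to
  E(S_(n-1), p), the scalar is removed by mu_J, and a power of t_l by a power of theta_lj(J + l);
  if no such theta is available, the exponent of t_l is a Fredholm index and vanishes. When J has more than
  two elements, these mu and theta are themselves in E(S_(n-1), p). Repeating this makes a trivial
  under every rho_J.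

  Uniqueness: the determinants of rho_{k,n} a for k in S are trivial on E(S_(n-1), p) and independent
  on the generators theta and mu.\<close>

section \<open>Units of a ring\<close>

text \<open>The triviality of the special Whitehead group costs most of the work. Over the fraction
  field it is Gaussian elimination; the variables are then taken out of the denominators one by one.
  An elementary matrix with denominators in one more variable t has a common denominator, up to a
  unit a monic f in t. That a relation using 1/f holds without it is shown by a symbol: the class in
  K1 that remains when a linear pencil is stripped off. Companion matrices give f a symbol, symbols
  multiply, and multiplying by f on a large block clears the denominator of an elementary matrix
  without changing the symbol of that block. Two more obstacles shape the rest. All elementary
  matrices must lie in the relative group of p, so explicit commutators with a factor in p replace
  the usual absolute identities. And the determinants used for uniqueness must survive conjugation
  by elementary matrices over S_(n-1), whose images need not be finite perturbations of 1;
  multiplicativity of the determinant does not reach them, but det (1 + a b) = det (1 + b a)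
  does.\<close>

definition unt :: "'w::ring_1 \<Rightarrow> bool" where
  "unt u \<longleftrightarrow> (\<exists>v. u * v = 1 \<and> v * u = 1)"

definition uinv :: "'w::ring_1 \<Rightarrow> 'w" where
  "uinv u = (THE v. u * v = 1 \<and> v * u = 1)"

lemma uinv_eq:
  fixes u v :: "'w::ring_1"
  assumes "u * v = 1" "v * u = 1"
  shows "uinv u = v"
  unfolding uinv_def
proof (rule the_equality)
  fix w assume "u * w = 1 \<and> w * u = 1"
  then show "w = v" by (metis assms(2) mult.assoc mult.left_neutral mult.right_neutral)
qed (use assms in simp)

lemma untI: "u * v = 1 ==> v * u = 1 ==> unt u"
  unfolding unt_def by blast

lemma unt_inv: "unt u ==> u * uinv u = 1" "unt u ==> uinv u * u = 1"
  unfolding unt_def using uinv_eq by blast+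

lemma unt_inv_cancel [simp]:
  assumes "unt u"
  shows "u * uinv u = 1" "uinv u * u = 1" "u * (uinv u * z) = z" "uinv u * (u * z) = z"
  using unt_inv[OF assms] by (simp_all flip: mult.assoc)

lemma unt_uinv [simp]: "unt u ==> unt (uinv u)"
  using unt_inv untI by blast

lemma uinv_uinv [simp]: "unt u ==> uinv (uinv u) = u"
  by (simp add: uinv_eq)

lemma unt_one [simp]: "unt 1" and uinv_one [simp]: "uinv (1::'w::ring_1) = 1"
  by (auto intro!: untI[of 1 1] uinv_eq)

lemma unt_mult [simp]: "unt u ==> unt v ==> unt (u * v)"
  by (rule untI[of _ "uinv v * uinv u"]) (simp_all add: mult.assoc)

lemma uinv_mult: "unt u ==> unt v ==> uinv (u * v) = uinv v * uinv u"
  by (rule uinv_eq) (simp_all add: mult.assoc)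

section \<open>Finite matrices in a ring with a one-sided inverse pair\<close>

text \<open>With y x = 1, the elements x^k (1 - x y) y^l multiply like matrix units, and 1 - x^r y^r
  is the identity matrix of size r; left multiplication by x^r and right multiplication by y^r
  move a matrix to another block.\<close>

locale shift_pair =
  fixes x y :: "'w::ring_1"
  assumes yx: "y * x = 1"
begin

definition mx :: "nat \<Rightarrow> nat \<Rightarrow> 'w" where
  "mx k l = x ^ k * (1 - x * y) * y ^ l"

definition pr :: "nat \<Rightarrow> 'w" where
  "pr r = 1 - x ^ r * y ^ r"

lemma yx_pow: "y ^ k * x ^ k = 1"
proof (induction k)
  case (Suc k)
  have "y ^ Suc k * x ^ Suc k = y ^ k * (y * x) * x ^ k"
    by (simp only: power_Suc2[of y] power_Suc[of x] mult.assoc)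
  then show ?case using Suc yx by simp
qed simp

lemma yx_pow_simps [simp]: "y ^ k * x ^ k = 1" "y ^ k * (x ^ k * z) = z"
  using yx_pow by (simp_all flip: mult.assoc)

lemma y_pow_x_pow: "y ^ k * x ^ l = (if k \<le> l then x ^ (l - k) else y ^ (k - l))"
proof (cases "k \<le> l")
  case True
  have "y ^ k * x ^ l = y ^ k * (x ^ k * x ^ (l - k))"
    using True by (simp flip: power_add)
  then show ?thesis using True by simp
next
  case False
  have "y ^ k * x ^ l = y ^ (k - l) * y ^ l * x ^ l"
    using False by (simp flip: power_add)
  then show ?thesis using False by (simp add: mult.assoc)
qed

lemma e_x: "(1 - x * y) * x = 0" and y_e: "y * (1 - x * y) = 0"
  using yx by (simp_all add: algebra_simps) (simp add: mult.assoc[symmetric])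

lemma e_xpow: "(1 - x * y) * x ^ k = (if k = 0 then 1 - x * y else 0)"
proof (cases k)
  case (Suc m)
  then show ?thesis using e_x by (simp flip: mult.assoc)
qed simp

lemma ypow_e: "y ^ k * (1 - x * y) = (if k = 0 then 1 - x * y else 0)"
proof (cases k)
  case (Suc m)
  then show ?thesis using y_e by (simp only: power_Suc2 mult.assoc) simp
qed simp

lemma e_idem: "(1 - x * y) * (1 - x * y) = 1 - x * y"
  using e_x by (simp add: right_diff_distrib flip: mult.assoc)

lemma x_mx [simp]: "x ^ r * mx k l = mx (r + k) l"
  by (simp add: mx_def power_add mult.assoc)

lemma mx_y [simp]: "mx k l * y ^ r = mx k (l + r)"
  by (simp add: mx_def power_add mult.assoc)

lemma y_mx: "y ^ r * mx k l = (if r \<le> k then mx (k - r) l else 0)"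
proof -
  have "y ^ r * mx k l = (y ^ r * x ^ k) * (1 - x * y) * y ^ l"
    by (simp add: mx_def mult.assoc)
  then show ?thesis using ypow_e by (simp add: y_pow_x_pow mx_def)
qed

lemma mx_x: "mx k l * x ^ r = (if r \<le> l then mx k (l - r) else 0)"
proof -
  have "mx k l * x ^ r = x ^ k * ((1 - x * y) * (y ^ l * x ^ r))"
    by (simp add: mx_def mult.assoc)
  then show ?thesis using e_xpow by (simp add: y_pow_x_pow mx_def mult.assoc)
qed

lemma mx_mult: "mx k l * mx m n = (if l = m then mx k n else 0)"
proof -
  have eq: "mx k l * mx m n = (mx k l * x ^ m) * (1 - x * y) * y ^ n"
    by (simp add: mx_def mult.assoc)
  show ?thesis
  proof (cases "m \<le> l")
    case True
    have "mx k (l - m) * (1 - x * y) = (if l = m then mx k 0 else 0)"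
      using True ypow_e[of "l - m"] e_idem by (simp add: mx_def mult.assoc)
    then have "mx k (l - m) * (1 - x * y) * y ^ n = (if l = m then mx k n else 0)"
      by simp
    then show ?thesis using eq True by (simp only: mx_x if_True)
  next
    case False
    then show ?thesis using eq mx_x by simp
  qed
qed

lemma pr_mx: "pr r * mx k l = (if k < r then mx k l else 0)"
proof -
  have "pr r * mx k l = mx k l - x ^ r * (y ^ r * mx k l)"
    by (simp add: pr_def left_diff_distrib mult.assoc)
  then show ?thesis by (simp add: y_mx)
qed

lemma mx_pr: "mx k l * pr r = (if l < r then mx k l else 0)"
proof -
  have "mx k l * pr r = mx k l - (mx k l * x ^ r) * y ^ r"
    by (simp add: pr_def right_diff_distrib mult.assoc)
  then show ?thesis by (simp add: mx_x)
qed

lemma y_pr [simp]: "y ^ r * pr r = 0" "y ^ r * (pr r * z) = 0"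
  and pr_x [simp]: "pr r * x ^ r = 0" "pr r * (x ^ r * z) = 0"
proof -
  show 1: "y ^ r * pr r = 0" by (simp add: pr_def algebra_simps)
  show 2: "pr r * x ^ r = 0" by (simp add: pr_def algebra_simps mult.assoc)
  show "y ^ r * (pr r * z) = 0" "pr r * (x ^ r * z) = 0"
    using 1 2 by (simp_all flip: mult.assoc)
qed

lemma pr_le: "r \<le> s ==> pr r * pr s = pr r" "r \<le> s ==> pr s * pr r = pr r"
proof -
  assume rs: "r \<le> s"
  then obtain d where d: "s = r + d" using le_Suc_ex by blast
  have "y ^ r * (x ^ s * y ^ s) = x ^ d * y ^ s" "x ^ s * (y ^ s * x ^ r) = x ^ s * y ^ d"
    using y_pow_x_pow[of s r] rs
    by (auto simp: d power_add mult.assoc y_pow_x_pow)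
  then have 1: "x ^ r * y ^ r * (x ^ s * y ^ s) = x ^ s * y ^ s"
    and 2: "x ^ s * y ^ s * (x ^ r * y ^ r) = x ^ s * y ^ s"
    unfolding d by (simp_all add: mult.assoc power_add)
      (metis (no_types, lifting) add.commute mult.assoc power_add)
  show "pr r * pr s = pr r" "pr s * pr r = pr r"
    using 1 2 by (simp_all add: pr_def algebra_simps)
qed

lemma pr_idem [simp]: "pr r * pr r = pr r" "pr r * (pr r * z) = pr r * z"
  using pr_le[of r r] by (simp_all flip: mult.assoc)

end

section \<open>Finite matrices, general linear and elementary groups over a coefficient ring\<close>

locale coeff_ring = shift_pair x y for x y :: "'w::ring_1" +
  fixes C :: "'w set"
  assumes C_0: "0 \<in> C" and C_1: "1 \<in> C"
    and C_add: "c \<in> C ==> d \<in> C ==> c + d \<in> C"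
    and C_neg: "c \<in> C ==> - c \<in> C"
    and C_mult: "c \<in> C ==> d \<in> C ==> c * d \<in> C"
    and C_x: "c \<in> C ==> c * x = x * c" and C_y: "c \<in> C ==> c * y = y * c"
begin

definition idl :: "'w set \<Rightarrow> bool" where
  "idl D \<longleftrightarrow> D \<subseteq> C \<and> 0 \<in> D \<and> (\<forall>c\<in>D. \<forall>d\<in>D. c + d \<in> D)
     \<and> (\<forall>c\<in>C. \<forall>d\<in>D. c * d \<in> D \<and> d * c \<in> D)"

lemma idl_C: "idl C"
  using C_0 C_add C_mult by (auto simp: idl_def)

lemma idl_neg: "idl D ==> c \<in> D ==> - c \<in> D"
  using C_neg[OF C_1] unfolding idl_def by (metis mult_minus1)

lemma C_xpow: "c \<in> C ==> c * x ^ k = x ^ k * c"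
proof (induction k)
  case (Suc k)
  then have "c * x ^ Suc k = x * (c * x ^ k)" by (metis C_x mult.assoc power_Suc)
  then show ?case using Suc by (simp add: mult.assoc)
qed simp

lemma C_ypow: "c \<in> C ==> c * y ^ k = y ^ k * c"
proof (induction k)
  case (Suc k)
  then have "c * y ^ Suc k = y * (c * y ^ k)" by (metis C_y mult.assoc power_Suc)
  then show ?case using Suc by (simp add: mult.assoc)
qed simp

lemma C_mx: assumes "c \<in> C" shows "c * mx k l = mx k l * c"
proof -
  have "c * (1 - x * y) = (1 - x * y) * c"
    using C_x[OF assms] C_y[OF assms] by (simp add: algebra_simps) (metis mult.assoc)
  then show ?thesis unfolding mx_def using C_xpow[OF assms, of k] C_ypow[OF assms, of l]
    by (metis mult.assoc)
qed

lemma C_pr: assumes "c \<in> C" shows "c * pr r = pr r * c"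
proof -
  have "c * (x ^ r * y ^ r) = x ^ r * y ^ r * c"
    using C_xpow[OF assms, of r] C_ypow[OF assms, of r] by (metis mult.assoc)
  then show ?thesis by (simp add: pr_def algebra_simps)
qed

inductive_set Fin :: "'w set \<Rightarrow> 'w set" for D where
  zero: "0 \<in> Fin D"
| step: "c \<in> D ==> u \<in> Fin D ==> c * mx k l + u \<in> Fin D"

lemma Fin_mx: "c \<in> D ==> c * mx k l \<in> Fin D"
  using Fin.step[OF _ Fin.zero] by simp

lemma Fin_mono: "D \<subseteq> D' ==> u \<in> Fin D ==> u \<in> Fin D'"
  by (rotate_tac, induction u rule: Fin.induct) (auto intro: Fin.intros)

lemma Fin_C: "idl D ==> u \<in> Fin D ==> u \<in> Fin C"
  using Fin_mono idl_def by metis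

lemma Fin_add: "u \<in> Fin D ==> v \<in> Fin D ==> u + v \<in> Fin D"
  by (induction u rule: Fin.induct) (auto simp: add.assoc intro: Fin.intros)

lemma Fin_neg: "idl D ==> u \<in> Fin D ==> - u \<in> Fin D"
proof (rotate_tac, induction u rule: Fin.induct)
  case (step c u k l)
  then have "- c * mx k l + - u \<in> Fin D" using idl_neg Fin.step by blast
  then show ?case by simp
qed (simp add: Fin.zero)

lemma Fin_diff: "idl D ==> u \<in> Fin D ==> v \<in> Fin D ==> u - v \<in> Fin D"
  using Fin_add[OF _ Fin_neg] by (metis uminus_add_conv_diff add.commute)

lemma Fin_mult_l:
  assumes D: "idl D" and "u \<in> Fin C" "v \<in> Fin D" shows "u * v \<in> Fin D"
  using assms(2)
proof (induction u rule: Fin.induct)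
  case (step c u k l)
  have "c * mx k l * v \<in> Fin D" using assms(3)
  proof (induction v rule: Fin.induct)
    case (step d v k' l')
    have "d \<in> C" using D step by (auto simp: idl_def)
    then have "c * mx k l * (d * mx k' l') = c * d * (mx k l * mx k' l')"
      using C_mx[of d k l] by (metis mult.assoc)
    then have "c * mx k l * (d * mx k' l') \<in> Fin D"
      using D step(1) \<open>c \<in> C\<close> by (auto simp: mx_mult idl_def intro: Fin_mx Fin.zero)
    then show ?case using step Fin_add by (simp add: distrib_left)
  qed (simp add: Fin.zero)
  then show ?case using step Fin_add by (simp add: distrib_right)
qed (simp add: Fin.zero)

lemma Fin_mult_r:
  assumes D: "idl D" and "u \<in> Fin D" "v \<in> Fin C" shows "u * v \<in> Fin D"
  using assms(2)
proof (induction u rule: Fin.induct)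
  case (step c u k l)
  have "c * mx k l * v \<in> Fin D" using assms(3)
  proof (induction v rule: Fin.induct)
    case (step d v k' l')
    have "c * mx k l * (d * mx k' l') = c * d * (mx k l * mx k' l')"
      using C_mx[of d k l] step by (metis mult.assoc)
    then have "c * mx k l * (d * mx k' l') \<in> Fin D"
      using D step(1) \<open>c \<in> D\<close> by (auto simp: mx_mult idl_def intro: Fin_mx Fin.zero)
    then show ?case using step Fin_add by (simp add: distrib_left)
  qed (simp add: Fin.zero)
  then show ?case using step Fin_add by (simp add: distrib_right)
qed (simp add: Fin.zero)

lemma Fin_mult: "idl D ==> u \<in> Fin D ==> v \<in> Fin D ==> u * v \<in> Fin D"
  using Fin_mult_l Fin_C by blast

lemma Fin_xl: "idl D ==> u \<in> Fin D ==> x ^ r * u \<in> Fin D"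
proof (rotate_tac, induction u rule: Fin.induct)
  case (step c u k l)
  have "x ^ r * (c * mx k l) = c * mx (r + k) l"
    using C_xpow[of c r] step by (metis (no_types) idl_def in_mono mult.assoc x_mx)
  then show ?case using step by (auto simp: distrib_left intro: Fin.step)
qed (simp add: Fin.zero)

lemma Fin_yr: "u \<in> Fin D ==> u * y ^ r \<in> Fin D"
  by (induction u rule: Fin.induct) (auto simp: distrib_right mult.assoc intro: Fin.intros)

lemma Fin_bound:
  assumes "idl D" "u \<in> Fin D"
  shows "\<exists>r. \<forall>s\<ge>r. pr s * u = u \<and> u * pr s = u"
  using assms(2)
proof (induction u rule: Fin.induct)
  case (step c u k l)
  then obtain r where r: "\<And>s. s \<ge> r ==> pr s * u = u \<and> u * pr s = u" by blast
  have c: "c \<in> C" using step assms by (auto simp: idl_def)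
  have "pr s * (c * mx k l + u) = c * mx k l + u \<and> (c * mx k l + u) * pr s = c * mx k l + u"
    if "s \<ge> max r (Suc (max k l))" for s
  proof -
    have "pr s * (c * mx k l) = c * (pr s * mx k l)" using C_pr[OF c] by (metis mult.assoc)
    then show ?thesis using that r[of s]
      by (auto simp: distrib_left distrib_right mult.assoc pr_mx mx_pr)
  qed
  then show ?case by blast
qed simp

lemma Fin_one: "1 * pr r \<in> Fin C"
proof (induction r)
  case (Suc r)
  have "pr (Suc r) = mx r r + pr r"
    by (simp only: mx_def pr_def power_Suc2[of x] power_Suc[of y])
      (simp add: algebra_simps)
  then show ?case using Suc Fin_add Fin_mx[OF C_1, of r r] by simp
qed (simp add: pr_def Fin.zero)

lemma Fin_pr: "pr r \<in> Fin C" using Fin_one by simp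

text \<open>Only the element itself is asked to be congruent to 1 modulo D; \<open>GL_inv\<close>
  shows that its inverse then is so too, because D absorbs products with finite matrices over
  C.\<close>

definition GL :: "'w set \<Rightarrow> 'w set" where
  "GL D = {u. u - 1 \<in> Fin D \<and> unt u \<and> uinv u - 1 \<in> Fin C}"

lemma GLI: "u - 1 \<in> Fin D ==> v - 1 \<in> Fin C ==> u * v = 1 ==> v * u = 1 ==> u \<in> GL D"
  unfolding GL_def using uinv_eq untI by (metis (mono_tags, lifting) mem_Collect_eq)

lemma GL_unt: "u \<in> GL D ==> unt u" by (simp add: GL_def)

lemma GL_C: "idl D ==> u \<in> GL D ==> u \<in> GL C"
  by (auto simp: GL_def intro: Fin_C)

lemma GL_1: "1 \<in> GL D" by (simp add: GL_def Fin.zero)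

lemma one_Fin_mult:
  assumes "idl D" "u - 1 \<in> Fin D" "v - 1 \<in> Fin D" shows "u * v - 1 \<in> Fin D"
proof -
  have "u * v - 1 = (u - 1) * (v - 1) + ((u - 1) + (v - 1))" by (simp add: algebra_simps)
  then show ?thesis using assms Fin_mult Fin_add by metis
qed

lemma GL_mult: assumes "idl D" "u \<in> GL D" "v \<in> GL D" shows "u * v \<in> GL D"
  using assms one_Fin_mult[OF assms(1)] one_Fin_mult[OF idl_C]
  by (auto simp: GL_def uinv_mult)

lemma GL_inv: assumes "idl D" "u \<in> GL D" shows "uinv u \<in> GL D"
proof -
  have u: "u - 1 \<in> Fin D" "unt u" "uinv u - 1 \<in> Fin C" using assms by (auto simp: GL_def)
  have "uinv u - 1 = - (u - 1) - (uinv u - 1) * (u - 1)" using u(2) by (simp add: algebra_simps)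
  then have "uinv u - 1 \<in> Fin D"
    using Fin_diff[OF assms(1) Fin_neg[OF assms(1) u(1)] Fin_mult_l[OF assms(1) u(3,1)]] by simp
  then show ?thesis using u Fin_C[OF assms(1) u(1)] by (simp add: GL_def)
qed

lemma elem_inv:
  assumes "c \<in> C" "k \<noteq> l"
  shows "(1 + c * mx k l) * (1 + - c * mx k l) = 1" "(1 + - c * mx k l) * (1 + c * mx k l) = 1"
proof -
  have "mx k l * (c * mx k l) = 0"
    using C_mx[OF assms(1), of k l] assms(2) mx_mult[of k l k l] by (metis mult.assoc mult_zero_right)
  then show "(1 + c * mx k l) * (1 + - c * mx k l) = 1" "(1 + - c * mx k l) * (1 + c * mx k l) = 1"
    by (simp_all add: algebra_simps mult.assoc)
qed

lemma elem_GL: assumes "idl D" "c \<in> D" "k \<noteq> l" shows "1 + c * mx k l \<in> GL D"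
proof (rule GLI[of _ _ "1 + - c * mx k l"])
  have "c \<in> C" using assms by (auto simp: idl_def)
  then show "1 + - c * mx k l - 1 \<in> Fin C" using Fin_mx[OF C_neg] by simp
  show "1 + c * mx k l - 1 \<in> Fin D" using Fin_mx assms by simp
qed (use elem_inv assms in \<open>auto simp: idl_def\<close>)

inductive_set El :: "'w set \<Rightarrow> 'w set" for D where
  one: "1 \<in> El D"
| step: "c \<in> D ==> k \<noteq> l ==> g \<in> El D ==> (1 + c * mx k l) * g \<in> El D"

text \<open>Words in conjugates suffice: the inverse of \<open>1 + c * mx k l\<close> has the same
  form with -c, so closure under inverses is a consequence (\<open>Er_inv\<close>). The conjugating
  matrices are elementary over all of C, not over D.\<close>

inductive_set Er :: "'w set \<Rightarrow> 'w set" for D where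
  one: "1 \<in> Er D"
| step: "g \<in> El C ==> c \<in> D ==> k \<noteq> l ==> h \<in> Er D
         ==> g * (1 + c * mx k l) * uinv g * h \<in> Er D"

lemma El_GL: "idl D ==> g \<in> El D ==> g \<in> GL D"
  by (rotate_tac, induction g rule: El.induct) (auto intro: GL_1 GL_mult elem_GL)

lemma El_elem: "c \<in> D ==> k \<noteq> l ==> 1 + c * mx k l \<in> El D"
  using El.step[OF _ _ El.one] by simp

lemma El_mult: "g \<in> El D ==> h \<in> El D ==> g * h \<in> El D"
  by (induction g rule: El.induct) (auto simp: mult.assoc intro: El.step)

lemma El_inv: "idl D ==> g \<in> El D ==> uinv g \<in> El D"
proof (rotate_tac, induction g rule: El.induct)
  case (step c k l g)
  have c: "c \<in> C" using step by (auto simp: idl_def)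
  have "uinv (1 + c * mx k l) = 1 + - c * mx k l" using uinv_eq elem_inv[OF c step(2)] by blast
  then have "uinv ((1 + c * mx k l) * g) = uinv g * (1 + - c * mx k l)"
    using uinv_mult[OF GL_unt[OF elem_GL] GL_unt[OF El_GL]] step by metis
  then show ?case using step El_mult[OF _ El_elem] idl_neg by metis
qed (simp add: El.one)

lemma El_mono: "D \<subseteq> D' ==> g \<in> El D ==> g \<in> El D'"
  by (rotate_tac, induction g rule: El.induct) (auto intro: El.intros)

lemma El_C: "idl D ==> g \<in> El D ==> g \<in> El C"
  using El_mono idl_def by metis

lemma El_unt: "g \<in> El C ==> unt g" using El_GL[OF idl_C] GL_unt by blast

lemma Er_mult: "g \<in> Er D ==> h \<in> Er D ==> g * h \<in> Er D"
  by (induction g rule: Er.induct) (auto simp: mult.assoc intro: Er.step[unfolded mult.assoc])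

lemma Er_conj: "g \<in> El C ==> h \<in> Er D ==> g * h * uinv g \<in> Er D"
proof (rotate_tac, induction h rule: Er.induct)
  case one
  then show ?case using El_unt by (simp add: Er.one)
next
  case (step a c k l h)
  have "g * (a * (1 + c * mx k l) * uinv a * h) * uinv g
      = (g * a) * (1 + c * mx k l) * uinv (g * a) * (g * h * uinv g)"
    using El_unt[OF \<open>g \<in> El C\<close>] El_unt[OF \<open>a \<in> El C\<close>] by (simp add: uinv_mult mult.assoc)
  then show ?case using step Er.step[OF El_mult[OF \<open>g \<in> El C\<close>]] by metis
qed

lemma Er_elem: "c \<in> D ==> k \<noteq> l ==> 1 + c * mx k l \<in> Er D"
  using Er.step[OF El.one _ _ Er.one] by simp

lemma El_Er: "g \<in> El D ==> g \<in> Er D"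
  by (induction g rule: El.induct) (auto intro: Er.one Er_mult Er_elem)

lemma Er_GL: "idl D ==> g \<in> Er D ==> g \<in> GL D"
proof (rotate_tac, induction g rule: Er.induct)
  case (step g c k l h)
  have g: "g \<in> GL C" using El_GL[OF idl_C] step by blast
  have c: "c \<in> C" using step by (auto simp: idl_def)
  let ?z = "g * (1 + c * mx k l) * uinv g"
  have zC: "?z \<in> GL C"
    using GL_mult[OF idl_C GL_mult[OF idl_C g elem_GL[OF idl_C c step(3)]] GL_inv[OF idl_C g]] .
  have "?z - 1 = g * (c * mx k l) * uinv g"
    using GL_unt[OF g] by (simp add: algebra_simps)
  also have "\<dots> = (g - 1) * (c * mx k l) * (uinv g - 1) + (g - 1) * (c * mx k l)
       + c * mx k l * (uinv g - 1) + c * mx k l"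
    by (simp add: algebra_simps)
  finally have "?z - 1 \<in> Fin D"
    using g Fin_mult_l[OF step(6)] Fin_mult_r[OF step(6)] Fin_mx[OF step(2), of k l] Fin_add
    by (auto simp: GL_def)
  then have "?z \<in> GL D" using zC by (auto simp: GL_def)
  then show ?case using GL_mult[OF step(6)] step by blast
qed (simp add: GL_1)

lemma Er_unt: "idl D ==> g \<in> Er D ==> unt g" using Er_GL GL_unt by blast

lemma Er_inv: "idl D ==> g \<in> Er D ==> uinv g \<in> Er D"
proof (rotate_tac, induction g rule: Er.induct)
  case (step g c k l h)
  have c: "c \<in> C" using step by (auto simp: idl_def)
  have u: "unt g" "unt h" "unt (1 + c * mx k l)"
    using step El_unt Er_unt elem_GL GL_unt by blast+
  have "uinv (1 + c * mx k l) = 1 + - c * mx k l" using uinv_eq elem_inv[OF c step(3)] by blast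
  then have "uinv (g * (1 + c * mx k l) * uinv g * h)
     = uinv h * (g * (1 + - c * mx k l) * uinv g * 1)"
    using u by (simp add: uinv_mult mult.assoc)
  then show ?case using step Er_mult Er.step[OF _ _ _ Er.one] idl_neg by metis
qed (simp add: Er.one)

lemma Er_C_El: "g \<in> Er C ==> g \<in> El C"
  by (induction g rule: Er.induct) (auto intro!: El.one El_mult El_elem El_inv[OF idl_C])

text \<open>All rows lie below r and all columns at r or beyond, so any two such matrices multiply
  to zero and the elementary factors of the single entries just add up.\<close>

lemma upper_El:
  assumes D: "idl D" and "u \<in> Fin D" "pr r * u = u" "u * pr r = 0"
  shows "1 + u \<in> El D"
proof -
  have "1 + pr r * v * (1 - pr r) \<in> El D" if "v \<in> Fin D" for v
    using that
  proof (induction v rule: Fin.induct)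
    case (step c v k l)
    have c: "c \<in> C" using D step by (auto simp: idl_def)
    have 0: "(1 - pr r) * (pr r * z) = 0" for z by (simp add: algebra_simps)
    have "pr r * (c * mx k l) = c * (pr r * mx k l)" using C_pr[OF c] by (metis mult.assoc)
    then have eq: "pr r * (c * mx k l) * (1 - pr r) = (if k < r \<and> r \<le> l then c * mx k l else 0)"
      by (auto simp: pr_mx mx_pr right_diff_distrib mult.assoc)
    have "1 + pr r * (c * mx k l) * (1 - pr r) \<in> El D"
      unfolding eq using step(1) El_elem[of c D k l] by (auto intro: El.one)
    from El_mult[OF this step(3)] show ?case
      using 0 by (simp add: algebra_simps mult.assoc)
  qed (simp add: El.one)
  from this[OF assms(2)] show ?thesis using assms by (simp add: right_diff_distrib)
qed

lemma lower_El:
  assumes D: "idl D" and "u \<in> Fin D" "pr r * u = 0" "u * pr r = u"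
  shows "1 + u \<in> El D"
proof -
  have "1 + (1 - pr r) * v * pr r \<in> El D" if "v \<in> Fin D" for v
    using that
  proof (induction v rule: Fin.induct)
    case (step c v k l)
    have c: "c \<in> C" using D step by (auto simp: idl_def)
    have 0: "pr r * ((1 - pr r) * z) = 0" for z
      by (simp add: algebra_simps)
    have "pr r * (c * mx k l) = c * (pr r * mx k l)" using C_pr[OF c] by (metis mult.assoc)
    then have eq: "(1 - pr r) * (c * mx k l) * pr r = (if r \<le> k \<and> l < r then c * mx k l else 0)"
      by (auto simp: pr_mx mx_pr left_diff_distrib mult.assoc)
    have "1 + (1 - pr r) * (c * mx k l) * pr r \<in> El D"
      unfolding eq using step(1) El_elem[of c D k l] by (auto intro: El.one)
    from El_mult[OF this step(3)] show ?case
      using 0 by (simp add: algebra_simps mult.assoc)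
  qed (simp add: El.one)
  from this[OF assms(2)] show ?thesis using assms by (simp add: left_diff_distrib)
qed

text \<open>Seen as 2 x 2 matrices of blocks of size r, the right factor \<open>y ^ r\<close> moves
  the block c to the upper right corner and the left factor \<open>x ^ r\<close> moves it to the
  lower left one.\<close>

lemma block_El:
  assumes "idl D" "c \<in> Fin D" "pr r * c = c" "c * pr r = c"
  shows "1 + c * y ^ r \<in> El D" "1 + x ^ r * c \<in> El D"
proof -
  show "1 + c * y ^ r \<in> El D"
    by (rule upper_El[OF assms(1) Fin_yr[OF assms(2)], of r])
      (use assms in \<open>simp_all add: mult.assoc flip: mult.assoc[of "pr r" c]\<close>)
  show "1 + x ^ r * c \<in> El D"
    by (rule lower_El[OF assms(1) Fin_xl[OF assms(1,2)], of r]) (use assms in \<open>simp_all add: mult.assoc\<close>)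
qed

end

text \<open>A factorization of the block matrix diag (u, v), v the inverse of u, in which the only
  factors with entries outside the ideal generated by q and q' are the conjugating pair
  \<open>1 + f * Y\<close> and \<open>1 + - f * Y\<close>. This form is what makes the relative
  version possible.\<close>

lemma whitehead_identity:
  fixes X Y f u v q q' :: "'w::ring_1"
  assumes "Y * X = 1" and f: "f = 1 - X * Y" and uv: "u * v = 1" "v * u = 1"
    and q: "q = u - 1" "q' = v - 1" and "f * q = q" "q * f = q" "f * q' = q'" "q' * f = q'"
  shows "(1 + X * q') * ((1 + f * Y) * (1 + X * q) * (1 + - f * Y)) * (1 + - q' * Y)
     = u * (1 + X * q' * Y)"
proof -
  have 1: "Y * X = 1" "Y * (X * z) = z" for z using assms(1) by (simp_all flip: mult.assoc)
  have 2: "Y * f = 0" "Y * (f * z) = 0" for z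
  proof -
    show "Y * f = 0" by (simp add: f algebra_simps 1)
    then show "Y * (f * z) = 0" by (simp flip: mult.assoc)
  qed
  have 3: "f * X = 0" "f * (X * z) = 0" for z
  proof -
    show "f * X = 0" by (simp add: f algebra_simps 1)
    then show "f * (X * z) = 0" by (simp flip: mult.assoc)
  qed
  have 4: "f * q = q" "q * f = q" "f * (q * z) = q * z" "q * (f * z) = q * z"
     "f * q' = q'" "q' * f = q'" "f * (q' * z) = q' * z" "q' * (f * z) = q' * z" for z
    using assms by (simp_all flip: mult.assoc)
  have 5: "Y * q = 0" "Y * q' = 0" "q * X = 0" "q' * X = 0"
    using 2 3 4 by (metis mult.assoc mult_zero_left mult_zero_right)+
  then have 6: "Y * (q * z) = 0" "Y * (q' * z) = 0" "q * (X * z) = 0" "q' * (X * z) = 0" for z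
    by (simp_all flip: mult.assoc)
  have 7: "q * q' = - q - q'" "q' * q = - q - q'" unfolding q using uv by (simp_all add: algebra_simps)
  have 8: "q * (q' * z) = - (q * z) - q' * z" "q' * (q * z) = - (q * z) - q' * z" for z
    using 7 by (simp_all add: left_diff_distrib flip: mult.assoc)
  have u: "u = 1 + q" using q by simp
  show ?thesis unfolding u
    by (simp add: algebra_simps 1 2 3 4 5 6 7 8)
qed

context coeff_ring begin

text \<open>The block matrix diag (1, u) with an identity block of size r in front.\<close>

definition sh :: "nat \<Rightarrow> 'w \<Rightarrow> 'w" where
  "sh r u = 1 + x ^ r * (u - 1) * y ^ r"

lemma sh_mult: "sh r (u * v) = sh r u * sh r v"
  by (simp add: sh_def algebra_simps mult.assoc)

lemma sh_one [simp]: "sh r 1 = 1" by (simp add: sh_def)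

lemma sh_unt: assumes "unt u" shows "unt (sh r u)" "uinv (sh r u) = sh r (uinv u)"
  using sh_mult[of r u "uinv u"] sh_mult[of r "uinv u" u] assms
  by (auto intro: untI uinv_eq)

lemma sh_Fin: "idl D ==> u - 1 \<in> Fin D ==> sh r u - 1 \<in> Fin D"
  using Fin_yr[OF Fin_xl] by (simp add: sh_def)

lemma sh_GL: "idl D ==> u \<in> GL D ==> sh r u \<in> GL D"
  by (auto simp: GL_def sh_unt intro: sh_Fin idl_C)

lemma sh_commute:
  assumes "(u - 1) * pr r = u - 1" "pr r * (u - 1) = u - 1"
  shows "u * sh r v = sh r v * u"
proof -
  let ?q = "u - 1"
  have 1: "?q * x ^ r = 0" "y ^ r * ?q = 0"
    using assms by (metis pr_x(1) mult.assoc mult_zero_right, metis y_pr(1) mult.assoc mult_zero_left)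
  have "?q * (x ^ r * (v - 1) * y ^ r) = 0" "x ^ r * (v - 1) * y ^ r * ?q = 0"
    using 1 by (metis mult.assoc mult_zero_left, metis mult.assoc mult_zero_right)
  then have "(1 + ?q) * sh r v = sh r v * (1 + ?q)"
    unfolding sh_def distrib_left distrib_right mult_1_left mult_1_right by simp
  then show ?thesis by simp
qed

definition sized :: "nat \<Rightarrow> 'w \<Rightarrow> bool" where
  "sized r u \<longleftrightarrow> pr r * (u - 1) = u - 1 \<and> (u - 1) * pr r = u - 1"

lemma sized_le: "sized r u ==> r \<le> s ==> sized s u"
  unfolding sized_def using pr_le by (metis mult.assoc)

lemma sized_ex: "idl D ==> u - 1 \<in> Fin D ==> \<exists>r. sized r u"
  using Fin_bound by (metis sized_def order_refl)

lemma sized_inv: assumes "sized r u" "unt u" shows "sized r (uinv u)"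
proof -
  have "uinv u - 1 = - (uinv u * (u - 1))" "uinv u - 1 = - ((u - 1) * uinv u)"
    using assms(2) by (simp_all add: algebra_simps)
  then show ?thesis using assms(1) unfolding sized_def
    by (metis mult.assoc mult_minus_left mult_minus_right)
qed

lemma sized_mult: assumes "sized r u" "sized r v" shows "sized r (u * v)"
proof -
  define a b where "a = u - 1" and "b = v - 1"
  have 1: "u * v - 1 = a * b + (a + b)" by (simp add: a_def b_def algebra_simps)
  have 2: "pr r * a = a" "a * pr r = a" "pr r * b = b" "b * pr r = b"
    using assms by (simp_all add: sized_def a_def b_def)
  then have "pr r * (a * b) = a * b" by (simp flip: mult.assoc)
  then show ?thesis unfolding sized_def 1 using 2 by (simp add: distrib_left distrib_right mult.assoc)
qed

lemma sized_Fin_common: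
  assumes "u - 1 \<in> Fin C" "v - 1 \<in> Fin C" shows "\<exists>r. sized r u \<and> sized r v"
  using sized_ex[OF idl_C] assms sized_le by (meson linorder_linear)

text \<open>In \<open>whitehead_identity\<close> every factor apart from the conjugating one has its
  entries in D, so diag (u, 1/u) lies in the relative elementary group and not merely in the
  absolute one.\<close>

lemma whitehead:
  assumes D: "idl D" and u: "u \<in> GL D" "sized r u"
  shows "u * sh r (uinv u) \<in> Er D"
proof -
  have uu: "unt u" using u GL_unt by blast
  let ?v = "uinv u"
  have s: "sized r ?v" using sized_inv u(2) uu by blast
  have qF: "u - 1 \<in> Fin D" "?v - 1 \<in> Fin D" using u GL_inv[OF D u(1)] by (auto simp: GL_def)
  note sz = u(2)[unfolded sized_def] s[unfolded sized_def]
  have a: "1 + pr r * y ^ r \<in> El C"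
    using block_El(1)[OF idl_C Fin_pr] by simp
  have a': "uinv (1 + pr r * y ^ r) = 1 + - pr r * y ^ r"
    by (rule uinv_eq) (simp_all add: algebra_simps mult.assoc)
  have n: "pr r * - (?v - 1) = - (?v - 1)" "- (?v - 1) * pr r = - (?v - 1)"
    using sz by (metis mult_minus_right, metis mult_minus_left)
  have q: "1 + x ^ r * (u - 1) \<in> Er D" "1 + x ^ r * (?v - 1) \<in> Er D" "1 + - (?v - 1) * y ^ r \<in> Er D"
    using block_El(2)[OF D qF(1), of r] block_El(2)[OF D qF(2), of r]
      block_El(1)[OF D Fin_neg[OF D qF(2)] n] sz
    by (blast intro: El_Er)+
  have "(1 + x ^ r * (?v - 1)) * ((1 + pr r * y ^ r) * (1 + x ^ r * (u - 1)) * (1 + - pr r * y ^ r))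
      * (1 + - (?v - 1) * y ^ r) = u * (1 + x ^ r * (?v - 1) * y ^ r)"
    by (rule whitehead_identity) (use uu sz in \<open>simp_all add: pr_def\<close>)
  moreover have "(1 + pr r * y ^ r) * (1 + x ^ r * (u - 1)) * (1 + - pr r * y ^ r) \<in> Er D"
    using Er_conj[OF a q(1)] a' by simp
  ultimately show ?thesis using Er_mult q unfolding sh_def by metis
qed

text \<open>Multiply g by its inverse moved to the second block and h by its inverse moved to the
  third. The moved copies commute with each other and with both g and h, so the commutator is
  unchanged; but now the first factor is elementary and the second relatively elementary.\<close>

lemma commutator_Er:
  assumes D: "idl D" and g: "g \<in> GL C" and h: "h \<in> GL D"
  shows "g * h * uinv g * uinv h \<in> Er D"
proof -
  have "g - 1 \<in> Fin C" "h - 1 \<in> Fin C" using g h Fin_C[OF D] by (auto simp: GL_def)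
  then obtain r where r: "sized r g" "sized r h" using sized_Fin_common by blast
  have u: "unt g" "unt h" using g h GL_unt by blast+
  let ?g = "uinv g" and ?h = "uinv h"
  have r2: "sized (r + r) g" "sized (r + r) h" "sized (r + r) ?g" "sized (r + r) ?h" "sized r ?g" "sized r ?h"
    using r sized_le sized_inv u by (simp_all add: sized_le)
  define G where "G = g * sh r ?g"
  define H where "H = h * sh (r + r) ?h"
  have GEl: "G \<in> El C" unfolding G_def using whitehead[OF idl_C g r(1)] Er_C_El by blast
  have HEr: "H \<in> Er D" unfolding H_def using whitehead[OF D h r2(2)] .
  have shg: "sized (r + r) (sh r ?g)"
  proof -
    have e: "pr (r + r) * x ^ r = x ^ r * pr r" "y ^ r * pr (r + r) = pr r * y ^ r"
      by (simp_all add: pr_def left_diff_distrib right_diff_distrib power_add mult.assoc)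
    show ?thesis using r2(5) unfolding sized_def sh_def
      by (simp add: mult.assoc e(2)) (simp add: e(1) flip: mult.assoc, simp add: mult.assoc)
  qed
  have c1: "u * sh r v = sh r v * u" if "sized r u" for u v
    using that sh_commute by (simp add: sized_def)
  have c2: "u * sh (r + r) v = sh (r + r) v * u" if "sized (r + r) u" for u v
    using that sh_commute by (simp add: sized_def)
  let ?A = "sh r ?g" and ?B = "sh (r + r) ?h" and ?A' = "sh r g" and ?B' = "sh (r + r) h"
  have Ginv: "uinv G = ?g * ?A'"
    unfolding G_def using u c1[OF r2(5), of g] by (simp add: uinv_mult sh_unt)
  have Hinv: "uinv H = ?h * ?B'"
    unfolding H_def using u c2[OF r2(4), of h] by (simp add: uinv_mult sh_unt)
  have AA: "?A * ?A' = 1" "?B * ?B' = 1" using u by (simp_all flip: sh_mult)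
  have shg': "sized (r + r) ?A'" using sized_inv[OF shg] u by (simp add: sh_unt)
  have "G * H * uinv G * uinv H = g * ?A * (h * ?B) * (?g * ?A') * (?h * ?B')"
    unfolding Ginv Hinv by (simp add: G_def H_def)
  also have "\<dots> = g * (?A * h) * (?B * (?g * ?A')) * (?h * ?B')" by (simp add: mult.assoc)
  also have "\<dots> = g * (h * ?A) * (?g * ?A' * ?B) * (?h * ?B')"
    using c1[OF r(2), of ?g] c2[OF sized_mult[OF r2(3) shg'], of ?h] by simp
  also have "\<dots> = g * h * (?A * ?g) * ?A' * (?B * ?h) * ?B'" by (simp add: mult.assoc)
  also have "\<dots> = g * h * (?g * ?A) * ?A' * (?h * ?B) * ?B'"
    using c1[OF r2(5), of ?g] c2[OF r2(4), of ?h] by simp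
  also have "\<dots> = g * h * ?g * (?A * ?A') * ?h * (?B * ?B')" by (simp add: mult.assoc)
  also have "\<dots> = g * h * ?g * ?h" using AA by simp
  finally have "g * h * ?g * ?h = G * H * uinv G * uinv H" by simp
  then show ?thesis using Er_mult[OF Er_conj[OF GEl HEr] Er_inv[OF D HEr]] by simp
qed

text \<open>The definition of \<open>Er\<close> conjugates by elementary matrices only; the
  commutator formula extends normality to all of \<open>GL C\<close>.\<close>

lemma Er_normal: assumes "idl D" "g \<in> GL C" "h \<in> Er D" shows "g * h * uinv g \<in> Er D"
proof -
  have "g * h * uinv g = g * h * uinv g * uinv h * h"
    using Er_unt[OF assms(1,3)] by (simp add: mult.assoc)
  then show ?thesis
    using Er_mult[OF commutator_Er[OF assms(1,2) Er_GL[OF assms(1,3)]] assms(3)] by simp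
qed

end

context coeff_ring begin

section \<open>Equality in K1\<close>

definition eqv :: "'w \<Rightarrow> 'w \<Rightarrow> bool" (infix "\<simeq>" 50) where
  "u \<simeq> v \<longleftrightarrow> u \<in> GL C \<and> v \<in> GL C \<and> u * uinv v \<in> El C"

lemma GLC: "u \<in> GL C ==> v \<in> GL C ==> u * v \<in> GL C" "u \<in> GL C ==> uinv u \<in> GL C"
  using GL_mult[OF idl_C] GL_inv[OF idl_C] by blast+

lemma ElC: "u \<in> El C ==> u \<in> GL C" "u \<in> El C ==> uinv u \<in> El C"
  using El_GL[OF idl_C] El_inv[OF idl_C] by blast+

lemma El_normal: "g \<in> GL C ==> h \<in> El C ==> g * h * uinv g \<in> El C"
  using Er_normal[OF idl_C] El_Er Er_C_El by blast

lemma eqvI: "u \<in> GL C ==> e \<in> El C ==> v = e * u ==> v \<simeq> u"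
  unfolding eqv_def using GLC ElC GL_unt by (simp add: mult.assoc)

lemma eqvD: assumes "u \<simeq> v" shows "\<exists>e\<in>El C. u = e * v"
  using assms GL_unt[of v C] unfolding eqv_def
  by (intro bexI[of _ "u * uinv v"]) (simp_all add: mult.assoc)

lemma eqv_refl: "u \<in> GL C ==> u \<simeq> u"
  using eqvI[OF _ El.one] by simp

lemma eqv_sym: assumes "u \<simeq> v" shows "v \<simeq> u"
proof -
  obtain e where e: "e \<in> El C" "u = e * v" using eqvD assms by blast
  then have "v = uinv e * u" using El_unt by simp
  then show ?thesis using eqvI[OF _ ElC(2)[OF e(1)]] assms eqv_def by blast
qed

lemma eqv_trans [trans]: assumes "u \<simeq> v" "v \<simeq> w" shows "u \<simeq> w"
proof -
  obtain e f where "e \<in> El C" "u = e * v" "f \<in> El C" "v = f * w" using eqvD assms by blast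
  then show ?thesis using eqvI[of w "e * f"] assms El_mult by (simp add: eqv_def mult.assoc)
qed

lemma eqv_mult: assumes "u \<simeq> u'" "v \<simeq> v'" shows "u * v \<simeq> u' * v'"
proof -
  obtain e f where e: "e \<in> El C" "u = e * u'" "f \<in> El C" "v = f * v'" using eqvD assms by blast
  have g: "u' \<in> GL C" "v' \<in> GL C" using assms by (auto simp: eqv_def)
  have "u * v = e * (u' * f * uinv u') * (u' * v')"
    using e GL_unt[OF g(1)] by (simp add: mult.assoc)
  then show ?thesis using eqvI[OF GLC(1)[OF g] El_mult[OF e(1) El_normal[OF g(1) e(3)]]] by blast
qed

lemma eqv_El: "e \<in> El C ==> u \<in> GL C ==> e * u \<simeq> u" "e \<in> El C ==> u \<in> GL C ==> u * e \<simeq> u"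
proof -
  assume e: "e \<in> El C" "u \<in> GL C"
  then show "e * u \<simeq> u" using eqvI by blast
  have "u * e = (u * e * uinv u) * u" using GL_unt[OF e(2)] by (simp add: mult.assoc)
  then show "u * e \<simeq> u" using eqvI[OF e(2) El_normal[OF e(2,1)]] by blast
qed

lemma eqv_El_one: "e \<simeq> 1 \<longleftrightarrow> e \<in> El C"
  using eqv_El(1)[OF _ GL_1] by (auto simp: eqv_def)

lemma eqv_cancel_l: assumes "w * u \<simeq> w * v" "w \<in> GL C" "u \<in> GL C" "v \<in> GL C" shows "u \<simeq> v"
  using eqv_mult[OF eqv_refl[OF GLC(2)[OF assms(2)]] assms(1)] GL_unt[OF assms(2)] by simp

lemma eqv_sh: assumes "u \<in> GL C" "sized r u" shows "u \<simeq> sh r u"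
proof -
  have "u = (u * sh r (uinv u)) * sh r u"
    using sh_mult[of r "uinv u" u] GL_unt[OF assms(1)] by (simp add: mult.assoc)
  then show ?thesis
    using eqvI[OF sh_GL[OF idl_C assms(1)] Er_C_El[OF whitehead[OF idl_C assms]]] by blast
qed

lemma Fin_bound_common:
  assumes "a \<in> Fin C" "b \<in> Fin C"
  shows "\<exists>r. pr r * a = a \<and> a * pr r = a \<and> pr r * b = b \<and> b * pr r = b"
  using Fin_bound[OF idl_C] assms by (meson linorder_linear)

text \<open>The block matrix (1, a; -b, 1) can be reduced by elementary operations to diag (1 + a b,
  1) as well as to diag (1, 1 + b a). This is the K1 form of det (1 + a b) = det (1 + b a).\<close>

lemma one_plus_mult_swap:
  assumes a: "a \<in> Fin C" and b: "b \<in> Fin C" and u: "1 + a * b \<in> GL C"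
  shows "1 + b * a \<in> GL C" "1 + a * b \<simeq> 1 + b * a"
proof -
  define w where "w = uinv (1 + a * b)"
  have w: "(1 + a * b) * w = 1" "w * (1 + a * b) = 1" "w - 1 \<in> Fin C"
    unfolding w_def using GL_unt[OF u] u by (simp_all add: GL_def)
  have abw: "a * (b * w) = 1 - w" "w * (a * b) = 1 - w" using w(1,2) by (simp_all add: algebra_simps)
  have wab: "w * (a * (b * z)) = z - w * z" for z
    using abw(2) by (metis left_diff_distrib mult.assoc mult_1_left)
  note F = Fin_mult[OF idl_C]
  have bwa: "b * w * a = b * (w - 1) * a + b * a" by (simp add: algebra_simps)
  show G: "1 + b * a \<in> GL C"
  proof (rule GLI[of _ _ "1 - b * w * a"])
    show "1 + b * a - 1 \<in> Fin C" using F[OF b a] by simp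
    show "1 - b * w * a - 1 \<in> Fin C"
      unfolding bwa using Fin_neg[OF idl_C Fin_add[OF F[OF F[OF b w(3)] a] F[OF b a]]] by simp
    have "b * (a * (b * (w * a))) = b * a - b * (w * a)"
      using abw(1) by (metis left_diff_distrib right_diff_distrib mult.assoc mult_1_left)
    then show "(1 + b * a) * (1 - b * w * a) = 1" by (simp add: algebra_simps)
    show "(1 - b * w * a) * (1 + b * a) = 1" by (simp add: algebra_simps wab)
  qed
  obtain r where r: "pr r * a = a" "a * pr r = a" "pr r * b = b" "b * pr r = b"
    using Fin_bound_common[OF a b] by blast
  \<comment> \<open>Chosen so that \<open>c * (1 + a * b) = - b\<close>: the row operation with c
    creates the lower left corner.\<close>
  define c where "c = - b * w"
  have cF: "c \<in> Fin C"
    using Fin_neg[OF idl_C Fin_add[OF F[OF b w(3)] b]] by (simp add: c_def algebra_simps)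
  have wp: "w * pr r = pr r * w"
  proof -
    have "sized r (1 + a * b)" using r by (simp add: sized_def mult.assoc flip: mult.assoc[of "pr r" a])
    then have "sized r w" unfolding w_def using sized_inv GL_unt[OF u] by blast
    then show ?thesis by (simp add: sized_def algebra_simps) (metis add_left_cancel)
  qed
  have c: "pr r * c = c" "c * pr r = c"
    using r wp by (simp_all add: c_def mult.assoc) (metis mult.assoc)+
  have E: "1 + a * y ^ r \<in> El C" "1 + x ^ r * c \<in> El C" "1 + x ^ r * (- b) \<in> El C"
    using block_El[OF idl_C a] block_El[OF idl_C cF] block_El[OF idl_C Fin_neg[OF idl_C b], of r] r c
    by auto
  have z: "y ^ r * a = 0" "b * x ^ r = 0" "y ^ r * (a * s) = 0" "b * (x ^ r * s) = 0" for s
    using r y_pr pr_x by (metis mult.assoc mult_zero_left, metis mult.assoc mult_zero_right,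
        metis mult.assoc mult_zero_left, metis mult.assoc mult_zero_right mult_zero_left)
  have cab: "c * (1 + a * b) = - b" unfolding c_def using w(2) by (simp add: mult.assoc)
  \<comment> \<open>The two reductions meet in the block matrix (1, a; -b, 1), which reads
    \<open>1 + a * y ^ r - x ^ r * b\<close>.\<close>
  have "(1 + a * y ^ r) * ((1 + x ^ r * c) * (1 + a * b)) = (1 + a * y ^ r) * (1 + a * b - x ^ r * b)"
    using cab by (simp add: distrib_right[of _ _ "1 + a * b"] mult.assoc)
  also have "\<dots> = 1 + a * y ^ r - x ^ r * b" using z by (simp add: algebra_simps)
  also have "\<dots> = (1 + x ^ r * (- b)) * (sh r (1 + b * a) * (1 + a * y ^ r))"
    unfolding sh_def using z by (simp add: algebra_simps)
  finally have eq: "(1 + a * y ^ r) * ((1 + x ^ r * c) * (1 + a * b))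
     = (1 + x ^ r * (- b)) * (sh r (1 + b * a) * (1 + a * y ^ r))" .
  have shG: "sh r (1 + b * a) \<in> GL C" using sh_GL[OF idl_C G] .
  have "1 + a * b \<simeq> (1 + x ^ r * c) * (1 + a * b)"
    using eqv_sym eqv_El(1)[OF E(2) u] by blast
  also have "\<dots> \<simeq> (1 + a * y ^ r) * ((1 + x ^ r * c) * (1 + a * b))"
    using eqv_sym[OF eqv_El(1)[OF E(1)]] GLC(1)[OF ElC(1)[OF E(2)] u] by blast
  also have "\<dots> \<simeq> sh r (1 + b * a) * (1 + a * y ^ r)"
    unfolding eq using eqv_El(1)[OF E(3) GLC(1)[OF shG ElC(1)[OF E(1)]]] .
  also have "\<dots> \<simeq> sh r (1 + b * a)" using eqv_El(2)[OF E(1) shG] .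
  also have "\<dots> \<simeq> 1 + b * a"
  proof (rule eqv_sym[OF eqv_sh[OF G]])
    show "sized r (1 + b * a)" using r by (simp add: sized_def mult.assoc flip: mult.assoc[of "pr r" b])
  qed
  finally show "1 + a * b \<simeq> 1 + b * a" .
qed

text \<open>N h N' is equivalent to the block matrix (N, 0; h^{-1}, N'), whose lower left corner
  may be changed modulo left multiples of N' and right multiples of N.\<close>

lemma block_factor:
  assumes N: "N - 1 \<in> Fin C" "sized r N" and N': "N' - 1 \<in> Fin C" "sized r N'"
    and h: "h \<in> GL C" "sized r h"
    and z: "z \<in> Fin C" "pr r * z = z" "z * pr r = z"
    and z': "z' \<in> Fin C" "pr r * z' = z'" "z' * pr r = z'"
    and v0: "pr r * uinv h = z * N + N' * z' + v0"
  shows "\<exists>P\<in>El C. \<exists>Q\<in>GL C. Q \<simeq> h \<and> N * h * N' = P * (N * sh r N' + x ^ r * v0) * Q"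
proof -
  define p X Y where "p = pr r" and "X = x ^ r" and "Y = y ^ r"
  note d = p_def X_def Y_def
  have s [simp]: "p * p = p" "p * (p * s) = p * s" "Y * X = 1" "Y * (X * s) = s"
    "Y * p = 0" "Y * (p * s) = 0" "p * X = 0" "p * (X * s) = 0" for s by (simp_all add: d)
  define a b g g' where "a = N - 1" and "b = N' - 1" and "g = h - 1" and "g' = uinv h - 1"
  have hu: "unt h" using h GL_unt by blast
  have F: "a \<in> Fin C" "b \<in> Fin C" "g \<in> Fin C" "g' \<in> Fin C"
    using N N' h by (simp_all add: a_def b_def g_def g'_def GL_def)
  have ps: "p * a = a" "a * p = a" "p * b = b" "b * p = b" "p * g = g" "g * p = g"
    "p * g' = g'" "g' * p = g'" "p * z = z" "z * p = z" "p * z' = z'" "z' * p = z'"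
    using N N' h sized_inv[OF h(2) hu] z z' by (simp_all add: a_def b_def g_def g'_def d sized_def)
  have ps2: "p * (a * s) = a * s" "a * (p * s) = a * s" "p * (b * s) = b * s" "b * (p * s) = b * s"
    "p * (g * s) = g * s" "g * (p * s) = g * s" "p * (g' * s) = g' * s" "g' * (p * s) = g' * s"
    "p * (z * s) = z * s" "z * (p * s) = z * s" "p * (z' * s) = z' * s" "z' * (p * s) = z' * s" for s
    using ps by (simp_all flip: mult.assoc)
  have zero: "Y * a = 0" "a * X = 0" "Y * b = 0" "b * X = 0" "Y * g = 0" "g * X = 0"
    "Y * z = 0" "z * X = 0" "Y * z' = 0" "z' * X = 0" "Y * g' = 0" "g' * X = 0"
    using ps s by (metis mult.assoc mult_zero_left mult_zero_right)+
  have zero2: "Y * (a * s) = 0" "a * (X * s) = 0" "Y * (b * s) = 0" "b * (X * s) = 0"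
    "Y * (g * s) = 0" "g * (X * s) = 0"
    "Y * (z * s) = 0" "z * (X * s) = 0" "Y * (z' * s) = 0" "z' * (X * s) = 0"
    "Y * (g' * s) = 0" "g' * (X * s) = 0" for s
    using zero by (simp_all flip: mult.assoc)
  note R = ps ps2 zero zero2
  have gg: "g * g' = - g - g'" "g' * g = - g - g'"
    using hu by (simp_all add: g_def g'_def algebra_simps)
  have gg2: "g * (g' * s) = - (g * s) - g' * s" "g' * (g * s) = - (g * s) - g' * s" for s
    using gg by (simp_all add: left_diff_distrib flip: mult.assoc)
  note Fa = Fin_add Fin_mult[OF idl_C]
  have pF: "p \<in> Fin C" using Fin_pr by (simp add: d)
  \<comment> \<open>U and V are the corners of size r of \<open>N * h\<close> and of N'.\<close>
  define U where "U = p + a + g + a * g"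
  define V where "V = p + b"
  have UF: "U \<in> Fin C" "V \<in> Fin C" unfolding U_def V_def using F pF Fa by simp_all
  have Up: "p * U = U" "U * p = U" "p * V = V" "V * p = V"
    unfolding U_def V_def using R by (simp_all add: distrib_left distrib_right mult.assoc)
  define e1 where "e1 = 1 + U * Y"
  define e2 where "e2 = 1 + X * (- V)"
  define w1 where "w1 = 1 + X * p"
  define w2 where "w2 = 1 + (- p) * Y"
  define ez where "ez = 1 + X * z"
  define ez' where "ez' = 1 + X * z'"
  have npF: "- p \<in> Fin C" "- V \<in> Fin C" using Fin_neg[OF idl_C] pF UF by blast+
  have El: "e1 \<in> El C" "e2 \<in> El C" "w1 \<in> El C" "w2 \<in> El C" "ez \<in> El C" "ez' \<in> El C"
    unfolding e1_def e2_def w1_def w2_def ez_def ez'_def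
    using block_El[OF idl_C UF(1)] block_El[OF idl_C npF(2), of r] block_El[OF idl_C pF, of r]
      block_El[OF idl_C npF(1), of r] block_El[OF idl_C z(1)] block_El[OF idl_C z'(1)] Up R
    by (simp_all add: d)
  \<comment> \<open>The interchange of the first two blocks of size r, with a sign; the expansion is
    \<open>ww\<close> below.\<close>
  define w where "w = w1 * w2 * w1"
  have wE: "w \<in> El C" unfolding w_def using El El_mult by blast
  define M where "M = N * sh r N' + X * v0"
  have N_e: "N = 1 + a" "N' = 1 + b" "h = 1 + g" "uinv h = 1 + g'"
    by (simp_all add: a_def b_def g_def g'_def)
  have shN: "sh r N' = 1 + X * b * Y" by (simp add: sh_def N_e d)
  have v0': "v0 = p + g' - z - z * a - z' - b * z'"
  proof -
    have "p * (1 + g') = z * (1 + a) + (1 + b) * z' + v0" using v0 unfolding N_e(4) unfolding N_e(1,2) by (simp add: d)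
    then show ?thesis by (simp add: algebra_simps R)
  qed
  have ww: "w = 1 - p - X * p * Y + X * p - p * Y"
    unfolding w_def w1_def w2_def by (simp add: algebra_simps)
  \<comment> \<open>Both sides equal the block matrix (N h, 0; 1, N'): on the left after operations
    that start from diag (N h N', 1), on the right after h is pulled out of the first block column,
    which leaves 1/h in the corner.\<close>
  have key: "e1 * (N * h * N') * (e2 * w) = ez * (M * (ez' * h))"
  proof -
    have L: "e1 * (N * h * N') * (e2 * w) = N * h * (1 + X * b * Y) + X * p"
      unfolding ww e1_def e2_def U_def V_def N_e by (simp add: algebra_simps R)
    have R': "ez * (M * (ez' * h)) = N * h * (1 + X * b * Y) + X * p"
      unfolding M_def shN unfolding ez_def ez'_def v0' N_e by (simp add: algebra_simps R gg gg2)
    show ?thesis using L R' by simp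
  qed
  define P where "P = uinv e1 * ez"
  define Q where "Q = ez' * h * uinv (e2 * w)"
  have e2w: "e2 * w \<in> El C" using El wE El_mult by blast
  have "e1 * (N * h * N') * (e2 * w) * uinv (e2 * w) = ez * (M * (ez' * h)) * uinv (e2 * w)"
    using key by simp
  then have "e1 * (N * h * N') = ez * (M * (ez' * h)) * uinv (e2 * w)"
    by (simp only: mult.assoc[of "e1 * (N * h * N')"] unt_inv_cancel(1)[OF El_unt[OF e2w]] mult_1_right)
  then have "uinv e1 * (e1 * (N * h * N')) = P * M * Q"
    unfolding P_def Q_def by (simp add: mult.assoc)
  then have "N * h * N' = P * M * Q" using El_unt[OF El(1)] by simp
  moreover have "P \<in> El C" unfolding P_def using El ElC El_mult by blast
  moreover have "Q \<simeq> h"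
    unfolding Q_def using eqv_trans[OF eqv_El(2)[OF ElC(2)[OF e2w]] eqv_El(1)[OF El(6)]]
      GLC(1)[OF ElC(1)[OF El(6)]] h(1) by blast
  ultimately show ?thesis unfolding M_def X_def by (auto simp: eqv_def)
qed

end

section \<open>Linear matrix pencils and their symbols\<close>

text \<open>C is a Laurent polynomial ring over R in the variable t.  A matrix over C has symbol
  P Q if it factors as P N Q with P, Q invertible and N an invertible linear pencil
  t - nu on a corner.  The class of P Q in K1 of C is unique: two factorisations present the
  same R-module with automorphism, and the resolution of such a module by t - nu is functorial.\<close>

locale laurent_ring = coeff_ring x y C for x y :: "'w::ring_1" and C +
  fixes R :: "'w set" and t t' :: 'w
  assumes comm: "c \<in> C ==> d \<in> C ==> c * d = d * c"
    and R_C: "R \<subseteq> C" and R_0: "0 \<in> R" and R_1: "1 \<in> R"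
    and R_add: "c \<in> R ==> d \<in> R ==> c + d \<in> R"
    and R_neg: "c \<in> R ==> - c \<in> R"
    and R_mult: "c \<in> R ==> d \<in> R ==> c * d \<in> R"
    and t_C: "t \<in> C" and t'_C: "t' \<in> C" and tt': "t * t' = 1"
    and gen: "c \<in> C ==> \<exists>m n a. (\<forall>k. a k \<in> R) \<and> c = t' ^ m * (\<Sum>k<(n::nat). a k * t ^ k)"
    and indep: "(\<And>k. a k \<in> Fin R) ==> (\<Sum>k<n. a k * t ^ k) = 0 ==> k < n ==> a k = 0"
begin

interpretation R: coeff_ring x y R
  by unfold_locales (use R_C R_0 R_1 R_add R_neg R_mult C_x C_y in auto)

lemmas RF = Fin_add R.Fin_neg[OF R.idl_C] R.Fin_diff[OF R.idl_C] R.Fin_mult[OF R.idl_C]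
lemmas CF = Fin_add Fin_neg[OF idl_C] Fin_diff[OF idl_C] Fin_mult[OF idl_C]

lemma RF_C: "u \<in> Fin R ==> u \<in> Fin C" using Fin_mono[OF R_C] .

lemma C_Fin: assumes "c \<in> C" "u \<in> Fin C" shows "c * u = u * c"
  using assms(2)
proof (induction u rule: Fin.induct)
  case (step d u k l)
  have "c * (d * mx k l) = d * mx k l * c"
    using C_mx[OF assms(1), of k l] comm[OF assms(1) step(1)] by (metis mult.assoc)
  then show ?case using step by (simp add: algebra_simps)
qed simp

lemma C_Fin_closed: assumes "c \<in> C" "u \<in> Fin C" shows "c * u \<in> Fin C"
  using assms(2)
proof (induction u rule: Fin.induct)
  case (step d u k l)
  have "c * (d * mx k l + u) = (c * d) * mx k l + c * u" by (simp add: algebra_simps)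
  then show ?case using step C_mult[OF assms(1)] Fin.step by simp
qed (simp add: Fin.zero)

lemma R_Fin_closed: assumes "c \<in> R" "u \<in> Fin R" shows "c * u \<in> Fin R"
  using assms(2)
proof (induction u rule: Fin.induct)
  case (step d u k l)
  have "c * (d * mx k l + u) = (c * d) * mx k l + c * u" by (simp add: algebra_simps)
  then show ?case using step R_mult[OF assms(1)] Fin.step by simp
qed (simp add: Fin.zero)

lemma t't: "t' * t = 1" using tt' comm[OF t_C t'_C] by simp

lemma tt'_simps [simp]: "t * t' = 1" "t' * t = 1" "t * (t' * s) = s" "t' * (t * s) = s"
  using tt' t't by (simp_all flip: mult.assoc)

text \<open>N is t - v on the corner cut out by the idempotent b, and the identity elsewhere. Modulo
  N the variable t acts as v on that corner, so the inverse v' is what lets 1/t act there as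
  well.\<close>

definition lin :: "'w \<Rightarrow> 'w \<Rightarrow> 'w \<Rightarrow> 'w \<Rightarrow> bool" where
  "lin b v v' N \<longleftrightarrow> b \<in> Fin R \<and> v \<in> Fin R \<and> v' \<in> Fin R \<and> b * b = b \<and> b * v = v \<and> v * b = v
     \<and> b * v' = v' \<and> v' * b = v' \<and> v * v' = b \<and> v' * v = b \<and> N = 1 + (t - 1) * b - v"

lemma lin_Fin: assumes "lin b v v' N" shows "N - 1 \<in> Fin C"
proof -
  have b: "b \<in> Fin C" "v \<in> Fin C" and N: "N = 1 + (t - 1) * b - v"
    using assms RF_C by (auto simp: lin_def)
  have "t * b - b - v \<in> Fin C" using CF(3)[OF CF(3)[OF C_Fin_closed[OF t_C b(1)] b(1)] b(2)] .
  then show ?thesis by (simp add: N left_diff_distrib)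
qed

lemma lin_apply:
  assumes "lin b v v' N"
  shows "b * s = s ==> N * s = t * s - v * s" and "N * (1 - b) = 1 - b"
    and "b * N = t * b - v" and "N * b = t * b - v"
proof -
  have bv: "b * v = v" "v * b = v" "b * b = b" and N: "N = 1 + (t - 1) * b - v"
    and bt: "b * t = t * b"
    using assms RF_C C_Fin[OF t_C] by (auto simp: lin_def)
  show "N * s = t * s - v * s" if "b * s = s"
    using that by (simp add: N algebra_simps)
  show "N * (1 - b) = 1 - b" using bv by (simp add: N algebra_simps)
  show "b * N = t * b - v" "N * b = t * b - v"
    using bv by (simp_all add: N algebra_simps bt) (metis bt bv(3) mult.assoc)
qed

lemma lin_one: "lin 0 0 0 1" by (simp add: lin_def Fin.zero)

text \<open>Division with remainder by t - v. The set of matrices that can be divided contains the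
  matrices over R, since N is the identity off the corner, and it is stable under t and 1/t, which
  act on remainders as v and v'.\<close>

lemma division:
  assumes L: "lin b v v' N" and "w \<in> Fin C"
  shows "\<exists>g z. g \<in> Fin R \<and> z \<in> Fin C \<and> b * g = g \<and> w = g + N * z"
proof -
  let ?D = "{w. \<exists>g z. g \<in> Fin R \<and> z \<in> Fin C \<and> b * g = g \<and> w = g + N * z}"
  have l: "b \<in> Fin R" "v \<in> Fin R" "v' \<in> Fin R" "b * b = b" "b * v = v" "b * v' = v'" "v * v' = b"
    using L by (auto simp: lin_def)
  have base: "w \<in> ?D" if "w \<in> Fin R" for w
  proof -
    have "N * ((1 - b) * w) = (1 - b) * w" using lin_apply(2)[OF L] by (simp flip: mult.assoc)
    then have "w = b * w + N * ((1 - b) * w)" by (simp add: algebra_simps)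
    moreover have "b * w \<in> Fin R" using RF(4)[OF l(1) that] .
    moreover have "(1 - b) * w \<in> Fin C"
      using RF_C[OF RF(3)[OF that \<open>b * w \<in> Fin R\<close>]] by (simp add: left_diff_distrib)
    moreover have "b * (b * w) = b * w" using l by (simp flip: mult.assoc)
    ultimately show ?thesis by blast
  qed
  have add: "w + w' \<in> ?D" if W: "w \<in> ?D" "w' \<in> ?D" for w w'
  proof -
    obtain g z g' z' where "g \<in> Fin R" "z \<in> Fin C" "b * g = g" "w = g + N * z"
      "g' \<in> Fin R" "z' \<in> Fin C" "b * g' = g'" "w' = g' + N * z'" using W by blast
    then have "g + g' \<in> Fin R" "z + z' \<in> Fin C" "b * (g + g') = g + g'"
      "w + w' = (g + g') + N * (z + z')" using Fin_add by (auto simp: algebra_simps)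
    then show ?thesis by blast
  qed
  have Nt: "c * (N * z) = N * (c * z)" if "c \<in> C" "z \<in> Fin C" for c z
  proof -
    have "c * N = N * c" using C_Fin[OF that(1) lin_Fin[OF L]] by (simp add: algebra_simps)
    then show ?thesis by (metis mult.assoc)
  qed
  have mt: "t * w \<in> ?D" if W: "w \<in> ?D" for w
  proof -
    obtain g z where g: "g \<in> Fin R" "z \<in> Fin C" "b * g = g" "w = g + N * z" using W by blast
    have "t * w = v * g + N * (g + t * z)"
      using lin_apply(1)[OF L g(3)] Nt[OF t_C g(2)] g(4) by (simp add: distrib_left)
    moreover have "v * g \<in> Fin R" "g + t * z \<in> Fin C" "b * (v * g) = v * g"
      using RF(4)[OF l(2) g(1)] CF(1)[OF RF_C[OF g(1)] C_Fin_closed[OF t_C g(2)]] l(5)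
      by (simp_all flip: mult.assoc)
    ultimately show ?thesis by blast
  qed
  have mt': "t' * w \<in> ?D" if W: "w \<in> ?D" for w
  proof -
    obtain g z where g: "g \<in> Fin R" "z \<in> Fin C" "b * g = g" "w = g + N * z" using W by blast
    have vg: "v' * g \<in> Fin R" "b * (v' * g) = v' * g" "v * (v' * g) = g"
      using RF(4)[OF l(3) g(1)] l(6,7) g(3) by (simp_all flip: mult.assoc)
    have "N * (t' * (v' * g)) = t' * (t * (v' * g) - v * (v' * g))"
      using Nt[OF t'_C RF_C[OF vg(1)]] lin_apply(1)[OF L vg(2)] by simp
    then have "t' * w = v' * g + N * (t' * z - t' * (v' * g))"
      using g(4) Nt[OF t'_C g(2)] vg(3) by (simp add: algebra_simps)
    moreover have "t' * z - t' * (v' * g) \<in> Fin C"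
      using CF(3)[OF C_Fin_closed[OF t'_C g(2)] C_Fin_closed[OF t'_C RF_C[OF vg(1)]]] .
    ultimately show ?thesis using vg by blast
  qed
  have pow: "t ^ k * w \<in> ?D" "t' ^ k * w \<in> ?D" if "w \<in> ?D" for w k
  proof -
    show "t ^ k * w \<in> ?D"
      by (induction k) (use that mt in \<open>simp_all only: power_0 power_Suc mult_1_left mult.assoc\<close>)
    show "t' ^ k * w \<in> ?D"
      by (induction k) (use that mt' in \<open>simp_all only: power_0 power_Suc mult_1_left mult.assoc\<close>)
  qed
  have zero: "0 \<in> ?D" using base Fin.zero by blast
  from assms(2) have "w \<in> ?D"
  proof (induction w rule: Fin.induct)
    case (step c u k l)
    obtain m n a where a: "\<And>k. a k \<in> R" "c = t' ^ m * (\<Sum>k<(n::nat). a k * t ^ k)"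
      using gen[OF step(1)] by blast
    have "(\<Sum>k<n. t ^ k * (a k * mx kk l)) \<in> ?D" for kk
    proof (induction n)
      case (Suc n)
      then show ?case using add pow(1)[OF base[OF Fin_mx[OF a(1)]]] by simp
    qed (use zero in simp)
    then have "t' ^ m * (\<Sum>i<n. t ^ i * (a i * mx k l)) \<in> ?D" using pow by blast
    moreover have "a i * t ^ i = t ^ i * a i" for i
      using power_commuting_commutes[of t "a i" i] comm[OF t_C, of "a i"] a(1)[of i] R_C by auto
    then have "c * mx k l = t' ^ m * (\<Sum>i<n. t ^ i * (a i * mx k l))"
      unfolding a(2) by (simp add: sum_distrib_right mult.assoc)
    ultimately show ?case using add[OF _ step(3)] by simp
  qed (rule zero)
  then show ?thesis by blast
qed

inductive_set Pol :: "'w set" where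
  zero: "0 \<in> Pol"
| step: "p \<in> Pol ==> r \<in> Fin R ==> t * p + r \<in> Pol"

lemma Pol_add: "p \<in> Pol ==> q \<in> Pol ==> p + q \<in> Pol"
proof (induction p arbitrary: q rule: Pol.induct)
  case (step p r)
  from step(4) show ?case
  proof (cases rule: Pol.cases)
    case zero
    then show ?thesis using Pol.step[OF step(1,2)] by simp
  next
    case (step q' s)
    have "t * (p + q') + (r + s) \<in> Pol"
      using Pol.step[OF \<open>\<And>q. q \<in> Pol ==> p + q \<in> Pol\<close>[OF step(2)] Fin_add[OF \<open>r \<in> Fin R\<close> step(3)]] .
    then show ?thesis unfolding step(1) by (simp add: algebra_simps)
  qed
qed simp

lemma Pol_tpow: "p \<in> Pol ==> t ^ k * p \<in> Pol"
proof (induction k)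
  case (Suc k)
  then show ?case using Pol.step[OF _ Fin.zero, of "t ^ k * p"] by (simp add: mult.assoc)
qed simp

lemma Pol_sum: "p \<in> Pol ==> \<exists>n a. (\<forall>k. a k \<in> Fin R) \<and> p = (\<Sum>k<(n::nat). a k * t ^ k)"
proof (induction p rule: Pol.induct)
  case zero
  then show ?case by (intro exI[of _ 0] exI[of _ "\<lambda>_. 0"]) (simp add: Fin.zero)
next
  case (step p r)
  then obtain n a where a: "\<And>k. a k \<in> Fin R" "p = (\<Sum>k<(n::nat). a k * t ^ k)" by blast
  have "t * (a k * t ^ k) = a k * t ^ Suc k" for k
    using C_Fin[OF t_C RF_C[OF a(1)], of k] by (simp flip: mult.assoc)
  then have "t * p = (\<Sum>k<n. a k * t ^ Suc k)"
    unfolding a(2) sum_distrib_left by simp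
  then have "t * p + r = (\<Sum>k<Suc n. (case k of 0 \<Rightarrow> r | Suc i \<Rightarrow> a i) * t ^ k)"
    unfolding sum.lessThan_Suc_shift by simp
  moreover have "\<forall>k. (case k of 0 \<Rightarrow> r | Suc i \<Rightarrow> a i) \<in> Fin R"
    using a(1) step(2) by (auto split: nat.split)
  ultimately show ?case by (intro exI conjI)
qed

lemma t_pow_t': "t ^ m * (t' ^ m * s) = s"
proof (induction m arbitrary: s)
  case (Suc m)
  have "t ^ Suc m * (t' ^ Suc m * s) = t ^ m * (t * (t' * (t' ^ m * s)))"
    by (simp only: power_Suc2[of t] power_Suc[of t'] mult.assoc)
  then show ?case using Suc by (simp only: tt'_simps)
qed simp

lemma Fin_Pol: "z \<in> Fin C ==> \<exists>m. t ^ m * z \<in> Pol"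
proof (induction z rule: Fin.induct)
  case zero
  then show ?case by (auto intro: Pol.zero)
next
  case (step c u k l)
  obtain m n a where a: "\<And>k. a k \<in> R" "c = t' ^ m * (\<Sum>k<(n::nat). a k * t ^ k)"
    using gen[OF step(1)] by blast
  obtain m' where m': "t ^ m' * u \<in> Pol" using step(3) by blast
  have R: "r \<in> Pol" if "r \<in> Fin R" for r using Pol.step[OF Pol.zero that] by simp
  have "a i * t ^ i * mx k l = t ^ i * (a i * mx k l)" for i
    using power_commuting_commutes[of t "a i" i] comm[OF t_C, of "a i"] a(1)[of i] R_C
    by (auto simp flip: mult.assoc)
  then have "t ^ m * (c * mx k l) = (\<Sum>i<n. t ^ i * (a i * mx k l))"
    unfolding a(2) mult.assoc t_pow_t' by (simp add: sum_distrib_right mult.assoc)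
  moreover have "(\<Sum>i<n. t ^ i * (a i * mx k l)) \<in> Pol"
  proof (induction n)
    case (Suc n)
    then show ?case using Pol_add Pol_tpow[OF R[OF Fin_mx[OF a(1)]]] by simp
  qed (simp add: Pol.zero)
  ultimately have "t ^ m * (c * mx k l) \<in> Pol" by simp
  then have "t ^ m' * (t ^ m * (c * mx k l)) + t ^ m * (t ^ m' * u) \<in> Pol"
    using Pol_add Pol_tpow m' by blast
  moreover have "t ^ m * (t ^ m' * u) = t ^ (m' + m) * u"
    by (simp only: add.commute[of m' m] power_add mult.assoc)
  ultimately have "t ^ (m' + m) * (c * mx k l + u) \<in> Pol"
    by (simp only: distrib_left power_add mult.assoc)
  then show ?case by blast
qed

text \<open>After multiplication by a power of t, comparison of coefficients applies. The
  coefficients below \<open>t ^ m\<close> vanish from the bottom up because v is invertible on the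
  corner, those from \<open>t ^ m\<close> on vanish from the top down because the leading
  coefficient of t - v is 1.\<close>

lemma division_unique:
  assumes L: "lin b v v' N" and u: "u \<in> Fin R" "b * u = u" and z: "z \<in> Fin C" "u = N * z"
  shows "u = 0" "z = 0"
proof -
  have l: "b \<in> Fin R" "v \<in> Fin R" "v' \<in> Fin R" "b * b = b" "b * v = v" "v' * v = b"
      and N: "N = 1 + (t - 1) * b - v"
    using L by (auto simp: lin_def)
  have "(1 - b) * N = 1 - b"
    using lin_apply(3)[OF L] by (simp add: left_diff_distrib) (simp add: N left_diff_distrib)
  moreover have "(1 - b) * (N * z) = 0" using u(2) z(2) by (simp add: left_diff_distrib)
  ultimately have "(1 - b) * z = 0" by (metis mult.assoc)
  then have bz: "b * z = z" by (simp add: left_diff_distrib)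
  obtain m where "t ^ m * z \<in> Pol" using Fin_Pol[OF z(1)] by blast
  then obtain n a where a: "\<And>k. a k \<in> Fin R" "t ^ m * z = (\<Sum>k<(n::nat). a k * t ^ k)"
    using Pol_sum by blast
  define c where "c = (\<lambda>k. if k < n then b * a k else 0)"
  have cF: "c k \<in> Fin R" for k using RF(4)[OF l(1) a(1)] Fin.zero by (auto simp: c_def)
  have tb: "t ^ m * b = b * t ^ m"
    using power_commuting_commutes[of t b m] C_Fin[OF t_C RF_C[OF l(1)]] by simp
  have zc: "t ^ m * z = (\<Sum>k<n. c k * t ^ k)"
  proof -
    have "t ^ m * z = t ^ m * (b * z)" using bz by simp
    also have "\<dots> = b * (t ^ m * z)" using tb by (metis mult.assoc)
    also have "\<dots> = (\<Sum>k<n. c k * t ^ k)" unfolding a(2) by (simp add: sum_distrib_left mult.assoc c_def)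
    finally show ?thesis .
  qed
  have bc: "b * c k = c k" for k using l(4) by (simp add: c_def flip: mult.assoc)
  have ut: "u * t ^ m = t ^ m * u" and vt: "t ^ m * v = v * t ^ m"
    using power_commuting_commutes[of t u m] C_Fin[OF t_C RF_C[OF u(1)]]
      power_commuting_commutes[of t v m] C_Fin[OF t_C RF_C[OF l(2)]] by simp_all
  have "t ^ m * (v * z) = v * (t ^ m * z)" using vt by (simp flip: mult.assoc)
  moreover have "t ^ m * (t * z) = t * (t ^ m * z)" by (simp only: power_commutes flip: mult.assoc)
  ultimately have "t ^ m * u = t * (t ^ m * z) - v * (t ^ m * z)"
    using z(2) lin_apply(1)[OF L bz] by (simp only: right_diff_distrib)
  then have eq: "u * t ^ m = t * (\<Sum>k<n. c k * t ^ k) - v * (\<Sum>k<n. c k * t ^ k)"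
    using ut zc by simp
  \<comment> \<open>Long enough to contain all coefficients of both the product with t - v and of
    \<open>u * t ^ m\<close>.\<close>
  define M where "M = Suc (max m n)"
  have ext: "(\<Sum>k<n. c k * t ^ k) = (\<Sum>k<M. c k * t ^ k)"
    by (rule sum.mono_neutral_left) (auto simp: M_def c_def)
  \<comment> \<open>The coefficient of \<open>t ^ k\<close> in the difference of the two
    sides.\<close>
  define d where "d = (\<lambda>k. (if k = 0 then 0 else c (k - 1)) - v * c k - (if k = m then u else 0))"
  have dF: "d k \<in> Fin R" for k
    unfolding d_def using RF(3)[OF RF(3)[OF _ RF(4)[OF l(2) cF]]] cF u(1) Fin.zero by auto
  have tc: "t * c k = c k * t" for k using C_Fin[OF t_C RF_C[OF cF]] .
  have "t * (\<Sum>k<n. c k * t ^ k) = (\<Sum>k<M. (if k = 0 then 0 else c (k - 1)) * t ^ k)"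
  proof -
    have "t * (\<Sum>k<n. c k * t ^ k) = (\<Sum>k<max m n. c k * t ^ Suc k)"
      unfolding sum_distrib_left
    proof (rule sum.mono_neutral_cong_left)
      show "t * (c k * t ^ k) = c k * t ^ Suc k" for k using tc[of k] by (simp flip: mult.assoc)
    qed (auto simp: c_def)
    then show ?thesis unfolding M_def sum.lessThan_Suc_shift by simp
  qed
  moreover have "v * (\<Sum>k<n. c k * t ^ k) = (\<Sum>k<M. v * c k * t ^ k)"
    unfolding ext by (simp add: sum_distrib_left mult.assoc)
  moreover have "u * t ^ m = (\<Sum>k<M. (if k = m then u else 0) * t ^ k)"
  proof -
    have "(\<Sum>k<M. (if k = m then u else 0) * t ^ k) = (\<Sum>k<M. if k = m then u * t ^ m else 0)"
      by (rule sum.cong) auto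
    then show ?thesis by (simp add: M_def)
  qed
  ultimately have "(\<Sum>k<M. d k * t ^ k) = 0"
    using eq by (simp add: d_def left_diff_distrib sum_subtractf)
  then have d0: "d k = 0" if "k < M" for k using indep[of d M k, OF dF] that by blast
  have vc: "v' * (v * c k) = c k" for k using l(6) bc by (simp flip: mult.assoc)
  have low: "k < m ==> c k = 0" for k
  proof (induction k)
    case 0
    then have "v * c 0 = 0" using d0[of 0] by (simp add: d_def M_def)
    then show ?case using vc[of 0] by simp
  next
    case (Suc k)
    then have "v * c (Suc k) = 0" using d0[of "Suc k"] by (simp add: d_def M_def)
    then show ?case using vc[of "Suc k"] by simp
  qed
  have high: "c (n - j) = 0" if "m \<le> n - j" for j using that
  proof (induction j)
    case (Suc j)
    show ?case
    proof (cases "n - j = 0")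
      case False
      then have e: "n - j = Suc (n - Suc j)" "m \<le> n - j" using Suc by auto
      have "d (n - j) = 0" using d0 by (simp add: M_def)
      then show ?thesis using e Suc by (simp add: d_def)
    qed (use Suc in simp)
  qed (simp add: c_def)
  have "c k = 0" for k
  proof (cases "k < m \<or> n \<le> k")
    case True then show ?thesis using low[of k] by (auto simp: c_def split: if_splits)
  next
    case False then show ?thesis using high[of "n - k"] by simp
  qed
  then have "t ^ m * z = 0" using zc by simp
  moreover have "t' ^ m * t ^ m = 1"
    using t_pow_t'[of m 1] power_commuting_commutes[of t' "t ^ m" m] power_commuting_commutes[of t t' m] by simp
  ultimately show "z = 0" by (metis mult.assoc mult_1_left mult_zero_right)
  then show "u = 0" using z by simp
qed

lemma GL_t: "u - 1 \<in> Fin C ==> t * u = u * t"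
  using C_Fin[OF t_C, of "u - 1"] by (simp add: algebra_simps)

lemma one_Fin_times: "u - 1 \<in> Fin C ==> w \<in> Fin C ==> u * w \<in> Fin C"
  "u - 1 \<in> Fin C ==> w \<in> Fin C ==> w * u \<in> Fin C"
proof -
  assume a: "u - 1 \<in> Fin C" "w \<in> Fin C"
  have "u * w = (u - 1) * w + w" "w * u = w * (u - 1) + w" by (simp_all add: algebra_simps)
  then show "u * w \<in> Fin C" "w * u \<in> Fin C" using CF(1)[OF CF(4)] a by metis+
qed

text \<open>P induces a map between the modules presented by the two pencils. Its matrix g over R
  consists of the remainders of the columns of P modulo N2, and uniqueness of remainders forces it
  to intertwine v with v2.\<close>

lemma pencil_map:
  assumes L: "lin b v v' N" and L2: "lin b2 v2 v2' N2"
    and PQ: "P - 1 \<in> Fin C" "Q - 1 \<in> Fin C" "P * N = N2 * Q"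
  shows "\<exists>g Z. g \<in> Fin R \<and> Z \<in> Fin C \<and> b2 * g = g \<and> g * b = g \<and> Z * b = Z
     \<and> P * b = g + N2 * Z \<and> v2 * g = g * v"
proof -
  have l: "b \<in> Fin R" "v \<in> Fin R" "b * b = b" "b * v = v" "v2 \<in> Fin R" "b2 * v2 = v2"
    using L L2 by (auto simp: lin_def)
  obtain g0 Z0 where g0: "g0 \<in> Fin R" "Z0 \<in> Fin C" "b2 * g0 = g0" "P * b = g0 + N2 * Z0"
    using division[OF L2 one_Fin_times(1)[OF PQ(1) RF_C[OF l(1)]]] by blast
  define g Z where "g = g0 * b" and "Z = Z0 * b"
  have gF: "g \<in> Fin R" unfolding g_def using RF(4)[OF g0(1) l(1)] .
  have ZF: "Z \<in> Fin C" unfolding Z_def using CF(4)[OF g0(2) RF_C[OF l(1)]] .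
  have gb: "b2 * g = g" "g * b = g" "Z * b = Z"
    unfolding g_def Z_def using g0 l(3) by (simp_all add: mult.assoc) (simp flip: mult.assoc)
  have Pb: "P * b = g + N2 * Z"
  proof -
    have "P * b = P * b * b" using l(3) by (simp add: mult.assoc)
    then show ?thesis unfolding g_def Z_def using g0(4) by (metis distrib_right mult.assoc)
  qed
  have "P * N * b = P * (t * b - v)" using lin_apply(4)[OF L] by (simp add: mult.assoc)
  also have "\<dots> = t * (P * b) - P * b * v"
    using GL_t[OF PQ(1)] l(4) by (simp add: right_diff_distrib mult.assoc) (simp flip: mult.assoc)
  also have "\<dots> = t * g - g * v + (t * (N2 * Z) - N2 * Z * v)"
    unfolding Pb by (simp add: algebra_simps)
  also have "t * (N2 * Z) = N2 * (t * Z)" using GL_t[OF lin_Fin[OF L2]] by (metis mult.assoc)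
  also have "t * g = N2 * g + v2 * g" using lin_apply(1)[OF L2 gb(1)] by simp
  finally have e: "v2 * g - g * v = N2 * (Q * b - t * Z + Z * v - g)"
    unfolding PQ(3) by (simp add: algebra_simps)
  have "v2 * g - g * v = 0"
  proof (rule division_unique(1)[OF L2 _ _ _ e])
    show "v2 * g - g * v \<in> Fin R" using RF(3)[OF RF(4)[OF l(5) gF] RF(4)[OF gF l(2)]] .
    show "b2 * (v2 * g - g * v) = v2 * g - g * v"
      using l(6) gb(1) by (simp add: right_diff_distrib flip: mult.assoc)
    show "Q * b - t * Z + Z * v - g \<in> Fin C"
      using CF(3)[OF CF(1)[OF CF(3)[OF one_Fin_times(1)[OF PQ(2) RF_C[OF l(1)]]
              C_Fin_closed[OF t_C ZF]] CF(4)[OF ZF RF_C[OF l(2)]]] RF_C[OF gF]] .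
  qed
  then show ?thesis using gF ZF gb Pb by (intro exI[of _ g] exI[of _ Z]) simp
qed

text \<open>The maps g and g' induced by P and its inverse are inverse to each other, and as the
  corners are disjoint they combine to an involution G with \<open>G * N = N2 * G\<close>. Then P
  and Q differ from G by N2 W and W N for one matrix W, so P G and Q G have the shapes 1 + N2 w and
  1 + w N2, and \<open>one_plus_mult_swap\<close> identifies their classes.\<close>

lemma pencil_unique_disjoint:
  assumes L: "lin b v v' N" and L2: "lin b2 v2 v2' N2" and dis: "b * b2 = 0" "b2 * b = 0"
    and P: "P \<in> GL C" and Q: "Q \<in> GL C" and PNQ: "P * N = N2 * Q"
  shows "P \<simeq> Q"
proof -
  have l: "b \<in> Fin R" "v \<in> Fin R" "b * b = b" "b * v = v" "v * b = v"
    "b2 \<in> Fin R" "v2 \<in> Fin R" "b2 * b2 = b2" "b2 * v2 = v2" "v2 * b2 = v2"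
    and N: "N = 1 + (t - 1) * b - v" and N2: "N2 = 1 + (t - 1) * b2 - v2"
    using L L2 by (auto simp: lin_def)
  have PF: "P - 1 \<in> Fin C" "Q - 1 \<in> Fin C" "uinv P - 1 \<in> Fin C" "uinv Q - 1 \<in> Fin C"
    using P Q by (auto simp: GL_def)
  have PNQ': "uinv P * N2 = N * uinv Q"
    using arg_cong[OF PNQ, of "\<lambda>s. uinv P * (s * uinv Q)"] GL_unt[OF P] GL_unt[OF Q]
    by (simp add: mult.assoc)
  obtain g Z where g: "g \<in> Fin R" "Z \<in> Fin C" "b2 * g = g" "g * b = g" "P * b = g + N2 * Z"
      "v2 * g = g * v"
    using pencil_map[OF L L2 PF(1,2) PNQ] by blast
  obtain g' Z' where g': "g' \<in> Fin R" "Z' \<in> Fin C" "b * g' = g'" "g' * b2 = g'"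
      "uinv P * b2 = g' + N * Z'"
    using pencil_map[OF L2 L PF(3,4) PNQ'] by blast
  have gg': "g * g' = b2"
  proof -
    have "b2 = P * (uinv P * b2)" using GL_unt[OF P] by simp
    also have "\<dots> = P * b * g' + P * N * Z'" unfolding g'(5) using g'(3) by (simp add: algebra_simps)
    also have "\<dots> = g * g' + N2 * (Z * g' + Q * Z')" unfolding g(5) PNQ by (simp add: algebra_simps)
    finally have e: "b2 - g * g' = N2 * (Z * g' + Q * Z')" by (simp add: algebra_simps)
    have "b2 - g * g' = 0"
    proof (rule division_unique(1)[OF L2 _ _ _ e])
      show "b2 - g * g' \<in> Fin R" using RF(3)[OF l(6) RF(4)[OF g(1) g'(1)]] .
      show "b2 * (b2 - g * g') = b2 - g * g'"
        using l(8) g(3) by (simp add: right_diff_distrib flip: mult.assoc)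
      show "Z * g' + Q * Z' \<in> Fin C"
        using CF(1)[OF CF(4)[OF g(2) RF_C[OF g'(1)]] one_Fin_times(1)[OF PF(2) g'(2)]] .
    qed
    then show ?thesis by simp
  qed
  have g'g: "g' * g = b"
  proof -
    have "b = uinv P * (P * b)" using GL_unt[OF P] by simp
    also have "\<dots> = uinv P * b2 * g + uinv P * N2 * Z" unfolding g(5) using g(3) by (simp add: algebra_simps)
    also have "\<dots> = g' * g + N * (Z' * g + uinv Q * Z)" unfolding g'(5) PNQ' by (simp add: algebra_simps)
    finally have e: "b - g' * g = N * (Z' * g + uinv Q * Z)" by (simp add: algebra_simps)
    have "b - g' * g = 0"
    proof (rule division_unique(1)[OF L _ _ _ e])
      show "b - g' * g \<in> Fin R" using RF(3)[OF l(1) RF(4)[OF g'(1) g(1)]] .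
      show "b * (b - g' * g) = b - g' * g"
        using l(3) g'(3) by (simp add: right_diff_distrib flip: mult.assoc)
      show "Z' * g + uinv Q * Z \<in> Fin C"
        using CF(1)[OF CF(4)[OF g'(2) RF_C[OF g(1)]] one_Fin_times(1)[OF PF(4) g(2)]] .
    qed
    then show ?thesis by simp
  qed
  have z: "b * g = 0" "g * b2 = 0" "g * g = 0" "b2 * g' = 0" "g' * b = 0" "g' * g' = 0"
    "b2 * v = 0" "g' * v = 0" "v2 * b = 0" "v2 * g' = 0" "b * v2 = 0" "v * b2 = 0"
    by (metis dis g(3,4) g'(3,4) l(4,5,9,10) mult.assoc mult_zero_left mult_zero_right)+
  \<comment> \<open>G exchanges the two corners through g and g' and is the identity off
    them.\<close>
  define G where "G = 1 - b - b2 + g + g'"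
  have GG: "G * G = 1"
    unfolding G_def using z l g g' gg' g'g dis by (simp add: algebra_simps)
  have tG: "t * g = g * t" "t * b2 = b2 * t" using C_Fin[OF t_C RF_C[OF g(1)]] C_Fin[OF t_C RF_C[OF l(6)]] by simp_all
  have Gb: "G * b = g" "b2 * G = g" unfolding G_def using z l g g' dis by (simp_all add: algebra_simps)
  have Gv: "G * v = g * v" "v2 * G = v2 * g"
    unfolding G_def using z l by (simp_all add: algebra_simps)
  have GF: "G - 1 \<in> Fin C"
  proof -
    have "g + g' - b - b2 \<in> Fin R" using RF(3)[OF RF(3)[OF RF(1)[OF g(1) g'(1)] l(1)] l(6)] .
    then show ?thesis using RF_C by (simp add: G_def algebra_simps)
  qed
  have Gt: "t * G = G * t" using GL_t[OF GF] .
  have GN: "G * N = N2 * G"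
  proof -
    have "G * N = G + (t - 1) * (G * b) - G * v" unfolding N using Gt
      by (simp add: algebra_simps) (metis mult.assoc)
    moreover have "N2 * G = G + (t - 1) * (b2 * G) - v2 * G" unfolding N2 by (simp add: algebra_simps)
    ultimately show ?thesis unfolding Gb Gv using g(6) by simp
  qed
  have GGL: "G \<in> GL C" using GLI[OF GF GF GG GG] .
  define W where "W = Z + (Q - G) * (1 - b)"
  have QG: "Q - G \<in> Fin C" using CF(3)[OF PF(2) GF] by simp
  have WF: "W \<in> Fin C"
    unfolding W_def using CF(1)[OF g(2) CF(3)[OF QG CF(4)[OF QG RF_C[OF l(1)]]]] by (simp add: right_diff_distrib)
  have PW: "P - G = N2 * W"
  proof -
    have "(P - G) * b = N2 * Z" using g(5) Gb by (simp add: left_diff_distrib)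
    moreover have "(P - G) * (1 - b) = N2 * ((Q - G) * (1 - b))"
    proof -
      have "(P - G) * (1 - b) = (P - G) * (N * (1 - b))" using lin_apply(2)[OF L] by simp
      also have "\<dots> = (P * N - G * N) * (1 - b)" by (simp only: left_diff_distrib mult.assoc)
      also have "\<dots> = N2 * ((Q - G) * (1 - b))"
        unfolding PNQ GN by (simp only: left_diff_distrib right_diff_distrib mult.assoc)
      finally show ?thesis .
    qed
    ultimately have "(P - G) * b + (P - G) * (1 - b) = N2 * Z + N2 * ((Q - G) * (1 - b))" by simp
    then show ?thesis by (simp add: W_def distrib_left flip: distrib_left[of "P - G"])
  qed
  have e0: "N2 * (Q - G - W * N) = 0"
  proof -
    have "N2 * (Q - G) = (P - G) * N" using PNQ GN by (simp add: left_diff_distrib right_diff_distrib)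
    then show ?thesis unfolding PW by (simp add: right_diff_distrib mult.assoc)
  qed
  have eF: "Q - G - W * N \<in> Fin C" using CF(3)[OF QG one_Fin_times(2)[OF lin_Fin[OF L] WF]] .
  have "Q - G - W * N = 0"
    by (rule division_unique(2)[OF L2 Fin.zero mult_zero_right eF e0[symmetric]])
  then have QW: "Q = G + W * N" by (simp add: algebra_simps)
  have NG: "N * G = G * N2"
  proof -
    have "G * (G * N) * G = G * (N2 * G) * G" using GN by simp
    then show ?thesis using GG by (simp add: mult.assoc) (simp flip: mult.assoc)
  qed
  define w where "w = W * G"
  have wF: "w \<in> Fin C" unfolding w_def using one_Fin_times(2)[OF GF WF] .
  have PG: "P * G = 1 + N2 * w" using PW GG by (simp add: w_def algebra_simps flip: mult.assoc)
  have QG: "Q * G = 1 + w * N2" unfolding QW w_def using GG NG by (simp add: distrib_right mult.assoc)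
  obtain r0 where r0: "\<And>s. s \<ge> r0 ==> pr s * w = w \<and> w * pr s = w" using Fin_bound[OF idl_C wF] by blast
  obtain r1 where r1: "sized r1 N2" using sized_ex[OF idl_C lin_Fin[OF L2]] by blast
  define r where "r = max r0 r1"
  have r: "pr r * w = w" "w * pr r = w" using r0[of r] by (simp_all add: r_def)
  have "sized r N2" using sized_le[OF r1] by (simp add: r_def)
  then have pN: "pr r * N2 = N2 * pr r" by (simp add: sized_def right_diff_distrib left_diff_distrib)
      (metis add_diff_cancel_right' diff_add_cancel diff_right_commute)
  \<comment> \<open>N2 is only a finite perturbation of 1; the inserted idempotent turns it into the
    finite matrix that \<open>one_plus_mult_swap\<close> asks for.\<close>
  have e1: "P * G = 1 + (N2 * pr r) * w" unfolding PG using r by (simp add: mult.assoc)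
  have e2: "Q * G = 1 + w * (N2 * pr r)" unfolding QG pN[symmetric] using r by (simp flip: mult.assoc)
  have "P * G \<simeq> Q * G"
    unfolding e1 e2
    by (rule one_plus_mult_swap(2)[OF one_Fin_times(1)[OF lin_Fin[OF L2] Fin_pr] wF])
      (use GLC(1)[OF P GGL] e1 in simp)
  from eqv_mult[OF this eqv_refl[OF GGL]] show ?thesis using GG by (simp add: mult.assoc)
qed

end

context laurent_ring begin

interpretation R: coeff_ring x y R
  by unfold_locales (use R_C R_0 R_1 R_add R_neg R_mult C_x C_y in auto)

lemma Fin_sum: "(\<And>i. i \<in> I ==> f i \<in> Fin D) ==> sum f I \<in> Fin D"
  by (induction I rule: infinite_finite_induct) (auto intro: Fin.zero Fin_add)

definition swp :: "nat \<Rightarrow> 'w" where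
  "swp r = 1 - pr r - x ^ r * pr r * y ^ r + x ^ r * pr r + pr r * y ^ r"

lemma swp_swp: "swp r * swp r = 1"
  by (simp add: swp_def algebra_simps)

lemma swp_GL: "swp r \<in> GL C"
proof (rule GLI[OF _ _ swp_swp swp_swp])
  have p: "pr r \<in> Fin C" "x ^ r * pr r \<in> Fin C" "pr r * y ^ r \<in> Fin C" "x ^ r * pr r * y ^ r \<in> Fin C"
    using Fin_pr Fin_xl[OF idl_C Fin_pr] Fin_yr[OF Fin_pr] Fin_yr[OF Fin_xl[OF idl_C Fin_pr]] by blast+
  have "x ^ r * pr r + pr r * y ^ r - pr r - x ^ r * pr r * y ^ r \<in> Fin C"
    using CF(3)[OF CF(3)[OF CF(1)[OF p(2,3)] p(1)] p(4)] .
  then show "swp r - 1 \<in> Fin C" by (simp add: swp_def algebra_simps)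
  then show "swp r - 1 \<in> Fin C" .
qed

lemma swp_sh: assumes "sized r u" shows "swp r * u = sh r u * swp r"
proof -
  define a where "a = u - 1"
  have u: "u = 1 + a" by (simp add: a_def)
  have pa: "pr r * a = a" "a * pr r = a" using assms by (simp_all add: sized_def a_def)
  have ya: "y ^ r * a = 0" "a * x ^ r = 0"
    using pa y_pr(1) pr_x(1) by (metis mult.assoc mult_zero_left, metis mult.assoc mult_zero_right)
  have ap: "a * (pr r * s) = a * s" "a * (x ^ r * s) = 0" "y ^ r * (a * s) = 0" for s
    using pa ya by (simp_all flip: mult.assoc)
  have "swp r * a = x ^ r * a" unfolding swp_def using pa ya by (simp add: algebra_simps ap)
  moreover have "x ^ r * a * y ^ r * swp r = x ^ r * a"
    unfolding swp_def using pa ya by (simp add: algebra_simps ap)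
  ultimately show ?thesis unfolding u sh_def by (simp add: distrib_left distrib_right)
qed

lemma t_xy: "t * x ^ r = x ^ r * t" "t * y ^ r = y ^ r * t"
  using C_xpow[OF t_C] C_ypow[OF t_C] by blast+

lemma lin_sh:
  assumes L: "lin b v v' N"
  shows "lin (x ^ r * b * y ^ r) (x ^ r * v * y ^ r) (x ^ r * v' * y ^ r) (sh r N)"
proof -
  have l: "b \<in> Fin R" "v \<in> Fin R" "v' \<in> Fin R" "b * b = b" "b * v = v" "v * b = v"
      "b * v' = v'" "v' * b = v'" "v * v' = b" "v' * v = b" and N: "N = 1 + (t - 1) * b - v"
    using L by (auto simp: lin_def)
  have m: "x ^ r * s * y ^ r * (x ^ r * s' * y ^ r) = x ^ r * (s * s') * y ^ r" for s s'
    by (simp add: mult.assoc)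
  have F: "s \<in> Fin R ==> x ^ r * s * y ^ r \<in> Fin R" for s
    using R.Fin_yr[OF R.Fin_xl[OF R.idl_C]] .
  have "x ^ r * ((t - 1) * b - v) * y ^ r = (t - 1) * (x ^ r * b * y ^ r) - x ^ r * v * y ^ r"
    using t_xy(1)[of r] by (simp add: algebra_simps) (metis mult.assoc)
  then have "sh r N = 1 + (t - 1) * (x ^ r * b * y ^ r) - x ^ r * v * y ^ r"
    by (simp add: sh_def N)
  then show ?thesis unfolding lin_def m using l F by auto
qed

text \<open>The permutation \<open>swp r\<close> moves the second pencil to a block away from the
  corner of the first. It multiplies P and Q alike, so it cancels at the end.\<close>

lemma pencil_unique:
  assumes L: "lin b v v' N" and L2: "lin b2 v2 v2' N2"
    and P: "P \<in> GL C" and Q: "Q \<in> GL C" and PNQ: "P * N = N2 * Q"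
  shows "P \<simeq> Q"
proof -
  have bF: "b \<in> Fin C" using L RF_C by (auto simp: lin_def)
  obtain r0 where r0: "\<And>s. s \<ge> r0 ==> pr s * b = b \<and> b * pr s = b" using Fin_bound[OF idl_C bF] by blast
  obtain r1 where r1: "sized r1 N2" using sized_ex[OF idl_C lin_Fin[OF L2]] by blast
  define r where "r = max r0 r1"
  have r: "pr r * b = b" "b * pr r = b" using r0[of r] by (simp_all add: r_def)
  have s: "sized r N2" using sized_le[OF r1] by (simp add: r_def)
  have z: "b * x ^ r = 0" "y ^ r * b = 0"
    using r y_pr(1) pr_x(1) by (metis mult.assoc mult_zero_right, metis mult.assoc mult_zero_left)
  have d: "b * (x ^ r * b2 * y ^ r) = 0" "x ^ r * b2 * y ^ r * b = 0"
    using z by (metis mult.assoc mult_zero_left, metis mult.assoc mult_zero_right)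
  have "swp r * P * N = sh r N2 * (swp r * Q)"
    using PNQ swp_sh[OF s] by (metis mult.assoc)
  then have "swp r * P \<simeq> swp r * Q"
    using pencil_unique_disjoint[OF L lin_sh[OF L2] d] GLC(1)[OF swp_GL] P Q by blast
  then show ?thesis using eqv_cancel_l[OF _ swp_GL P Q] by blast
qed

definition sym :: "'w \<Rightarrow> 'w \<Rightarrow> bool" where
  "sym a k \<longleftrightarrow> (\<exists>b v v' N P Q. lin b v v' N \<and> P \<in> GL C \<and> Q \<in> GL C \<and> a = P * N * Q \<and> k \<simeq> P * Q)"

lemma sym_unique: assumes "sym a k" "sym a k'" shows "k \<simeq> k'"
proof -
  obtain b v v' N P Q where 1: "lin b v v' N" "P \<in> GL C" "Q \<in> GL C" "a = P * N * Q" "k \<simeq> P * Q"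
    using assms(1) sym_def by blast
  obtain b2 v2 v2' N2 P2 Q2 where 2: "lin b2 v2 v2' N2" "P2 \<in> GL C" "Q2 \<in> GL C"
    "a = P2 * N2 * Q2" "k' \<simeq> P2 * Q2"
    using assms(2) sym_def by blast
  have u: "unt P" "unt Q" "unt P2" "unt Q2" using 1 2 GL_unt by blast+
  have "uinv P2 * P * N = uinv P2 * (P * N * Q) * uinv Q"
    using u by (simp add: mult.assoc)
  also have "\<dots> = uinv P2 * (P2 * N2 * Q2) * uinv Q" using 1(4) 2(4) by simp
  also have "\<dots> = N2 * (Q2 * uinv Q)" using u by (simp add: mult.assoc)
  finally have "uinv P2 * P \<simeq> Q2 * uinv Q"
    by (rule pencil_unique[OF 1(1) 2(1) GLC(1)[OF GLC(2)[OF 2(2)] 1(2)] GLC(1)[OF 2(3) GLC(2)[OF 1(3)]]])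
  from eqv_mult[OF eqv_mult[OF eqv_refl[OF 2(2)] this] eqv_refl[OF 1(3)]]
  have "P2 * (uinv P2 * P) * Q \<simeq> P2 * (Q2 * uinv Q) * Q" .
  then have "P * Q \<simeq> P2 * Q2" using u by (simp add: mult.assoc)
  then show ?thesis using eqv_trans[OF 1(5) eqv_trans[OF _ eqv_sym[OF 2(5)]]] by blast
qed

lemma sym_GL: "g \<in> GL C ==> sym g g"
  unfolding sym_def using lin_one eqv_refl GL_1
  by (intro exI[of _ "0::'w"] exI[of _ "1::'w"] exI[of _ g]) auto

lemma sym_eqv: "sym a k ==> k' \<simeq> k ==> sym a k'"
  unfolding sym_def using eqv_trans by blast

lemma sym_inGL: "sym a k ==> k \<in> GL C" unfolding sym_def eqv_def by blast

text \<open>A block triangular matrix with two pencils on the diagonal is again a pencil, for the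
  block triangular endomorphism d, as soon as the lower corner w has entries in R and maps the first
  corner to the second.\<close>

lemma lin_block:
  assumes L: "lin b v v' N" and L2: "lin b2 v2 v2' N2" and r: "pr r * b = b" "b * pr r = b"
    "pr r * b2 = b2" "b2 * pr r = b2"
    and w: "w \<in> Fin R" "b2 * w = w" "w * b = w"
  shows "\<exists>c d d'. lin c d d' (N * sh r N2 + x ^ r * w)"
proof -
  have l: "b \<in> Fin R" "v \<in> Fin R" "v' \<in> Fin R" "b * b = b" "b * v = v" "v * b = v"
      "b * v' = v'" "v' * b = v'" "v * v' = b" "v' * v = b" and N: "N = 1 + (t - 1) * b - v"
    using L by (auto simp: lin_def)
  have l2: "b2 \<in> Fin R" "v2 \<in> Fin R" "v2' \<in> Fin R" "b2 * b2 = b2" "b2 * v2 = v2" "v2 * b2 = v2"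
      "b2 * v2' = v2'" "v2' * b2 = v2'" "v2 * v2' = b2" "v2' * v2 = b2" and N2: "N2 = 1 + (t - 1) * b2 - v2"
    using L2 by (auto simp: lin_def)
  define X Y where "X = x ^ r" and "Y = y ^ r"
  have YX [simp]: "Y * X = 1" "Y * (X * s) = s" for s by (simp_all add: X_def Y_def)
  have z1: "b * X = 0" "Y * b = 0" "b2 * X = 0" "Y * b2 = 0"
    using r y_pr(1) pr_x(1) unfolding X_def Y_def
    by (metis mult.assoc mult_zero_right, metis mult.assoc mult_zero_left,
        metis mult.assoc mult_zero_right, metis mult.assoc mult_zero_left)
  have z2: "v * X = 0" "Y * v = 0" "v' * X = 0" "Y * v' = 0" "w * X = 0" "Y * w = 0"
      "Y * v2' = 0" "Y * v2 = 0"
    using z1 l l2 w by (metis mult.assoc mult_zero_right mult_zero_left)+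
  have z3: "v * (X * s) = 0" "Y * (v * s) = 0" "v' * (X * s) = 0" "Y * (v' * s) = 0" "w * (X * s) = 0"
      "Y * (w * s) = 0" "b * (X * s) = 0" "Y * (b * s) = 0" "b2 * (X * s) = 0" "Y * (b2 * s) = 0"
      "Y * (v2' * s) = 0" "Y * (v2 * s) = 0" for s
    using z1 z2 by (simp_all flip: mult.assoc)
  have m: "b * (b * s) = b * s" "b * (v * s) = v * s" "v * (b * s) = v * s" "b * (v' * s) = v' * s"
    "v' * (b * s) = v' * s" "v * (v' * s) = b * s" "v' * (v * s) = b * s"
    "b2 * (b2 * s) = b2 * s" "b2 * (v2 * s) = v2 * s" "v2 * (b2 * s) = v2 * s" "b2 * (v2' * s) = v2' * s"
    "v2' * (b2 * s) = v2' * s" "v2 * (v2' * s) = b2 * s" "v2' * (v2 * s) = b2 * s"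
    "b2 * (w * s) = w * s" "w * (b * s) = w * s" for s
    using l l2 w by (simp_all flip: mult.assoc)
  note S = z1 z2 z3 m l(4-10) l2(4-10) w(2,3)
  define c where "c = b + X * b2 * Y"
  define d where "d = v + X * v2 * Y - X * w"
  \<comment> \<open>The inverse of the block matrix (v, 0; -w, v2) on the joint corner.\<close>
  define d' where "d' = v' + X * v2' * Y + X * v2' * w * v'"
  have FX: "s \<in> Fin R ==> X * s \<in> Fin R" "s \<in> Fin R ==> X * s * Y \<in> Fin R" for s
    unfolding X_def Y_def using R.Fin_xl[OF R.idl_C] R.Fin_yr by blast+
  have cF: "c \<in> Fin R" unfolding c_def using RF(1)[OF l(1) FX(2)[OF l2(1)]] .
  have dF: "d \<in> Fin R" unfolding d_def using RF(3)[OF RF(1)[OF l(2) FX(2)[OF l2(2)]] FX(1)[OF w(1)]] .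
  have dF': "d' \<in> Fin R" unfolding d'_def
    using RF(1)[OF RF(1)[OF l(3) FX(2)[OF l2(3)]] RF(4)[OF RF(4)[OF FX(1)[OF l2(3)] w(1)] l(3)]] .
  have "N * sh r N2 + x ^ r * w = 1 + (t - 1) * c - d"
  proof -
    have "sh r N2 = 1 + X * ((t - 1) * b2 - v2) * Y" by (simp add: sh_def N2 X_def Y_def)
    moreover have "X * ((t - 1) * b2 - v2) * Y = (t - 1) * (X * b2 * Y) - X * v2 * Y"
      using t_xy(1)[of r] unfolding X_def Y_def by (simp add: algebra_simps) (metis mult.assoc)
    ultimately have e: "sh r N2 = 1 + (t - 1) * (X * b2 * Y) - X * v2 * Y" by simp
    have tX: "b * (t * (X * s)) = 0" "v * (t * (X * s)) = 0" for s
      using t_xy(1)[of r] z3(1,7) unfolding X_def by (metis mult.assoc)+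
    show ?thesis unfolding e N c_def d_def X_def[symmetric] by (simp add: algebra_simps S tX)
  qed
  moreover have "c * c = c" "c * d = d" "d * c = d" "c * d' = d'" "d' * c = d'" "d * d' = c" "d' * d = c"
    unfolding c_def d_def d'_def by (simp_all add: algebra_simps S)
  ultimately show ?thesis unfolding lin_def using cF dF dF' by blast
qed

text \<open>The matrix h = Q P2 stands between the two pencils. \<open>block_factor\<close> moves it
  aside at the price of the corner block 1/h; dividing that corner by the pencils leaves a remainder
  over R, and \<open>lin_block\<close> recognizes a single pencil.\<close>

lemma sym_mult: assumes "sym a k" "sym a' k'" shows "sym (a * a') (k * k')"
proof -
  obtain b v v' N P Q where 1: "lin b v v' N" "P \<in> GL C" "Q \<in> GL C" "a = P * N * Q" "k \<simeq> P * Q"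
    using assms(1) sym_def by blast
  obtain b2 v2 v2' N2 P2 Q2 where 2: "lin b2 v2 v2' N2" "P2 \<in> GL C" "Q2 \<in> GL C"
    "a' = P2 * N2 * Q2" "k' \<simeq> P2 * Q2"
    using assms(2) sym_def by blast
  define h where "h = Q * P2"
  have h: "h \<in> GL C" unfolding h_def using GLC(1)[OF 1(3) 2(2)] .
  have hF: "h - 1 \<in> Fin C" "uinv h - 1 \<in> Fin C" using h by (auto simp: GL_def)
  have bF: "b \<in> Fin C" "b2 \<in> Fin C" using 1 2 RF_C by (auto simp: lin_def)
  obtain r1 r2 r3 where r: "\<And>s. s \<ge> r1 ==> pr s * b = b \<and> b * pr s = b"
    "\<And>s. s \<ge> r2 ==> pr s * b2 = b2 \<and> b2 * pr s = b2" "sized r3 h"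
    using Fin_bound[OF idl_C bF(1)] Fin_bound[OF idl_C bF(2)] sized_ex[OF idl_C hF(1)] by blast
  obtain r4 where r4: "sized r4 N" "sized r4 N2"
    using sized_Fin_common[OF lin_Fin[OF 1(1)] lin_Fin[OF 2(1)]] by blast
  define r where "r = max (max r1 r2) (max r3 r4)"
  have rb: "pr r * b = b" "b * pr r = b" "pr r * b2 = b2" "b2 * pr r = b2"
    using r(1)[of r] r(2)[of r] by (auto simp: r_def)
  have rs: "sized r h" "sized r N" "sized r N2"
    using sized_le[OF r(3)] sized_le[OF r4(1)] sized_le[OF r4(2)] by (auto simp: r_def)
  have rh: "sized r (uinv h)" using sized_inv[OF rs(1) GL_unt[OF h]] .
  have comm_p: "pr r * s = s * pr r" if "sized r s" for s
    using that by (simp add: sized_def right_diff_distrib left_diff_distrib)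
      (metis add_diff_cancel_right' diff_add_cancel diff_right_commute)
  define p where "p = pr r"
  define w where "w = p * uinv h"
  have wF: "w \<in> Fin C" unfolding w_def p_def using one_Fin_times(2)[OF hF(2) Fin_pr] .
  have pw: "p * w = w" "w * p = w"
  proof -
    show "p * w = w" by (simp add: w_def p_def)
    show "w * p = w" unfolding w_def p_def comm_p[OF rh] by (simp add: mult.assoc)
  qed
  \<comment> \<open>Off its corner N is the identity, so this part of w is already a right-hand
    multiple of N; only \<open>w * b\<close> has to be divided by N2.\<close>
  define z where "z = w * (p - b)"
  have zN: "z * N = w - w * b"
  proof -
    have bN: "b * N = N * b" using lin_apply(3,4)[OF 1(1)] by simp
    have "(p - b) * N = p * (N * (1 - b))"
      using comm_p[OF rs(2)] bN rb unfolding p_def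
      by (simp add: left_diff_distrib right_diff_distrib) (metis mult.assoc)
    also have "\<dots> = p - b" using lin_apply(2)[OF 1(1)] rb by (simp add: right_diff_distrib p_def)
    finally have "z * N = w * (p - b)" unfolding z_def by (simp add: mult.assoc)
    then show ?thesis using pw by (simp add: right_diff_distrib)
  qed
  obtain g z0 where g: "g \<in> Fin R" "z0 \<in> Fin C" "b2 * g = g" "w * b = g + N2 * z0"
    using division[OF 2(1) CF(4)[OF wF bF(1)]] by blast
  define v0 where "v0 = g * b"
  define z' where "z' = p * z0 * b"
  have bb: "b * b = b" using 1(1) by (auto simp: lin_def)
  have bR: "b \<in> Fin R" using 1(1) by (auto simp: lin_def)
  have v0F: "v0 \<in> Fin R" unfolding v0_def using RF(4)[OF g(1) bR] .
  have v0b: "b2 * v0 = v0" "v0 * b = v0"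
    unfolding v0_def using g(3) bb by (simp_all add: mult.assoc) (simp flip: mult.assoc)
  have "w * b = p * (w * b) * b" using pw bb by (simp add: mult.assoc) (simp flip: mult.assoc)
  also have "\<dots> = p * g * b + p * N2 * z0 * b" unfolding g(4) by (simp add: algebra_simps)
  also have "p * g = g" using g(3) rb(3) unfolding p_def by (metis mult.assoc)
  also have "p * N2 = N2 * p" using comm_p[OF rs(3)] by (simp add: p_def)
  finally have wb: "w * b = v0 + N2 * z'" unfolding v0_def z'_def by (simp add: mult.assoc)
  have pF: "p \<in> Fin C" unfolding p_def using Fin_pr .
  have zF: "z \<in> Fin C" unfolding z_def using CF(4)[OF wF CF(3)[OF pF bF(1)]] .
  have zF': "z' \<in> Fin C" unfolding z'_def using CF(4)[OF CF(4)[OF pF g(2)] bF(1)] .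
  have zp: "p * z = z" "z * p = z" "p * z' = z'" "z' * p = z'"
  proof -
    show "p * z = z" unfolding z_def using pw(1) by (simp flip: mult.assoc)
    have "p * p = p" "b * p = b" using rb by (simp_all add: p_def)
    then show "z * p = z" "p * z' = z'" "z' * p = z'"
      unfolding z_def z'_def by (simp_all add: mult.assoc left_diff_distrib) (simp flip: mult.assoc)
  qed
  have "pr r * uinv h = z * N + N2 * z' + v0"
    using zN wb by (simp add: w_def p_def algebra_simps)
  then obtain P1 Q1 where PQ: "P1 \<in> El C" "Q1 \<in> GL C" "Q1 \<simeq> h"
      "N * h * N2 = P1 * (N * sh r N2 + x ^ r * v0) * Q1"
    using block_factor[OF lin_Fin[OF 1(1)] rs(2) lin_Fin[OF 2(1)] rs(3) h rs(1) zF _ _ zF'] zp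
    unfolding p_def by blast
  obtain c d d' where L: "lin c d d' (N * sh r N2 + x ^ r * v0)"
    using lin_block[OF 1(1) 2(1) rb v0F v0b] by blast
  have "a * a' = P * (N * h * N2) * Q2" unfolding 1(4) 2(4) h_def by (simp add: mult.assoc)
  also have "\<dots> = (P * P1) * (N * sh r N2 + x ^ r * v0) * (Q1 * Q2)"
    unfolding PQ(4) by (simp add: mult.assoc)
  finally have e: "a * a' = (P * P1) * (N * sh r N2 + x ^ r * v0) * (Q1 * Q2)" .
  have "(P * P1) * (Q1 * Q2) \<simeq> P * (h * Q2)"
    using eqv_mult[OF eqv_El(2)[OF PQ(1) 1(2)] eqv_mult[OF PQ(3) eqv_refl[OF 2(3)]]] .
  also have "P * (h * Q2) = (P * Q) * (P2 * Q2)" by (simp add: h_def mult.assoc)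
  finally have "k * k' \<simeq> (P * P1) * (Q1 * Q2)"
    using eqv_trans[OF eqv_mult[OF 1(5) 2(5)] eqv_sym] by metis
  then show ?thesis unfolding sym_def
    using L e GLC(1)[OF 1(2) ElC(1)[OF PQ(1)]] GLC(1)[OF PQ(2) 2(3)] by blast
qed

end

section \<open>Companion matrices and symbols of monic polynomials\<close>

context laurent_ring begin

interpretation R: coeff_ring x y R
  by unfold_locales (use R_C R_0 R_1 R_add R_neg R_mult C_x C_y in auto)

lemma mx_C: "c \<in> C ==> mx k l * c = c * mx k l" "c \<in> C ==> mx k l * (c * s) = c * (mx k l * s)"
  using C_mx by (metis, metis mult.assoc)

text \<open>The base case is t + c k, so the value is monic of degree j + 1 with lower coefficients
  c k, ..., c (k + j).\<close>

fun horner :: "(nat \<Rightarrow> 'w) \<Rightarrow> nat \<Rightarrow> nat \<Rightarrow> 'w" where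
  "horner c 0 k = t + c k"
| "horner c (Suc j) k = t * horner c j (Suc k) + c k"

lemma horner_C: "(\<And>i. c i \<in> R) ==> horner c j k \<in> C"
  using R_C t_C by (induction j arbitrary: k) (auto intro!: C_add C_mult)

text \<open>A partly unrolled companion matrix: t on the diagonal and -1 below it in the columns
  before k, and in column k the c i above the polynomial h that is still to be unrolled.\<close>

definition companion :: "(nat \<Rightarrow> 'w) \<Rightarrow> nat \<Rightarrow> 'w \<Rightarrow> 'w" where
  "companion c k h = 1 + (\<Sum>j<k. (t - 1) * mx j j - mx (Suc j) j) + (\<Sum>i<k. c i * mx i k)
     + (h - 1) * mx k k"

lemma rotation_El:
  assumes "k \<noteq> l"
  shows "1 - mx k k - mx l l - mx l k + mx k l \<in> El C"
proof -
  have "(1 + 1 * mx k l) * ((1 + (- 1) * mx l k) * (1 + 1 * mx k l)) \<in> El C"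
    using assms C_1 C_neg[OF C_1] by (intro El.step El_elem) auto
  moreover have "(1 + 1 * mx k l) * ((1 + (- 1) * mx l k) * (1 + 1 * mx k l))
     = 1 - mx k k - mx l l - mx l k + mx k l"
    using assms by (simp add: algebra_simps mx_mult)
  ultimately show ?thesis by simp
qed

text \<open>One row operation with t, one column operation with h and a signed exchange of the
  indices k and k + 1 trade the entry t h + c k for one more column of the companion matrix.\<close>

lemma companion_step:
  assumes c: "\<And>i. c i \<in> R" and h: "h \<in> C"
  shows "\<exists>P\<in>El C. \<exists>Q\<in>El C. companion c k (t * h + c k) = P * companion c (Suc k) h * Q"
proof -
  define m where "m = mx k (Suc k)"
  define L where "L = 1 + t * mx k (Suc k)"
  define E where "E = 1 + h * mx k (Suc k)"
  define S where "S = 1 - mx k k - mx (Suc k) (Suc k) - mx (Suc k) k + mx k (Suc k)"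
  define T where "T = (\<Sum>j<k. (t - 1) * mx j j - mx (Suc j) j)"
  define V where "V = (\<Sum>i<k. c i * mx i 0)"
  have cC: "c i \<in> C" for i using c R_C by blast
  have Vm: "(\<Sum>i<k. c i * mx i l) = V * mx 0 l" for l
    by (simp add: V_def sum_distrib_right mult.assoc mx_mult)
  have T0: "T * mx a b = 0" if "a \<ge> k" for a b
    unfolding T_def sum_distrib_right
    by (rule sum.neutral) (use that in \<open>auto simp: algebra_simps mx_mult\<close>)
  have T1: "mx a b * T = 0" if "b > k" for a b
    unfolding T_def sum_distrib_left
    by (rule sum.neutral) (use that in \<open>auto simp: algebra_simps mx_mult mx_C[OF t_C]\<close>)
  have V0: "mx a b * V = 0" if "b \<ge> k" for a b
    unfolding V_def sum_distrib_left
    by (rule sum.neutral) (use that in \<open>auto simp: mx_mult mx_C[OF cC]\<close>)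
  have V1: "mx a b * (V * s) = 0" if "b \<ge> k" for a b s using V0[OF that] by (simp flip: mult.assoc)
  have T2: "mx a b * (T * s) = 0" if "b > k" for a b s using T1[OF that] by (simp flip: mult.assoc)
  have T3: "T * (mx a b * s) = 0" if "a \<ge> k" for a b s using T0[OF that] by (simp flip: mult.assoc)
  have m2: "mx a b * (mx a' b' * s) = (if b = a' then mx a b' * s else 0)" for a b a' b' s
    by (simp add: mx_mult flip: mult.assoc)
  have Tt: "T * (d * s) = d * (T * s)" "V * (d * s) = d * (V * s)" if "d \<in> C" for d s
  proof -
    have "T \<in> Fin C" unfolding T_def
    proof (rule Fin_sum)
      fix j show "(t - 1) * mx j j - mx (Suc j) j \<in> Fin C"
        using CF(3)[OF Fin_mx Fin_mx[OF C_1], of "t - 1" j j "Suc j" j] C_add[OF t_C C_neg[OF C_1]] by simp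
    qed
    moreover have "V \<in> Fin C" unfolding V_def by (rule Fin_sum) (use Fin_mx cC in blast)
    ultimately have "d * T = T * d" "d * V = V * d" using C_Fin[OF that] by blast+
    then show "T * (d * s) = d * (T * s)" "V * (d * s) = d * (V * s)" by (metis mult.assoc)+
  qed
  have th: "h * t = t * h" "h * (t * s) = t * (h * s)" for s
    using comm[OF h t_C] by (simp_all flip: mult.assoc)
  have A1: "companion c (Suc k) h = 1 + T + (t - 1) * mx k k - mx (Suc k) k + V * mx 0 (Suc k)
     + c k * mx k (Suc k) + (h - 1) * mx (Suc k) (Suc k)"
    unfolding companion_def by (simp add: T_def Vm[symmetric])
  have A0: "companion c k (t * h + c k) = 1 + T + V * mx 0 k + (t * h + c k - 1) * mx k k"
    unfolding companion_def by (simp add: T_def Vm[symmetric])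
  note RL = mx_mult m2 mx_C[OF t_C] mx_C[OF h] mx_C[OF cC] T0 T1 T2 T3 V0 V1 Tt[OF t_C] Tt[OF h] Tt[OF cC] th
  have key: "L * companion c (Suc k) h * E = companion c k (t * h + c k) * S"
    unfolding A1 A0 L_def E_def S_def by (simp add: algebra_simps RL)
  have El: "L \<in> El C" "E \<in> El C" "S \<in> El C"
    unfolding L_def E_def S_def using El_elem[OF t_C] El_elem[OF h] rotation_El[of k "Suc k"] by simp_all
  have "companion c k (t * h + c k) = companion c k (t * h + c k) * S * uinv S"
    using El_unt[OF El(3)] by (simp add: mult.assoc)
  also have "\<dots> = L * companion c (Suc k) h * (E * uinv S)"
    unfolding key[symmetric] by (simp add: mult.assoc)
  finally show ?thesis using El(1) El_mult[OF El(2) ElC(2)[OF El(3)]] by blast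
qed

lemma companion_reduce:
  assumes c: "\<And>i. c i \<in> R"
  shows "\<exists>P\<in>El C. \<exists>Q\<in>El C. companion c k (horner c j k) = P * companion c (k + j) (t + c (k + j)) * Q"
proof (induction j arbitrary: k)
  case 0
  then show ?case by (intro bexI[of _ 1]) (simp_all add: El.one)
next
  case (Suc j)
  obtain P Q where 1: "P \<in> El C" "Q \<in> El C"
    "companion c k (horner c (Suc j) k) = P * companion c (Suc k) (horner c j (Suc k)) * Q"
    using companion_step[of c "horner c j (Suc k)" k, OF c horner_C[OF c]] unfolding horner.simps by blast
  obtain P' Q' where 2: "P' \<in> El C" "Q' \<in> El C" "companion c (Suc k) (horner c j (Suc k))
      = P' * companion c (Suc k + j) (t + c (Suc k + j)) * Q'"
    using Suc by blast
  have "companion c k (horner c (Suc j) k)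
     = (P * P') * companion c (k + Suc j) (t + c (k + Suc j)) * (Q' * Q)"
    unfolding 1(3) 2(3) by (simp add: mult.assoc)
  then show ?case using El_mult[OF 1(1) 2(1)] El_mult[OF 2(2) 1(2)] by blast
qed

text \<open>Completely unrolled, the matrix is t - v on a corner of size k + 1. Here v maps e_j to
  e_(j+1) for j < k and e_k to minus the sum of the c i e_i; it is invertible exactly through the
  invertible constant coefficient c 0.\<close>

lemma companion_lin:
  assumes c: "\<And>i. c i \<in> R" and c0: "c0' \<in> R" "c 0 * c0' = 1"
  shows "\<exists>b v v'. lin b v v' (companion c k (t + c k))"
proof -
  define q where "q = pr k"
  define e where "e = mx 0 0"
  define m where "m = mx 0 k"
  define m' where "m' = mx k 0"
  define V where "V = (\<Sum>i<Suc k. c i * mx i 0)"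
  define v where "v = x * q - V * m"
  \<comment> \<open>e_(i+1) goes back to e_i, and the preimage of e_0 is solved for from the last
    column of v, which is where the inverse of c 0 enters.\<close>
  define v' where "v' = q * y - c0' * m' - c0' * (q * y * V)"
  have cC: "c i \<in> C" "c0' \<in> C" for i using c c0 R_C by blast+
  have cc: "c0' * c 0 = 1" using comm cC c0(2) by metis
  have VF: "V \<in> Fin R" unfolding V_def by (rule Fin_sum) (use Fin_mx c in blast)
  have pk: "pr (Suc k) = q + mx k k" unfolding q_def
    by (simp only: mx_def pr_def power_Suc2[of x] power_Suc[of y]) (simp add: algebra_simps)
  have qs: "q = (\<Sum>j<k. mx j j)" unfolding q_def
  proof (induction k)
    case (Suc k)
    have "pr (Suc k) = pr k + mx k k"
      by (simp only: mx_def pr_def power_Suc2[of x] power_Suc[of y]) (simp add: algebra_simps)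
    then show ?case using Suc by simp
  qed (simp add: pr_def)
  have xmx: "x * mx a b = mx (Suc a) b" for a b using x_mx[of 1 a b] by simp
  have V0: "mx a 0 * V = c 0 * mx a 0" for a
  proof -
    have "mx a 0 * V = (\<Sum>i<Suc k. if i = 0 then c 0 * mx a 0 else 0)"
      unfolding V_def sum_distrib_left by (rule sum.cong) (auto simp: mx_C[OF cC(1)] mx_mult)
    then show ?thesis by simp
  qed
  have VV: "V * V = c 0 * V"
  proof -
    have "V * V = (\<Sum>i<Suc k. c i * (mx i 0 * V))"
      by (subst V_def) (simp add: sum_distrib_right mult.assoc del: sum.lessThan_Suc)
    also have "\<dots> = (\<Sum>i<Suc k. c 0 * (c i * mx i 0))"
      by (rule sum.cong) (use V0 comm[OF cC(1) cC(1)] in \<open>simp_all flip: mult.assoc\<close>)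
    finally show ?thesis unfolding V_def sum_distrib_left .
  qed
  have Ve: "V * e = V" unfolding V_def e_def by (simp add: sum_distrib_right distrib_right mult.assoc mx_mult)
  have pV: "pr (Suc k) * V = V"
    unfolding V_def sum_distrib_left
  proof (rule sum.cong)
    fix i assume "i \<in> {..<Suc k}"
    then show "pr (Suc k) * (c i * mx i 0) = c i * mx i 0"
      using C_pr[OF cC(1), of i "Suc k"] pr_mx[of "Suc k" i 0] by (metis lessThan_iff mult.assoc)
  qed simp
  have Vx: "V * x = 0" unfolding V_def using mx_x[of _ 0 1] by (simp add: sum_distrib_right distrib_right mult.assoc)
  have A: "companion c k (t + c k) = 1 + (t - 1) * pr (Suc k) - v"
  proof -
    have "x * q = (\<Sum>j<k. mx (Suc j) j)" unfolding qs by (simp add: sum_distrib_left xmx)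
    moreover have "V * m = (\<Sum>i<k. c i * mx i k) + c k * mx k k"
      unfolding V_def m_def by (simp add: sum_distrib_right distrib_right mult.assoc mx_mult)
    ultimately show ?thesis unfolding companion_def v_def pk
      by (simp only: qs sum_subtractf sum_distrib_left[symmetric]) (simp add: algebra_simps)
  qed
  have s: "q * q = q" "q * m' = 0" "m * q = 0" "m * m' = e" "q * (q * s) = q * s" "q * (m' * s) = 0"
     "m' * m = mx k k" "m * (q * s) = 0" "m' * (m * s) = mx k k * s" for s
  proof -
    show 1: "q * q = q" "q * m' = 0" "m * q = 0" "m * m' = e" "m' * m = mx k k"
      by (simp_all add: q_def m_def m'_def e_def mx_mult pr_mx mx_pr)
    show "q * (q * s) = q * s" "q * (m' * s) = 0" "m * (q * s) = 0" "m' * (m * s) = mx k k * s"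
      using 1 by (simp_all flip: mult.assoc)
  qed
  have m'x: "m' * x = 0" unfolding m'_def using mx_x[of k 0 1] by simp
  have xqy: "x * (q * y) = pr (Suc k) - e"
    unfolding q_def e_def by (simp add: pr_def mx_def algebra_simps power_commutes)
  have eV: "e * V = c 0 * e" unfolding e_def using V0 .
  have yx': "y * (x * s) = s" for s using yx by (simp flip: mult.assoc)
  have c0c: "mx a b * (c0' * s) = c0' * (mx a b * s)" for a b s using mx_C(2)[OF cC(2)] .
  have c0p: "c0' * x = x * c0'" "c0' * q = q * c0'" "c0' * V = V * c0'" "c 0 * V = V * c 0"
    using C_x[OF cC(2)] C_pr[OF cC(2)] C_Fin[OF cC(2) RF_C[OF VF]] C_Fin[OF cC(1) RF_C[OF VF]]
    by (simp_all add: q_def)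
  have vv': "v * v' = pr (Suc k)"
  proof -
    have c': "q * (c0' * z) = c0' * (q * z)" "x * (c0' * z) = c0' * (x * z)" "m * (c0' * z) = c0' * (m * z)"
       "V * (c0' * z) = c0' * (V * z)" for z
      using c0p c0c[of 0 k z] unfolding m_def by (simp_all flip: mult.assoc)
    have "v * v' = x * (q * y) - c0' * (x * (q * (y * V))) + c0' * V"
      unfolding v_def v'_def by (simp add: algebra_simps c' s Ve)
    also have "x * (q * (y * V)) = V - c 0 * e"
    proof -
      have "x * (q * (y * V)) = x * (q * y) * V" by (simp add: mult.assoc)
      then show ?thesis unfolding xqy using pV eV by (simp add: left_diff_distrib)
    qed
    finally show ?thesis unfolding xqy using cc by (simp add: algebra_simps flip: mult.assoc)
  qed
  have v'v: "v' * v = pr (Suc k)"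
  proof -
    have "v' * v = q * (y * (x * q)) - q * (y * (V * m)) - c0' * (m' * (x * q)) + c0' * (m' * (V * m))
        - c0' * (q * (y * (V * (x * q)))) + c0' * (q * (y * (V * (V * m))))"
      unfolding v_def v'_def by (simp add: algebra_simps)
    moreover have "m' * (x * q) = 0" "V * (x * q) = 0" using m'x Vx by (simp_all flip: mult.assoc)
    moreover have "m' * (V * m) = c 0 * mx k k"
    proof -
      have "m' * (V * m) = mx k 0 * V * m" by (simp add: m'_def mult.assoc)
      then show ?thesis unfolding V0 using s(7) by (simp add: m'_def mult.assoc)
    qed
    moreover have "c0' * (q * (y * (V * (V * m)))) = q * (y * (V * m))"
    proof -
      have "V * (V * m) = c 0 * (V * m)" using VV by (simp flip: mult.assoc)
      moreover have "q * (c 0 * z) = c 0 * (q * z)" "y * (c 0 * z) = c 0 * (y * z)" for z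
        using C_pr[OF cC(1), symmetric] C_y[OF cC(1), symmetric] by (simp_all add: q_def flip: mult.assoc)
      ultimately have "q * (y * (V * (V * m))) = c 0 * (q * (y * (V * m)))" by simp
      then show ?thesis using cc by (simp flip: mult.assoc)
    qed
    moreover have "c0' * (c 0 * mx k k) = mx k k" using cc by (simp flip: mult.assoc)
    ultimately show ?thesis unfolding yx' pk using s by simp
  qed
  have qF: "q \<in> Fin R" "pr (Suc k) \<in> Fin R" unfolding q_def using R.Fin_pr by blast+
  have mF: "m \<in> Fin R" "m' \<in> Fin R" unfolding m_def m'_def using Fin_mx[OF R_1] by simp_all
  have qy: "q * y \<in> Fin R" using R.Fin_yr[OF qF(1), of 1] by simp
  have xq: "x * q \<in> Fin R" using R.Fin_xl[OF R.idl_C qF(1), of 1] by simp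
  have vF: "v \<in> Fin R" unfolding v_def using RF(3)[OF xq RF(4)[OF VF mF(1)]] .
  have v'F: "v' \<in> Fin R" unfolding v'_def
    using RF(3)[OF RF(3)[OF qy R_Fin_closed[OF c0(1) mF(2)]] R_Fin_closed[OF c0(1) RF(4)[OF qy VF]]] .
  have pp: "pr (Suc k) * v = v" "v * pr (Suc k) = v" "pr (Suc k) * v' = v'" "v' * pr (Suc k) = v'"
  proof -
    have px: "pr (Suc k) * x = x * q" "y * pr (Suc k) = q * y"
    proof -
      have "x ^ Suc k * y ^ Suc k * x = x * (x ^ k * y ^ k)"
        using yx by (simp only: power_Suc[of x] power_Suc2[of y] mult.assoc) simp
      then show "pr (Suc k) * x = x * q" by (simp add: q_def pr_def left_diff_distrib right_diff_distrib)
      have "y * (x ^ Suc k * y ^ Suc k) = x ^ k * y ^ k * y"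
        using yx' by (simp only: power_Suc[of x] power_Suc2[of y] mult.assoc)
      then show "y * pr (Suc k) = q * y" by (simp add: q_def pr_def left_diff_distrib right_diff_distrib)
    qed
    have pq: "pr (Suc k) * q = q" "q * pr (Suc k) = q" unfolding q_def using pr_le[of k "Suc k"] by simp_all
    have pm: "m * pr (Suc k) = m" "pr (Suc k) * m' = m'" "m' * pr (Suc k) = m'" "e * pr (Suc k) = e"
      unfolding m_def m'_def e_def by (simp_all add: mx_pr pr_mx)
    have Vp: "V * pr (Suc k) = V"
    proof -
      have "V * pr (Suc k) = V * (e * pr (Suc k))" using Ve by (simp flip: mult.assoc)
      then show ?thesis unfolding pm using Ve by simp
    qed
    show "pr (Suc k) * v = v" unfolding v_def right_diff_distrib
      using px(1) pV s(1) by (simp add: mult.assoc flip: mult.assoc[of "pr (Suc k)"])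
    show "v * pr (Suc k) = v" unfolding v_def left_diff_distrib using pq pm by (simp add: mult.assoc)
    show "pr (Suc k) * v' = v'" unfolding v'_def right_diff_distrib
      using pq pm C_pr[OF cC(2), of "Suc k", symmetric] by (simp flip: mult.assoc) (simp add: mult.assoc)
    show "v' * pr (Suc k) = v'" unfolding v'_def left_diff_distrib
      using px(2) s(1,5) pm Vp by (simp add: mult.assoc)
  qed
  show ?thesis unfolding lin_def using A qF vF v'F vv' v'v pp
    by (intro exI[of _ "pr (Suc k)"] exI[of _ v] exI[of _ v']) simp
qed

lemma sym_companion:
  assumes c: "\<And>i. c i \<in> R" and c0: "c0' \<in> R" "c 0 * c0' = 1"
  shows "\<exists>k. sym (1 + (horner c j 0 - 1) * mx 0 0) k"
proof -
  obtain P Q where PQ: "P \<in> El C" "Q \<in> El C"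
    "companion c 0 (horner c j 0) = P * companion c j (t + c j) * Q"
    using companion_reduce[of c 0 j, OF c] by auto
  obtain b v v' where L: "lin b v v' (companion c j (t + c j))"
    using companion_lin[of c, OF c c0] by blast
  have "companion c 0 (horner c j 0) = 1 + (horner c j 0 - 1) * mx 0 0" by (simp add: companion_def)
  then show ?thesis unfolding sym_def
    using L PQ ElC(1)[OF PQ(1)] ElC(1)[OF PQ(2)] eqv_refl[OF GLC(1)[OF ElC(1)[OF PQ(1)] ElC(1)[OF PQ(2)]]]
    by metis
qed

section \<open>Inverting an element whose 1 x 1 matrix has a symbol\<close>

context
  fixes f fi :: 'w
  assumes fC: "f \<in> C" and f0: "\<exists>k. sym (1 + (f - 1) * mx 0 0) k"
    and fi: "f * fi = 1" "fi * f = 1" "\<And>k l. fi * mx k l = mx k l * fi"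
begin

definition dg :: "nat set \<Rightarrow> 'w" where
  "dg J = 1 + (f - 1) * (\<Sum>j\<in>J. mx j j)"

lemma f1: "f - 1 \<in> C" using C_add[OF fC C_neg[OF C_1]] by simp

lemma sym_dg1: "\<exists>k. sym (dg {j}) k"
proof (cases "j = 0")
  case False
  define w where "w = 1 - mx j j - mx 0 0 - mx 0 j + mx j 0"
  have w: "w \<in> El C" unfolding w_def using rotation_El[of j 0] False by simp
  have "w * (1 + (f - 1) * mx 0 0) = dg {j} * w"
    unfolding w_def dg_def using False by (simp add: algebra_simps mx_mult mx_C[OF fC])
  then have "dg {j} = w * (1 + (f - 1) * mx 0 0) * uinv w"
    using El_unt[OF w] by (simp add: mult.assoc)
  then show ?thesis
    using f0 sym_mult[OF sym_mult[OF sym_GL[OF ElC(1)[OF w]]] sym_GL[OF ElC(1)[OF ElC(2)[OF w]]]] by metis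
qed (use f0 in \<open>simp add: dg_def\<close>)

lemma dg_insert: assumes "finite J" "j \<notin> J" shows "dg (insert j J) = dg {j} * dg J"
proof -
  have "mx j j * (\<Sum>i\<in>J. mx i i) = 0"
    unfolding sum_distrib_left by (rule sum.neutral) (use assms in \<open>auto simp: mx_mult\<close>)
  then have "mx j j * ((f - 1) * (\<Sum>i\<in>J. mx i i)) = 0" using mx_C[OF f1] by simp
  then show ?thesis unfolding dg_def using assms by (simp add: distrib_left distrib_right mult.assoc)
qed

lemma sym_dg: "finite J ==> \<exists>k. sym (dg J) k"
proof (induction J rule: finite_induct)
  case empty
  then show ?case using sym_GL[OF GL_1] by (auto simp: dg_def)
next
  case (insert j J)
  then show ?case using sym_dg1[of j] sym_mult unfolding dg_insert[OF insert(1,2)] by blast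
qed

lemma dg_mx: "finite J ==> dg J * mx k l = (if k \<in> J then f * mx k l else mx k l)"
  "finite J ==> mx k l * dg J = (if l \<in> J then f * mx k l else mx k l)"
proof -
  assume J: "finite J"
  have 1: "(\<Sum>i\<in>J. mx i i) * mx k l = (if k \<in> J then mx k l else 0)"
    using J by (simp add: sum_distrib_right mx_mult)
  have 2: "mx k l * (\<Sum>i\<in>J. mx i i) = (if l \<in> J then mx k l else 0)"
    using J by (simp add: sum_distrib_left mx_mult)
  show "dg J * mx k l = (if k \<in> J then f * mx k l else mx k l)"
    unfolding dg_def using 1 by (simp add: distrib_right mult.assoc) (simp add: algebra_simps)
  show "mx k l * dg J = (if l \<in> J then f * mx k l else mx k l)"
    unfolding dg_def using 2 mx_C(2)[OF f1] by (simp add: distrib_left) (simp add: algebra_simps)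
qed

text \<open>A matrix g with denominators f is invisible to symbols: some power of f on a large
  block, which commutes with g, has the same symbol with or without the factor g. Asking for all
  large r allows two such matrices to be compared on a common block.\<close>

definition trv :: "'w \<Rightarrow> bool" where
  "trv g \<longleftrightarrow> (\<exists>r0. \<forall>r\<ge>r0. dg {..<r} * g = g * dg {..<r}
     \<and> (\<exists>m k. sym (dg {..<r} ^ m * g) k \<and> sym (dg {..<r} ^ m) k))"

lemma trv_one: "trv 1"
  unfolding trv_def using sym_GL[OF GL_1] by (intro exI[of _ 0]) (metis mult_1_left mult_1_right power_0)

text \<open>Split the block f ... f as A B, with B carrying the f in place i. Then the block times 1
  + (c / f) e_ij equals A (1 + c e_ij) B, since A does not touch row i and B does not touch column
  j; the elementary factor in the middle does not change the symbol.\<close>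

lemma trv_elem: assumes "c \<in> C" "i \<noteq> j" shows "trv (1 + c * fi * mx i j)"
  unfolding trv_def
proof (rule exI[of _ "Suc (max i j)"], intro allI impI conjI)
  fix r assume r: "Suc (max i j) \<le> r"
  let ?d = "dg {..<r}"
  have cd: "?d * c = c * ?d"
  proof -
    have "?d - 1 \<in> Fin C"
      unfolding dg_def using C_Fin_closed[OF f1 Fin_sum[of "{..<r}" "\<lambda>j. mx j j" C]] Fin_mx[OF C_1] by simp
    from C_Fin[OF assms(1) this] show ?thesis by (simp add: algebra_simps)
  qed
  have dm: "?d * mx i j = f * mx i j" "mx i j * ?d = f * mx i j" using r dg_mx[of "{..<r}"] by auto
  have "?d * (c * fi * mx i j) = c * (?d * (mx i j * fi))"
    using cd fi(3) by (simp flip: mult.assoc) (simp add: mult.assoc fi(3))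
  also have "\<dots> = c * (f * (mx i j * fi))" using dm(1) by (simp flip: mult.assoc)
  also have "\<dots> = c * mx i j" using fi by (simp flip: fi(3)) (simp flip: mult.assoc)
  finally have 1: "?d * (c * fi * mx i j) = c * mx i j" .
  have "c * fi * mx i j * ?d = c * (fi * (f * mx i j))" using dm(2) by (simp add: mult.assoc)
  also have "\<dots> = c * mx i j" using fi(2) by (simp flip: mult.assoc)
  finally have 2: "c * fi * mx i j * ?d = c * mx i j" .
  show "?d * (1 + c * fi * mx i j) = (1 + c * fi * mx i j) * ?d"
    using 1 2 by (simp add: distrib_left distrib_right)
  let ?A = "dg ({..<r} - {i})" and ?B = "dg {i}"
  have d: "?d = ?B * ?A" using dg_insert[of "{..<r} - {i}" i] r by (simp add: insert_absorb)
  have AB: "?A * ?B = ?B * ?A"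
  proof -
    have "?A * mx i i = mx i i * ?A" using dg_mx[of "{..<r} - {i}"] by simp
    moreover have "?A * (f - 1) = (f - 1) * ?A"
    proof -
      have "?A - 1 \<in> Fin C"
        unfolding dg_def using C_Fin_closed[OF f1 Fin_sum[of "{..<r} - {i}" "\<lambda>j. mx j j" C]] Fin_mx[OF C_1] by simp
      from C_Fin[OF f1 this] show ?thesis by (simp add: algebra_simps)
    qed
    ultimately have "?A * ((f - 1) * mx i i) = (f - 1) * mx i i * ?A" by (simp flip: mult.assoc) (simp add: mult.assoc)
    then show ?thesis unfolding dg_def[of "{i}"] by (simp add: distrib_left distrib_right)
  qed
  obtain k1 k2 where k: "sym ?A k1" "sym ?B k2" using sym_dg[of "{..<r} - {i}"] sym_dg[of "{i}"] by auto
  define E where "E = 1 + c * mx i j"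
  have E: "E \<in> El C" unfolding E_def using El_elem assms by blast
  have Am: "?A * (c * mx i j) = c * mx i j"
  proof -
    have "?A - 1 \<in> Fin C"
      unfolding dg_def using C_Fin_closed[OF f1 Fin_sum[of "{..<r} - {i}" "\<lambda>j. mx j j" C]] Fin_mx[OF C_1] by simp
    from C_Fin[OF assms(1) this] have "?A * c = c * ?A" by (simp add: algebra_simps)
    moreover have "?A * mx i j = mx i j" using dg_mx(1)[of "{..<r} - {i}" i j] by simp
    ultimately show ?thesis by (simp flip: mult.assoc) (simp add: mult.assoc)
  qed
  have mB: "c * mx i j * ?B = c * mx i j" using dg_mx(2)[of "{i}" i j] assms(2) by (simp add: mult.assoc)
  have "?d * (1 + c * fi * mx i j) = ?A * E * ?B"
    unfolding E_def using 1 Am mB AB d by (simp add: distrib_left distrib_right mult.assoc[of _ "c * mx i j"])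
  moreover have "sym (?A * E * ?B) (k1 * E * k2)"
    using sym_mult[OF sym_mult[OF k(1) sym_GL[OF ElC(1)[OF E]]] k(2)] .
  moreover have "k1 * k2 \<simeq> k1 * E * k2"
    using eqv_mult[OF eqv_sym[OF eqv_El(2)[OF E sym_inGL[OF k(1)]]] eqv_refl[OF sym_inGL[OF k(2)]]] .
  ultimately have "sym (?d ^ 1 * (1 + c * fi * mx i j)) (k1 * k2)" using sym_eqv by simp
  moreover have "sym (?d ^ 1) (k1 * k2)" using sym_mult[OF k] AB d by simp
  ultimately show "\<exists>m k. sym (?d ^ m * (1 + c * fi * mx i j)) k \<and> sym (?d ^ m) k" by blast
qed

lemma trv_mult: assumes "trv g" "trv h" shows "trv (g * h)"
proof -
  obtain r1 where r1: "\<And>r. r \<ge> r1 ==> dg {..<r} * g = g * dg {..<r}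
     \<and> (\<exists>m k. sym (dg {..<r} ^ m * g) k \<and> sym (dg {..<r} ^ m) k)" using assms(1) trv_def by blast
  obtain r2 where r2: "\<And>r. r \<ge> r2 ==> dg {..<r} * h = h * dg {..<r}
     \<and> (\<exists>m k. sym (dg {..<r} ^ m * h) k \<and> sym (dg {..<r} ^ m) k)" using assms(2) trv_def by blast
  show ?thesis unfolding trv_def
  proof (rule exI[of _ "max r1 r2"], intro allI impI conjI)
    fix r assume "max r1 r2 \<le> r"
    then have r: "r1 \<le> r" "r2 \<le> r" by auto
    let ?d = "dg {..<r}"
    have c: "?d * g = g * ?d" "?d * h = h * ?d" using r1[OF r(1)] r2[OF r(2)] by auto
    have "?d * (g * h) = g * ?d * h" using c(1) by (simp flip: mult.assoc)
    also have "\<dots> = g * h * ?d" using c(2) by (simp add: mult.assoc)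
    finally show "?d * (g * h) = g * h * ?d" .
    obtain m k where m: "sym (?d ^ m * g) k" "sym (?d ^ m) k" using r1[OF r(1)] by blast
    obtain m' k' where m': "sym (?d ^ m' * h) k'" "sym (?d ^ m') k'" using r2[OF r(2)] by blast
    have dg: "g * ?d ^ m' = ?d ^ m' * g" using power_commuting_commutes[OF c(1), of m'] by simp
    have "?d ^ m * g * (?d ^ m' * h) = ?d ^ m * (g * ?d ^ m') * h" by (simp add: mult.assoc)
    also have "\<dots> = ?d ^ (m + m') * (g * h)" unfolding dg by (simp add: power_add mult.assoc)
    finally have "sym (?d ^ (m + m') * (g * h)) (k * k')" using sym_mult[OF m(1) m'(1)] by simp
    moreover have "sym (?d ^ (m + m')) (k * k')" using sym_mult[OF m(2) m'(2)] by (simp add: power_add)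
    ultimately show "\<exists>m k. sym (?d ^ m * (g * h)) k \<and> sym (?d ^ m) k" by blast
  qed
qed

text \<open>A matrix g that is invertible over C is its own symbol, so multiplicativity and
  uniqueness of symbols give k g = k in K1.\<close>

lemma trv_El: assumes "trv g" "g \<in> GL C" shows "g \<in> El C"
proof -
  obtain r m k where k: "sym (dg {..<r} ^ m * g) k" "sym (dg {..<r} ^ m) k"
    using assms(1) trv_def by blast
  have "k * g \<simeq> k" using sym_unique[OF sym_mult[OF k(2) sym_GL[OF assms(2)]] k(1)] .
  then have "g \<simeq> 1" using eqv_cancel_l[of k g 1, OF _ sym_inGL[OF k(1)] assms(2) GL_1] by simp
  then show ?thesis using eqv_El_one by blast
qed

end

text \<open>Monic inversion: inverting a central element whose 1x1 matrix has a symbol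
  creates no new relations in K1.\<close>

theorem El_localization:
  assumes "f \<in> C" "\<exists>k. sym (1 + (f - 1) * mx 0 0) k"
    and "f * fi = 1" "fi * f = 1" "\<And>k l. fi * mx k l = mx k l * fi"
    and g: "g \<in> El {c * fi | c. c \<in> C}" "g \<in> GL C"
  shows "g \<in> El C"
proof (rule trv_El[OF assms(1-5) _ g(2)])
  show "trv f g" using g(1)
  proof (induction g rule: El.induct)
    case one
    show ?case using trv_one[OF assms(1-5)] .
  next
    case (step d k l g)
    then show ?case using trv_mult[OF assms(1-5) trv_elem[OF assms(1-5)]] by auto
  qed
qed

end

section \<open>Row and column finite matrices\<close>

lemma sum_mult_nonzero:
  fixes f g :: "'b \<Rightarrow> 'c::comm_ring_1"
  assumes "(\<Sum>j\<in>J. f j * g j) \<noteq> 0" shows "\<exists>j\<in>J. f j \<noteq> 0 \<and> g j \<noteq> 0"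
proof -
  obtain j where "j \<in> J" "f j * g j \<noteq> 0" using assms by (meson sum.neutral)
  then show ?thesis using mult_not_zero by blast
qed

text \<open>Finite rows make the product a finite sum. Together with finite columns they make the
  finite matrices a two-sided ideal (\<open>Fin_ideal\<close>), which is the setting for indices and
  determinants.\<close>

typedef (overloaded) 'c rcf =
  "{M :: nat \<Rightarrow> nat \<Rightarrow> 'c::zero. (\<forall>i. finite {j. M i j \<noteq> 0}) \<and> (\<forall>j. finite {i. M i j \<noteq> 0})}"
  morphisms ent Rcf
  by (rule exI[of _ "\<lambda>_ _. 0"]) simp

setup_lifting type_definition_rcf

lemma ent_fin [simp]: "finite {j. ent M i j \<noteq> 0}" "finite {i. ent M i j \<noteq> 0}"
  using ent[of M] by auto

lemma rcf_eqI: "(\<And>i j. ent M i j = ent N i j) ==> M = N"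
  using ent_inject by blast

instantiation rcf :: (comm_ring_1) ring_1
begin

lift_definition zero_rcf :: "'a rcf" is "\<lambda>_ _. 0" by simp

lift_definition one_rcf :: "'a rcf" is "\<lambda>i j. if i = j then 1 else 0" by simp

lift_definition plus_rcf :: "'a rcf \<Rightarrow> 'a rcf \<Rightarrow> 'a rcf" is "\<lambda>M N i j. M i j + N i j"
proof (intro conjI allI)
  fix M N :: "nat \<Rightarrow> nat \<Rightarrow> 'a" and k
  assume a: "(\<forall>i. finite {j. M i j \<noteq> 0}) \<and> (\<forall>j. finite {i. M i j \<noteq> 0})"
    "(\<forall>i. finite {j. N i j \<noteq> 0}) \<and> (\<forall>j. finite {i. N i j \<noteq> 0})"
  show "finite {j. M k j + N k j \<noteq> 0}"
    by (rule finite_subset[of _ "{j. M k j \<noteq> 0} \<union> {j. N k j \<noteq> 0}"]) (use a in auto)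
  show "finite {i. M i k + N i k \<noteq> 0}"
    by (rule finite_subset[of _ "{i. M i k \<noteq> 0} \<union> {i. N i k \<noteq> 0}"]) (use a in auto)
qed

lift_definition uminus_rcf :: "'a rcf \<Rightarrow> 'a rcf" is "\<lambda>M i j. - M i j" by simp

definition minus_rcf :: "'a rcf \<Rightarrow> 'a rcf \<Rightarrow> 'a rcf" where "minus_rcf M N = M + - N"

lift_definition times_rcf :: "'a rcf \<Rightarrow> 'a rcf \<Rightarrow> 'a rcf" is
  "\<lambda>M N i k. \<Sum>j | M i j \<noteq> 0. M i j * N j k"
proof (intro conjI allI)
  fix M N :: "nat \<Rightarrow> nat \<Rightarrow> 'a" and k
  assume a: "(\<forall>i. finite {j. M i j \<noteq> 0}) \<and> (\<forall>j. finite {i. M i j \<noteq> 0})"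
    "(\<forall>i. finite {j. N i j \<noteq> 0}) \<and> (\<forall>j. finite {i. N i j \<noteq> 0})"
  have "{l. (\<Sum>j | M k j \<noteq> 0. M k j * N j l) \<noteq> 0} \<subseteq> (\<Union>j\<in>{j. M k j \<noteq> 0}. {l. N j l \<noteq> 0})"
    by (fastforce dest!: sum_mult_nonzero)
  then show "finite {l. (\<Sum>j | M k j \<noteq> 0. M k j * N j l) \<noteq> 0}"
    by (rule finite_subset) (use a in auto)
  have "{i. (\<Sum>j | M i j \<noteq> 0. M i j * N j k) \<noteq> 0} \<subseteq> (\<Union>j\<in>{j. N j k \<noteq> 0}. {i. M i j \<noteq> 0})"
    by (fastforce dest!: sum_mult_nonzero)
  then show "finite {i. (\<Sum>j | M i j \<noteq> 0. M i j * N j k) \<noteq> 0}"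
    by (rule finite_subset) (use a in auto)
qed

lemma ent_simps [simp]:
  "ent (0 :: 'a rcf) i j = 0" "ent (1 :: 'a rcf) i j = (if i = j then 1 else 0)"
  "ent (M + N) i j = ent M i j + ent N i j" "ent (- M) i j = - ent M i j"
  "ent (M - N) i j = ent M i j - ent N i j"
  by (simp_all add: zero_rcf.rep_eq one_rcf.rep_eq plus_rcf.rep_eq uminus_rcf.rep_eq minus_rcf_def)

lemma ent_mult:
  assumes "finite J" "{j. ent M i j \<noteq> 0} \<subseteq> J"
  shows "ent (M * N) i k = (\<Sum>j\<in>J. ent M i j * ent N j k)"
  unfolding times_rcf.rep_eq by (rule sum.mono_neutral_left) (use assms in auto)

lemma ent_mult': "ent (M * N) i k = (\<Sum>j | ent M i j \<noteq> 0. ent M i j * ent N j k)"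
  by (rule ent_mult) auto

lemma rcf_assoc: "(A * B) * C = A * (B * (C :: 'a rcf))"
proof (rule rcf_eqI)
  fix i l
  define J where "J = {j. ent A i j \<noteq> 0}"
  define K where "K = (\<Union>j\<in>J. {k. ent B j k \<noteq> 0})"
  have fin: "finite J" "finite K" unfolding J_def K_def by auto
  have AB: "ent (A * B) i k = (\<Sum>j\<in>J. ent A i j * ent B j k)" for k
    by (rule ent_mult) (auto simp: J_def)
  have "{k. ent (A * B) i k \<noteq> 0} \<subseteq> K"
    unfolding AB K_def by (fastforce dest!: sum_mult_nonzero)
  from ent_mult[OF fin(2) this]
  have "ent (A * B * C) i l = (\<Sum>k\<in>K. (\<Sum>j\<in>J. ent A i j * ent B j k) * ent C k l)"
    unfolding AB .
  also have "\<dots> = (\<Sum>j\<in>J. \<Sum>k\<in>K. ent A i j * (ent B j k * ent C k l))"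
    unfolding sum_distrib_right by (subst sum.swap) (simp add: mult.assoc)
  also have "\<dots> = (\<Sum>j\<in>J. ent A i j * ent (B * C) j l)"
  proof (rule sum.cong[OF refl])
    fix j assume "j \<in> J"
    then have "ent (B * C) j l = (\<Sum>k\<in>K. ent B j k * ent C k l)"
      by (intro ent_mult fin) (auto simp: K_def)
    then show "(\<Sum>k\<in>K. ent A i j * (ent B j k * ent C k l)) = ent A i j * ent (B * C) j l"
      by (simp add: sum_distrib_left)
  qed
  also have "\<dots> = ent (A * (B * C)) i l" by (rule ent_mult[symmetric]) (auto simp: J_def)
  finally show "ent (A * B * C) i l = ent (A * (B * C)) i l" .
qed

instance
proof
  fix a b c :: "'a rcf"
  show "a * b * c = a * (b * c)" by (rule rcf_assoc)
  show "1 * a = a"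
  proof (rule rcf_eqI)
    fix i j
    have "ent (1 * a) i j = (\<Sum>k\<in>{i}. ent 1 i k * ent a k j)" by (rule ent_mult) auto
    then show "ent (1 * a) i j = ent a i j" by simp
  qed
  show "a * 1 = a"
  proof (rule rcf_eqI)
    fix i j
    have "ent (a * 1) i j = (\<Sum>k\<in>insert j {k. ent a i k \<noteq> 0}. ent a i k * ent 1 k j)"
      by (rule ent_mult) auto
    also have "\<dots> = (\<Sum>k\<in>{j}. ent a i k * ent 1 k j)" by (rule sum.mono_neutral_right) auto
    finally show "ent (a * 1) i j = ent a i j" by simp
  qed
  show "(a + b) * c = a * c + b * c"
  proof (rule rcf_eqI)
    fix i j
    define J where "J = {k. ent a i k \<noteq> 0} \<union> {k. ent b i k \<noteq> 0}"
    have J: "finite J" "{k. ent a i k \<noteq> 0} \<subseteq> J" "{k. ent b i k \<noteq> 0} \<subseteq> J" "{k. ent (a + b) i k \<noteq> 0} \<subseteq> J"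
      by (auto simp: J_def)
    show "ent ((a + b) * c) i j = ent (a * c + b * c) i j"
      by (simp only: ent_simps ent_mult[OF J(1,2)] ent_mult[OF J(1,3)] ent_mult[OF J(1,4)] distrib_right sum.distrib)
  qed
  show "a * (b + c) = a * b + a * c"
    by (rule rcf_eqI) (simp only: ent_simps ent_mult' distrib_left sum.distrib)
  show "(0::'a rcf) \<noteq> 1" by (metis ent_simps(1,2) zero_neq_one)
qed (auto intro!: rcf_eqI simp: minus_rcf_def)

end

lift_definition sx :: "'c::comm_ring_1 rcf" is "\<lambda>i j. if i = Suc j then 1 else 0"
proof (intro conjI allI)
  fix i :: nat
  show "finite {j. (if i = Suc j then 1 else 0 :: 'c) \<noteq> 0}"
    by (rule finite_subset[of _ "{..i}"]) auto
qed simp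

lift_definition sy :: "'c::comm_ring_1 rcf" is "\<lambda>i j. if j = Suc i then 1 else 0"
proof (intro conjI allI)
  fix j :: nat
  show "finite {i. (if j = Suc i then 1 else 0 :: 'c) \<noteq> 0}"
    by (rule finite_subset[of _ "{..j}"]) auto
qed simp

lift_definition sc :: "'c::comm_ring_1 \<Rightarrow> 'c rcf" is "\<lambda>c i j. if i = j then c else 0"
proof (intro conjI allI)
  fix i :: nat and c :: 'c
  show "finite {j. (if i = j then c else 0) \<noteq> 0}" by (rule finite_subset[of _ "{i}"]) auto
  show "finite {j. (if j = i then c else 0) \<noteq> 0}" by (rule finite_subset[of _ "{i}"]) auto
qed

lemma ent_shift [simp]: "ent sx i j = (if i = Suc j then 1 else 0)" "ent sy i j = (if j = Suc i then 1 else 0)"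
  "ent (sc c) i j = (if i = j then c else 0)"
  by (simp_all add: sx.rep_eq sy.rep_eq sc.rep_eq)

lemma ent_sc_mult [simp]: "ent (sc c * M) i j = c * ent M i j"
proof -
  have "ent (sc c * M) i j = (\<Sum>k\<in>{i}. ent (sc c) i k * ent M k j)" by (rule ent_mult) auto
  then show ?thesis by simp
qed

lemma ent_mult_sc [simp]: "ent (M * sc c) i j = c * ent M i j"
proof -
  have "ent (M * sc c) i j = (\<Sum>k\<in>insert j {k. ent M i k \<noteq> 0}. ent M i k * ent (sc c) k j)"
    by (rule ent_mult) auto
  also have "\<dots> = (\<Sum>k\<in>{j}. ent M i k * ent (sc c) k j)" by (rule sum.mono_neutral_right) auto
  finally show ?thesis by (simp add: mult.commute)
qed

lemma sc_commute: "sc c * M = M * sc c" by (rule rcf_eqI) simp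

lemma sc_hom: "sc 0 = 0" "sc 1 = 1" "sc (c + d) = sc c + sc d" "sc (- c) = - sc c"
  "sc (c - d) = sc c - sc d" "sc (c * d) = sc c * sc d"
  by (auto intro!: rcf_eqI)

lemma sc_inj [simp]: "sc c = sc d \<longleftrightarrow> c = d"
  by (metis ent_shift(3))

lemma sc_power: "sc (c ^ k) = sc c ^ k" by (induction k) (simp_all add: sc_hom)

lemma sc_sum: "sc (sum f I) = (\<Sum>i\<in>I. sc (f i))"
  by (induction I rule: infinite_finite_induct) (simp_all add: sc_hom)

lemma ent_sum: "ent (sum f I) i j = (\<Sum>k\<in>I. ent (f k) i j)" for f :: "'b \<Rightarrow> 'c::comm_ring_1 rcf"
  by (induction I rule: infinite_finite_induct) simp_all

lemma ent_sx_mult: "ent (sx * M) i j = (case i of 0 \<Rightarrow> 0 | Suc k \<Rightarrow> ent M k j)"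
proof -
  have "ent (sx * M) i j = (\<Sum>k\<in>(case i of 0 \<Rightarrow> {} | Suc k \<Rightarrow> {k}). ent sx i k * ent M k j)"
    by (rule ent_mult) (auto split: nat.splits)
  then show ?thesis by (auto split: nat.splits)
qed

lemma ent_mult_sy: "ent (M * sy) i j = (case j of 0 \<Rightarrow> 0 | Suc k \<Rightarrow> ent M i k)"
proof -
  have "ent (M * sy) i j = (\<Sum>k\<in>{k. ent M i k \<noteq> 0}. ent M i k * ent sy k j)" by (rule ent_mult) auto
  also have "\<dots> = (\<Sum>k\<in>(case j of 0 \<Rightarrow> {} | Suc k \<Rightarrow> {k}). ent M i k * ent sy k j)"
    by (rule sum.mono_neutral_cong) (auto split: nat.splits)
  finally show ?thesis by (auto split: nat.splits)
qed

interpretation rc: shift_pair "sx :: 'c::comm_ring_1 rcf" sy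
proof
  show "sy * sx = (1 :: 'c rcf)"
  proof (rule rcf_eqI)
    fix i j
    have "ent (sy * sx) i j = (\<Sum>k\<in>{Suc i}. ent sy i k * ent sx k j :: 'c)" by (rule ent_mult) auto
    then show "ent (sy * sx) i j = ent (1 :: 'c rcf) i j" by auto
  qed
qed

lemma ent_mx [simp]: "ent (rc.mx k l :: 'c::comm_ring_1 rcf) i j = (if i = k \<and> j = l then 1 else 0)"
proof -
  have e0: "ent (1 - sx * sy :: 'c rcf) i j = (if i = 0 \<and> j = 0 then 1 else 0)" for i j
    by (cases i; cases j) (simp_all add: ent_sx_mult)
  have e1: "ent (sx ^ k * (1 - sx * sy) :: 'c rcf) i j = (if i = k \<and> j = 0 then 1 else 0)" for k i j
  proof (induction k arbitrary: i)
    case 0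
    show ?case using e0 by (simp only: power_0 mult_1_left)
  next
    case (Suc k)
    show ?case unfolding power_Suc mult.assoc ent_sx_mult using Suc by (auto split: nat.splits)
  qed
  have 2: "ent (sx ^ k * (1 - sx * sy) * sy ^ l :: 'c rcf) i j = (if i = k \<and> j = l then 1 else 0)"
  proof (induction l arbitrary: j)
    case 0
    show ?case using e1 by (simp only: power_0 mult_1_right)
  next
    case (Suc l)
    show ?case unfolding power_Suc2 mult.assoc[symmetric] ent_mult_sy using Suc by (auto split: nat.splits)
  qed
  then show ?thesis by (simp add: rc.mx_def)
qed

lemma ent_mx_mult: "ent (rc.mx k l * M) i j = (if i = k then ent M l j else 0)"
proof -
  have "ent (rc.mx k l * M) i j = (\<Sum>a\<in>{l}. ent (rc.mx k l) i a * ent M a j)" by (rule ent_mult) auto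
  then show ?thesis by simp
qed

lemma ent_mult_mx: "ent (M * rc.mx k l) i j = (if j = l then ent M i k else 0)"
proof -
  have "ent (M * rc.mx k l) i j = (\<Sum>a\<in>insert k {a. ent M i a \<noteq> 0}. ent M i a * ent (rc.mx k l) a j)"
    by (rule ent_mult) auto
  also have "\<dots> = (\<Sum>a\<in>{k}. ent M i a * ent (rc.mx k l) a j)" by (rule sum.mono_neutral_right) auto
  finally show ?thesis by simp
qed

lemma ent_pr: "ent (rc.pr r :: 'c::comm_ring_1 rcf) i j = (if i = j \<and> i < r then 1 else 0)"
proof (induction r)
  case (Suc r)
  have "rc.pr (Suc r) = rc.pr r + (rc.mx r r :: 'c rcf)"
    by (simp only: rc.mx_def rc.pr_def power_Suc2[of sx] power_Suc[of sy]) (simp add: algebra_simps)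
  then show ?case using Suc by auto
qed (simp add: rc.pr_def)

lemma ent_pr_mult: "ent (rc.pr r * M) i j = (if i < r then ent M i j else 0)"
proof -
  have "ent (rc.pr r * M) i j = (\<Sum>a\<in>{i}. ent (rc.pr r) i a * ent M a j)"
    by (rule ent_mult) (auto simp: ent_pr)
  then show ?thesis by (simp add: ent_pr)
qed

lemma ent_mult_pr: "ent (M * rc.pr r) i j = (if j < r then ent M i j else 0)"
proof -
  have "ent (M * rc.pr r) i j = (\<Sum>a\<in>insert j {a. ent M i a \<noteq> 0}. ent M i a * ent (rc.pr r) a j)"
    by (rule ent_mult) auto
  also have "\<dots> = (\<Sum>a\<in>{j}. ent M i a * ent (rc.pr r) a j)"
    by (rule sum.mono_neutral_right) (auto simp: ent_pr)
  finally show ?thesis by (simp add: ent_pr)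
qed

definition subring :: "'c::comm_ring_1 set \<Rightarrow> bool" where
  "subring C \<longleftrightarrow> 0 \<in> C \<and> 1 \<in> C \<and> (\<forall>c\<in>C. - c \<in> C) \<and> (\<forall>c\<in>C. \<forall>d\<in>C. c + d \<in> C \<and> c * d \<in> C)"

lemma subringD:
  assumes "subring C"
  shows "0 \<in> C" "1 \<in> C" "c \<in> C ==> - c \<in> C" "c \<in> C ==> d \<in> C ==> c + d \<in> C"
    "c \<in> C ==> d \<in> C ==> c * d \<in> C" "c \<in> C ==> d \<in> C ==> c - d \<in> C"
    "(\<And>i. i \<in> I ==> f i \<in> C) ==> sum f I \<in> C" "(\<And>i. i \<in> I ==> f i \<in> C) ==> prod f I \<in> C"
proof -
  show 1: "0 \<in> C" "1 \<in> C" and 2: "c \<in> C ==> - c \<in> C" for c using assms by (auto simp: subring_def)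
  show 3: "c \<in> C ==> d \<in> C ==> c + d \<in> C" "c \<in> C ==> d \<in> C ==> c * d \<in> C" for c d
    using assms by (auto simp: subring_def)
  show "c \<in> C ==> d \<in> C ==> c - d \<in> C" using 3(1)[of c "- d"] 2 by simp
  show "(\<And>i. i \<in> I ==> f i \<in> C) ==> sum f I \<in> C"
    by (induction I rule: infinite_finite_induct) (auto intro: 1 3)
  show "(\<And>i. i \<in> I ==> f i \<in> C) ==> prod f I \<in> C"
    by (induction I rule: infinite_finite_induct) (auto intro: 1 3)
qed

lemma subring_UNIV [simp]: "subring UNIV" by (simp add: subring_def)

lemma coeff_ring_sc: assumes C: "subring C" shows "coeff_ring sx sy (sc ` C)"
proof
  show "0 \<in> sc ` C" "1 \<in> sc ` C"
    using imageI[OF subringD(1)[OF C], of sc] imageI[OF subringD(2)[OF C], of sc] by (simp_all add: sc_hom)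
  show "c \<in> sc ` C ==> d \<in> sc ` C ==> c + d \<in> sc ` C"
    "c \<in> sc ` C ==> d \<in> sc ` C ==> c * d \<in> sc ` C" "c \<in> sc ` C ==> - c \<in> sc ` C" for c d
    using subringD(3-5)[OF C] by (auto simp: sc_hom(3,4,6)[symmetric])
qed (auto simp: sc_commute)

interpretation ru: coeff_ring "sx :: 'c::comm_ring_1 rcf" sy "range sc"
  using coeff_ring_sc[OF subring_UNIV] .

lemma Fin_iff:
  assumes C: "subring C"
  shows "u \<in> ru.Fin (sc ` C) \<longleftrightarrow> (\<exists>r. \<forall>i j. (i \<ge> r \<or> j \<ge> r) \<longrightarrow> ent u i j = 0) \<and> (\<forall>i j. ent u i j \<in> C)"
    (is "_ \<longleftrightarrow> ?P u")
proof
  assume "u \<in> ru.Fin (sc ` C)"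
  then show "?P u"
  proof (induction u rule: ru.Fin.induct)
    case (step c u k l)
    obtain r where r: "\<And>i j. (i \<ge> r \<or> j \<ge> r) ==> ent u i j = 0" "\<And>i j. ent u i j \<in> C"
      using step(3) by blast
    obtain d where d: "c = sc d" "d \<in> C" using step(1) by blast
    have "ent (c * rc.mx k l + u) i j \<in> C" for i j
      using r d subringD[OF C] by auto
    moreover have "ent (c * rc.mx k l + u) i j = 0" if "i \<ge> max r (Suc (max k l)) \<or> j \<ge> max r (Suc (max k l))" for i j
      using r d that by auto
    ultimately show ?case by blast
  qed (use subringD[OF C] in simp)
next
  assume "?P u"
  then obtain r where r: "\<And>i j. (i \<ge> r \<or> j \<ge> r) ==> ent u i j = 0" "\<And>i j. ent u i j \<in> C" by blast
  have "u = (\<Sum>i<r. \<Sum>j<r. sc (ent u i j) * rc.mx i j)"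
  proof (rule rcf_eqI)
    fix a b
    have "ent (\<Sum>i<r. \<Sum>j<r. sc (ent u i j) * rc.mx i j) a b
       = (\<Sum>i<r. \<Sum>j<r. if i = a then (if j = b then ent u i j else 0) else 0)"
      unfolding ent_sum by (intro sum.cong) auto
    also have "\<dots> = (\<Sum>i<r. if i = a then (\<Sum>j<r. if j = b then ent u i j else 0) else 0)"
      by (intro sum.cong) auto
    also have "\<dots> = ent u a b" using r(1)[of a b] by (auto simp: not_less)
    finally show "ent u a b = ent (\<Sum>i<r. \<Sum>j<r. sc (ent u i j) * rc.mx i j) a b" by simp
  qed
  moreover have sumF: "(\<And>i. i \<in> I ==> f i \<in> ru.Fin D) ==> sum f I \<in> ru.Fin D" for I :: "nat set" and f D
    by (induction I rule: infinite_finite_induct) (auto intro: ru.Fin.zero ru.Fin_add)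
  have "(\<Sum>i<r. \<Sum>j<r. sc (ent u i j) * rc.mx i j) \<in> ru.Fin (sc ` C)"
    by (intro sumF ru.Fin_mx) (use r in auto)
  ultimately show "u \<in> ru.Fin (sc ` C)" by simp
qed

lemma Fin_UNIV_iff: "u \<in> ru.Fin (range sc) \<longleftrightarrow> (\<exists>r. \<forall>i j. (i \<ge> r \<or> j \<ge> r) \<longrightarrow> ent u i j = 0)"
  using Fin_iff[OF subring_UNIV] by simp

lemma Fin_ideal:
  fixes u w :: "'c::comm_ring_1 rcf"
  assumes "u \<in> ru.Fin (range sc)" shows "w * u \<in> ru.Fin (range sc)" "u * w \<in> ru.Fin (range sc)"
proof -
  obtain r where r: "\<And>i j. (i \<ge> r \<or> j \<ge> r) ==> ent u i j = 0" using assms Fin_UNIV_iff by blast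
  have "finite (\<Union>k<r. {i. ent w i k \<noteq> 0})" by auto
  then obtain s where s: "\<And>i k. k < r ==> ent w i k \<noteq> 0 ==> i < s"
    unfolding finite_nat_iff_bounded by auto
  have "ent (w * u) i j = 0" if "i \<ge> max r s \<or> j \<ge> max r s" for i j
    unfolding ent_mult'
  proof (rule sum.neutral, intro ballI)
    fix k assume "k \<in> {k. ent w i k \<noteq> 0}"
    then have "k < r ==> i < s" using s by blast
    then show "ent w i k * ent u k j = 0" using that r[of k j] by (cases "k < r") auto
  qed
  then show "w * u \<in> ru.Fin (range sc)" unfolding Fin_UNIV_iff by blast
  have "finite (\<Union>k<r. {i. ent w k i \<noteq> 0})" by auto
  then obtain s where s: "\<And>i k. k < r ==> ent w k i \<noteq> 0 ==> i < s"
    unfolding finite_nat_iff_bounded by auto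
  have "ent (u * w) i j = 0" if "i \<ge> max r s \<or> j \<ge> max r s" for i j
    unfolding ent_mult'
  proof (rule sum.neutral, intro ballI)
    fix k assume "k \<in> {k. ent u i k \<noteq> 0}"
    then have "k < r" "i < r" using r[of i k] not_le by auto
    then show "ent u i k * ent w k j = 0" using that s[of k j] by (cases "ent w k j = 0") auto
  qed
  then show "u * w \<in> ru.Fin (range sc)" unfolding Fin_UNIV_iff by blast
qed

section \<open>Determinants of matrices that differ from the identity in finitely many entries\<close>

definition trim :: "nat \<Rightarrow> 'c::field rcf \<Rightarrow> bool" where
  "trim r u \<longleftrightarrow> (\<forall>i j. i \<ge> r \<or> j \<ge> r \<longrightarrow> ent u i j = (if i = j then 1 else 0))"

definition dmat :: "nat \<Rightarrow> 'c::field rcf \<Rightarrow> 'c Matrix.mat" where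
  "dmat r u = mat r r (\<lambda>(i,j). ent u i j)"

text \<open>The least size is only a choice of representative; \<open>dt_eq\<close> evaluates the
  determinant on any block outside of which the matrix is the identity.\<close>

definition dt :: "'c::field rcf \<Rightarrow> 'c" where
  "dt u = det (dmat (LEAST r. trim r u) u)"

lemma dmat_carrier [simp]: "dmat r u \<in> carrier_mat r r" by (simp add: dmat_def)

lemma trim_le: "trim r u ==> r \<le> s ==> trim s u"
  by (auto simp: trim_def)

lemma trim_iff: "u - 1 \<in> ru.Fin (range sc) \<longleftrightarrow> (\<exists>r. trim r u)"
  unfolding Fin_UNIV_iff trim_def by (auto simp: algebra_simps)

lemma sized_trim: "ru.sized r u \<longleftrightarrow> trim r u"
proof
  assume s: "ru.sized r u"
  show "trim r u" unfolding trim_def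
  proof (intro allI impI)
    fix i j assume "i \<ge> r \<or> j \<ge> r"
    moreover have "ent (rc.pr r * (u - 1)) i j = ent (u - 1) i j" "ent ((u - 1) * rc.pr r) i j = ent (u - 1) i j"
      using s by (auto simp: ru.sized_def)
    ultimately have "ent (u - 1) i j = 0" unfolding ent_pr_mult ent_mult_pr by (auto split: if_splits)
    then show "ent u i j = (if i = j then 1 else 0)" by (simp split: if_splits)
  qed
next
  assume t: "trim r u"
  then have "ent (u - 1) i j = 0" if "i \<ge> r \<or> j \<ge> r" for i j using that by (auto simp: trim_def)
  then show "ru.sized r u" unfolding ru.sized_def
    by (auto intro!: rcf_eqI simp: ent_pr_mult ent_mult_pr simp del: ent_simps)
qed

lemma det_dmat_Suc: assumes "trim r u" shows "det (dmat (Suc r) u) = det (dmat r u)"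
proof -
  have "dmat (Suc r) u = four_block_mat (dmat r u) (0\<^sub>m r 1) (0\<^sub>m 1 r) (1\<^sub>m 1)"
    using assms by (intro eq_matI) (auto simp: dmat_def trim_def)
  then show ?thesis using det_four_block_mat_upper_right_zero_col[of "dmat r u" r "0\<^sub>m r 1" "0\<^sub>m 1 r" "1\<^sub>m 1"]
    by simp
qed

lemma dt_eq: assumes "trim r u" shows "dt u = det (dmat r u)"
proof -
  have "det (dmat (s + d) u) = det (dmat s u)" if "trim s u" for s d
  proof (induction d)
    case (Suc d)
    then show ?case using det_dmat_Suc[OF trim_le[OF that], of "s + d"] by simp
  qed simp
  from this[OF LeastI[of "\<lambda>r. trim r u", OF assms], of "r - (LEAST r. trim r u)"]
  show ?thesis unfolding dt_def using Least_le[of "\<lambda>r. trim r u", OF assms] by simp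
qed

lemma trim_ent_mult: assumes "trim r u" "i < r" shows "ent (u * v) i j = (\<Sum>k<r. ent u i k * ent v k j)"
  by (rule ent_mult) (use assms in \<open>auto simp: trim_def, metis linorder_not_le nless_le\<close>)

lemma trim_mult: assumes "trim r u" "trim r v" shows "trim r (u * v)"
  using assms unfolding sized_trim[symmetric] by (rule ru.sized_mult)

lemma dmat_mult: assumes "trim r u" "trim r v" shows "dmat r (u * v) = dmat r u * dmat r v"
  by (rule eq_matI)
    (use assms in \<open>auto simp: dmat_def trim_ent_mult scalar_prod_def lessThan_atLeast0\<close>)

lemma dt_mult:
  assumes "u - 1 \<in> ru.Fin (range sc)" "v - 1 \<in> ru.Fin (range sc)"
  shows "dt (u * v) = dt u * dt v"
proof -
  obtain r s where "trim r u" "trim s v" using assms trim_iff by blast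
  then have t: "trim (max r s) u" "trim (max r s) v" using trim_le[of r u "max r s"] trim_le[of s v "max r s"] by simp_all
  show ?thesis
    unfolding dt_eq[OF t(1)] dt_eq[OF t(2)] dt_eq[OF trim_mult[OF t]] dmat_mult[OF t]
    by (rule det_mult[OF dmat_carrier dmat_carrier])
qed

lemma dt_one [simp]: "dt 1 = 1"
  using dt_eq[of 0 1] by (simp add: trim_def)

text \<open>Both matrices fit into one finite block, where a one-sided inverse over a field is
  two-sided.\<close>

lemma one_sided_inverse:
  fixes u v :: "'c::field rcf"
  assumes "u - 1 \<in> ru.Fin (range sc)" "v - 1 \<in> ru.Fin (range sc)" "u * v = 1"
  shows "v * u = 1"
proof -
  obtain r s where "trim r u" "trim s v" using assms trim_iff by blast
  then have t: "trim (max r s) u" "trim (max r s) v" using trim_le[of r u "max r s"] trim_le[of s v "max r s"] by simp_all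
  let ?n = "max r s"
  have 1: "dmat ?n (1 :: 'c rcf) = 1\<^sub>m ?n" by (intro eq_matI) (auto simp: dmat_def)
  have "dmat ?n u * dmat ?n v = 1\<^sub>m ?n" using dmat_mult[OF t] assms(3) 1 by simp
  then have "dmat ?n v * dmat ?n u = 1\<^sub>m ?n" by (rule mat_mult_left_right_inverse[rotated 2]) simp_all
  then have d: "dmat ?n (v * u) = dmat ?n 1" using dmat_mult[OF t(2,1)] 1 by simp
  show ?thesis
  proof (rule rcf_eqI)
    fix i j
    show "ent (v * u) i j = ent 1 i j"
    proof (cases "i < ?n \<and> j < ?n")
      case True
      then have "ent (v * u) i j = dmat ?n (v * u) $$ (i, j)" by (simp add: dmat_def)
      also have "\<dots> = dmat ?n 1 $$ (i, j)" using d by simp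
      finally show ?thesis using True by (simp add: dmat_def)
    next
      case False
      then have "i \<ge> ?n \<or> j \<ge> ?n" by (auto simp: not_less)
      then show ?thesis using trim_mult[OF t(2,1)] unfolding trim_def by (simp only: ent_simps)
    qed
  qed
qed

lemma dt_subring:
  assumes C: "subring C" and u: "u - 1 \<in> ru.Fin (sc ` C)" shows "dt u \<in> C"
proof -
  have "u - 1 \<in> ru.Fin (range sc)" using ru.Fin_mono[of "sc ` C" "range sc"] u by blast
  then obtain r where r: "trim r u" using trim_iff by blast
  have "ent u i j \<in> C" for i j
  proof -
    have "ent (u - 1) i j \<in> C" using u Fin_iff[OF C] by blast
    moreover have "(if i = j then 1 else 0) \<in> C" using subringD[OF C] by auto
    moreover have "ent u i j = ent (u - 1) i j + (if i = j then 1 else 0)" by simp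
    ultimately show ?thesis using subringD(4)[OF C] by metis
  qed
  then have "dmat r u $$ (i, j) \<in> C" if "i < r" "j < r" for i j using that by (simp add: dmat_def)
  moreover have "signof p \<in> C" for p :: "nat \<Rightarrow> nat" using subringD(2,3)[OF C] by (simp add: sign_def)
  ultimately show ?thesis unfolding dt_eq[OF r] det_def'[OF dmat_carrier]
    by (intro subringD(7)[OF C] subringD(5)[OF C] subringD(8)[OF C])
      (auto dest: permutes_in_image)
qed

text \<open>The difference of the inverse from 1 is a multiple of u - 1, and finite matrices are an
  ideal among all row and column finite ones.\<close>

lemma Fin_inverse:
  fixes u :: "'c::field rcf"
  assumes "u - 1 \<in> ru.Fin (range sc)" "unt u" shows "u \<in> ru.GL (range sc)"
proof -
  have "uinv u - 1 = - (uinv u * (u - 1))" using assms(2) by (simp add: right_diff_distrib)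
  then have "uinv u - 1 \<in> ru.Fin (range sc)"
    using ru.Fin_neg[OF ru.idl_C Fin_ideal(1)[OF assms(1)]] by simp
  then show ?thesis using assms by (simp add: ru.GL_def)
qed

lemma dt_inv: assumes "u \<in> ru.GL (range sc)" shows "dt u * dt (uinv u) = 1" "dt u \<noteq> 0"
proof -
  show "dt u * dt (uinv u) = 1"
    using dt_mult[of u "uinv u"] assms ru.GL_unt[OF assms] by (simp add: ru.GL_def)
  then show "dt u \<noteq> 0" by auto
qed

lemma dt_El: "g \<in> ru.El (range sc) ==> dt g = (1 :: 'c::field)"
proof (induction g rule: ru.El.induct)
  case (step c k l g)
  \<comment> \<open>A third index, different from k and l: the elementary matrix in place (k, l) is
    a commutator through it, so its determinant is 1.\<close>
  define j where "j = Suc (k + l)"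
  define a where "a = 1 + c * rc.mx k j"
  define a' where "a' = 1 + - c * rc.mx k j"
  define b where "b = 1 + 1 * (rc.mx j l :: 'c rcf)"
  define b' where "b' = 1 + - 1 * (rc.mx j l :: 'c rcf)"
  have j: "k \<noteq> j" "j \<noteq> l" by (auto simp: j_def)
  have one: "1 \<in> range (sc :: 'c \<Rightarrow> 'c rcf)" "- 1 \<in> range (sc :: 'c \<Rightarrow> 'c rcf)" "- c \<in> range sc"
    using ru.C_1 ru.C_neg[OF ru.C_1] ru.C_neg[OF step(1)] by blast+
  note M = ru.one_Fin_mult[OF ru.idl_C]
  have F: "a - 1 \<in> ru.Fin (range sc)" "a' - 1 \<in> ru.Fin (range sc)" "b - 1 \<in> ru.Fin (range sc)"
    "b' - 1 \<in> ru.Fin (range sc)"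
    unfolding a_def a'_def b_def b'_def using ru.Fin_mx[OF step(1)] ru.Fin_mx[OF one(1)] ru.Fin_mx[OF one(2)]
      ru.Fin_mx[OF one(3)] by simp_all
  have inv: "a * a' = 1" "b * b' = 1"
    unfolding a_def a'_def b_def b'_def using ru.elem_inv[OF step(1) j(1)] ru.elem_inv[OF one(1) j(2)] by simp_all
  have d: "dt a * dt a' = 1" "dt b * dt b' = 1" using dt_mult[OF F(1,2)] dt_mult[OF F(3,4)] inv by simp_all
  have cm: "rc.mx p q * c = c * rc.mx p q" "rc.mx p q * (c * s) = c * (rc.mx p q * s)" for p q s
    using ru.C_mx[OF step(1)] by (simp, simp flip: mult.assoc)
  have "1 + c * rc.mx k l = a * b * a' * b'"
    unfolding a_def a'_def b_def b'_def using j step(2)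
    by (simp add: algebra_simps rc.mx_mult cm)
  then have "dt (1 + c * rc.mx k l) = dt a * dt b * dt a' * dt b'"
    using dt_mult[OF M[OF M[OF F(1) F(3)] F(2)] F(4)] dt_mult[OF M[OF F(1) F(3)] F(2)] dt_mult[OF F(1) F(3)]
    by simp
  also have "\<dots> = 1" using d by (simp add: algebra_simps)
  finally have "dt (1 + c * rc.mx k l) = 1" .
  moreover have "1 + c * rc.mx k l - 1 \<in> ru.Fin (range sc)" "g - 1 \<in> ru.Fin (range sc)"
    using ru.Fin_mx[OF step(1)] ru.El_GL[OF ru.idl_C step(3)] by (simp_all add: ru.GL_def)
  ultimately show ?case using dt_mult[of "1 + c * rc.mx k l" g] step(4) by simp
qed simp

lemma dt_eqv: assumes "ru.eqv u v" shows "dt u = dt v"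
proof -
  obtain e where e: "e \<in> ru.El (range sc)" "u = e * v" using ru.eqvD[OF assms] by blast
  have "e - 1 \<in> ru.Fin (range sc)" "v - 1 \<in> ru.Fin (range sc)"
    using ru.El_GL[OF ru.idl_C e(1)] assms by (simp_all add: ru.GL_def ru.eqv_def)
  then show ?thesis using dt_mult[of e v] e dt_El[OF e(1)] by simp
qed

text \<open>g is any unit, possibly far from the identity, so \<open>dt_mult\<close> says nothing
  about it. Instead the conjugate is 1 + a b and u is 1 + b a, where a = g (u - 1), b = pr r / g and
  pr r is a block that contains u - 1.\<close>

lemma dt_conj:
  fixes u g :: "'c::field rcf"
  assumes u: "u \<in> ru.GL (range sc)" and g: "unt g"
  shows "g * u * uinv g \<in> ru.GL (range sc)" "dt (g * u * uinv g) = dt u"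
proof -
  have uF: "u - 1 \<in> ru.Fin (range sc)" using u by (simp add: ru.GL_def)
  have e: "g * u * uinv g - 1 = g * (u - 1) * uinv g" using g by (simp add: algebra_simps)
  show G: "g * u * uinv g \<in> ru.GL (range sc)"
  proof (rule Fin_inverse)
    show "g * u * uinv g - 1 \<in> ru.Fin (range sc)" unfolding e using Fin_ideal uF by blast
    show "unt (g * u * uinv g)" using g ru.GL_unt[OF u] by simp
  qed
  obtain r where r: "rc.pr r * (u - 1) = u - 1" "(u - 1) * rc.pr r = u - 1"
    using ru.Fin_bound[OF ru.idl_C uF] by blast
  define a where "a = g * (u - 1)"
  define b where "b = rc.pr r * uinv g"
  have F: "a \<in> ru.Fin (range sc)" "b \<in> ru.Fin (range sc)"
    unfolding a_def b_def using Fin_ideal uF ru.Fin_pr by blast+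
  have ab: "a * b = g * ((u - 1) * rc.pr r) * uinv g" by (simp only: a_def b_def mult.assoc)
  have 1: "1 + a * b = g * u * uinv g" using e unfolding ab r by (simp add: algebra_simps)
  have "b * a = rc.pr r * (uinv g * (g * (u - 1)))" by (simp only: a_def b_def mult.assoc)
  also have "\<dots> = u - 1" using g r by simp
  finally have 2: "1 + b * a = u" by simp
  show "dt (g * u * uinv g) = dt u"
    using dt_eqv[OF ru.one_plus_mult_swap(2)[OF F]] G unfolding 1 2 by blast
qed

lemma dt_diag: "dt (1 + (sc c - 1) * rc.mx k k) = (c :: 'c::field)"
proof -
  have t: "trim (Suc k) (1 + (sc c - 1) * rc.mx k k)" by (auto simp: trim_def left_diff_distrib)
  have "det (dmat (Suc k) (1 + (sc c - 1) * rc.mx k k)) = prod_list (diag_mat (dmat (Suc k) (1 + (sc c - 1) * rc.mx k k)))"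
    by (rule det_lower_triangular[of "Suc k"]) (auto simp: dmat_def left_diff_distrib)
  also have "\<dots> = (\<Prod>i = 0..<Suc k. if i = k then c else 1)"
    unfolding prod_list_diag_prod by (rule prod.cong) (auto simp: dmat_def left_diff_distrib)
  finally show ?thesis using dt_eq[OF t] by simp
qed

section \<open>The special Whitehead group of a field and of a Laurent polynomial ring\<close>

lemma mx_ent: "rc.mx i j * u * rc.mx k l = sc (ent u j k) * rc.mx i l"
  by (rule rcf_eqI) (auto simp: ent_mult_mx ent_mx_mult)

text \<open>Gaussian elimination of the last row and column: make the last diagonal entry 1, then
  clear first its column and next its row. The assumption n > 0 provides a second index, needed to
  produce the 1 by an elementary operation.\<close>

lemma field_reduce_step:
  fixes F :: "'c::field set"
  assumes F: "subring F" and inv: "\<And>c. c \<in> F ==> inverse c \<in> F"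
    and u: "u \<in> coeff_ring.GL sx sy (sc ` F) (sc ` F)" "ru.sized (Suc n) u" and n: "n > 0"
  shows "\<exists>w. coeff_ring.eqv sx sy (sc ` F) u w \<and> ru.sized n w"
proof -
  interpret c: coeff_ring sx sy "sc ` F" using coeff_ring_sc[OF F] .
  note GLF = u(1)
  have scF: "sc a \<in> sc ` F" if "a \<in> F" for a using that by blast
  have entF: "ent w i j \<in> F" if "w - 1 \<in> ru.Fin (sc ` F)" for w i j
  proof -
    have "ent (w - 1) i j \<in> F" using that Fin_iff[OF F] by blast
    moreover have "(if i = j then 1 else 0) \<in> F" using subringD[OF F] by auto
    moreover have "ent w i j = ent (w - 1) i j + (if i = j then 1 else 0)" by simp
    ultimately show ?thesis using subringD(4)[OF F] by metis
  qed
  have elem_sized: "ru.sized (Suc n) (1 + sc a * rc.mx k l)" if "k \<le> n" "l \<le> n" for a :: 'c and k l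
    using that by (auto simp: sized_trim trim_def)
  have elem: "c.eqv w ((1 + sc a * rc.mx k l) * w)" if "w \<in> c.GL (sc ` F)" "a \<in> F" "k \<noteq> l" for w a k l
    using c.eqv_sym[OF c.eqv_El(1)[OF c.El_elem[OF scF[OF that(2)] that(3)] that(1)]] .
  have eG: "v \<in> c.GL (sc ` F)" if "c.eqv u v" for u v using that by (simp add: c.eqv_def)
  have ent_el: "ent ((1 + sc a * rc.mx k l) * w) i j = ent w i j + (if i = k then a * ent w l j else 0)" for a k l w i j
    by (simp add: distrib_right mult.assoc ent_mx_mult)
  have colnz: "\<exists>k\<le>n. ent u k n \<noteq> 0"
  proof (rule ccontr)
    assume "\<not> ?thesis"
    then have "ent u k n = 0" for k using u(2) unfolding sized_trim trim_def
      by (metis less_irrefl less_eq_Suc_le not_less_eq_eq)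
    then have "u * rc.mx n n = 0" by (intro rcf_eqI) (auto simp: ent_mult_mx)
    then have "uinv u * (u * rc.mx n n) = 0" by simp
    then have "(rc.mx n n :: 'c rcf) = 0" using c.GL_unt[OF u(1)] by simp
    then have "ent (rc.mx n n :: 'c rcf) n n = ent 0 n n" by simp
    then show False by simp
  qed
  have "\<exists>w. c.eqv u w \<and> ru.sized (Suc n) w \<and> (\<exists>k<n. ent w k n \<noteq> 0)"
  proof (cases "\<exists>k<n. ent u k n \<noteq> 0")
    case True
    then show ?thesis using c.eqv_refl[OF u(1)] u(2) by blast
  next
    case False
    then have nz: "ent u n n \<noteq> 0" using colnz by (auto simp: le_less)
    \<comment> \<open>If the last column has its only nonzero entry on the diagonal, a copy is made
      in row 0, so that the next step can work from an entry off the diagonal.\<close>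
    let ?w = "(1 + sc 1 * rc.mx 0 n) * u"
    have "c.eqv u ?w" by (rule elem[OF u(1) subringD(2)[OF F]]) (use n in simp)
    moreover have "ru.sized (Suc n) ?w" using ru.sized_mult[OF elem_sized u(2)] by simp
    moreover have "ent ?w 0 n \<noteq> 0" using nz False n by (simp add: ent_el del: sc_hom)
    ultimately show ?thesis using n by blast
  qed
  then obtain w k where w: "c.eqv u w" "ru.sized (Suc n) w" "k < n" "ent w k n \<noteq> 0" by blast
  have wF: "w - 1 \<in> ru.Fin (sc ` F)" using eG[OF w(1)] by (simp add: c.GL_def)
  \<comment> \<open>Adding a times row k to row n turns the entry in place (n, n) into 1.\<close>
  define a where "a = (1 - ent w n n) * inverse (ent w k n)"
  have aF: "a \<in> F" unfolding a_def
    by (rule subringD(5)[OF F subringD(6)[OF F subringD(2)[OF F] entF[OF wF]] inv[OF entF[OF wF]]])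
  define w1 where "w1 = (1 + sc a * rc.mx n k) * w"
  have w1: "c.eqv u w1" "ru.sized (Suc n) w1" "ent w1 n n = 1"
  proof -
    show "c.eqv u w1" unfolding w1_def by (rule c.eqv_trans[OF w(1) elem[OF eG[OF w(1)] aF]]) (use w(3) in simp)
    show "ru.sized (Suc n) w1" unfolding w1_def using ru.sized_mult[OF elem_sized w(2)] w(3) by simp
    show "ent w1 n n = 1" unfolding w1_def ent_el using w(4) by (simp add: a_def mult.assoc)
  qed
  have w1F: "w1 - 1 \<in> ru.Fin (sc ` F)" using eG[OF w1(1)] by (simp add: c.GL_def)
  have m1: "rc.mx n n * w1 * rc.mx n n = rc.mx n n" unfolding mx_ent w1(3) by (simp add: sc_hom)
  have mF: "rc.mx n n \<in> ru.Fin (sc ` F)" using ru.Fin_mx[OF c.C_1, of n n] by simp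
  have prF: "rc.pr n \<in> ru.Fin (sc ` F)" by (rule c.Fin_pr)
  have wm: "w' * rc.mx n n \<in> ru.Fin (sc ` F)" "rc.mx n n * w' \<in> ru.Fin (sc ` F)"
    if "w' - 1 \<in> ru.Fin (sc ` F)" for w'
  proof -
    have "w' * rc.mx n n = (w' - 1) * rc.mx n n + rc.mx n n" "rc.mx n n * w' = rc.mx n n * (w' - 1) + rc.mx n n"
      by (simp_all add: algebra_simps)
    then show "w' * rc.mx n n \<in> ru.Fin (sc ` F)" "rc.mx n n * w' \<in> ru.Fin (sc ` F)"
      using c.Fin_add[OF c.Fin_mult[OF c.idl_C that mF] mF] c.Fin_add[OF c.Fin_mult[OF c.idl_C mF that] mF] by simp_all
  qed
  define q where "q = - (rc.pr n * (w1 * rc.mx n n))"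
  have qF: "q \<in> ru.Fin (sc ` F)" unfolding q_def
    using c.Fin_neg[OF c.idl_C c.Fin_mult[OF c.idl_C prF wm(1)[OF w1F]]] .
  have mp: "rc.mx n n * rc.pr n = (0 :: 'c rcf)" "rc.pr n * rc.mx n n = (0 :: 'c rcf)" by (simp_all add: rc.mx_pr rc.pr_mx)
  have qE: "1 + q \<in> c.El (sc ` F)"
    by (rule c.upper_El[OF c.idl_C qF, of n]) (simp_all add: q_def mult.assoc mp)
  define w2 where "w2 = (1 + q) * w1"
  have e2: "c.eqv u w2" unfolding w2_def
    using c.eqv_trans[OF w1(1) c.eqv_sym[OF c.eqv_El(1)[OF qE eG[OF w1(1)]]]] .
  have w2F: "w2 - 1 \<in> ru.Fin (sc ` F)" using eG[OF e2] by (simp add: c.GL_def)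
  have pSn: "rc.pr (Suc n) = rc.pr n + (rc.mx n n :: 'c rcf)"
    by (rule rcf_eqI) (auto simp: ent_pr)
  have col: "w2 * rc.mx n n = rc.mx n n"
  proof -
    have "q * w1 * rc.mx n n = - (rc.pr n * (w1 * (rc.mx n n * w1 * rc.mx n n)))"
      by (simp add: q_def mult.assoc)
    then have "w2 * rc.mx n n = w1 * rc.mx n n - rc.pr n * (w1 * rc.mx n n)"
      unfolding w2_def m1 by (simp add: distrib_right)
    also have "\<dots> = rc.mx n n"
      by (rule rcf_eqI) (use w1(2,3) in \<open>auto simp: ent_mult_mx ent_pr_mult sized_trim trim_def not_less\<close>)
    finally show ?thesis .
  qed
  have s2: "ru.sized (Suc n) w2"
  proof -
    have "rc.pr (Suc n) * (rc.pr n * z) = rc.pr n * z" for z :: "'c rcf"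
    proof -
      have "rc.pr (Suc n) * rc.pr n = (rc.pr n :: 'c rcf)" by (rule rc.pr_le(2)) simp
      then show ?thesis by (simp flip: mult.assoc)
    qed
    then have "ru.sized (Suc n) (1 + q)"
      unfolding ru.sized_def by (simp add: q_def mult.assoc rc.mx_pr)
    then show ?thesis unfolding w2_def using ru.sized_mult[OF _ w1(2)] by blast
  qed
  define q' where "q' = - (rc.mx n n * w2 * rc.pr n)"
  have q'F: "q' \<in> ru.Fin (sc ` F)" unfolding q'_def
    using c.Fin_neg[OF c.idl_C c.Fin_mult[OF c.idl_C wm(2)[OF w2F] prF]] .
  have q'E: "1 + q' \<in> c.El (sc ` F)"
  proof (rule c.lower_El[OF c.idl_C q'F, of n])
    have "rc.pr n * (rc.mx n n * z) = 0" for z :: "'c rcf" using mp(2) by (simp flip: mult.assoc)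
    then show "rc.pr n * q' = 0" "q' * rc.pr n = q'" by (simp_all add: q'_def mult.assoc)
  qed
  define w3 where "w3 = w2 * (1 + q')"
  have e3: "c.eqv u w3" unfolding w3_def
    using c.eqv_trans[OF e2 c.eqv_sym[OF c.eqv_El(2)[OF q'E eG[OF e2]]]] .
  have "w3 = w2 - rc.mx n n * w2 * rc.pr n"
  proof -
    have "w2 * q' = - ((w2 * rc.mx n n) * (w2 * rc.pr n))" by (simp add: q'_def mult.assoc)
    then show ?thesis unfolding w3_def col by (simp add: distrib_left mult.assoc)
  qed
  then have ent3: "ent w3 i j = ent w2 i j - (if i = n \<and> j < n then ent w2 i j else 0)" for i j
    by (simp add: ent_mult_pr ent_mx_mult)
  have c2: "ent w2 i n = (if i = n then 1 else 0)" for i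
    using arg_cong[OF col, of "\<lambda>M. ent M i n"] by (simp add: ent_mult_mx)
  have "trim n w3" unfolding trim_def
  proof (intro allI impI)
    fix i j assume ij: "n \<le> i \<or> n \<le> j"
    show "ent w3 i j = (if i = j then 1 else 0)"
    proof (cases "Suc n \<le> i \<or> Suc n \<le> j")
      case True
      then show ?thesis using s2 unfolding ent3 sized_trim trim_def by auto
    next
      case False
      then have "i = n \<or> j = n" "i \<le> n" "j \<le> n" using ij by auto
      then show ?thesis unfolding ent3 using c2 by auto
    qed
  qed
  then show ?thesis using e3 sized_trim by blast
qed

text \<open>Elimination leads to a matrix whose only entry that may differ from the identity is its
  determinant.\<close>

lemma SK1_field:
  fixes F :: "'c::field set"
  assumes F: "subring F" and inv: "\<And>c. c \<in> F ==> inverse c \<in> F"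
    and u: "u \<in> coeff_ring.GL sx sy (sc ` F) (sc ` F)" "dt u = 1"
  shows "u \<in> ru.El (sc ` F)"
proof -
  interpret c: coeff_ring sx sy "sc ` F" using coeff_ring_sc[OF F] .
  have sub: "sc ` F \<subseteq> range sc" by blast
  have GLru: "w \<in> ru.GL (range sc)" if "w \<in> c.GL (sc ` F)" for w
    using that ru.Fin_mono[OF sub] by (auto simp: c.GL_def ru.GL_def)
  have red: "\<exists>w. c.eqv u w \<and> ru.sized 1 w" if "u \<in> c.GL (sc ` F)" "ru.sized (Suc n) u" for n u
    using that
  proof (induction n arbitrary: u)
    case 0
    then show ?case using c.eqv_refl by auto
  next
    case (Suc n)
    obtain w where w: "c.eqv u w" "ru.sized (Suc n) w"
      using field_reduce_step[OF F inv Suc(2,3)] by blast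
    have "w \<in> c.GL (sc ` F)" using w by (simp add: c.eqv_def)
    then show ?case using Suc.IH[OF _ w(2)] c.eqv_trans[OF w(1)] by blast
  qed
  have "u - 1 \<in> ru.Fin (range sc)" using GLru[OF u(1)] by (simp add: ru.GL_def)
  then obtain r where "ru.sized r u" using ru.sized_ex[OF ru.idl_C] by blast
  then have "ru.sized (Suc r) u" using ru.sized_le[of r u "Suc r"] by simp
  then obtain w where w: "c.eqv u w" "ru.sized 1 w" using red[OF u(1)] by blast
  have "dt u = dt w"
  proof (rule dt_eqv, unfold ru.eqv_def, intro conjI)
    show "u \<in> ru.GL (range sc)" "w \<in> ru.GL (range sc)" using GLru w u by (auto simp: c.eqv_def)
    show "u * uinv w \<in> ru.El (range sc)" using w ru.El_mono[OF sub] by (auto simp: c.eqv_def)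
  qed
  moreover have we: "w = 1 + (sc (ent w 0 0) - 1) * rc.mx 0 0"
    by (rule rcf_eqI) (use w(2) in \<open>auto simp: sized_trim trim_def left_diff_distrib\<close>)
  ultimately have "ent w 0 0 = 1" using dt_diag[of "ent w 0 0" 0] u(2) by simp
  then have "w = 1" using we by (simp add: sc_hom)
  then show ?thesis using w(1) c.eqv_El_one by blast
qed

section \<open>Laurent polynomials with denominators in some of the variables\<close>

abbreviation "pkeys \<equiv> Poly_Mapping.keys"
abbreviation "plookup \<equiv> Poly_Mapping.lookup"
abbreviation "psingle \<equiv> Poly_Mapping.single"

type_synonym 'k lp = "(nat \<Rightarrow>\<^sub>0 int) \<Rightarrow>\<^sub>0 'k"
type_synonym 'k om = "'k lp fract"

definition Lp :: "nat set \<Rightarrow> 'k::field lp set" where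
  "Lp V = {p. \<forall>m\<in>pkeys p. pkeys m \<subseteq> V}"

definition emb :: "'k::field lp \<Rightarrow> 'k om" where
  "emb p = Fract p 1"

definition lmon :: "(nat \<Rightarrow>\<^sub>0 int) \<Rightarrow> 'k::field om" where
  "lmon m = emb (psingle m 1)"

text \<open>Laurent polynomials in the variables V with denominators in the variables U. The case U
  = {} is the Laurent polynomial ring, U = V is its fraction field, and the sets in between are the
  stages of the descent.\<close>

definition Rn :: "nat set \<Rightarrow> nat set \<Rightarrow> 'k::field om set" where
  "Rn U V = {emb p * inverse (emb q) | p q. p \<in> Lp V \<and> q \<in> Lp U \<and> q \<noteq> 0}"

lemma emb_hom: "emb 0 = 0" "emb 1 = 1" "emb (p + q) = emb p + emb q" "emb (- p) = - emb p"
  "emb (p - q) = emb p - emb q" "emb (p * q) = emb p * emb q"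
  by (simp_all add: emb_def Zero_fract_def One_fract_def)

lemma emb_inj [simp]: "emb p = emb q \<longleftrightarrow> p = q"
  by (simp add: emb_def eq_fract)

lemma emb_0 [simp]: "emb p = 0 \<longleftrightarrow> p = 0"
  using emb_inj[of p 0] by (simp only: emb_hom)

lemma emb_sum: "emb (sum f I) = (\<Sum>i\<in>I. emb (f i))"
  by (induction I rule: infinite_finite_induct) (simp_all add: emb_hom)

lemma mon_add: "lmon (a + b) = lmon a * lmon b"
  by (simp add: lmon_def mult_single flip: emb_hom)

lemma mon_0 [simp]: "lmon 0 = 1" by (simp add: lmon_def emb_hom)

lemma mon_uminus: "lmon (- a) = inverse (lmon a)"
proof -
  have "lmon (- a) * lmon a = 1" unfolding mon_add[symmetric] by simp
  then show ?thesis by (metis inverse_unique mult.commute)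
qed

lemma mon_nonzero [simp]: "lmon a \<noteq> (0 :: 'k::field om)"
proof
  assume "lmon a = (0 :: 'k::field om)"
  then have "lmon (a + - a) = (0 :: 'k om)" by (simp only: mon_add mult_zero_left)
  then show False by simp
qed

lemma single_nat_power: "lmon (psingle v (int k)) = lmon (psingle v 1) ^ k"
proof (induction k)
  case (Suc k)
  have "psingle v (int (Suc k)) = psingle v 1 + psingle v (int k)"
    by (simp add: single_add[symmetric])
  then show ?case using Suc by (simp add: mon_add)
qed simp

lemma Lp_0: "0 \<in> Lp V" and Lp_1: "1 \<in> Lp V" by (auto simp: Lp_def)

lemma Lp_add: "p \<in> Lp V ==> q \<in> Lp V ==> p + q \<in> Lp V"
  by (auto simp: Lp_def dest!: subsetD[OF keys_add])

lemma Lp_neg: "p \<in> Lp V ==> - p \<in> Lp V"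
  by (simp add: Lp_def in_keys_iff)

lemma Lp_mult: assumes "p \<in> Lp V" "q \<in> Lp V" shows "p * q \<in> Lp V"
  unfolding Lp_def
proof (safe)
  fix m i assume m: "m \<in> pkeys (p * q)" "i \<in> pkeys m"
  then obtain a b where "m = a + b" "a \<in> pkeys p" "b \<in> pkeys q" using keys_mult by blast
  then show "i \<in> V" using m(2) keys_add[of a b] assms by (auto simp: Lp_def)
qed

lemma Lp_mono: "U \<subseteq> V ==> p \<in> Lp U ==> p \<in> Lp V"
  by (auto simp: Lp_def)

lemma Lp_single: "pkeys m \<subseteq> V ==> psingle m c \<in> Lp V"
  by (auto simp: Lp_def)

lemma RnI: "p \<in> Lp V ==> q \<in> Lp U ==> q \<noteq> 0 ==> emb p * inverse (emb q) \<in> Rn U V"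
  by (auto simp: Rn_def)

lemma Rn_emb: "p \<in> Lp V ==> emb p \<in> Rn U V"
  using RnI[of p V 1 U] Lp_1 by (auto simp: emb_hom)

lemma Rn_mono: "U \<subseteq> U' ==> V \<subseteq> V' ==> Rn U V \<subseteq> Rn U' V'"
  unfolding Rn_def using Lp_mono by blast

lemma Rn_subring: assumes "U \<subseteq> V" shows "subring (Rn U V :: 'k::field om set)"
  unfolding subring_def
proof (intro conjI ballI)
  show "0 \<in> (Rn U V :: 'k om set)" "1 \<in> (Rn U V :: 'k om set)"
    using Rn_emb[OF Lp_0] Rn_emb[OF Lp_1] by (auto simp: emb_hom)
  fix c assume "c \<in> (Rn U V :: 'k om set)"
  then obtain p q where pq: "p \<in> Lp V" "q \<in> Lp U" "q \<noteq> 0" "c = emb p * inverse (emb q)"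
    by (auto simp: Rn_def)
  have "- c = emb (- p) * inverse (emb q)" by (simp add: pq emb_hom)
  then show "- c \<in> Rn U V" using RnI[OF Lp_neg[OF pq(1)] pq(2,3)] by simp
  fix d assume "d \<in> (Rn U V :: 'k om set)"
  then obtain p' q' where pq': "p' \<in> Lp V" "q' \<in> Lp U" "q' \<noteq> 0" "d = emb p' * inverse (emb q')"
    by (auto simp: Rn_def)
  have "c + d = emb (p * q' + p' * q) * inverse (emb (q * q'))"
    using pq pq' by (simp add: emb_hom field_simps)
  moreover have "p * q' + p' * q \<in> Lp V"
    by (intro Lp_add Lp_mult) (use pq pq' Lp_mono[OF assms] in auto)
  ultimately show "c + d \<in> Rn U V" using RnI[of _ V "q * q'" U] Lp_mult[OF pq(2) pq'(2)] pq pq' by simp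
  have "c * d = emb (p * p') * inverse (emb (q * q'))"
    unfolding pq(4) pq'(4) by (simp add: emb_hom mult_ac)
  then show "c * d \<in> Rn U V"
    using RnI[OF Lp_mult[OF pq(1) pq'(1)] Lp_mult[OF pq(2) pq'(2)]] pq pq' by simp
qed

lemma Rn_field: assumes "c \<in> Rn U U" shows "inverse c \<in> Rn U U"
proof -
  obtain p q where pq: "p \<in> Lp U" "q \<in> Lp U" "q \<noteq> 0" "c = emb p * inverse (emb q)"
    using assms by (auto simp: Rn_def)
  show ?thesis
  proof (cases "p = 0")
    case True
    then show ?thesis using pq Rn_emb[OF Lp_0, of U U] by (simp add: emb_hom)
  next
    case False
    have "inverse c = emb q * inverse (emb p)" by (simp add: pq(4))
    then show ?thesis using RnI[OF pq(2,1) False] by simp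
  qed
qed

lemma poly_mapping_sum: "p = (\<Sum>m\<in>pkeys p. psingle m (plookup p m))"
proof (rule poly_mapping_eqI)
  fix k
  have "plookup (\<Sum>m\<in>pkeys p. psingle m (plookup p m)) k
     = (\<Sum>m\<in>pkeys p. if m = k then plookup p k else 0)"
    unfolding lookup_sum by (rule sum.cong) (auto simp: lookup_single)
  then show "plookup p k = plookup (\<Sum>m\<in>pkeys p. psingle m (plookup p m)) k"
    by (simp add: in_keys_iff)
qed

lemma lookup_shift:
  fixes p :: "'k::field lp"
  shows "plookup (p * psingle a 1) b = plookup p (b - a)"
proof -
  have "p * psingle a 1 = (\<Sum>m\<in>pkeys p. psingle (m + a) (plookup p m))"
    by (subst poly_mapping_sum[of p]) (simp add: sum_distrib_right mult_single)
  then have "plookup (p * psingle a 1) b = (\<Sum>m\<in>pkeys p. if m = b - a then plookup p (b - a) else 0)"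
    by (simp only: lookup_sum) (rule sum.cong, auto simp: lookup_single when_def eq_diff_eq)
  then show ?thesis by (simp add: in_keys_iff)
qed

lemma lp_expand:
  fixes p :: "'k::field lp"
  assumes "p \<in> Lp V"
  shows "\<exists>m n a. (\<forall>k. a k \<in> Lp (V - {v})) \<and>
    emb p = lmon (psingle v (-1)) ^ m * (\<Sum>k<(n::nat). emb (a k) * lmon (psingle v 1) ^ k)"
proof -
  \<comment> \<open>m bounds every exponent of v in absolute value, so after multiplication by the
    m-th power of that variable the exponents lie between 0 and 2 m; hence n = 2 m + 1
    coefficients.\<close>
  define m where "m = (\<Sum>\<mu>\<in>pkeys p. nat \<bar>plookup \<mu> v\<bar>)"
  define n where "n = Suc (2 * m)"
  define t where "t = (lmon (psingle v 1) :: 'k om)"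
  define t' where "t' = (lmon (psingle v (-1)) :: 'k om)"
  define Q where "Q = {s. \<exists>a. (\<forall>k. a k \<in> Lp (V - {v})) \<and> s = t' ^ m * (\<Sum>k<n. emb (a k) * t ^ k)}"
  have t': "t' = inverse t" unfolding t_def t'_def by (simp add: single_uminus mon_uminus flip: mon_uminus)
  have Q0: "0 \<in> Q" unfolding Q_def using Lp_0 by (intro CollectI exI[of _ "\<lambda>_. 0"]) (simp add: emb_hom)
  have Qadd: "s + s' \<in> Q" if S: "s \<in> Q" "s' \<in> Q" for s s'
  proof -
    obtain a a' where "\<And>k. a k \<in> Lp (V - {v})" "s = t' ^ m * (\<Sum>k<n. emb (a k) * t ^ k)"
      "\<And>k. a' k \<in> Lp (V - {v})" "s' = t' ^ m * (\<Sum>k<n. emb (a' k) * t ^ k)"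
      using S unfolding Q_def by blast
    then show ?thesis unfolding Q_def
      by (intro CollectI exI[of _ "\<lambda>k. a k + a' k"])
        (auto simp: Lp_add emb_hom distrib_left distrib_right sum.distrib)
  qed
  have Qm: "emb (psingle \<mu> c) \<in> Q" if "\<mu> \<in> pkeys p" for \<mu> c
  proof -
    define e where "e = plookup \<mu> v"
    have em: "nat \<bar>e\<bar> \<le> m" unfolding e_def m_def using that by (intro member_le_sum) auto
    define k where "k = nat (e + int m)"
    have k: "k < n" "int k = e + int m" using em by (auto simp: k_def n_def)
    define b where "b = \<mu> - psingle v e"
    have \<mu>: "\<mu> = b + psingle v e" by (simp add: b_def)
    have "pkeys b \<subseteq> V - {v}"
    proof -
      have "pkeys \<mu> \<subseteq> V" using that assms by (auto simp: Lp_def)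
      moreover have "plookup b i = (if i = v then 0 else plookup \<mu> i)" for i
        by (auto simp: b_def lookup_minus lookup_single e_def)
      ultimately show ?thesis by (auto simp: in_keys_iff subset_iff split: if_splits)
    qed
    then have bL: "psingle b c \<in> Lp (V - {v})" by (rule Lp_single)
    have "emb (psingle \<mu> c) = emb (psingle b c) * lmon (psingle v e)"
      unfolding \<mu> lmon_def by (simp add: mult_single flip: emb_hom)
    also have "lmon (psingle v e) = t' ^ m * t ^ k"
    proof -
      have "e = int k - int m" using k by simp
      then have ve: "psingle v e = psingle v (int k) + - psingle v (int m)"
        by (simp add: single_diff)
      show ?thesis unfolding ve mon_add mon_uminus single_nat_power t' t_def
        by (simp add: power_inverse mult.commute)
    qed
    finally have "emb (psingle \<mu> c) = t' ^ m * (\<Sum>i<n. emb (if i = k then psingle b c else 0) * t ^ i)"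
      using k(1) by (simp add: if_distrib if_distribR emb_hom cong: if_cong)
    moreover have "\<forall>i. (if i = k then psingle b c else 0) \<in> Lp (V - {v})" using bL Lp_0 by auto
    ultimately show ?thesis unfolding Q_def
      by (intro CollectI exI[of _ "\<lambda>i. if i = k then psingle b c else 0"] conjI)
  qed
  have "(\<Sum>\<mu>\<in>M. emb (psingle \<mu> (plookup p \<mu>))) \<in> Q" if "M \<subseteq> pkeys p" for M
    using finite_subset[OF that finite_keys] that
    by (induction M rule: finite_induct) (auto intro: Q0 Qadd Qm)
  from this[of "pkeys p"] have "emb p \<in> Q" unfolding emb_sum[symmetric] poly_mapping_sum[symmetric] by simp
  then show ?thesis unfolding Q_def t_def t'_def by blast
qed

lemma Rn_expand:
  assumes "c \<in> Rn U V"
  shows "\<exists>m n a. (\<forall>k. a k \<in> Rn U (V - {v})) \<and>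
    c = lmon (psingle v (-1)) ^ m * (\<Sum>k<(n::nat). a k * lmon (psingle v 1) ^ k)"
proof -
  obtain p q where pq: "p \<in> Lp V" "q \<in> Lp U" "q \<noteq> 0" "c = emb p * inverse (emb q)"
    using assms by (auto simp: Rn_def)
  obtain m n a where a: "\<And>k. a k \<in> Lp (V - {v})"
    "emb p = lmon (psingle v (-1)) ^ m * (\<Sum>k<(n::nat). emb (a k) * lmon (psingle v 1) ^ k)"
    using lp_expand[OF pq(1)] by blast
  have "c = lmon (psingle v (-1)) ^ m * (\<Sum>k<n. (emb (a k) * inverse (emb q)) * lmon (psingle v 1) ^ k)"
    unfolding pq(4) a(2) by (simp add: sum_distrib_right sum_distrib_left mult_ac)
  then show ?thesis using RnI[OF a(1) pq(2,3)]
    by (intro exI[of _ m] exI[of _ n] exI[of _ "\<lambda>k. emb (a k) * inverse (emb q)"]) blast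
qed

text \<open>A common denominator of the coefficients does not involve v, so it can be cleared, and
  then terms with different exponents of v cannot cancel.\<close>

lemma Rn_indep:
  fixes a :: "nat \<Rightarrow> 'k::field om"
  assumes a: "\<And>k. a k \<in> Rn U W" and UW: "U \<subseteq> W" and v: "v \<notin> W"
    and s: "(\<Sum>k<n. a k * lmon (psingle v 1) ^ k) = 0" and k: "k < n"
  shows "a k = 0"
proof -
  have "\<exists>q p. q \<in> Lp U \<and> q \<noteq> 0 \<and> (\<forall>k<n. p k \<in> Lp W \<and> a k * emb q = emb (p k))" for n
  proof (induction n)
    case 0
    then show ?case using Lp_1 by (intro exI[of _ 1]) auto
  next
    case (Suc n)
    then obtain q p where q: "q \<in> Lp U" "q \<noteq> 0" "\<And>k. k < n ==> p k \<in> Lp W \<and> a k * emb q = emb (p k)" by blast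
    obtain p' q' where pq: "p' \<in> Lp W" "q' \<in> Lp U" "q' \<noteq> 0" "a n = emb p' * inverse (emb q')"
      using a[of n] by (auto simp: Rn_def)
    have "a k * emb (q * q') = emb (if k < n then p k * q' else p' * q)" if "k < Suc n" for k
    proof (cases "k < n")
      case True
      then have "a k * emb (q * q') = (a k * emb q) * emb q'" by (simp add: emb_hom mult.assoc)
      then show ?thesis using q(3)[OF True] True by (simp add: emb_hom)
    next
      case False
      then have "k = n" using that by simp
      then show ?thesis using pq by (simp add: emb_hom)
    qed
    moreover have "(if k < n then p k * q' else p' * q) \<in> Lp W" for k
      using Lp_mult[of "p k" W q'] Lp_mult[OF pq(1) Lp_mono[OF UW q(1)]] q(3)[of k] Lp_mono[OF UW pq(2)] by simp
    moreover have "q * q' \<in> Lp U" "q * q' \<noteq> 0" using Lp_mult q pq by auto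
    ultimately show ?case
      by (intro exI[of _ "q * q'"] exI[of _ "\<lambda>k. if k < n then p k * q' else p' * q"]) blast
  qed
  then obtain q p where q: "q \<in> Lp U" "q \<noteq> 0" "\<And>k. k < n ==> p k \<in> Lp W \<and> a k * emb q = emb (p k)" by blast
  have "emb (\<Sum>k<n. p k * psingle (psingle v (int k)) 1)
     = (\<Sum>k<n. a k * emb q * lmon (psingle v 1) ^ k)"
    unfolding emb_sum by (rule sum.cong) (use q(3) in \<open>auto simp: emb_hom(6) single_nat_power simp flip: lmon_def\<close>)
  also have "\<dots> = emb q * (\<Sum>k<n. a k * lmon (psingle v 1) ^ k)"
    by (simp add: sum_distrib_left mult_ac)
  finally have 0: "(\<Sum>k<n. p k * psingle (psingle v (int k)) 1) = 0"
    using s by simp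
  have pW: "plookup (p j) \<mu> = 0" if "j < n" "plookup \<mu> v \<noteq> 0" for j \<mu>
  proof (rule ccontr)
    assume "plookup (p j) \<mu> \<noteq> 0"
    then have "pkeys \<mu> \<subseteq> W" using q(3)[OF that(1)] by (auto simp: Lp_def in_keys_iff)
    then show False using v that(2) by (auto simp: in_keys_iff)
  qed
  have "plookup (p k) \<mu> = 0" for \<mu>
  proof (cases "plookup \<mu> v = 0")
    case True
    have "0 = (\<Sum>j<n. plookup (p j) (\<mu> + psingle v (int k) - psingle v (int j)))"
      using arg_cong[OF 0, of "\<lambda>p. plookup p (\<mu> + psingle v (int k))"]
      by (simp add: lookup_sum lookup_shift)
    also have "\<dots> = (\<Sum>j<n. if j = k then plookup (p k) \<mu> else 0)"
      by (rule sum.cong) (use True in \<open>auto intro!: pW simp: lookup_add lookup_minus\<close>)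
    finally show ?thesis using k by simp
  qed (use pW k in blast)
  then have "p k = 0" by (intro poly_mapping_eqI) simp
  then show ?thesis using q(2) q(3)[OF k] by (simp add: emb_hom)
qed

context laurent_ring begin

lemma horner_sum:
  assumes c: "\<And>i. c i \<in> R"
  shows "horner c j k = (\<Sum>i<Suc j. c (k + i) * t ^ i) + t ^ Suc j"
proof (induction j arbitrary: k)
  case (Suc j)
  have tc: "t * c i = c i * t" for i using comm[OF t_C] c R_C by blast
  have "t * (\<Sum>i<Suc j. c (Suc k + i) * t ^ i) = (\<Sum>i<Suc j. c (k + Suc i) * t ^ Suc i)"
    unfolding sum_distrib_left by (rule sum.cong) (simp_all add: tc flip: mult.assoc)
  then have "horner c (Suc j) k = c k * t ^ 0 + (\<Sum>i<Suc j. c (k + Suc i) * t ^ Suc i) + t ^ Suc (Suc j)"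
    unfolding horner.simps Suc by (simp add: distrib_left del: sum.lessThan_Suc)
  then show ?case unfolding sum.lessThan_Suc_shift[of _ "Suc j"] by (simp del: sum.lessThan_Suc)
qed simp

end

lemma laurent_ring_Rn:
  assumes UV: "U \<subseteq> V" and v: "v \<in> V" "v \<notin> U"
  shows "laurent_ring sx sy (sc ` (Rn U V :: 'k::field om set)) (sc ` Rn U (V - {v}))
     (sc (lmon (psingle v 1))) (sc (lmon (psingle v (-1))))"
proof -
  let ?C = "Rn U V :: 'k om set" and ?R = "Rn U (V - {v}) :: 'k om set"
  let ?t = "lmon (psingle v 1) :: 'k om" and ?t' = "lmon (psingle v (-1)) :: 'k om"
  interpret c: coeff_ring sx sy "sc ` ?C" using coeff_ring_sc[OF Rn_subring[OF UV]] .
  have UR: "U \<subseteq> V - {v}" using UV v by blast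
  interpret r: coeff_ring sx sy "sc ` ?R" using coeff_ring_sc[OF Rn_subring[OF UR]] .
  have RC: "?R \<subseteq> ?C" using Rn_mono by blast
  have tt': "?t * ?t' = 1"
    unfolding mon_add[symmetric] single_add[symmetric] by simp
  have mC: "lmon m \<in> ?C" if "pkeys m \<subseteq> V" for m
    unfolding lmon_def using Rn_emb[OF Lp_single[OF that]] .
  show ?thesis
  proof
    fix a d :: "'k om rcf"
    show "a * d = d * a" if "a \<in> sc ` ?C" for a d :: "'k om rcf" using that sc_commute by auto
    show "sc ` ?R \<subseteq> sc ` ?C" using RC by blast
    show "sc ?t \<in> sc ` ?C" "sc ?t' \<in> sc ` ?C" using mC[of "psingle v 1"] mC[of "psingle v (-1)"] v
      by auto
    show "sc ?t * sc ?t' = 1" using tt' by (simp add: sc_hom flip: sc_hom(6))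
  next
    fix c assume "c \<in> sc ` ?C"
    then obtain d where d: "c = sc d" "d \<in> ?C" by blast
    obtain m n a where a: "\<And>k. a k \<in> ?R" "d = ?t' ^ m * (\<Sum>k<(n::nat). a k * ?t ^ k)"
      using Rn_expand[OF d(2)] by blast
    have "c = sc ?t' ^ m * (\<Sum>k<n. sc (a k) * sc ?t ^ k)"
      unfolding d(1) a(2) by (simp add: sc_hom sc_sum sc_power)
    moreover have "\<forall>k. sc (a k) \<in> sc ` ?R" using a(1) by blast
    ultimately show "\<exists>m n a. (\<forall>k. a k \<in> sc ` ?R) \<and> c = sc ?t' ^ m * (\<Sum>k<(n::nat). a k * sc ?t ^ k)"
      by (intro exI[of _ m] exI[of _ n] exI[of _ "\<lambda>k. sc (a k)"] conjI)
  next
    fix a :: "nat \<Rightarrow> 'k om rcf" and n k :: nat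
    assume a: "\<And>k. a k \<in> ru.Fin (sc ` ?R)" and s: "(\<Sum>k<n. a k * sc ?t ^ k) = 0" and k: "k < n"
    show "a k = 0"
    proof (rule rcf_eqI)
      fix i j
      have "ent (a k) i j \<in> ?R" for k using a[of k] Fin_iff[OF Rn_subring[OF UR]] by blast
      moreover have "(\<Sum>k<n. ent (a k) i j * ?t ^ k) = 0"
        using arg_cong[OF s, of "\<lambda>M. ent M i j"] by (simp add: ent_sum sc_power[symmetric] mult.commute)
      ultimately show "ent (a k) i j = ent 0 i j" using Rn_indep[OF _ UR _ _ k, of "\<lambda>k. ent (a k) i j" v] by simp
    qed
  qed (use r.C_0 r.C_1 r.C_add r.C_neg r.C_mult in auto)
qed

text \<open>Only finitely many elementary factors occur. Their denominators may involve v; the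
  product of these is f, while the part of a denominator in U alone could stay in the coefficient
  ring.\<close>

lemma El_common_denominator:
  assumes UV: "U \<subseteq> V" and v: "v \<in> V"
    and g: "g \<in> ru.El (sc ` (Rn (insert v U) V :: 'k::field om set))"
  shows "\<exists>f. f \<in> Lp (insert v U) \<and> f \<noteq> 0 \<and> g \<in> ru.El {c * sc (inverse (emb f)) | c. c \<in> sc ` (Rn U V :: 'k om set)}"
  using g
proof (induction g rule: ru.El.induct)
  case one
  then show ?case using ru.El.one Lp_1 by (intro exI[of _ 1]) auto
next
  case (step c k l g)
  let ?D = "\<lambda>f. {c * sc (inverse (emb f)) | c. c \<in> sc ` (Rn U V :: 'k om set)}"
  obtain f where f: "f \<in> Lp (insert v U)" "f \<noteq> 0" "g \<in> ru.El (?D f)" using step by blast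
  obtain p q where pq: "p \<in> Lp V" "q \<in> Lp (insert v U)" "q \<noteq> 0" "c = sc (emb p * inverse (emb q))"
    using step(1) by (auto simp: Rn_def)
  have sub: "insert v U \<subseteq> V" using UV v by blast
  have C: "subring (Rn U V :: 'k om set)" using Rn_subring[OF UV] .
  have "c = sc (emb (p * f)) * sc (inverse (emb (q * f)))"
    unfolding pq(4) using f(2) by (simp add: emb_hom flip: sc_hom(6))
  moreover have "emb (p * f) \<in> Rn U V" using Rn_emb[OF Lp_mult[OF pq(1) Lp_mono[OF sub f(1)]]] .
  ultimately have c: "c \<in> ?D (q * f)" by blast
  have "?D f \<subseteq> ?D (q * f)"
  proof
    fix d assume "d \<in> ?D f"
    then obtain e where e: "e \<in> Rn U V" "d = sc e * sc (inverse (emb f))" by blast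
    have "d = sc (e * emb q) * sc (inverse (emb (q * f)))"
      unfolding e(2) using pq(3) by (simp add: emb_hom flip: sc_hom(6))
    moreover have "e * emb q \<in> Rn U V" using subringD(5)[OF C e(1) Rn_emb[OF Lp_mono[OF sub pq(2)]]] .
    ultimately show "d \<in> ?D (q * f)" by blast
  qed
  then have "g \<in> ru.El (?D (q * f))" using ru.El_mono f(3) by blast
  then have "(1 + c * rc.mx k l) * g \<in> ru.El (?D (q * f))" using ru.El.step[OF c step(2)] by blast
  then show ?case using Lp_mult[OF pq(2) f(1)] pq(3) f(2) by (intro exI[of _ "q * f"]) auto
qed

text \<open>Split off the lowest power of t and the leading coefficient, both units since nonzero
  elements of \<open>Rn U U\<close> are invertible. What remains is monic, as the companion matrix
  requires, with a nonzero constant term, as the invertibility of its endomorphism requires.\<close>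

lemma monic_normal_form:
  assumes f: "f \<in> Rn U (insert v U)" "f \<noteq> (0 :: 'k::field om)" and v: "v \<notin> U"
  shows "\<exists>u u' d c. u \<in> Rn U (insert v U) \<and> u' \<in> Rn U (insert v U) \<and> u * u' = 1
     \<and> (\<forall>i. c i \<in> Rn U U) \<and> (d > 0 \<longrightarrow> c 0 \<noteq> 0)
     \<and> f = u * ((\<Sum>i<d. c i * lmon (psingle v 1) ^ i) + lmon (psingle v 1) ^ (d::nat))"
proof -
  let ?t = "lmon (psingle v 1) :: 'k om" and ?t' = "lmon (psingle v (-1)) :: 'k om"
  have V: "insert v U - {v} = U" using v by blast
  obtain m n a where a: "\<And>k. a k \<in> Rn U U" "f = ?t' ^ m * (\<Sum>k<(n::nat). a k * ?t ^ k)"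
    using Rn_expand[OF f(1), of v] unfolding V by blast
  define K where "K = {k. k < n \<and> a k \<noteq> 0}"
  have K: "finite K" "K \<noteq> {}"
  proof -
    show "finite K" by (simp add: K_def)
    show "K \<noteq> {}"
    proof
      assume "K = {}"
      then have "(\<Sum>k<n. a k * ?t ^ k) = 0" by (intro sum.neutral) (auto simp: K_def)
      then show False using f a by simp
    qed
  qed
  define lo hi where "lo = Min K" and "hi = Max K"
  have lohi: "lo \<in> K" "hi \<in> K" "lo \<le> hi" using K by (auto simp: lo_def hi_def)
  have out: "a k = 0" if "k < n" "k < lo \<or> hi < k" for k
  proof (rule ccontr)
    assume "a k \<noteq> 0"
    then have "k \<in> K" using that by (simp add: K_def)
    then show False using that K by (auto simp: lo_def hi_def dest: Min_le Max_ge)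
  qed
  define d where "d = hi - lo"
  have "(\<Sum>k<n. a k * ?t ^ k) = (\<Sum>k\<in>{lo..<Suc hi}. a k * ?t ^ k)"
    by (rule sum.mono_neutral_right) (use lohi out in \<open>auto simp: K_def\<close>)
  also have "\<dots> = (\<Sum>i<Suc d. a (lo + i) * ?t ^ (lo + i))"
    by (rule sum.reindex_bij_witness[of _ "\<lambda>i. lo + i" "\<lambda>k. k - lo"]) (use lohi in \<open>auto simp: d_def\<close>)
  finally have s: "(\<Sum>k<n. a k * ?t ^ k) = (\<Sum>i<Suc d. a (lo + i) * ?t ^ (lo + i))" .
  have h: "a hi \<noteq> 0" "lo + d = hi" "a lo \<noteq> 0" using lohi by (auto simp: K_def d_def)
  define u where "u = ?t' ^ m * ?t ^ lo * a hi"
  define u' where "u' = ?t ^ m * ?t' ^ lo * inverse (a hi)"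
  define c where "c = (\<lambda>i. a (lo + i) * inverse (a hi))"
  have tt: "?t * ?t' = 1" unfolding mon_add[symmetric] single_add[symmetric] by simp
  have "f = u * ((\<Sum>i<d. c i * ?t ^ i) + ?t ^ d)"
  proof -
    have "u * (\<Sum>i<d. c i * ?t ^ i) = ?t' ^ m * (\<Sum>i<d. a (lo + i) * ?t ^ (lo + i))"
      unfolding u_def c_def sum_distrib_left by (rule sum.cong) (use h in \<open>simp_all add: power_add field_simps\<close>)
    moreover have "u * ?t ^ d = ?t' ^ m * (a (lo + d) * ?t ^ (lo + d))"
    proof -
      have "?t ^ hi = ?t ^ lo * ?t ^ d" by (simp add: power_add flip: h(2))
      then show ?thesis unfolding u_def h(2) by (simp add: mult_ac)
    qed
    ultimately show ?thesis unfolding a(2) s by (simp add: distrib_left)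
  qed
  moreover have "u * u' = 1"
  proof -
    have "u * u' = (?t * ?t') ^ m * (?t * ?t') ^ lo" using h by (simp add: u_def u'_def power_mult_distrib)
    then show ?thesis unfolding tt by simp
  qed
  moreover have Cs: "subring (Rn U (insert v U) :: 'k om set)" by (rule Rn_subring) blast
  have tC: "?t \<in> Rn U (insert v U)" "?t' \<in> Rn U (insert v U)"
    unfolding lmon_def by (intro Rn_emb Lp_single; simp)+
  have pw: "w ^ k \<in> Rn U (insert v U)" if "w \<in> Rn U (insert v U)" for w :: "'k om" and k
    by (induction k) (use that subringD[OF Cs] in auto)
  have sub: "x \<in> Rn U (insert v U)" if "x \<in> Rn U U" for x :: "'k om" using that Rn_mono[of U U U "insert v U"] by blast
  have "u \<in> Rn U (insert v U)" "u' \<in> Rn U (insert v U)"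
    unfolding u_def u'_def by (intro subringD(5)[OF Cs] pw tC sub a Rn_field)+
  moreover have "\<forall>i. c i \<in> Rn U U" unfolding c_def
    using subringD(5)[OF Rn_subring[OF order_refl] a(1) Rn_field[OF a(1)]] by blast
  moreover have "d > 0 \<longrightarrow> c 0 \<noteq> 0" unfolding c_def using h by simp
  ultimately show ?thesis by blast
qed

text \<open>The common denominator f is a unit times a monic h, so only 1/h has to be removed. In
  degree 0 nothing is left to remove; otherwise h has a symbol and \<open>El_localization\<close>
  applies.\<close>

lemma SK1_step:
  assumes UV: "U \<subseteq> V" and v: "v \<in> V" "v \<notin> U"
    and g: "g \<in> ru.El (sc ` (Rn (insert v U) V :: 'k::field om set))"
      "g \<in> coeff_ring.GL sx sy (sc ` Rn U V) (sc ` Rn U V)"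
  shows "g \<in> ru.El (sc ` Rn U V)"
proof -
  let ?t = "lmon (psingle v 1) :: 'k om" and ?t' = "lmon (psingle v (-1)) :: 'k om"
  let ?C = "Rn U V :: 'k om set" and ?R = "Rn U (V - {v}) :: 'k om set"
  interpret l: laurent_ring sx sy "sc ` ?C" "sc ` ?R" "sc ?t" "sc ?t'"
    using laurent_ring_Rn[OF UV v] .
  obtain f where f: "f \<in> Lp (insert v U)" "f \<noteq> 0" "g \<in> ru.El {c * sc (inverse (emb f)) | c. c \<in> sc ` ?C}"
    using El_common_denominator[OF UV v(1) g(1)] by blast
  have f0: "emb f \<noteq> 0" using f(2) by simp
  obtain u u' d c where u: "u \<in> Rn U (insert v U)" "u' \<in> Rn U (insert v U)" "u * u' = (1 :: 'k om)"
     "\<And>i. c i \<in> Rn U U" "d > 0 \<longrightarrow> c 0 \<noteq> 0" "emb f = u * ((\<Sum>i<d. c i * ?t ^ i) + ?t ^ (d::nat))"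
    using monic_normal_form[OF Rn_emb[OF f(1)] f0 v(2)] by blast
  have sub: "Rn U (insert v U) \<subseteq> ?C" "Rn U U \<subseteq> ?R"
    using Rn_mono[of U U "insert v U" V] Rn_mono[of U U U "V - {v}"] UV v by auto
  have C: "subring ?C" using Rn_subring[OF UV] .
  define h where "h = (\<Sum>i<d. c i * ?t ^ i) + ?t ^ d"
  have h0: "h \<noteq> 0" using f(2) u(6) by (auto simp: h_def)
  have "{c * sc (inverse (emb f)) | c. c \<in> sc ` ?C} \<subseteq> {c * sc (inverse h) | c. c \<in> sc ` ?C}"
  proof
    fix x assume "x \<in> {c * sc (inverse (emb f)) | c. c \<in> sc ` ?C}"
    then obtain e where e: "e \<in> ?C" "x = sc e * sc (inverse (emb f))" by blast
    have "inverse u = u'" using u(3) by (rule inverse_unique)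
    then have "x = sc (e * u') * sc (inverse h)"
      unfolding e(2) u(6) h_def[symmetric] by (simp add: mult_ac flip: sc_hom(6))
    moreover have "e * u' \<in> ?C" using subringD(5)[OF C e(1)] u(2) sub by blast
    ultimately show "x \<in> {c * sc (inverse h) | c. c \<in> sc ` ?C}" by blast
  qed
  then have g': "g \<in> ru.El {c * sc (inverse h) | c. c \<in> sc ` ?C}" using ru.El_mono f(3) by blast
  show ?thesis
  proof (cases d)
    case 0
    then have "h = 1" by (simp add: h_def)
    then show ?thesis using g' by (simp add: sc_hom)
  next
    case (Suc j)
    let ?c = "\<lambda>i. sc (c i)"
    have cR: "?c i \<in> sc ` ?R" for i using u(4) sub by blast
    have hor: "sc h = l.horner ?c j 0"
      unfolding l.horner_sum[of ?c, OF cR] h_def Suc by (simp add: sc_hom sc_sum sc_power)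
    have c0: "sc (inverse (c 0)) \<in> sc ` ?R" "?c 0 * sc (inverse (c 0)) = 1"
      using Rn_field[OF u(4)] sub u(5) Suc by (auto simp: sc_hom simp flip: sc_hom(6))
    show ?thesis
    proof (rule l.El_localization[of "sc h" "sc (inverse h)", OF _ _ _ _ _ g' g(2)])
      show "sc h \<in> sc ` ?C" unfolding hor by (rule l.horner_C) (rule cR)
      show "\<exists>k. l.sym (1 + (sc h - 1) * rc.mx 0 0) k"
        unfolding hor by (rule l.sym_companion[of ?c, OF cR c0])
      show "sc h * sc (inverse h) = 1" "sc (inverse h) * sc h = 1"
        using h0 by (simp_all add: sc_hom flip: sc_hom(6))
    qed (simp add: sc_commute)
  qed
qed

text \<open>Induction on the number of variables that are not allowed in denominators, beginning
  with the fraction field; each step disallows one more variable.\<close>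

lemma SK1_Rn:
  assumes "finite V" "U \<subseteq> V"
    and u: "u \<in> coeff_ring.GL sx sy (sc ` Rn U V) (sc ` (Rn U V :: 'k::field om set))" "dt u = 1"
  shows "u \<in> ru.El (sc ` Rn U V)"
  using assms(2) u
proof (induction "card (V - U)" arbitrary: U u)
  case 0
  then have "U = V" using assms(1) by (metis card_0_eq Diff_eq_empty_iff finite_Diff subset_antisym)
  then show ?case using SK1_field[OF Rn_subring[OF order_refl] Rn_field] 0 by blast
next
  case (Suc n)
  obtain v where v: "v \<in> V" "v \<notin> U"
    using Suc.hyps(2) by (metis DiffE all_not_in_conv card.empty nat.distinct(1))
  have "n = card (V - insert v U)"
  proof -
    have "V - insert v U = (V - U) - {v}" by blast
    then show ?thesis using Suc.hyps(2) v assms(1) by simp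
  qed
  moreover have sub: "insert v U \<subseteq> V" using v Suc.prems by blast
  moreover have "u \<in> coeff_ring.GL sx sy (sc ` Rn (insert v U) V) (sc ` Rn (insert v U) V)"
  proof -
    interpret c: coeff_ring sx sy "sc ` (Rn U V :: 'k om set)" using coeff_ring_sc[OF Rn_subring[OF Suc.prems(1)]] .
    interpret d: coeff_ring sx sy "sc ` (Rn (insert v U) V :: 'k om set)" using coeff_ring_sc[OF Rn_subring[OF sub]] .
    have "sc ` (Rn U V :: 'k om set) \<subseteq> sc ` Rn (insert v U) V" using Rn_mono[of U "insert v U" V V] by blast
    then show ?thesis using Suc.prems(2) ru.Fin_mono by (auto simp: c.GL_def d.GL_def)
  qed
  ultimately have "u \<in> ru.El (sc ` Rn (insert v U) V)" using Suc.hyps(1) Suc.prems(3) by blast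
  then show ?case using SK1_step[OF Suc.prems(1) v _ Suc.prems(2)] by blast
qed

section \<open>Representations of the Jacobson algebra\<close>

text \<open>For a finite set J of variables, x_i and y_i with i in J act as shifts on the multi-indices
  supported on J, while x_i with i outside J is sent to an invertible scalar.\<close>

definition ea :: "bmono \<Rightarrow> nat \<Rightarrow> nat" where "ea m i = fst (Rep_bmono m i)"
definition eb :: "bmono \<Rightarrow> nat \<Rightarrow> nat" where "eb m i = snd (Rep_bmono m i)"

lemma ea_add: "ea (m + m') i = ea m i + (ea m' i - eb m i)"
  and eb_add: "eb (m + m') i = (eb m i - ea m' i) + eb m' i"
  by (simp_all add: ea_def eb_def plus_bmono.rep_eq bic_def)

lemma e_zero [simp]: "ea 0 i = 0" "eb 0 i = 0"
  by (simp_all add: ea_def eb_def zero_bmono.rep_eq)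

lemma e_mono_at: "ea (mono_at i p) j = (if j = i then fst p else 0)"
  "eb (mono_at i p) j = (if j = i then snd p else 0)"
  by (simp_all add: ea_def eb_def mono_at.rep_eq)

lemma bmono_eqI: "(\<And>i. ea m i = ea m' i) ==> (\<And>i. eb m i = eb m' i) ==> m = m'"
  by (simp add: ea_def eb_def Rep_bmono_inject[symmetric] fun_eq_iff prod_eq_iff)

lemma finite_e: "finite {i. ea m i \<noteq> 0 \<or> eb m i \<noteq> 0}"
proof -
  have "{i. ea m i \<noteq> 0 \<or> eb m i \<noteq> 0} \<subseteq> {i. Rep_bmono m i \<noteq> (0,0)}"
    by (auto simp: ea_def eb_def)
  moreover have "finite {i. Rep_bmono m i \<noteq> (0,0)}" using Rep_bmono[of m] by simp
  ultimately show ?thesis by (rule finite_subset)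
qed

definition ex :: "nat set \<Rightarrow> bmono \<Rightarrow> (nat \<Rightarrow>\<^sub>0 int)" where
  "ex J m = Abs_poly_mapping (\<lambda>i. if i \<in> J then 0 else int (ea m i) - int (eb m i))"

lemma lookup_ex: "plookup (ex J m) i = (if i \<in> J then 0 else int (ea m i) - int (eb m i))"
proof -
  have "finite {i. (if i \<in> J then 0 else int (ea m i) - int (eb m i)) \<noteq> 0}"
    by (rule finite_subset[OF _ finite_e[of m]]) (auto split: if_splits)
  then show ?thesis by (simp add: ex_def)
qed

lemma ex_add: "ex J (m + m') = ex J m + ex J m'"
proof (rule poly_mapping_eqI)
  have "int (a - b) - int (b - a) = int a - int b" for a b :: nat by (cases "a \<le> b") simp_all
  then show "plookup (ex J (m + m')) i = plookup (ex J m + ex J m') i" for i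
    by (simp add: lookup_ex lookup_add ea_add eb_add)
qed

lemma ex_zero [simp]: "ex J 0 = 0"
  by (rule poly_mapping_eqI) (simp add: lookup_ex)

definition Ix :: "nat set \<Rightarrow> (nat \<Rightarrow> nat) set" where
  "Ix J = {s. \<forall>i. i \<notin> J \<longrightarrow> s i = 0}"

text \<open>A nonempty J makes the set of multi-indices infinite, so that its numbering is a
  bijection with all natural numbers.\<close>

definition idx :: "nat set \<Rightarrow> bool" where
  "idx J \<longleftrightarrow> finite J \<and> J \<noteq> {}"

text \<open>Multi-indices are numbered so that all representations, whatever J is, take values in
  the same type of matrices over the natural numbers.\<close>

definition dec :: "nat set \<Rightarrow> nat \<Rightarrow> nat \<Rightarrow> nat" where
  "dec J = from_nat_into (Ix J)"

definition enc :: "nat set \<Rightarrow> (nat \<Rightarrow> nat) \<Rightarrow> nat" where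
  "enc J = to_nat_on (Ix J)"

lemma Ix_countable: assumes "finite J" shows "countable (Ix J)"
proof -
  have "inj_on (\<lambda>s. map s (sorted_list_of_set J)) (Ix J)"
  proof (rule inj_onI, rule ext)
    fix s t i assume a: "s \<in> Ix J" "t \<in> Ix J" "map s (sorted_list_of_set J) = map t (sorted_list_of_set J)"
    show "s i = t i" using a assms by (cases "i \<in> J") (auto simp: Ix_def)
  qed
  then show ?thesis by (rule countableI')
qed

lemma Ix_infinite: assumes "J \<noteq> {}" shows "infinite (Ix J)"
proof -
  obtain i where i: "i \<in> J" using assms by blast
  have "inj (\<lambda>n::nat. (\<lambda>j. if j = i then n else 0))"
    by (rule injI) (metis (full_types))
  moreover have "range (\<lambda>n::nat. (\<lambda>j. if j = i then n else 0)) \<subseteq> Ix J" using i by (auto simp: Ix_def)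
  ultimately show ?thesis using infinite_super range_inj_infinite by blast
qed

lemma dec_Ix: assumes "idx J" shows "dec J p \<in> Ix J"
  using from_nat_into[of "Ix J" p] Ix_infinite assms unfolding dec_def idx_def by (metis finite.emptyI)

lemma dec_enc: assumes "idx J" "s \<in> Ix J" shows "dec J (enc J s) = s"
  unfolding dec_def enc_def using assms Ix_countable by (simp add: idx_def)

lemma enc_dec: assumes "idx J" shows "enc J (dec J p) = p"
  unfolding dec_def enc_def using assms Ix_countable Ix_infinite
  by (simp add: idx_def to_nat_on_from_nat_into_infinite)

lemma dec_inj: assumes "idx J" "\<And>i. i \<in> J ==> dec J p i = dec J q i" shows "p = q"
proof -
  have "dec J p = dec J q"
  proof
    fix i show "dec J p i = dec J q i"
      using assms(2)[of i] dec_Ix[OF assms(1), of p] dec_Ix[OF assms(1), of q] by (cases "i \<in> J") (auto simp: Ix_def)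
  qed
  then show ?thesis using enc_dec[OF assms(1)] by metis
qed

text \<open>The monomial m sends the basis vector t to the basis vector s: in each direction of J
  the y-part lowers the index, or kills the vector if the index is too small, and the x-part raises
  it.\<close>

definition cond :: "nat set \<Rightarrow> bmono \<Rightarrow> (nat \<Rightarrow> nat) \<Rightarrow> (nat \<Rightarrow> nat) \<Rightarrow> bool" where
  "cond J m s t \<longleftrightarrow> (\<forall>i\<in>J. eb m i \<le> t i \<and> s i = t i - eb m i + ea m i)"

lemma rmon_finite:
  assumes "idx J"
  shows "finite {q. cond J m (dec J p) (dec J q)}" "finite {p. cond J m (dec J p) (dec J q)}"
proof -
  have "q = q'" if "cond J m (dec J p) (dec J q)" "cond J m (dec J p) (dec J q')" for q q'
    by (rule dec_inj[OF assms]) (use that in \<open>force simp: cond_def\<close>)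
  then show "finite {q. cond J m (dec J p) (dec J q)}"
    by (metis (mono_tags, lifting) finite_subset finite.emptyI finite_insert mem_Collect_eq subsetI insertCI)
  have "p = p'" if "cond J m (dec J p) (dec J q)" "cond J m (dec J p') (dec J q)" for p p'
    by (rule dec_inj[OF assms]) (use that in \<open>force simp: cond_def\<close>)
  then show "finite {p. cond J m (dec J p) (dec J q)}"
    by (metis (mono_tags, lifting) finite_subset finite.emptyI finite_insert mem_Collect_eq subsetI insertCI)
qed

definition rmon :: "nat set \<Rightarrow> bmono \<Rightarrow> 'k::field om rcf" where
  "rmon J m = Rcf (\<lambda>p q. if cond J m (dec J p) (dec J q) then lmon (ex J m) else 0)"

lemma ent_rmon:
  assumes "idx J"
  shows "ent (rmon J m) p q = (if cond J m (dec J p) (dec J q) then lmon (ex J m) else (0 :: 'k::field om))"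
proof -
  have "finite {q. (if cond J m (dec J p) (dec J q) then lmon (ex J m) else (0 :: 'k om)) \<noteq> 0}" for p
    by (rule finite_subset[OF _ rmon_finite(1)[OF assms, of m p]]) auto
  moreover have "finite {p. (if cond J m (dec J p) (dec J q) then lmon (ex J m) else (0 :: 'k om)) \<noteq> 0}" for q
    by (rule finite_subset[OF _ rmon_finite(2)[OF assms, of m q]]) auto
  ultimately show ?thesis unfolding rmon_def by (subst Rcf_inverse) auto
qed

lemma rmon_zero: "idx J ==> rmon J 0 = 1"
proof (rule rcf_eqI)
  fix p q assume J: "idx J"
  have "cond J 0 (dec J p) (dec J q) \<longleftrightarrow> p = q" using dec_inj[OF J, of p q] by (auto simp: cond_def)
  then show "ent (rmon J 0) p q = ent 1 p q" by (simp add: ent_rmon[OF J])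
qed

lemma rmon_add: assumes J: "idx J" shows "rmon J (m + m') = rmon J m * (rmon J m' :: 'k::field om rcf)"
proof (rule rcf_eqI)
  fix p q
  \<comment> \<open>w is the only index to which m' can send the basis vector numbered q, so the sum
    over intermediate indices has one term.\<close>
  define w where "w = (\<lambda>i. if i \<in> J then dec J q i - eb m' i + ea m' i else 0)"
  define r where "r = enc J w"
  have w: "w \<in> Ix J" "dec J r = w" using dec_enc[OF J] by (auto simp: w_def r_def Ix_def)
  have c': "cond J m' (dec J r') (dec J q) \<longleftrightarrow> (\<forall>i\<in>J. eb m' i \<le> dec J q i) \<and> r' = r" for r'
  proof -
    have "(\<forall>i\<in>J. dec J r' i = dec J q i - eb m' i + ea m' i) \<longleftrightarrow> r' = r"
      using dec_inj[OF J, of r' r] w by (auto simp: w_def)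
    then show ?thesis by (auto simp: cond_def)
  qed
  have c: "cond J (m + m') (dec J p) (dec J q) \<longleftrightarrow> (\<forall>i\<in>J. eb m' i \<le> dec J q i) \<and> cond J m (dec J p) w"
  proof -
    have "(eb (m + m') i \<le> t \<and> s = t - eb (m + m') i + ea (m + m') i) \<longleftrightarrow>
       eb m' i \<le> t \<and> eb m i \<le> t - eb m' i + ea m' i \<and> s = t - eb m' i + ea m' i - eb m i + ea m i" for i s t
      by (auto simp: ea_add eb_add)
    then show ?thesis unfolding cond_def w_def by auto
  qed
  define K where "K = insert r {r'. ent (rmon J m :: 'k om rcf) p r' \<noteq> 0}"
  have "ent (rmon J m * rmon J m') p q = (\<Sum>r'\<in>K. ent (rmon J m) p r' * ent (rmon J m' :: 'k om rcf) r' q)"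
    by (rule ent_mult) (auto simp: K_def)
  also have "\<dots> = (\<Sum>r'\<in>{r}. ent (rmon J m) p r' * ent (rmon J m') r' q)"
  proof (rule sum.mono_neutral_right)
    show "finite K" unfolding K_def by simp
  qed (auto simp: K_def ent_rmon[OF J] c')
  also have "\<dots> = ent (rmon J (m + m')) p q"
    using c'[of r] unfolding w(2) by (auto simp: ent_rmon[OF J] c w(2) ex_add mon_add)
  finally show "ent (rmon J (m + m')) p q = ent (rmon J m * (rmon J m' :: 'k om rcf)) p q" by simp
qed

definition embk :: "'k::field \<Rightarrow> 'k om" where "embk c = emb (psingle 0 c)"

lemma embk_hom: "embk 0 = 0" "embk 1 = 1" "embk (c + d) = embk c + embk d" "embk (c * d) = embk c * embk d"
  by (simp_all add: embk_def emb_hom single_add flip: emb_hom(6))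
    (simp add: mult_single)

definition rho :: "nat set \<Rightarrow> 'k::field jac \<Rightarrow> 'k om rcf" where
  "rho J u = (\<Sum>m\<in>pkeys u. sc (embk (plookup u m)) * rmon J m)"

lemma rho_single: "rho J (psingle m c) = sc (embk c) * rmon J m"
  by (simp add: rho_def embk_hom sc_hom)

lemma rho_add: "rho J (u + v) = rho J u + rho J v"
  unfolding rho_def
  by (rule setsum_keys_plus_distrib) (simp_all add: embk_hom sc_hom distrib_right)

lemma rho_zero [simp]: "rho J 0 = 0" by (simp add: rho_def)

lemma rho_neg: "rho J (- u) = - rho J u"
  using rho_add[of J "- u" u] by (simp add: eq_neg_iff_add_eq_0)

lemma rho_diff: "rho J (u - v) = rho J u - rho J v"
  using rho_add[of J u "- v"] rho_neg[of J v] by simp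

lemma rho_sum: "rho J (sum f I) = (\<Sum>i\<in>I. rho J (f i))"
  by (induction I rule: infinite_finite_induct) (simp_all add: rho_add)

lemma rho_one [simp]: "idx J ==> rho J 1 = 1"
  using rho_single[of J 0 1] by (simp add: rmon_zero embk_hom sc_hom)

lemma rho_mult: fixes u v :: "'a::field jac" assumes J: "idx J" shows "rho J (u * v) = rho J u * rho J v"
proof -
  define f where "f = (\<lambda>w m. psingle m (plookup w m) :: 'a jac)"
  have s: "w = (\<Sum>m\<in>pkeys w. f w m)" for w :: "'a jac"
    unfolding f_def using poly_mapping_sum .
  have 1: "rho J (f u m * f v m') = rho J (f u m) * rho J (f v m')" for m m'
  proof -
    have "sc (embk c) * rmon J m * (sc (embk d) * rmon J m') = sc (embk c) * sc (embk d) * (rmon J m * rmon J m')" for c d :: 'a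
    proof -
      have "sc (embk c) * rmon J m * (sc (embk d) * rmon J m') = sc (embk c) * (rmon J m * sc (embk d)) * rmon J m'"
        by (simp only: mult.assoc)
      then show ?thesis unfolding sc_commute[of "embk d" "rmon J m", symmetric] by (simp only: mult.assoc)
    qed
    then show ?thesis unfolding f_def mult_single rho_single rmon_add[OF J] embk_hom sc_hom by simp
  qed
  have "rho J (u * v) = rho J (\<Sum>m\<in>pkeys u. \<Sum>m'\<in>pkeys v. f u m * f v m')"
    using s[of u] s[of v] sum_product[of "f u" "pkeys u" "f v" "pkeys v"] by simp
  also have "\<dots> = (\<Sum>m\<in>pkeys u. \<Sum>m'\<in>pkeys v. rho J (f u m) * rho J (f v m'))"
    by (simp add: rho_sum 1)
  also have "\<dots> = rho J u * rho J v"
    using rho_sum[of J "f u" "pkeys u"] rho_sum[of J "f v" "pkeys v"] s[of u] s[of v]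
    by (simp add: sum_product)
  finally show ?thesis .
qed

text \<open>The matrix entry as a Laurent polynomial, before it is embedded into the fraction field,
  and indexed by multi-indices instead of their numbers.\<close>

definition entL :: "nat set \<Rightarrow> 'k::field jac \<Rightarrow> (nat \<Rightarrow> nat) \<Rightarrow> (nat \<Rightarrow> nat) \<Rightarrow> 'k lp" where
  "entL J u s t = (\<Sum>m\<in>pkeys u. if cond J m s t then psingle (ex J m) (plookup u m) else 0)"

lemma ent_rho: assumes "idx J" shows "ent (rho J u) p q = emb (entL J u (dec J p) (dec J q))"
proof -
  have "embk c * lmon e = emb (psingle e c)" for c :: 'a and e
    by (simp add: embk_def lmon_def mult_single flip: emb_hom(6))
  then show ?thesis unfolding rho_def entL_def ent_sum emb_sum
    by (intro sum.cong) (auto simp: ent_rmon[OF assms] emb_hom)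
qed

lemma rho_zero_iff:
  assumes "idx J"
  shows "rho J u = 0 \<longleftrightarrow> (\<forall>s\<in>Ix J. \<forall>t\<in>Ix J. entL J u s t = 0)"
proof
  assume a: "rho J u = 0"
  show "\<forall>s\<in>Ix J. \<forall>t\<in>Ix J. entL J u s t = 0"
  proof (intro ballI)
    fix s t assume "s \<in> Ix J" "t \<in> Ix J"
    then have "emb (entL J u s t) = ent (rho J u) (enc J s) (enc J t)"
      using ent_rho[OF assms, of u "enc J s" "enc J t"] dec_enc[OF assms] by simp
    then show "entL J u s t = 0" using a by simp
  qed
next
  assume "\<forall>s\<in>Ix J. \<forall>t\<in>Ix J. entL J u s t = 0"
  then show "rho J u = 0" using dec_Ix[OF assms] by (intro rcf_eqI) (simp add: ent_rho[OF assms] emb_hom)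
qed

text \<open>A membership test by monomials, for any set of variables. It agrees with the subalgebra
  generated by the x and y (\<open>Salg_eq\<close>) and makes commutation of elements with disjoint
  variables immediate.\<close>

definition Sn :: "nat set \<Rightarrow> 'k::field jac set" where
  "Sn V = {u. \<forall>m\<in>pkeys u. \<forall>i. i \<notin> V \<longrightarrow> ea m i = 0 \<and> eb m i = 0}"

lemma Sn_add: "u \<in> Sn V ==> v \<in> Sn V ==> u + v \<in> Sn V"
  by (auto simp: Sn_def dest!: subsetD[OF keys_add])

lemma Sn_mult: assumes "u \<in> Sn V" "v \<in> Sn V" shows "u * v \<in> Sn V"
  unfolding Sn_def
proof (intro CollectI ballI allI impI)
  fix m i assume m: "m \<in> pkeys (u * v)" "i \<notin> V"
  then obtain a b where "m = a + b" "a \<in> pkeys u" "b \<in> pkeys v"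
    using keys_mult by blast
  then show "ea m i = 0 \<and> eb m i = 0" using assms m(2) by (auto simp: Sn_def ea_add eb_add)
qed

lemma Sn_neg: "u \<in> Sn V ==> - u \<in> Sn V" by (simp add: Sn_def in_keys_iff)

lemma Sn_diff: "u \<in> Sn V ==> v \<in> Sn V ==> u - v \<in> Sn V"
  using Sn_add[OF _ Sn_neg] by fastforce

lemma Sn_scal: "scal c \<in> Sn V" by (auto simp: Sn_def scal_def)

lemma Sn_0: "0 \<in> Sn V" and Sn_1: "1 \<in> Sn V" by (auto simp: Sn_def)

lemma Sn_XY: "i \<in> V ==> X i \<in> Sn V" "i \<in> V ==> Y i \<in> Sn V"
  by (auto simp: Sn_def X_def Y_def e_mono_at)

lemma Sn_mono: "V \<subseteq> W ==> u \<in> Sn V ==> u \<in> Sn W" by (auto simp: Sn_def)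

lemma Sn_pow: "u \<in> Sn V ==> u ^ k \<in> Sn V" by (induction k) (auto intro: Sn_1 Sn_mult)

lemma Sn_sum: "(\<And>i. i \<in> I ==> f i \<in> Sn V) ==> sum f I \<in> Sn V"
  by (induction I rule: infinite_finite_induct) (auto intro: Sn_0 Sn_add)

lemma Sn_prod_list: "(\<And>i. i \<in> set xs ==> f i \<in> Sn V) ==> prod_list (map f xs) \<in> Sn V"
  by (induction xs) (auto intro: Sn_1 Sn_mult)

lemma X_pow: "X i ^ k = psingle (mono_at i (k, 0)) 1"
  and Y_pow: "Y i ^ k = psingle (mono_at i (0, k)) 1"
proof -
  have m0: "mono_at i (0,0) = 0" by (rule bmono_eqI) (simp_all add: e_mono_at)
  have x: "mono_at i (1,0) + mono_at i (k,0) = mono_at i (Suc k,0)" for k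
    by (rule bmono_eqI) (simp_all add: e_mono_at ea_add eb_add)
  have y: "mono_at i (0,1) + mono_at i (0,k) = mono_at i (0,Suc k)" for k
    by (rule bmono_eqI) (simp_all add: e_mono_at ea_add eb_add)
  show "X i ^ k = psingle (mono_at i (k, 0)) 1"
    by (induction k) (simp_all add: m0 X_def mult_single x[unfolded One_nat_def])
  show "Y i ^ k = psingle (mono_at i (0, k)) 1"
    by (induction k) (simp_all add: m0 Y_def mult_single y[unfolded One_nat_def])
qed

lemma Salg_eq: "Salg n = (Sn {1..n} :: 'k::field jac set)"
proof
  show "Salg n \<subseteq> (Sn {1..n} :: 'k jac set)"
  proof
    fix u :: "'k jac" assume "u \<in> Salg n"
    then show "u \<in> Sn {1..n}" unfolding Salg_def
      by (induction u rule: subalg.induct) (auto intro: Sn_XY Sn_scal Sn_add Sn_mult)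
  qed
  let ?A = "Salg n :: 'k jac set"
  have add: "u + v \<in> ?A" if "u \<in> ?A" "v \<in> ?A" for u v using that unfolding Salg_def by (rule subalg.add)
  have mult: "u * v \<in> ?A" if "u \<in> ?A" "v \<in> ?A" for u v using that unfolding Salg_def by (rule subalg.mult)
  have sc: "scal c \<in> ?A" for c unfolding Salg_def by (rule subalg.scal)
  have one: "1 \<in> ?A" using sc[of 1] by (simp add: scal_def)
  have pow: "u ^ k \<in> ?A" if "u \<in> ?A" for u k using that one mult by (induction k) auto
  have XY: "X i \<in> ?A" "Y i \<in> ?A" if "i \<in> {1..n}" for i
    using that unfolding Salg_def by (auto intro: subalg.gen)
  have mono: "psingle m 1 \<in> ?A" if "\<And>i. i \<notin> {1..n} ==> ea m i = 0 \<and> eb m i = 0" for m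
  proof -
    have "finite V ==> V \<subseteq> {1..n} ==> (\<And>i. i \<notin> V ==> ea m i = 0 \<and> eb m i = 0) ==> psingle m 1 \<in> ?A" for V m
    proof (induction V arbitrary: m rule: finite_induct)
      case empty
      then have "m = 0" by (intro bmono_eqI) auto
      then show ?case using one by simp
    next
      case (insert j V)
      define m' where "m' = Abs_bmono (\<lambda>i. if i = j then (0,0) else Rep_bmono m i)"
      have "finite {i. (if i = j then (0,0) else Rep_bmono m i) \<noteq> (0,0)}"
        by (rule finite_subset[of _ "{i. Rep_bmono m i \<noteq> (0,0)}"]) (use Rep_bmono[of m] in auto)
      then have R: "Rep_bmono m' i = (if i = j then (0,0) else Rep_bmono m i)" for i
        unfolding m'_def by (subst Abs_bmono_inverse) auto
      then have e: "ea m' i = (if i = j then 0 else ea m i)" "eb m' i = (if i = j then 0 else eb m i)" for i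
        by (simp_all add: ea_def eb_def)
      have "m = mono_at j (ea m j, 0) + mono_at j (0, eb m j) + m'"
        by (rule bmono_eqI) (simp_all add: ea_add eb_add e_mono_at e)
      then have "psingle m 1 = X j ^ ea m j * Y j ^ eb m j * (psingle m' 1 :: 'k jac)"
        unfolding X_pow Y_pow by (simp add: mult_single)
      moreover have "psingle m' 1 \<in> ?A" by (rule insert.IH) (use insert.prems e in auto)
      ultimately show ?case using mult pow XY insert.prems(1) by simp
    qed
    from this[OF _ order_refl, of m] show ?thesis using that by blast
  qed
  show "(Sn {1..n} :: 'k jac set) \<subseteq> ?A"
  proof
    fix u :: "'k jac" assume u: "u \<in> Sn {1..n}"
    have t: "psingle m (plookup u m) \<in> ?A" if "m \<in> pkeys u" for m
    proof -
      have "psingle m (plookup u m) = scal (plookup u m) * psingle m 1"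
        by (simp add: scal_def mult_single)
      then show ?thesis using mult[OF sc mono] u that by (simp add: Sn_def)
    qed
    have "(\<Sum>m\<in>M. psingle m (plookup u m)) \<in> ?A" if "finite M" "M \<subseteq> pkeys u" for M
      using that by (induction M rule: finite_induct) (use t add sc[of 0] in \<open>auto simp: scal_def\<close>)
    from this[OF finite_keys order_refl] show "u \<in> ?A" using poly_mapping_sum[of u] by simp
  qed
qed

lemma YX [simp]: fixes z :: "'k::field jac" shows "Y i * X i = (1 :: 'k jac)" "Y i * (X i * z) = z"
proof -
  have "mono_at i (0,1) + mono_at i (1,0) = 0" by (rule bmono_eqI) (simp_all add: e_mono_at ea_add eb_add)
  then show "Y i * X i = (1 :: 'k jac)" by (simp add: X_def Y_def mult_single)
  then show "Y i * (X i * z) = z" by (simp flip: mult.assoc)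
qed

lemma Sn_commute:
  assumes "u \<in> Sn V" "v \<in> Sn W" "V \<inter> W = {}" shows "u * v = v * u"
proof -
  have c: "m + m' = m' + m" if "m \<in> pkeys u" "m' \<in> pkeys v" for m m'
  proof (rule bmono_eqI)
    fix i
    have "i \<notin> V \<or> i \<notin> W" using assms(3) by blast
    then have "ea m i = 0 \<and> eb m i = 0 \<or> ea m' i = 0 \<and> eb m' i = 0" using assms(1,2) that unfolding Sn_def by blast
    then show "ea (m + m') i = ea (m' + m) i" "eb (m + m') i = eb (m' + m) i" by (auto simp: ea_add eb_add)
  qed
  let ?f = "\<lambda>w m. psingle m (plookup w m)"
  have "u * v = (\<Sum>m\<in>pkeys u. \<Sum>m'\<in>pkeys v. ?f u m * ?f v m')"
    by (subst poly_mapping_sum[of u], subst poly_mapping_sum[of v]) (rule sum_product)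
  also have "\<dots> = (\<Sum>m\<in>pkeys u. \<Sum>m'\<in>pkeys v. ?f v m' * ?f u m)"
    by (intro sum.cong) (simp_all add: mult_single mult.commute, metis c)
  also have "\<dots> = v * u"
    by (subst (2) poly_mapping_sum[of u], subst (2) poly_mapping_sum[of v]) (subst sum.swap, simp add: sum_product)
  finally show ?thesis .
qed

lemma rho_X: assumes J: "idx J"
  shows "i \<notin> J ==> rho J (X i) = sc (lmon (psingle i 1))"
    "i \<notin> J ==> rho J (Y i) = sc (lmon (psingle i (-1)))"
proof -
  assume i: "i \<notin> J"
  have c: "cond J (mono_at i a) (dec J p) (dec J q) \<longleftrightarrow> p = q" for a p q
    using dec_inj[OF J, of p q] i by (auto simp: cond_def e_mono_at)
  have "ex J (mono_at i (1,0)) = psingle i 1" "ex J (mono_at i (0,1)) = psingle i (-1)"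
    using i by (auto intro!: poly_mapping_eqI simp: lookup_ex e_mono_at lookup_single)
  then show "rho J (X i) = sc (lmon (psingle i 1))" "rho J (Y i) = sc (lmon (psingle i (-1)))"
    unfolding X_def Y_def rho_single
    by (auto intro!: rcf_eqI simp: embk_hom ent_rmon[OF J] c)
qed

lemma Est_eq: "Est s t i = X i ^ s * (1 - X i * Y i) * (Y i ^ t :: 'k::field jac)"
proof -
  have "X i ^ s * (1 - X i * Y i) * (Y i ^ t :: 'k jac) = X i ^ s * Y i ^ t - (X i ^ s * X i) * (Y i * Y i ^ t)"
    by (simp add: left_diff_distrib right_diff_distrib mult.assoc)
  then show ?thesis by (simp add: Est_def power_commutes)
qed

lemma ee_Est: "ee i = Est 0 0 i" by (simp add: ee_def Est_def)

lemma Est_mult: "Est s t i * Est s' t' i = (if t = s' then Est s t' i else (0 :: 'k::field jac))"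
proof -
  interpret shift_pair "X i :: 'k jac" "Y i" by unfold_locales simp
  show ?thesis using mx_mult by (simp add: mx_def Est_eq)
qed

lemma ee_X [simp]: "ee i * X i = 0" "Y i * ee i = 0" "ee i * ee i = ee i"
  by (simp_all add: ee_def algebra_simps)

lemma Sn_Est: "i \<in> V ==> Est s t i \<in> Sn V"
  unfolding Est_def by (intro Sn_diff Sn_mult Sn_pow Sn_XY)

lemma Sn_ee: "i \<in> V ==> ee i \<in> Sn V"
  unfolding ee_Est by (rule Sn_Est)

text \<open>For i outside J the product x_i y_i acts as t_i / t_i = 1, which annihilates every
  matrix unit in the variable i.\<close>

lemma rho_Est_out: assumes J: "idx J" and i: "i \<notin> J" shows "rho J (Est s t i) = (0 :: 'k::field om rcf)"
proof -
  have "rho J (X i * Y i :: 'k jac) = sc (lmon (psingle i 1) * lmon (psingle i (-1)))"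
    unfolding rho_mult[OF J] rho_X[OF J i] sc_hom ..
  also have "\<dots> = 1" unfolding mon_add[symmetric] single_add[symmetric] by (simp add: sc_hom)
  finally show ?thesis unfolding Est_eq rho_mult[OF J] rho_diff rho_one[OF J] by simp
qed

lemma ent_rho_Est:
  assumes J: "idx J" and i: "i \<in> J"
  shows "ent (rho J (Est a b i)) p q =
    (if dec J p i = a \<and> dec J q i = b \<and> (\<forall>j\<in>J. j \<noteq> i \<longrightarrow> dec J p j = dec J q j) then 1 else (0 :: 'k::field om))"
proof -
  have XY: "X i ^ a * Y i ^ b = (psingle (mono_at i (a,b)) 1 :: 'k jac)" for a b
    unfolding X_pow Y_pow mult_single
    by (intro arg_cong2[of _ _ _ _ psingle] bmono_eqI) (simp_all add: e_mono_at ea_add eb_add)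
  have ex0: "ex J (mono_at i m) = 0" for m
    using i by (intro poly_mapping_eqI) (auto simp: lookup_ex e_mono_at)
  have c: "cond J (mono_at i (a,b)) (dec J p) (dec J q) \<longleftrightarrow>
      b \<le> dec J q i \<and> dec J p i = dec J q i - b + a \<and> (\<forall>j\<in>J. j \<noteq> i \<longrightarrow> dec J p j = dec J q j)" for a b
    using i by (auto simp: cond_def e_mono_at)
  have e: "ent (rho J (Est a b i) :: 'k om rcf) p q =
      (if cond J (mono_at i (a,b)) (dec J p) (dec J q) then 1 else 0)
      - (if cond J (mono_at i (a + 1,b + 1)) (dec J p) (dec J q) then 1 else 0)"
    unfolding Est_def XY rho_diff rho_single ent_simps ent_sc_mult ent_rmon[OF J] ex0 by (simp add: embk_hom)
  consider "dec J q i < b" | "dec J q i = b" | "dec J q i > b" by linarith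
  then show ?thesis
  proof cases
    case 3
    then have "dec J q i - b + a = dec J q i - (b + 1) + (a + 1)" by simp
    then show ?thesis unfolding e c using 3 by simp
  qed (unfold e c, simp_all)
qed

definition MJ :: "nat list \<Rightarrow> (nat \<Rightarrow> nat) \<Rightarrow> (nat \<Rightarrow> nat) \<Rightarrow> 'k::field jac" where
  "MJ xs s t = prod_list (map (\<lambda>i. Est (s i) (t i) i) xs)"

lemma ent_rho_MJ:
  assumes J: "idx J" and "set xs \<subseteq> J" "distinct xs"
  shows "ent (rho J (MJ xs s t)) p q =
    (if (\<forall>i\<in>set xs. dec J p i = s i \<and> dec J q i = t i) \<and> (\<forall>j\<in>J - set xs. dec J p j = dec J q j) then 1 else (0 :: 'k::field om))"
  using assms(2,3)
proof (induction xs arbitrary: p)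
  case Nil
  then show ?case using dec_inj[OF J, of p q] by (auto simp: MJ_def rho_one[OF J])
next
  case (Cons i xs)
  define w where "w = (dec J p)(i := t i)"
  define r where "r = enc J w"
  have w: "dec J r = w" unfolding r_def using Cons.prems dec_Ix[OF J, of p]
    by (intro dec_enc[OF J]) (auto simp: w_def Ix_def)
  have e: "ent (rho J (Est (s i) (t i) i) :: 'k om rcf) p r' = (if dec J p i = s i \<and> r' = r then 1 else 0)" for r'
  proof -
    have "dec J r' i = t i \<and> (\<forall>j\<in>J. j \<noteq> i \<longrightarrow> dec J p j = dec J r' j) \<longleftrightarrow> r' = r"
    proof
      assume a: "dec J r' i = t i \<and> (\<forall>j\<in>J. j \<noteq> i \<longrightarrow> dec J p j = dec J r' j)"
      show "r' = r" by (rule dec_inj[OF J]) (use a in \<open>auto simp: w w_def\<close>)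
    qed (simp add: w w_def)
    moreover have "i \<in> J" using Cons.prems by simp
    ultimately show ?thesis unfolding ent_rho_Est[OF J \<open>i \<in> J\<close>] by metis
  qed
  have "ent (rho J (MJ (i # xs) s t) :: 'k om rcf) p q
     = (\<Sum>r'\<in>{r}. ent (rho J (Est (s i) (t i) i)) p r' * ent (rho J (MJ xs s t)) r' q)"
    unfolding MJ_def list.map prod_list.Cons rho_mult[OF J] by (rule ent_mult) (auto simp: e)
  also have "\<dots> = (if dec J p i = s i then ent (rho J (MJ xs s t)) r q else 0)" by (simp add: e)
  also have "\<dots> = (if (\<forall>k\<in>set (i # xs). dec J p k = s k \<and> dec J q k = t k) \<and> (\<forall>j\<in>J - set (i # xs). dec J p j = dec J q j) then 1 else 0)"
  proof -
    have "(\<forall>k\<in>set xs. w k = s k \<and> dec J q k = t k) \<and> (\<forall>j\<in>J - set xs. w j = dec J q j) \<longleftrightarrow>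
      (\<forall>k\<in>set xs. dec J p k = s k \<and> dec J q k = t k) \<and> dec J q i = t i \<and> (\<forall>j\<in>J - set (i # xs). dec J p j = dec J q j)"
      using Cons.prems by (auto simp: w_def)
    then show ?thesis using Cons.IH[of r] Cons.prems unfolding w by auto
  qed
  finally show ?case .
qed

lemma rho_MJ:
  assumes J: "idx J" "set xs = J" "distinct xs" "s \<in> Ix J" "t \<in> Ix J"
  shows "rho J (MJ xs s t) = (rc.mx (enc J s) (enc J t) :: 'k::field om rcf)"
proof (rule rcf_eqI)
  fix p q
  have "(\<forall>i\<in>J. dec J p i = s i) \<longleftrightarrow> p = enc J s" if "s \<in> Ix J" for p s
    using dec_inj[OF J(1), of p "enc J s"] dec_enc[OF J(1) that] by auto
  from this[OF J(4), of p] this[OF J(5), of q]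
  have "(\<forall>i\<in>J. dec J p i = s i \<and> dec J q i = t i) \<longleftrightarrow> p = enc J s \<and> q = enc J t" by blast
  then show "ent (rho J (MJ xs s t) :: 'k om rcf) p q = ent (rc.mx (enc J s) (enc J t)) p q"
    unfolding ent_rho_MJ[OF J(1) equalityD1[OF J(2)] J(3)] using J(2) by simp
qed

lemma rho_MJ_out:
  assumes J: "idx J" and "i \<in> set xs" "i \<notin> J" shows "rho J (MJ xs s t) = (0 :: 'k::field om rcf)"
  using assms(2)
proof (induction xs)
  case (Cons j xs)
  have "rho J (Est (s i) (t i) i) = (0 :: 'k om rcf)" using rho_Est_out[OF J assms(3)] .
  moreover have "rho J (MJ (j # xs) s t) = rho J (Est (s j) (t j) j) * (rho J (MJ xs s t) :: 'k om rcf)"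
    by (simp add: MJ_def rho_mult[OF J])
  ultimately show ?case using Cons by (cases "i = j") auto
qed simp

lemma entL_Lp: fixes u :: "'a::field jac" assumes "u \<in> Sn V" shows "entL J u s t \<in> Lp (V - J)"
proof -
  have s1: "psingle (ex J m) c \<in> Lp (V - J)" if "m \<in> pkeys u" for m and c :: 'a
  proof (rule Lp_single, rule subsetI)
    fix i assume "i \<in> pkeys (ex J m)"
    then have "i \<notin> J" "ea m i \<noteq> 0 \<or> eb m i \<noteq> 0" by (auto simp: in_keys_iff lookup_ex split: if_splits)
    moreover have "i \<in> V \<or> ea m i = 0 \<and> eb m i = 0" using assms that by (auto simp: Sn_def)
    ultimately show "i \<in> V - J" by auto
  qed
  have s2: "(\<And>m. m \<in> M ==> f m \<in> Lp W) ==> sum f M \<in> Lp W" for f :: "bmono \<Rightarrow> 'a lp" and M W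
    by (induction M rule: infinite_finite_induct) (auto intro: Lp_0 Lp_add)
  show ?thesis unfolding entL_def by (rule s2) (auto intro: Lp_0 s1)
qed

text \<open>When t i is at least every y_i-exponent of u, nothing is cut off in direction i and x_i
  acts there as a translation. The entry then is the part of the entry for J - {i} in which t_i has
  the exponent s i - t i.\<close>

lemma entL_stable:
  fixes u :: "'k::field jac"
  assumes i: "i \<in> J" and M: "\<And>m. m \<in> pkeys u ==> eb m i \<le> t i"
    and z: "entL (J - {i}) u (s(i := 0)) (t(i := 0)) = 0"
  shows "entL J u s t = 0"
proof (rule poly_mapping_eqI)
  fix \<epsilon> :: "nat \<Rightarrow>\<^sub>0 int"
  \<comment> \<open>The exponent \<epsilon> with the displacement in direction i recorded as an
    exponent of the variable t_i.\<close>
  define \<delta> where "\<delta> = \<epsilon> + psingle i (int (s i) - int (t i))"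
  have L: "plookup (entL K u s' t') e =
      (\<Sum>m\<in>pkeys u. if cond K m s' t' \<and> ex K m = e then plookup u m else 0)" for K s' t' e
    unfolding entL_def lookup_sum
    by (rule sum.cong) (auto simp: lookup_single)
  have "cond J m s t \<and> ex J m = \<epsilon> \<longleftrightarrow> plookup \<epsilon> i = 0 \<and> cond (J - {i}) m (s(i := 0)) (t(i := 0)) \<and> ex (J - {i}) m = \<delta>"
    if m: "m \<in> pkeys u" for m
  proof -
    have c: "cond J m s t \<longleftrightarrow> cond (J - {i}) m (s(i := 0)) (t(i := 0)) \<and> int (s i) - int (t i) = int (ea m i) - int (eb m i)"
      using M[OF m] i by (auto simp: cond_def)
    have e: "ex (J - {i}) m = ex J m + psingle i (int (ea m i) - int (eb m i))"
      using i by (intro poly_mapping_eqI)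
        (auto simp: lookup_ex lookup_add lookup_single when_def)
    show ?thesis
    proof
      assume "cond J m s t \<and> ex J m = \<epsilon>"
      then show "plookup \<epsilon> i = 0 \<and> cond (J - {i}) m (s(i := 0)) (t(i := 0)) \<and> ex (J - {i}) m = \<delta>"
        unfolding c e \<delta>_def using i by (auto simp: lookup_ex)
    next
      assume a: "plookup \<epsilon> i = 0 \<and> cond (J - {i}) m (s(i := 0)) (t(i := 0)) \<and> ex (J - {i}) m = \<delta>"
      then have eq: "ex J m + psingle i (int (ea m i) - int (eb m i)) = \<epsilon> + psingle i (int (s i) - int (t i))"
        unfolding e \<delta>_def by simp
      have "int (ea m i) - int (eb m i) = int (s i) - int (t i)"
        using arg_cong[OF eq, of "\<lambda>p. plookup p i"] a i
        by (simp add: lookup_add lookup_ex)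
      then show "cond J m s t \<and> ex J m = \<epsilon>" unfolding c using a eq by simp
    qed
  qed
  then have "plookup (entL J u s t) \<epsilon> =
     (if plookup \<epsilon> i = 0 then plookup (entL (J - {i}) u (s(i := 0)) (t(i := 0))) \<delta> else 0)"
    unfolding L by (auto intro!: sum.cong)
  then show "plookup (entL J u s t) \<epsilon> = plookup 0 \<epsilon>" using z by simp
qed

text \<open>Since u dies when any i is taken out of J, \<open>entL_stable\<close> makes every entry
  vanish whose column index is large in some direction, and row and column indices differ by a
  bounded amount.\<close>

lemma rho_finite:
  fixes u :: "'k::field jac"
  assumes J: "idx J" and u: "u \<in> Sn V" and z: "\<And>i. i \<in> J ==> idx (J - {i}) \<and> rho (J - {i}) u = 0"
  shows "rho J u \<in> ru.Fin (sc ` Rn {} (V - J))"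
proof -
  have fJ: "finite J" using J by (simp add: idx_def)
  define M where "M = (\<Sum>m\<in>pkeys u. \<Sum>i\<in>J. ea m i + eb m i)"
  have M: "ea m i + eb m i \<le> M" if "m \<in> pkeys u" "i \<in> J" for m i
  proof -
    have "ea m i + eb m i \<le> (\<Sum>i\<in>J. ea m i + eb m i)"
      using that fJ by (intro member_le_sum) auto
    also have "\<dots> \<le> M" unfolding M_def
      by (rule member_le_sum[of m "pkeys u" "\<lambda>m. \<Sum>i\<in>J. ea m i + eb m i"]) (use that in auto)
    finally show ?thesis .
  qed
  \<comment> \<open>M bounds all exponents in u: columns with an index of at least M vanish, and the
    row index exceeds the column index by at most M, so 2 M + 1 is safe for both.\<close>
  have bound: "dec J p i < 2 * M + 1 \<and> dec J q i < 2 * M + 1" if nz: "ent (rho J u) p q \<noteq> 0" and i: "i \<in> J" for p q i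
  proof (rule ccontr)
    assume a: "\<not> ?thesis"
    have e: "entL J u (dec J p) (dec J q) \<noteq> 0" using nz unfolding ent_rho[OF J] by (auto simp: emb_hom)
    have "\<exists>m\<in>pkeys u. cond J m (dec J p) (dec J q)"
    proof (rule ccontr)
      assume "\<not> ?thesis"
      then have "entL J u (dec J p) (dec J q) = 0" unfolding entL_def by (intro sum.neutral) auto
      then show False using e by simp
    qed
    then obtain m where m: "m \<in> pkeys u" "cond J m (dec J p) (dec J q)" by blast
    have "dec J p i = dec J q i - eb m i + ea m i" "eb m i \<le> dec J q i" using m i by (auto simp: cond_def)
    then have q: "dec J q i \<ge> M" using a M[OF m(1) i] by auto
    have "(dec J p)(i := 0) \<in> Ix (J - {i})" "(dec J q)(i := 0) \<in> Ix (J - {i})"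
      using dec_Ix[OF J, of p] dec_Ix[OF J, of q] by (auto simp: Ix_def)
    then have z': "entL (J - {i}) u ((dec J p)(i := 0)) ((dec J q)(i := 0)) = 0"
      using z[OF i] rho_zero_iff[of "J - {i}" u] by blast
    have "entL J u (dec J p) (dec J q) = 0"
    proof (rule entL_stable[OF i _ z'])
      show "eb m i \<le> dec J q i" if "m \<in> pkeys u" for m using M[OF that i] q by simp
    qed
    then show False using e by simp
  qed
  have "finite {s. \<forall>i. (i \<in> J \<longrightarrow> s i \<in> {..<2 * M + 1}) \<and> (i \<notin> J \<longrightarrow> s i = (0::nat))}" (is "finite ?F")
    using fJ by (intro finite_set_of_finite_funs) auto
  then have "finite (enc J ` ?F)" by simp
  then obtain r where r: "\<And>x. x \<in> enc J ` ?F ==> x < r" unfolding finite_nat_iff_bounded by auto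
  have small: "p < r" if "\<And>i. i \<in> J ==> dec J p i < 2 * M + 1" for p
  proof (rule r, rule image_eqI)
    show "p = enc J (dec J p)" using enc_dec[OF J] by simp
    show "dec J p \<in> ?F" using that dec_Ix[OF J, of p] by (auto simp: Ix_def)
  qed
  have "ent (rho J u) p q = 0" if "p \<ge> r \<or> q \<ge> r" for p q
  proof (rule ccontr)
    assume "ent (rho J u) p q \<noteq> 0"
    then have "p < r" "q < r" using bound small by blast+
    then show False using that by simp
  qed
  moreover have "ent (rho J u) p q \<in> Rn {} (V - J)" for p q
    unfolding ent_rho[OF J] by (rule Rn_emb[OF entL_Lp[OF u]])
  ultimately show ?thesis unfolding Fin_iff[OF Rn_subring[OF empty_subsetI]] by blast
qed

text \<open>Take a monomial m0 of u with the least total y-degree. The entry in row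
  \<open>ea m0\<close> and column \<open>eb m0\<close> can be reached only by monomials with
  y-exponents at most those of m0, hence only by m0 itself.\<close>

lemma rho_faithful:
  fixes u :: "'k::field jac"
  assumes V: "idx V" and u: "u \<in> Sn V" and z: "rho V u = 0" shows "u = 0"
proof (rule ccontr)
  assume "u \<noteq> 0"
  then have ne: "pkeys u \<noteq> {}" by simp
  define w where "w = (\<lambda>m. \<Sum>i\<in>V. eb m i)"
  obtain m0 where m0: "m0 \<in> pkeys u" "\<And>m. m \<in> pkeys u ==> w m0 \<le> w m"
  proof -
    have "Min (w ` pkeys u) \<in> w ` pkeys u" using ne by (intro Min_in) auto
    then obtain m0 where "m0 \<in> pkeys u" "w m0 = Min (w ` pkeys u)" by auto
    then show ?thesis using that by simp
  qed
  have off: "ea m i = 0" "eb m i = 0" if "m \<in> pkeys u" "i \<notin> V" for m i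
    using u that by (auto simp: Sn_def)
  have fV: "finite V" using V by (simp add: idx_def)
  have c: "cond V m (ea m0) (eb m0) \<longleftrightarrow> m = m0" if m: "m \<in> pkeys u" for m
  proof
    assume cd: "cond V m (ea m0) (eb m0)"
    then have le: "eb m i \<le> eb m0 i" if "i \<in> V" for i using that by (auto simp: cond_def)
    have eq: "eb m i = eb m0 i" if "i \<in> V" for i
    proof (rule ccontr)
      assume "eb m i \<noteq> eb m0 i"
      then have "w m < w m0" unfolding w_def using le that
        by (intro sum_strict_mono_ex1[OF fV]) (auto intro!: bexI[of _ i] simp: le_less)
      then show False using m0(2)[OF m] by simp
    qed
    then have "ea m i = ea m0 i" if "i \<in> V" for i using cd that by (auto simp: cond_def)
    then show "m = m0" using eq off m m0(1) by (intro bmono_eqI) metis+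
  qed (simp add: cond_def)
  have "entL V u (ea m0) (eb m0) = (\<Sum>m\<in>pkeys u. if m = m0 then psingle (ex V m0) (plookup u m0) else 0)"
    unfolding entL_def by (rule sum.cong) (auto simp: c)
  then have "entL V u (ea m0) (eb m0) = psingle (ex V m0) (plookup u m0)" using m0(1) by simp
  moreover have "entL V u (ea m0) (eb m0) = 0"
  proof -
    have "ea m0 \<in> Ix V" "eb m0 \<in> Ix V" using off m0(1) by (auto simp: Ix_def)
    then show ?thesis using z rho_zero_iff[OF V, of u] by blast
  qed
  ultimately have "pkeys (psingle (ex V m0) (plookup u m0)) = {}" by simp
  then show False using m0(1) by (simp add: in_keys_iff split: if_splits)
qed

lemma lookup_mult_extreme:
  fixes p q :: "'k::field lp"
  assumes a: "a \<in> pkeys p" "b \<in> pkeys q"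
    and e: "\<And>a' b'. a' \<in> pkeys p ==> b' \<in> pkeys q ==> a' + b' = a + b ==> a' = a \<and> b' = b"
  shows "plookup (p * q) (a + b) \<noteq> 0"
proof -
  let ?f = "\<lambda>w m. psingle m (plookup w m) :: 'k lp"
  have "p * q = (\<Sum>m\<in>pkeys p. \<Sum>m'\<in>pkeys q. ?f p m * ?f q m')"
    by (subst poly_mapping_sum[of p], subst poly_mapping_sum[of q]) (rule sum_product)
  then have "plookup (p * q) (a + b) = (\<Sum>m\<in>pkeys p. \<Sum>m'\<in>pkeys q.
      if m + m' = a + b then plookup p m * plookup q m' else 0)"
    by (simp add: lookup_sum mult_single lookup_single when_def)
  also have "\<dots> = (\<Sum>m\<in>pkeys p. \<Sum>m'\<in>pkeys q.
      if m = a then (if m' = b then plookup p a * plookup q b else 0) else 0)"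
    by (intro sum.cong) (use e in auto)
  also have "\<dots> = (\<Sum>m\<in>pkeys p. if m = a then (\<Sum>m'\<in>pkeys q.
      if m' = b then plookup p a * plookup q b else 0) else 0)"
    by (intro sum.cong) auto
  also have "\<dots> = plookup p a * plookup q b" using a by simp
  finally show ?thesis using a by (simp add: in_keys_iff)
qed

text \<open>The exponents form a linearly ordered group, so the products of the two largest terms
  and of the two smallest terms cannot cancel. Both must be the constant term of 1, which leaves p
  with a single term.\<close>

lemma laurent_unit:
  fixes p q :: "'k::field lp"
  assumes pq: "p * q = 1"
  shows "\<exists>\<mu> c. c \<noteq> 0 \<and> p = psingle \<mu> c"
proof -
  let ?P = "pkeys p" and ?Q = "pkeys q"
  have ne: "?P \<noteq> {}" "?Q \<noteq> {}" using pq by auto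
  have 0: "a + b = 0" if "plookup (p * q) (a + b) \<noteq> 0" for a b
    using that unfolding pq by (auto simp: lookup_one when_def split: if_splits)
  have "Max ?P + Max ?Q = 0"
  proof (rule 0, rule lookup_mult_extreme)
    fix a b assume "a \<in> ?P" "b \<in> ?Q" and e: "a + b = Max ?P + Max ?Q"
    then have "a \<le> Max ?P" "b \<le> Max ?Q" by auto
    then show "a = Max ?P \<and> b = Max ?Q" using e by (metis add_le_imp_le_left add_less_le_mono nless_le add_le_less_mono)
  qed (use ne in auto)
  moreover have "Min ?P + Min ?Q = 0"
  proof (rule 0, rule lookup_mult_extreme)
    fix a b assume "a \<in> ?P" "b \<in> ?Q" and e: "a + b = Min ?P + Min ?Q"
    then have "Min ?P \<le> a" "Min ?Q \<le> b" by auto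
    then show "a = Min ?P \<and> b = Min ?Q" using e by (metis add_le_imp_le_left add_less_le_mono nless_le add_le_less_mono)
  qed (use ne in auto)
  moreover have "Min ?P \<le> Max ?P" "Min ?Q \<le> Max ?Q" using ne by auto
  ultimately have "Min ?P = Max ?P" by (metis add_less_le_mono nless_le)
  then have "a = Max ?P" if "a \<in> ?P" for a using that by (metis Max_ge Min_le antisym finite_keys)
  then have "?P = {Max ?P}" using ne by (metis Max_in finite_keys insert_absorb singletonI subsetI subset_singleton_iff empty_iff)
  then have "p = psingle (Max ?P) (plookup p (Max ?P))"
    using poly_mapping_sum[of p] by (metis (no_types, lifting) sum.insert sum.empty finite.emptyI empty_iff add.right_neutral)
  moreover have "plookup p (Max ?P) \<noteq> 0" using ne by (metis Max_in finite_keys in_keys_iff)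
  ultimately show ?thesis by blast
qed

definition lbm :: "(nat \<Rightarrow>\<^sub>0 int) \<Rightarrow> bmono" where
  "lbm \<mu> = Abs_bmono (\<lambda>i. (nat (plookup \<mu> i), nat (- plookup \<mu> i)))"

text \<open>Positive exponents become powers of x and negative ones powers of y. The map is not
  multiplicative, but \<open>rho J\<close> turns the lift into a scalar when the variables lie
  outside J, which is all that is needed of it.\<close>

definition lft :: "'k::field lp \<Rightarrow> 'k jac" where
  "lft c = (\<Sum>\<mu>\<in>pkeys c. psingle (lbm \<mu>) (plookup c \<mu>))"

lemma e_lbm: "ea (lbm \<mu>) i = nat (plookup \<mu> i)" "eb (lbm \<mu>) i = nat (- plookup \<mu> i)"
proof -
  have "finite {i. (nat (plookup \<mu> i), nat (- plookup \<mu> i)) \<noteq> (0,0)}"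
    by (rule finite_subset[of _ "pkeys \<mu>"]) (auto simp: in_keys_iff)
  then have "Rep_bmono (lbm \<mu>) i = (nat (plookup \<mu> i), nat (- plookup \<mu> i))"
    unfolding lbm_def by (subst Abs_bmono_inverse) auto
  then show "ea (lbm \<mu>) i = nat (plookup \<mu> i)" "eb (lbm \<mu>) i = nat (- plookup \<mu> i)"
    by (simp_all add: ea_def eb_def)
qed

lemma lft_Sn: assumes "c \<in> Lp W" shows "lft c \<in> Sn W"
  unfolding lft_def
proof (rule Sn_sum)
  fix \<mu> assume "\<mu> \<in> pkeys c"
  then have "pkeys \<mu> \<subseteq> W" using assms by (auto simp: Lp_def)
  then have "plookup \<mu> i = 0" if "i \<notin> W" for i using that by (auto simp: in_keys_iff)
  then show "psingle (lbm \<mu>) (plookup c \<mu>) \<in> Sn W" by (auto simp: Sn_def e_lbm)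
qed

lemma rho_lft:
  fixes c :: "'k::field lp"
  assumes J: "idx J" and c: "c \<in> Lp W" and W: "W \<inter> J = {}"
  shows "rho J (lft c) = sc (emb c)"
proof -
  have "rho J (psingle (lbm \<mu>) k) = sc (emb (psingle \<mu> k))" if "\<mu> \<in> pkeys c" for \<mu> and k :: 'k
  proof (rule rcf_eqI)
    fix p q
    have "pkeys \<mu> \<subseteq> W" using c that by (auto simp: Lp_def)
    then have z: "plookup \<mu> i = 0" if "i \<in> J" for i using that W by (auto simp: in_keys_iff)
    then have "ex J (lbm \<mu>) = \<mu>" by (intro poly_mapping_eqI) (auto simp: lookup_ex e_lbm)
    moreover have "cond J (lbm \<mu>) (dec J p) (dec J q) \<longleftrightarrow> p = q"
      using dec_inj[OF J, of p q] z by (auto simp: cond_def e_lbm)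
    moreover have "embk k * lmon \<mu> = emb (psingle \<mu> k)"
      by (simp add: embk_def lmon_def mult_single flip: emb_hom(6))
    ultimately show "ent (rho J (psingle (lbm \<mu>) k)) p q = ent (sc (emb (psingle \<mu> k))) p q"
      by (simp add: rho_single ent_rmon[OF J])
  qed
  then have "rho J (lft c) = (\<Sum>\<mu>\<in>pkeys c. sc (emb (psingle \<mu> (plookup c \<mu>))))"
    unfolding lft_def rho_sum by (intro sum.cong) auto
  also have "\<dots> = sc (emb c)" unfolding sc_sum[symmetric] emb_sum[symmetric] poly_mapping_sum[symmetric] ..
  finally show ?thesis .
qed

section \<open>Explicit elements of the relative elementary group\<close>

context coeff_ring begin

lemma mx_coeff: "c \<in> C ==> mx k l * c = c * mx k l" "c \<in> C ==> mx k l * (c * s) = c * (mx k l * s)"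
  using C_mx by (simp, simp flip: mult.assoc)

lemma mx_mult_assoc: "mx k l * (mx m n * s) = (if l = m then mx k n * s else 0)"
  by (simp add: mx_mult flip: mult.assoc)

text \<open>For b a = 1 the matrix (a, ab - 1; 0, b) is elementary; it lifts the diagonal matrix (a, 1/a).\<close>

definition hyp :: "'w \<Rightarrow> 'w \<Rightarrow> 'w \<Rightarrow> nat \<Rightarrow> nat \<Rightarrow> 'w" where
  "hyp g a b k l = 1 + g * ((a - 1) * mx k k - (1 - a * b) * mx k l + (b - 1) * mx l l)"

text \<open>The usual factorization of diag (a, 1/a) into elementary matrices still makes sense when
  only b a = 1; the defect 1 - a b shows up as the corner entry. The central idempotent g keeps all
  entries in D.\<close>

lemma hyp_El:
  assumes D: "idl D" and g: "g \<in> D" "g * g = g" and a: "a \<in> C" and b: "b \<in> C" and ba: "b * a = 1"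
    and c: "a * g = g * a" "b * g = g * b" and kl: "k \<noteq> l"
  shows "hyp g a b k l \<in> El D"
proof -
  have gC: "g \<in> C" using D g by (auto simp: idl_def)
  have co: "g * a \<in> D" "g * b \<in> D" "- (g * b) \<in> D" "- g \<in> D"
    using D g a b idl_neg[OF D] by (auto simp: idl_def)
  note E = El_elem[OF co(1) kl] El_elem[OF co(3) kl[symmetric]] El_elem[OF co(4) kl] El_elem[OF g(1) kl[symmetric]]
  have R: "g * (g * s) = g * s" "a * (g * s) = g * (a * s)" "b * (g * s) = g * (b * s)" "b * (a * s) = s" for s
    using g c ba by (simp_all flip: mult.assoc)
  have eq: "(1 + g * a * mx k l) * (1 + - (g * b) * mx l k) * (1 + g * a * mx k l)
     * ((1 + - g * mx k l) * (1 + g * mx l k) * (1 + - g * mx k l)) = hyp g a b k l"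
    unfolding hyp_def using kl kl[symmetric]
    by (simp add: algebra_simps mx_mult mx_mult_assoc mx_coeff[OF gC] mx_coeff[OF a] mx_coeff[OF b] g(2) c ba R)
  have "(1 + g * a * mx k l) * (1 + - (g * b) * mx l k) * (1 + g * a * mx k l)
     * ((1 + - g * mx k l) * (1 + g * mx l k) * (1 + - g * mx k l)) \<in> El D"
    by (intro El_mult E)
  then show ?thesis unfolding eq .
qed

text \<open>Conjugating 1 + q' e_kk by the elementary matrix V = \<open>hyp 1 a b k (Suc k)\<close>
  replaces q' by q' a b. The commutator with it is relatively elementary and equals 1 + q (1 - a b)
  e_kk, so an additional factor 1 - a b makes a diagonal element trivial in K1.\<close>

lemma absorb_idempotent_Er:
  assumes D: "idl D" and q: "q \<in> D" "q' \<in> D" "q * q' = - q - q'" "q' * q = - q - q'"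
    and a: "a \<in> C" and b: "b \<in> C" and ba: "b * a = 1"
    and c: "a * q' = q' * a" "b * q' = q' * b"
  shows "1 + q * (1 - a * b) * mx k k \<in> Er D"
proof -
  have qC: "q \<in> C" "q' \<in> C" using D q by (auto simp: idl_def)
  define V where "V = hyp 1 a b k (Suc k)"
  have V: "V \<in> El C" unfolding V_def using hyp_El[OF idl_C C_1 _ a b ba] by simp
  define u where "u = 1 + q' * mx k k"
  define v where "v = 1 + q * mx k k"
  have qq: "q * (q' * s) = - (q * s) - q' * s" "q' * (q * s) = - (q * s) - q' * s" for s
    using q(3,4) by (simp_all add: left_diff_distrib flip: mult.assoc)
  have uv: "u * v = 1" "v * u = 1"
    unfolding u_def v_def
    by (simp_all add: algebra_simps mx_mult mx_mult_assoc mx_coeff[OF qC(1)] mx_coeff[OF qC(2)] qq)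
  have uG: "u \<in> GL D"
  proof (rule GLI[OF _ _ uv])
    show "u - 1 \<in> Fin D" unfolding u_def using Fin_mx[OF q(2)] by simp
    show "v - 1 \<in> Fin C" unfolding v_def using Fin_mx[OF qC(1)] by simp
  qed
  define z where "z = 1 + q' * a * b * mx k k"
  have R: "a * (q' * s) = q' * (a * s)" "b * (q' * s) = q' * (b * s)" "b * (a * s) = s" for s
    using c ba by (simp_all flip: mult.assoc)
  have Vu: "V * u = z * V"
    unfolding V_def hyp_def u_def z_def
    by (simp add: algebra_simps mx_mult mx_mult_assoc mx_coeff[OF qC(2)] mx_coeff[OF a] mx_coeff[OF b] c ba R)
  have "V * u * uinv V * uinv u = z * v"
    using Vu El_unt[OF V] uinv_eq[OF uv] by (simp add: mult.assoc)
  then have "z * v \<in> Er D" using commutator_Er[OF D ElC(1)[OF V] uG] by simp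
  also have "z * v = 1 + (q + q' * a * b + q' * (a * (b * q))) * mx k k"
    unfolding z_def v_def
    by (simp add: algebra_simps mx_mult mx_mult_assoc mx_coeff[OF qC(1)])
  also have "q' * (a * (b * q)) = a * b * (q' * q)"
    using c by (simp add: mult.assoc R)
  also have "q + q' * a * b + a * b * (q' * q) = q * 1 - a * b * q"
  proof -
    have "a * b * q' = q' * a * b" by (simp add: mult.assoc c R)
    then show ?thesis unfolding q(4) by (simp add: algebra_simps)
  qed
  finally have res: "1 + (q - a * b * q) * mx k k \<in> Er D" by simp
  have "a * b * q = q * (a * b)"
  proof -
    \<comment> \<open>q is the quasi-inverse of q', so it commutes with everything q' commutes with\<close>
    have *: "s * q = q * s" if "s * q' = q' * s" for s
    proof -
      have 1: "(1 + q) * (1 + q') = 1" "(1 + q') * (1 + q) = 1" using q(3,4) by (simp_all add: algebra_simps)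
      have "(1 + q) * ((1 + q') * s) * (1 + q) = (1 + q) * (s * (1 + q')) * (1 + q)"
        using that by (simp add: algebra_simps)
      then have "s * (1 + q) = (1 + q) * s" using 1 by (simp add: mult.assoc) (simp flip: mult.assoc)
      then show ?thesis by (simp add: algebra_simps)
    qed
    have "a * q = q * a" "b * q = q * b" using * c by blast+
    then show ?thesis by (simp add: mult.assoc) (simp flip: mult.assoc)
  qed
  then show ?thesis using res by (simp add: right_diff_distrib)
qed

text \<open>V lifts diag (a, 1/a) in the places k, l and V' lifts diag (a', 1/a') in the places k,
  m. They commute up to one diagonal entry in place k, and that entry is the unit from which theta
  is built.\<close>

lemma hyp_commutator_El:
  assumes D: "idl D" and g: "g \<in> D" "g * g = g"
    and a: "a \<in> C" "b \<in> C" "b * a = 1" and a': "a' \<in> C" "b' \<in> C" "b' * a' = 1"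
    and c: "a * g = g * a" "b * g = g * b" "a' * g = g * a'" "b' * g = g * b'"
    and cc: "a * a' = a' * a" "a * b' = b' * a" "b * a' = a' * b" "b * b' = b' * b"
  shows "1 + ((1 + (b - 1) * (1 - a' * b')) * (1 + (a' - 1) * (1 - a * b)) - 1) * g * mx k k \<in> El D"
proof -
  define l m where "l = Suc k" and "m = Suc (Suc k)"
  have kl: "k \<noteq> l" "k \<noteq> m" "l \<noteq> m" by (auto simp: l_def m_def)
  define w where "w = (1 + (b - 1) * (1 - a' * b')) * (1 + (a' - 1) * (1 - a * b))"
  define V V' where "V = hyp g a b k l" and "V' = hyp g a' b' k m"
  have VE: "V \<in> El D" "V' \<in> El D"
    unfolding V_def V'_def using hyp_El[OF D g a c(1,2) kl(1)] hyp_El[OF D g a' c(3,4) kl(2)] by blast+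
  have gC: "g \<in> C" using D g by (auto simp: idl_def)
  define e e' where "e = 1 - a * b" and "e' = 1 - a' * b'"
  have C1: "e \<in> C" "e' \<in> C"
    unfolding e_def e'_def using C_add[OF C_1 C_neg[OF C_mult[OF a(1,2)]]] C_add[OF C_1 C_neg[OF C_mult[OF a'(1,2)]]] by simp_all
  have R0: "b * (a * s) = s" "b' * (a' * s) = s" "b * (a' * s) = a' * (b * s)" "b * (b' * s) = b' * (b * s)"
      "a * (a' * s) = a' * (a * s)" "a * (b' * s) = b' * (a * s)" for s
    using a(3) a'(3) cc by (simp_all flip: mult.assoc)
  have ea: "e * a = 0" "e' * a' = 0" "b * e = 0" "e * e = e" "e' * e' = e'" "e * e' = e' * e"
    "a * e' = e' * a" "b * e' = e' * b" "a' * e = e * a'" "b' * e = e * b'"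
    unfolding e_def e'_def using a(3) a'(3) cc by (simp_all add: algebra_simps R0)
  \<comment> \<open>These three products are precisely what turns row k of V V' into row k of V'
    V.\<close>
  have wa: "w * (a * a') = a * a'" "w * (a * e') = e'" "w * e = a' * e"
  proof -
    have 1: "(1 + (a' - 1) * e) * (a * s) = a * s" for s
      using ea(1) by (simp add: distrib_right mult.assoc) (simp flip: mult.assoc)
    have 2: "(1 + (b - 1) * e') * (a' * s) = a' * s" for s
      using ea(2) by (simp add: distrib_right mult.assoc) (simp flip: mult.assoc)
    have w: "w * s = (1 + (b - 1) * e') * ((1 + (a' - 1) * e) * s)" for s
      by (simp add: w_def e_def e'_def mult.assoc)
    show "w * (a * a') = a * a'" unfolding w 1 unfolding cc(1) 2 ..
    have "(1 + (b - 1) * e') * (a * e') = a * e' + (b - 1) * (e' * a * e')" by (simp add: algebra_simps)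
    also have "e' * a * e' = a * e'" using ea(5,7) by (simp flip: ea(7)) (simp add: mult.assoc ea(5))
    also have "a * e' + (b - 1) * (a * e') = e'" by (simp add: left_diff_distrib R0)
    finally show "w * (a * e') = e'" unfolding w 1 .
    have "(1 + (a' - 1) * e) * e = a' * e" using ea(4) by (simp add: algebra_simps)
    then show "w * e = a' * e" unfolding w using 2 by simp
  qed
  have gs: "g * (g * s) = g * s" "a * (g * s) = g * (a * s)" "b * (g * s) = g * (b * s)"
     "a' * (g * s) = g * (a' * s)" "b' * (g * s) = g * (b' * s)" for s
    using g(2) c by (simp_all flip: mult.assoc)
  have eg: "e * g = g * e" "e' * g = g * e'" "e * (g * s) = g * (e * s)" "e' * (g * s) = g * (e' * s)" for s
    unfolding e_def e'_def by (simp_all add: algebra_simps gs c)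
  note MX = mx_mult mx_mult_assoc mx_coeff[OF gC] mx_coeff[OF a(1)] mx_coeff[OF a(2)]
    mx_coeff[OF a'(1)] mx_coeff[OF a'(2)] mx_coeff[OF C1(1)] mx_coeff[OF C1(2)]
  have VV': "V * V' = 1 + g * ((a * a' - 1) * mx k k - e * mx k l - a * e' * mx k m + (b - 1) * mx l l + (b' - 1) * mx m m)"
    unfolding V_def V'_def hyp_def e_def[symmetric] e'_def[symmetric] using kl kl[symmetric]
    by (simp add: algebra_simps MX gs eg c g(2))
  have V'V: "V' * V = 1 + g * ((a * a' - 1) * mx k k - e' * mx k m - a' * e * mx k l + (b - 1) * mx l l + (b' - 1) * mx m m)"
    unfolding V_def V'_def hyp_def e_def[symmetric] e'_def[symmetric] using kl kl[symmetric]
    by (simp add: algebra_simps MX gs eg c g(2) cc)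
  have wg: "w * g = g * w" unfolding w_def e_def[symmetric] e'_def[symmetric]
    by (simp add: algebra_simps gs eg c)
  have wC: "w \<in> C" unfolding w_def e_def[symmetric] e'_def[symmetric]
    using C_mult[OF C_add[OF C_1 C_mult[OF _ C1(2)]] C_add[OF C_1 C_mult[OF _ C1(1)]], of "b - 1" "a' - 1"]
      C_add[OF a(2) C_neg[OF C_1]] C_add[OF a'(1) C_neg[OF C_1]] by simp
  have wg1: "(w - 1) * g = g * (w - 1)" using wg by (simp add: algebra_simps)
  have "(1 + (w - 1) * g * mx k k) * (V * V') = V' * V"
  proof -
    have 1: "mx k k * (V * V') = mx k k + g * ((a * a' - 1) * mx k k - e * mx k l - a * e' * mx k m)"
      unfolding VV' using kl kl[symmetric] by (simp add: algebra_simps MX)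
    have "(w - 1) * g * (mx k k * (V * V')) = (w - 1) * g * (a * a' * mx k k - e * mx k l - a * e' * mx k m)"
      unfolding 1 by (simp add: algebra_simps gs g(2))
    also have "\<dots> = g * ((w - 1) * (a * a' * mx k k - e * mx k l - a * e' * mx k m))"
      unfolding wg1 by (simp only: mult.assoc)
    also have "(w - 1) * (a * a' * mx k k - e * mx k l - a * e' * mx k m)
       = - (a' * e * mx k l - e * mx k l) - (e' * mx k m - a * e' * mx k m)"
      using wa by (simp add: left_diff_distrib right_diff_distrib flip: mult.assoc)
    finally have 2: "(w - 1) * g * (mx k k * (V * V')) = g * (- (a' * e * mx k l - e * mx k l) - (e' * mx k m - a * e' * mx k m))" .
    have "(1 + (w - 1) * g * mx k k) * (V * V') = V * V' + (w - 1) * g * (mx k k * (V * V'))"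
      by (simp only: distrib_right mult_1_left mult.assoc)
    also have "\<dots> = V' * V" unfolding 2 unfolding VV' V'V by (simp add: algebra_simps)
    finally show ?thesis .
  qed
  note key = this
  have vu: "unt (V * V')" using El_unt[OF El_C[OF D El_mult[OF VE]]] .
  have "1 + (w - 1) * g * mx k k = (1 + (w - 1) * g * mx k k) * ((V * V') * uinv (V * V'))"
    unfolding unt_inv_cancel(1)[OF vu] by simp
  also have "\<dots> = V' * V * uinv (V * V')" by (simp only: key flip: mult.assoc[of _ "V * V'"])
  finally have "1 + (w - 1) * g * mx k k = V' * V * uinv (V * V')" .
  then show ?thesis unfolding w_def[symmetric] using El_mult[OF El_mult[OF VE(2,1)] El_inv[OF D El_mult[OF VE]]] by simp
qed

text \<open>1 + d e_kk is the commutator of 1 + d e_kl and 1 + d' e_lk, because d d' = d while d' d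
  and d d vanish. Both factors have their entries in D.\<close>

lemma commutator_diag_El:
  assumes D: "idl D" and d: "d \<in> D" "d' \<in> D" "d * d' = d" "d' * d = 0"
  shows "1 + d * mx k k \<in> El D"
proof -
  have dC: "d \<in> C" "d' \<in> C" using D d by (auto simp: idl_def)
  define l where "l = Suc k"
  have kl: "k \<noteq> l" by (simp add: l_def)
  have d2: "d * d = 0" using d(3,4) by (metis mult.assoc mult_zero_right)
  have dd: "d' * (d * s) = 0" "d * (d' * s) = d * s" "d * (d * s) = 0" for s
    using d d2 by (simp_all flip: mult.assoc)
  have "(1 + d * mx k l) * (1 + d' * mx l k) * (1 + - d * mx k l) * (1 + - d' * mx l k) = 1 + d * mx k k"
    using kl kl[symmetric] by (simp add: algebra_simps mx_mult mx_mult_assoc mx_coeff[OF dC(1)] mx_coeff[OF dC(2)] d dd d2)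
  moreover have "(1 + d * mx k l) * (1 + d' * mx l k) * (1 + - d * mx k l) * (1 + - d' * mx l k) \<in> El D"
    by (intro El_mult El_elem) (use d idl_neg[OF D] kl in auto)
  ultimately show ?thesis by simp
qed

end

text \<open>Exchanging the two pairs inverts the unit. The inner factors cancel up to the common
  idempotent e e', which the outer factors annihilate.\<close>

lemma hyp_product_inverse:
  fixes a b a' b' :: "'w::ring_1"
  assumes ba: "b * a = 1" "b' * a' = 1"
    and cc: "a * a' = a' * a" "a * b' = b' * a" "b * a' = a' * b" "b * b' = b' * b"
  defines "w \<equiv> (1 + (b - 1) * (1 - a' * b')) * (1 + (a' - 1) * (1 - a * b))"
    and "w' \<equiv> (1 + (b' - 1) * (1 - a * b)) * (1 + (a - 1) * (1 - a' * b'))"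
  shows "w * w' = 1" "w' * w = 1"
proof -
  define e e' where "e = 1 - a * b" and "e' = 1 - a' * b'"
  have R0: "b * (a * s) = s" "b' * (a' * s) = s" "b * (a' * s) = a' * (b * s)" "b * (b' * s) = b' * (b * s)"
      "a * (a' * s) = a' * (a * s)" "a * (b' * s) = b' * (a * s)" for s
    using ba cc by (simp_all flip: mult.assoc)
  have ea: "e * a = 0" "e' * a' = 0" "b * e = 0" "b' * e' = 0" "e * e = e" "e' * e' = e'" "e * e' = e' * e"
    "a * e' = e' * a" "b * e' = e' * b" "a' * e = e * a'" "b' * e = e * b'"
    unfolding e_def e'_def using ba cc by (simp_all add: algebra_simps R0)
  have ab: "a * b = 1 - e" "a' * b' = 1 - e'" by (simp_all add: e_def e'_def)
  have R: "e * (a * s) = 0" "e' * (a' * s) = 0" "b * (e * s) = 0" "b' * (e' * s) = 0" "e * (e * s) = e * s"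
    "e' * (e' * s) = e' * s" "e * (e' * s) = e' * (e * s)" "a * (e' * s) = e' * (a * s)" "b * (e' * s) = e' * (b * s)"
    "a' * (e * s) = e * (a' * s)" "b' * (e * s) = e * (b' * s)" "a * (b * s) = s - e * s" "a' * (b' * s) = s - e' * s" for s
    using ea ab by (simp_all add: left_diff_distrib flip: mult.assoc)
  have "(1 + (b - 1) * e') * (1 + (a - 1) * e') = 1" "(1 + (a - 1) * e') * (1 + (b - 1) * e') = 1 - e * e'"
    "(1 + (a' - 1) * e) * (1 + (b' - 1) * e) = 1 - e * e'" "(1 + (b' - 1) * e) * (1 + (a' - 1) * e) = 1"
    by (simp_all add: algebra_simps ea R ba ab)
  note U = this
  have w: "w = (1 + (b - 1) * e') * (1 + (a' - 1) * e)" "w' = (1 + (b' - 1) * e) * (1 + (a - 1) * e')"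
    by (simp_all add: w_def w'_def e_def e'_def)
  have "w * w' = (1 + (b - 1) * e') * ((1 + (a' - 1) * e) * (1 + (b' - 1) * e)) * (1 + (a - 1) * e')"
    unfolding w by (simp only: mult.assoc)
  also have "\<dots> = (1 + (b - 1) * e') * (1 + (a - 1) * e') - (1 + (b - 1) * e') * (e * e') * (1 + (a - 1) * e')"
    unfolding U(3) by (simp only: right_diff_distrib left_diff_distrib mult_1_right mult.assoc)
  also have "(1 + (b - 1) * e') * (e * e') = 0" by (simp add: algebra_simps ea R)
  finally show "w * w' = 1" unfolding U(1) by simp
  have "w' * w = (1 + (b' - 1) * e) * ((1 + (a - 1) * e') * (1 + (b - 1) * e')) * (1 + (a' - 1) * e)"
    unfolding w by (simp only: mult.assoc)
  also have "\<dots> = (1 + (b' - 1) * e) * (1 + (a' - 1) * e) - (1 + (b' - 1) * e) * (e * e' * (1 + (a' - 1) * e))"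
    unfolding U(2) by (simp only: right_diff_distrib left_diff_distrib mult_1_right mult.assoc)
  also have "e * e' * (1 + (a' - 1) * e) = 0"
  proof -
    have "e' * (e * a') = e' * a' * e" by (simp only: ea(10)[symmetric] mult.assoc)
    then have "e' * (e * a') = 0" using ea(2) by simp
    then show ?thesis by (simp add: algebra_simps ea R)
  qed
  finally show "w' * w = 1" unfolding U(4) by simp
qed

section \<open>The ideal generated by the idempotents\<close>

lemma ee_commute: "ee i * ee j = ee j * (ee i :: 'k::field jac)"
proof (cases "i = j")
  case False
  then show ?thesis using Sn_commute[OF Sn_ee[of i "{i}"] Sn_ee[of j "{j}"]] by simp
qed simp

lemma eI_empty [simp]: "eI {} = 1" by (simp add: eI_def)

lemma eI_insert:
  assumes "finite I" "i \<notin> I" shows "eI (insert i I) = ee i * (eI I :: 'k::field jac)"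
proof -
  have "prod_list (map ee (insort i xs)) = ee i * (prod_list (map ee xs) :: 'k jac)" for xs
  proof (induction xs)
    case (Cons j xs)
    have "ee j * (ee i * prod_list (map ee xs)) = ee i * (ee j * (prod_list (map ee xs) :: 'k jac))"
      unfolding mult.assoc[symmetric] ee_commute[of j i] ..
    then show ?case using Cons by simp
  qed simp
  then show ?thesis unfolding eI_def using sorted_list_of_set_insert[OF assms(1,2)] by simp
qed

lemma eI_remove: "finite I ==> i \<in> I ==> eI I = ee i * (eI (I - {i}) :: 'k::field jac)"
  using eI_insert[of "I - {i}" i] by (simp add: insert_absorb)

lemma eI_Sn: "finite I ==> I \<subseteq> V ==> eI I \<in> Sn V"
  by (induction I rule: finite_induct) (auto simp: eI_insert intro: Sn_1 Sn_mult Sn_ee)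

lemma eI_commute: assumes "finite I" "u \<in> Sn V" "V \<inter> I = {}" shows "u * eI I = eI I * (u :: 'k::field jac)"
  using Sn_commute[OF assms(2) eI_Sn[OF assms(1) order_refl] assms(3)] .

lemma eI_idem [simp]: assumes "finite I" shows "eI I * eI I = (eI I :: 'k::field jac)"
  using assms
proof (induction I rule: finite_induct)
  case (insert i I)
  have c: "ee i * eI I = eI I * (ee i :: 'k jac)"
    using eI_commute[OF insert(1) Sn_ee[of i "{i}"]] insert(2) by simp
  have "ee i * eI I * (ee i * eI I) = ee i * ee i * (eI I * (eI I :: 'k jac))"
    by (metis c mult.assoc)
  then show ?case using insert by (simp add: eI_insert)
qed simp

lemma rho_eI_out: assumes "idx B" "finite I" "i \<in> I" "i \<notin> B" shows "rho B (eI I) = (0 :: 'k::field om rcf)"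
  unfolding eI_remove[OF assms(2,3)] rho_mult[OF assms(1)] ee_Est rho_Est_out[OF assms(1,4)] by simp

lemma rho_eI: assumes "idx J" shows "rho J (eI J) = (rc.mx (enc J (\<lambda>_. 0)) (enc J (\<lambda>_. 0)) :: 'k::field om rcf)"
proof -
  have "eI J = (MJ (sorted_list_of_set J) (\<lambda>_. 0) (\<lambda>_. 0) :: 'k jac)"
    unfolding eI_def MJ_def using ee_Est by (metis (no_types, lifting) map_eq_conv)
  then show ?thesis using rho_MJ[OF assms, of "sorted_list_of_set J" "\<lambda>_. 0" "\<lambda>_. 0"] assms
    by (simp add: idx_def Ix_def)
qed

lemma MJ_Sn: "set xs \<subseteq> V ==> MJ xs s t \<in> Sn V"
  unfolding MJ_def by (rule Sn_prod_list) (auto intro: Sn_Est)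

lemma MJ_mult:
  assumes "distinct xs"
  shows "MJ xs s t * MJ xs s' t' = (if \<forall>i\<in>set xs. t i = s' i then MJ xs s t' else (0 :: 'k::field jac))"
  using assms
proof (induction xs)
  case (Cons i xs)
  have c: "MJ xs s t * Est (s' i) (t' i) i = Est (s' i) (t' i) i * (MJ xs s t :: 'k jac)"
    using Sn_commute[OF MJ_Sn[of xs "set xs" s t] Sn_Est[of i "{i}" "s' i" "t' i"]] Cons.prems by simp
  have M: "MJ (i # xs) s t = Est (s i) (t i) i * (MJ xs s t :: 'k jac)" for s t by (simp add: MJ_def)
  have "MJ (i # xs) s t * MJ (i # xs) s' t' = Est (s i) (t i) i * (MJ xs s t * Est (s' i) (t' i) i) * (MJ xs s' t' :: 'k jac)"
    unfolding M by (simp only: mult.assoc)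
  also have "\<dots> = Est (s i) (t i) i * Est (s' i) (t' i) i * (MJ xs s t * (MJ xs s' t' :: 'k jac))"
    unfolding c by (simp only: mult.assoc)
  finally show ?case unfolding Est_mult using Cons by (auto simp: M)
qed (simp add: MJ_def)

lemma Rn_empty: assumes "c \<in> Rn {} W" shows "\<exists>p. p \<in> Lp W \<and> c = (emb p :: 'k::field om)"
proof -
  obtain p q where pq: "p \<in> Lp W" "q \<in> Lp {}" "q \<noteq> 0" "c = emb p * inverse (emb q)"
    using assms by (auto simp: Rn_def)
  have "pkeys q \<subseteq> {0}" using pq(2) by (auto simp: Lp_def)
  then have q: "q = psingle 0 (plookup q 0)"
    by (intro poly_mapping_eqI) (auto simp: lookup_single in_keys_iff when_def)
  define l where "l = plookup q 0"
  have q': "q = psingle 0 l" using q unfolding l_def .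
  have l: "l \<noteq> 0" using q' pq(3) by auto
  have "emb q * emb (psingle 0 (inverse l)) = 1"
    unfolding q' emb_hom(6)[symmetric] using l by (simp add: mult_single emb_hom)
  then have "inverse (emb q) = emb (psingle 0 (inverse l))" by (metis inverse_unique)
  then have "c = emb (p * psingle 0 (inverse l))" using pq(4) by (simp add: emb_hom)
  moreover have "p * psingle 0 (inverse l) \<in> Lp W" using pq(1) by (intro Lp_mult Lp_single) auto
  ultimately show ?thesis by blast
qed

locale jacobson_ideal =
  fixes n :: nat and S :: "nat set" and P :: "'k::field jac set"
  assumes n2: "n \<ge> 2" and S_sub: "S \<subseteq> {1..n-1}" and S_ne: "S \<noteq> {}"
    and P_def: "P = ideal_gen (Salg (n - 1)) (\<Union>i\<in>S. ideal_gen (Salg (n - 1)) {ee i})"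
begin

definition "N = {1..n}"
definition "N' = {1..n - 1}"

lemma n_notin [simp]: "n \<notin> N'" and n_in [simp]: "n \<in> N" and N'_sub: "N' \<subseteq> N" and S_N: "S \<subseteq> N" "n \<notin> S"
  and S_fin: "finite S" and N_eq: "N = insert n N'"
  and N_fin [simp]: "finite N" "finite N'" and S_N': "S \<subseteq> N'"
proof -
  show sub: "N' \<subseteq> N" and S: "S \<subseteq> N'" using S_sub by (auto simp: N_def N'_def)
  show nn: "n \<notin> N'" "n \<in> N" "N = insert n N'" "finite N" "finite N'" using n2 by (auto simp: N_def N'_def)
  show "S \<subseteq> N" "n \<notin> S" "finite S" using S sub nn(1,5) finite_subset by blast+
qed

lemma Salg_N': "Salg (n - 1) = Sn N'" and Salg_N: "Salg n = Sn N"
  by (simp_all only: Salg_eq N_def N'_def)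

text \<open>The matrix theory with x_n and y_n as the shifts and S_(n-1) as coefficients:
  \<open>mx k l\<close> is E_kl(n), and \<open>GL P\<close> is the group of units of 1 + p p_n,
  before any identification with matrices.\<close>

sublocale coeff_ring "X n :: 'k jac" "Y n" "Sn N'"
proof
  have "c * X n = X n * c" "c * Y n = Y n * c" if "c \<in> Sn N'" for c :: "'k jac"
    using Sn_commute[OF that Sn_XY(1)[of n "{n}"]] Sn_commute[OF that Sn_XY(2)[of n "{n}"]] n2 by auto
  then show "c \<in> Sn N' ==> c * X n = X n * c" "c \<in> Sn N' ==> c * Y n = Y n * c" for c :: "'k jac" by blast+
qed (auto intro: Sn_0 Sn_1 Sn_add Sn_neg Sn_mult)

lemma mx_Est: "mx k l = Est k l n"
  by (simp add: mx_def Est_eq)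

lemma ideal_gen_idl:
  fixes G :: "'k jac set"
  assumes "G \<subseteq> Sn N'" shows "idl (ideal_gen (Sn N') G)"
  unfolding idl_def
proof (intro conjI ballI subsetI)
  fix u assume "u \<in> ideal_gen (Sn N') G"
  then show "u \<in> Sn N'" using assms by (induction u rule: ideal_gen.induct) (auto intro: Sn_0 Sn_add Sn_mult)
next
  fix c u :: "'k jac" assume c: "c \<in> Sn N'" and "u \<in> ideal_gen (Sn N') G"
  from this(2) show "c * u \<in> ideal_gen (Sn N') G"
  proof (induction u rule: ideal_gen.induct)
    case (gen g a b)
    then have "(c * a) * g * b \<in> ideal_gen (Sn N') G" using c by (intro ideal_gen.gen Sn_mult)
    then show ?case by (simp add: mult.assoc)
  qed (auto simp: distrib_left intro: ideal_gen.zero ideal_gen.add)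
next
  fix c u :: "'k jac" assume c: "c \<in> Sn N'" and "u \<in> ideal_gen (Sn N') G"
  from this(2) show "u * c \<in> ideal_gen (Sn N') G"
  proof (induction u rule: ideal_gen.induct)
    case (gen g a b)
    then have "a * g * (b * c) \<in> ideal_gen (Sn N') G" using c by (intro ideal_gen.gen Sn_mult)
    then show ?case by (simp add: mult.assoc)
  qed (auto simp: distrib_right intro: ideal_gen.zero ideal_gen.add)
qed (auto intro: ideal_gen.zero ideal_gen.add)

lemma gens_sub: "(\<Union>i\<in>S. ideal_gen (Sn N') {ee i}) \<subseteq> (Sn N' :: 'k jac set)"
proof -
  have "idl (ideal_gen (Sn N') {ee i :: 'k jac})" if "i \<in> S" for i
    using that S_N' by (intro ideal_gen_idl) (auto intro: Sn_ee)
  then show ?thesis unfolding idl_def by blast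
qed

lemma P_idl: "idl P"
  unfolding P_def Salg_N' using gens_sub by (rule ideal_gen_idl)

lemma P_sub: "(u :: 'k jac) \<in> P ==> u \<in> Sn N'" and P_l: "(c :: 'k jac) \<in> Sn N' ==> u \<in> P ==> c * u \<in> P"
  and P_r: "(c :: 'k jac) \<in> Sn N' ==> u \<in> P ==> u * c \<in> P" and P_add: "(u :: 'k jac) \<in> P ==> v \<in> P ==> u + v \<in> P"
  using P_idl by (auto simp: idl_def)

lemma ee_P: assumes "k \<in> S" shows "ee k \<in> P"
proof -
  have "1 * ee k * 1 \<in> ideal_gen (Sn N') {ee k :: 'k jac}" by (intro ideal_gen.gen Sn_1) simp
  then have "1 * ee k * 1 \<in> P" unfolding P_def Salg_N' using assms by (intro ideal_gen.gen Sn_1) auto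
  then show ?thesis by simp
qed

lemma Est_P: assumes "k \<in> S" shows "Est s t k \<in> P"
proof -
  have "k \<in> N'" using assms S_N' by blast
  then have "X k ^ s * ee k * Y k ^ t \<in> P"
    by (intro P_l P_r ee_P assms Sn_pow Sn_XY)
  then show ?thesis by (simp add: Est_eq ee_def)
qed

lemma MJ_P: assumes "k \<in> S" "k \<in> set xs" "set xs \<subseteq> N'" shows "MJ xs s t \<in> P"
  using assms
proof (induction xs)
  case (Cons i xs)
  have M: "MJ (i # xs) s t = Est (s i) (t i) i * (MJ xs s t :: 'k jac)" by (simp add: MJ_def)
  show ?case
  proof (cases "k = i")
    case True
    then show ?thesis unfolding M using Cons.prems by (intro P_r Est_P MJ_Sn) auto
  next
    case False
    then show ?thesis unfolding M using Cons by (intro P_l Sn_Est) auto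
  qed
qed simp

lemma eI_P: assumes "k \<in> S" "k \<in> I" "I \<subseteq> N'" shows "eI I \<in> P"
proof -
  have f: "finite I" using finite_subset[OF assms(3) N_fin(2)] .
  show ?thesis unfolding eI_remove[OF f assms(2)] using assms f by (intro P_r ee_P eI_Sn) auto
qed

lemma rho_P:
  assumes u: "u \<in> P" and B: "idx B" "B \<inter> S = {}" shows "rho B u = 0"
proof -
  have *: "rho B u = 0" if g: "\<And>g. g \<in> G ==> rho B g = 0" and u: "u \<in> ideal_gen R G" for u G R
    using u by (induction u rule: ideal_gen.induct) (simp_all add: rho_mult[OF B(1)] rho_add g)
  have e: "rho B (ee i) = (0 :: 'k om rcf)" if "i \<in> S" for i
    unfolding ee_Est by (rule rho_Est_out[OF B(1)]) (use that B in auto)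
  show ?thesis
  proof (rule *[OF _ u[unfolded P_def]])
    fix g :: "'k jac" assume "g \<in> (\<Union>i\<in>S. ideal_gen (Salg (n - 1)) {ee i})"
    then obtain i where i: "i \<in> S" "g \<in> ideal_gen (Salg (n - 1)) {ee i}" by blast
    show "rho B g = 0" by (rule *[OF _ i(2)]) (use e i in auto)
  qed
qed

text \<open>Elements that only the representations in the family can see. By faithfulness an empty
  family leaves just 0, which is what the induction in the generation proof aims at.\<close>

definition IJ :: "nat set set \<Rightarrow> 'k jac set" where
  "IJ \<J> = {u \<in> Sn N. \<forall>B. idx B \<longrightarrow> B \<subseteq> N \<longrightarrow> B \<notin> \<J> \<longrightarrow> rho B u = 0}"

text \<open>Elements of p p_n vanish unless n is in B, because of the factor from p_n, and unless B
  meets S, because of the factor from p.\<close>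

definition J0 :: "nat set set" where "J0 = {B. B \<subseteq> N \<and> n \<in> B \<and> B \<inter> S \<noteq> {}}"

lemma IJ_I: "u \<in> Sn N ==> (\<And>B. idx B ==> B \<subseteq> N ==> B \<notin> \<J> ==> rho B u = 0) ==> u \<in> IJ \<J>"
  by (simp add: IJ_def)

lemma IJ_D: "u \<in> IJ \<J> ==> idx B ==> B \<subseteq> N ==> B \<notin> \<J> ==> rho B u = 0" and IJ_Sn: "u \<in> IJ \<J> ==> u \<in> Sn N"
  by (simp_all add: IJ_def)

lemma IJ_closed: "0 \<in> IJ \<J>" "u \<in> IJ \<J> ==> v \<in> IJ \<J> ==> u + v \<in> IJ \<J>" "u \<in> IJ \<J> ==> - u \<in> IJ \<J>"
  "w \<in> Sn N ==> u \<in> IJ \<J> ==> w * u \<in> IJ \<J>" "w \<in> Sn N ==> u \<in> IJ \<J> ==> u * w \<in> IJ \<J>"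
  by (auto simp: IJ_def rho_add rho_neg rho_mult intro: Sn_0 Sn_add Sn_neg Sn_mult)

lemma Fin_Sn: "u \<in> Fin (Sn N') ==> u \<in> Sn N"
  by (induction u rule: Fin.induct) (auto simp: mx_Est intro!: Sn_0 Sn_add Sn_mult Sn_Est intro: Sn_mono[OF N'_sub])

lemma GL_Sn: assumes "u \<in> GL (Sn N')" shows "u \<in> Sn N"
proof -
  have "1 + (u - 1) \<in> Sn N" using assms by (intro Sn_add Sn_1 Fin_Sn) (simp add: GL_def)
  then show ?thesis by simp
qed

lemma Fin_P_IJ: "u \<in> Fin P ==> u \<in> IJ J0"
proof (induction u rule: Fin.induct)
  case (step c u k l)
  have "c * mx k l \<in> IJ J0"
  proof (rule IJ_I)
    show "c * mx k l \<in> Sn N" unfolding mx_Est using P_sub[OF step(1)] by (auto intro!: Sn_mult Sn_Est intro: Sn_mono[OF N'_sub])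
    fix B assume B: "idx B" "B \<subseteq> N" "B \<notin> J0"
    show "rho B (c * mx k l) = 0"
    proof (cases "n \<in> B")
      case True
      then have "rho B c = 0" using B by (intro rho_P[OF step(1) B(1)]) (auto simp: J0_def)
      then show ?thesis by (simp add: rho_mult[OF B(1)])
    next
      case False
      then show ?thesis by (simp add: rho_mult[OF B(1)] mx_Est rho_Est_out[OF B(1)])
    qed
  qed
  then show ?case using step by (intro IJ_closed(2))
qed (rule IJ_closed)

lemma one_IJ_mult:
  assumes "a - 1 \<in> IJ \<J>" "b - 1 \<in> IJ \<J>" shows "a * b - 1 \<in> IJ \<J>"
proof -
  have "b \<in> Sn N" using Sn_add[OF Sn_1 IJ_Sn[OF assms(2)]] by simp
  then have "(a - 1) * b + (b - 1) \<in> IJ \<J>" using assms by (intro IJ_closed)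
  then show ?thesis by (simp add: algebra_simps)
qed

lemma one_IJ_inv:
  assumes "a - 1 \<in> IJ \<J>" "unt a" "uinv a \<in> Sn N" shows "uinv a - 1 \<in> IJ \<J>"
proof -
  have "- (uinv a * (a - 1)) \<in> IJ \<J>" using assms by (intro IJ_closed)
  then show ?thesis using assms(2) by (simp add: algebra_simps)
qed

lemma idx_J0: "J \<in> J0 ==> idx J" "J \<in> J0 ==> i \<in> J ==> idx (J - {i})"
proof -
  assume J: "J \<in> J0"
  then have f: "finite J" by (auto simp: J0_def intro: finite_subset)
  then show "idx J" using J by (auto simp: idx_def J0_def)
  obtain k where "k \<in> J" "k \<in> S" using J by (auto simp: J0_def)
  then have "k \<noteq> n" "n \<in> J" using S_N J by (auto simp: J0_def)
  then have "J - {i} \<noteq> {}" using \<open>k \<in> J\<close> by auto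
  then show "idx (J - {i})" using f by (simp add: idx_def)
qed

lemma J0_split: assumes "J \<in> J0" shows "J = insert n (J - {n})" "J - {n} \<subseteq> N'" "\<exists>k. k \<in> S \<and> k \<in> J - {n}"
  using assms S_N N_eq by (auto simp: J0_def)

text \<open>An entry c in place (p, q) lifts to \<open>lft p0\<close> times the product of matrix
  units over all indices in J. An index of J in S puts the coefficient into P, and the factor for
  each index of J makes the lift invisible to every B that does not contain J.\<close>

lemma lift_elementary:
  assumes J: "J \<in> J0" and e: "e \<in> ru.El (sc ` Rn {} (N - J))"
  shows "\<exists>w. w \<in> Er P \<and> rho J w = e \<and> w - 1 \<in> IJ {B. J \<subseteq> B}"
  using e
proof (induction e rule: ru.El.induct)
  case one
  show ?case by (rule exI[of _ 1]) (simp add: Er.one IJ_closed idx_J0[OF J])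
next
  case (step c p q g)
  have iJ: "idx J" using idx_J0[OF J] by simp
  obtain w where w: "w \<in> Er P" "rho J w = g" "w - 1 \<in> IJ {B. J \<subseteq> B}" using step by blast
  obtain p0 where p0: "p0 \<in> Lp (N - J)" "c = sc (emb p0)" using step(1) Rn_empty by blast
  define s t where "s = dec J p" and "t = dec J q"
  have st: "s \<in> Ix J" "t \<in> Ix J" "enc J s = p" "enc J t = q"
    unfolding s_def t_def using dec_Ix[OF iJ] enc_dec[OF iJ] by auto
  have "s \<noteq> t" using st step(2) by auto
  define ys where "ys = sorted_list_of_set (J - {n})"
  have ys: "set ys = J - {n}" "distinct ys" unfolding ys_def using iJ by (auto simp: idx_def)
  obtain k where k: "k \<in> S" "k \<in> J - {n}" using J0_split[OF J] by blast
  define d where "d = lft p0 * MJ ys s t"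
  have l: "lft p0 \<in> Sn N'" "lft p0 \<in> Sn (N - J)"
    using lft_Sn[OF p0(1)] Sn_mono[of "N - J" N'] J N_eq by (auto simp: J0_def)
  have d: "d \<in> P" unfolding d_def using ys J0_split[OF J] k by (intro P_l l MJ_P[of k]) auto
  define v where "v = 1 + d * mx (s n) (t n)"
  have vM: "v = 1 + lft p0 * MJ (ys @ [n]) s t" by (simp add: v_def d_def MJ_def mx_Est mult.assoc)
  have xs: "set (ys @ [n]) = J" "distinct (ys @ [n])" using ys J0_split(1)[OF J] by auto
  have v1: "v \<in> Er P"
  proof (cases "s n = t n")
    \<comment> \<open>The lift is then diagonal in the matrices over S_(n-1), though the
      multi-indices s and t differ in another coordinate. The idempotent d', the diagonal matrix
      unit at t, exhibits it as a commutator.\<close>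
    case True
    define d' where "d' = (MJ ys t t :: 'k jac)"
    have d'P: "d' \<in> P" unfolding d'_def using ys J0_split[OF J] k by (intro MJ_P[of k]) auto
    have ne: "\<not> (\<forall>i\<in>set ys. t i = s i)"
    proof
      assume a: "\<forall>i\<in>set ys. t i = s i"
      have "s = t"
      proof
        fix i show "s i = t i" using a True st(1,2) ys(1) by (cases "i \<in> J"; cases "i = n") (auto simp: Ix_def)
      qed
      then show False using \<open>s \<noteq> t\<close> by simp
    qed
    have "d * d' = d" unfolding d_def d'_def mult.assoc MJ_mult[OF ys(2)] by simp
    moreover have "d' * d = 0"
    proof -
      have "d' * lft p0 = lft p0 * d'" unfolding d'_def
        by (rule Sn_commute[OF MJ_Sn[of ys "set ys"] l(2)]) (use ys in auto)
      then have "d' * d = lft p0 * (d' * MJ ys s t)" unfolding d_def by (metis mult.assoc)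
      then show ?thesis unfolding d'_def MJ_mult[OF ys(2)] using ne by simp
    qed
    ultimately show ?thesis unfolding v_def True using commutator_diag_El[OF P_idl d d'P] El_Er by blast
  next
    case False
    then show ?thesis unfolding v_def using Er_elem[OF d] by blast
  qed
  have rl: "rho J (lft p0) = sc (emb p0)" by (rule rho_lft[OF iJ p0(1)]) blast
  have v2: "rho J v = 1 + c * rc.mx p q"
    unfolding vM rho_add rho_one[OF iJ] rho_mult[OF iJ] rho_MJ[OF iJ xs st(1,2)] st p0(2)
    rl ..
  have v3: "v - 1 \<in> IJ {B. J \<subseteq> B}"
  proof (rule IJ_I)
    show "v - 1 \<in> Sn N" unfolding vM using Sn_mono[OF N'_sub l(1)] xs J
      by (auto simp: J0_def intro!: Sn_mult MJ_Sn)
    fix B assume B: "idx B" "B \<notin> {B. J \<subseteq> B}"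
    then obtain i where "i \<in> J" "i \<notin> B" by blast
    then have "rho B (MJ (ys @ [n]) s t) = (0 :: 'k om rcf)" using xs by (intro rho_MJ_out[OF B(1), of i]) auto
    then show "rho B (v - 1) = 0" unfolding vM by (simp add: rho_mult[OF B(1)])
  qed
  show ?case
  proof (intro exI conjI)
    show "v * w \<in> Er P" using v1 w(1) by (rule Er_mult)
    show "rho J (v * w) = (1 + c * rc.mx p q) * g" by (simp add: rho_mult[OF iJ] v2 w)
    show "v * w - 1 \<in> IJ {B. J \<subseteq> B}" using v3 w by (intro one_IJ_mult)
  qed
qed

end

section \<open>The elements theta and mu as diagonal matrices over S_(n-1)\<close>

context jacobson_ideal begin

lemma ee_mx: "ee n = mx 0 0" by (simp add: ee_Est mx_Est)

text \<open>This is theta for the set {l, j}. By \<open>theta_form\<close> a larger set only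
  multiplies the difference from 1 by idempotents.\<close>

definition wlj :: "nat \<Rightarrow> nat \<Rightarrow> 'k jac" where
  "wlj l j = (1 + (Y l - 1) * ee j) * (1 + (X j - 1) * ee l)"

lemma wlj_Sn: "l \<in> V ==> j \<in> V ==> wlj l j \<in> Sn V"
  unfolding wlj_def by (intro Sn_mult Sn_add Sn_diff Sn_1 Sn_XY Sn_ee)

lemma XY_commute:
  assumes "l \<noteq> j"
  shows "X l * X j = X j * (X l :: 'k jac)" "X l * Y j = Y j * (X l :: 'k jac)"
    "Y l * X j = X j * (Y l :: 'k jac)" "Y l * Y j = Y j * (Y l :: 'k jac)"
  by (rule Sn_commute[of _ "{l}" _ "{j}"]; use assms in \<open>auto intro: Sn_XY\<close>)+

lemma wlj_inverse: assumes "l \<noteq> j" shows "wlj l j * wlj j l = 1"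
  using hyp_product_inverse(1)[OF YX(1)[of l] YX(1)[of j] XY_commute[OF assms]]
  unfolding wlj_def ee_def .

lemma wlj_P: assumes "l \<in> S" "j \<in> S" shows "wlj l j - 1 \<in> P"
proof -
  have N: "l \<in> N'" "j \<in> N'" using assms S_N' by auto
  have a: "(Y l - 1) * ee j \<in> P" "(X j - 1) * ee l \<in> P"
    by (rule P_l[OF Sn_diff[OF Sn_XY(2)[OF N(1)] Sn_1] ee_P[OF assms(2)]], rule P_l[OF Sn_diff[OF Sn_XY(1)[OF N(2)] Sn_1] ee_P[OF assms(1)]])
  have "(Y l - 1) * ee j + (X j - 1) * ee l + (Y l - 1) * ee j * ((X j - 1) * ee l) \<in> P"
    by (intro P_add a P_l P_sub)
  then show ?thesis unfolding wlj_def by (simp add: algebra_simps)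
qed

lemma eI_n: assumes "I \<subseteq> N'" shows "eI (insert n I) = eI I * mx 0 0"
proof -
  have f: "finite I" "n \<notin> I" using assms finite_subset[OF _ N_fin(2)] by auto
  show ?thesis unfolding eI_insert[OF f] ee_mx using C_mx[OF eI_Sn[OF f(1) assms]] by simp
qed

lemma theta_form:
  assumes I: "I \<subseteq> N'" "l \<in> N'" "j \<in> N'" "l \<notin> I" "j \<notin> I" "l \<noteq> j"
  shows "theta l j (insert l (insert j (insert n I))) = 1 + (wlj l j - 1) * eI I * mx 0 0"
proof -
  have f: "finite I" using I finite_subset[OF _ N_fin(2)] by auto
  have n: "l \<noteq> n" "j \<noteq> n" using I by auto
  define g where "g = (eI I * mx 0 0 :: 'k jac)"
  define a b where "a = (Y l - 1) * (ee j :: 'k jac)" and "b = (X j - 1) * (ee l :: 'k jac)"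
  have 1: "insert l (insert j (insert n I)) - {l} = insert j (insert n I)"
    "insert l (insert j (insert n I)) - {j} = insert l (insert n I)" using I n by auto
  have e: "eI (insert j (insert n I)) = ee j * g" "eI (insert l (insert n I)) = ee l * g"
    unfolding g_def eI_n[OF I(1), symmetric] using f I n by (auto intro!: eI_insert)
  have gg: "g * g = g" unfolding g_def eI_n[OF I(1), symmetric] using f by simp
  have "b \<in> Sn {l, j}" unfolding b_def by (intro Sn_mult Sn_diff Sn_XY Sn_1 Sn_ee) auto
  then have bg: "b * g = g * b"
    unfolding g_def eI_n[OF I(1), symmetric] using f I n by (intro eI_commute[of _ _ "{l, j}"]) auto
  have "theta l j (insert l (insert j (insert n I))) = (1 + a * g) * (1 + b * g)"
    unfolding theta_def 1 e a_def b_def by (simp only: mult.assoc)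
  also have "\<dots> = 1 + (a + b) * g + a * (g * b) * g" by (simp add: algebra_simps)
  also have "a * (g * b) * g = a * b * g" unfolding bg[symmetric] mult.assoc gg ..
  also have "1 + (a + b) * g + a * b * g = 1 + (wlj l j - 1) * g"
    unfolding wlj_def a_def[symmetric] b_def[symmetric] by (simp add: algebra_simps)
  finally show ?thesis by (simp add: g_def mult.assoc)
qed

lemma scal_commute: "scal c * u = u * (scal c :: 'k jac)"
  by (rule Sn_commute[OF Sn_scal[of c "{}"], of _ UNIV]) (auto simp: Sn_def)

lemma scal_hom: "scal 1 = (1 :: 'k jac)" "scal c * scal d = (scal (c * d) :: 'k jac)"
  by (simp_all add: scal_def mult_single)

lemma mu_form: assumes "I \<subseteq> N'" shows "mu (insert n I) c = 1 + (scal c - 1) * eI I * mx 0 0"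
  unfolding mu_def eI_n[OF assms] by (simp add: algebra_simps)

text \<open>Inverses of theta are listed as generators; the elements mu and the group
  \<open>Er P\<close> are closed under inverses, so H is a group (\<open>H_inv\<close>).\<close>

inductive_set H :: "'k jac set" where
  Er: "e \<in> Er P ==> e \<in> H"
| theta: "i \<in> S ==> j \<in> S ==> j < i ==> theta i j {i, j, n} \<in> H"
| theta_inv: "i \<in> S ==> j \<in> S ==> j < i ==> uinv (theta i j {i, j, n}) \<in> H"
| mu: "k \<in> S ==> c \<noteq> 0 ==> mu {k, n} c \<in> H"
| mult: "u \<in> H ==> v \<in> H ==> u * v \<in> H"

lemma diag_mult:
  assumes "q \<in> Sn N'" "q' \<in> Sn N'"
  shows "(1 + q * mx k k) * (1 + q' * mx k k) = 1 + (q + q' + q * q') * mx k k"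
  using assms by (simp add: algebra_simps mx_mult mx_mult_assoc mx_coeff)

lemma diag_GL:
  assumes "q \<in> P" "q' \<in> Sn N'" "(1 + q) * (1 + q') = 1" "(1 + q') * (1 + q) = 1"
  shows "1 + q * mx k k \<in> GL P" "uinv (1 + q * mx k k) = 1 + q' * mx k k"
proof -
  have c: "q \<in> Sn N'" using P_sub assms by simp
  have e: "q + q' + q * q' = 0" "q' + q + q' * q = 0" using assms(3,4) by (simp_all add: algebra_simps)
  have i: "(1 + q * mx k k) * (1 + q' * mx k k) = 1" "(1 + q' * mx k k) * (1 + q * mx k k) = 1"
    unfolding diag_mult[OF c assms(2)] diag_mult[OF assms(2) c] e by simp_all
  show "1 + q * mx k k \<in> GL P" by (rule GLI[OF _ _ i]) (use Fin_mx assms in auto)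
  show "uinv (1 + q * mx k k) = 1 + q' * mx k k" using i by (rule uinv_eq)
qed

lemma theta3:
  assumes "l \<in> S" "j \<in> S" "l \<noteq> j"
  shows "theta l j {l, j, n} = 1 + (wlj l j - 1) * mx 0 0" "theta l j {l, j, n} \<in> GL P"
    "uinv (theta l j {l, j, n}) = (theta j l {j, l, n} :: 'k jac)"
proof -
  have f: "theta l j {l, j, n} = 1 + (wlj l j - 1) * mx 0 0" if "l \<in> S" "j \<in> S" "l \<noteq> j" for l j
    using theta_form[of "{}" l j] that S_N' by auto
  show 1: "theta l j {l, j, n} = 1 + (wlj l j - 1) * mx 0 0" using f assms by blast
  have i: "(1 + (wlj l j - 1)) * (1 + (wlj j l - 1)) = 1" "(1 + (wlj j l - 1)) * (1 + (wlj l j - 1)) = 1"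
    using wlj_inverse assms by simp_all
  have w: "wlj l j - 1 \<in> P" "wlj j l - 1 \<in> Sn N'" using wlj_P assms P_sub by auto
  show "theta l j {l, j, n} \<in> GL P" unfolding 1 by (rule diag_GL(1)[OF w i])
  show "uinv (theta l j {l, j, n}) = (theta j l {j, l, n} :: 'k jac)"
    unfolding 1 f[OF assms(2,1) assms(3)[symmetric]] by (rule diag_GL(2)[OF w i])
qed

text \<open>If I meets S, the idempotent e_I lies in P and theta comes from a commutator of two
  hyperbolic lifts. If I is empty, theta is a generator or the inverse of the one with exchanged
  indices. Otherwise l and j are in S, and an index of I supplies the idempotent to be
  absorbed.\<close>

lemma theta_H:
  assumes I: "I \<subseteq> N'" "l \<in> N'" "j \<in> N'" "l \<notin> I" "j \<notin> I" "l \<noteq> j" and S: "I \<inter> S \<noteq> {} \<or> l \<in> S \<and> j \<in> S"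
  shows "theta l j (insert l (insert j (insert n I))) \<in> H"
proof -
  have f: "finite I" using I finite_subset[OF _ N_fin(2)] by auto
  note cc = XY_commute[OF I(6)]
  have w: "(1 + (Y l - 1) * (1 - X j * Y j)) * (1 + (X j - 1) * (1 - X l * Y l)) = wlj l j"
    by (simp add: wlj_def ee_def)
  consider (a) "I \<inter> S \<noteq> {}" | (b) "l \<in> S" "j \<in> S" "I = {}" | (c) i where "l \<in> S" "j \<in> S" "i \<in> I" using S by blast
  then show ?thesis
  proof cases
    case a
    then have g: "eI I \<in> P" using eI_P I by blast
    have x: "X l \<in> Sn N'" "Y l \<in> Sn N'" "X j \<in> Sn N'" "Y j \<in> Sn N'" using I Sn_XY by auto
    have c: "X l * eI I = eI I * (X l :: 'k jac)" "Y l * eI I = eI I * (Y l :: 'k jac)"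
      "X j * eI I = eI I * (X j :: 'k jac)" "Y j * eI I = eI I * (Y j :: 'k jac)"
      using eI_commute[OF f Sn_XY(1)[of l "{l}"]] eI_commute[OF f Sn_XY(2)[of l "{l}"]]
        eI_commute[OF f Sn_XY(1)[of j "{j}"]] eI_commute[OF f Sn_XY(2)[of j "{j}"]] I by auto
    show ?thesis unfolding theta_form[OF I]
      using hyp_commutator_El[OF P_idl g eI_idem[OF f] x(1,2) YX(1) x(3,4) YX(1) c cc, of 0]
      unfolding w by (intro H.Er El_Er)
  next
    case b
    show ?thesis
    proof (cases "j < l")
      case True
      then show ?thesis using H.theta[OF b(1,2)] b by simp
    next
      case False
      then have "theta l j {l, j, n} = (uinv (theta j l {j, l, n}) :: 'k jac)" using theta3(3)[of j l] b I(6) by simp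
      then show ?thesis using H.theta_inv[OF b(2,1)] False I(6) b by simp
    qed
  next
    case c
    have iN: "i \<in> N'" "i \<noteq> l" "i \<noteq> j" using c I by auto
    define h where "h = (eI (I - {i}) :: 'k jac)"
    have hS: "h \<in> Sn (I - {i})" "h \<in> Sn N'" unfolding h_def using f I by (auto intro!: eI_Sn)
    have hh: "h * h = h" unfolding h_def using f by simp
    have hw: "wlj l j * h = h * wlj l j" "wlj j l * h = h * wlj j l"
      unfolding h_def using f I by (auto intro!: eI_commute[of _ _ "{l, j}"] wlj_Sn)
    define q q' where "q = (wlj l j - 1) * h" and "q' = (wlj j l - 1) * h"
    have qP: "q \<in> P" "q' \<in> P" unfolding q_def q'_def using wlj_P c hS by (auto intro!: P_r)
    have qq: "q * q' = - q - q'" "q' * q = - q - q'"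
    proof -
      have *: "(a - 1) * h * ((b - 1) * h) = - ((a - 1) * h) - (b - 1) * h"
        if "a * b = 1" "b * h = h * b" for a b
      proof -
        have "(a - 1) * h * ((b - 1) * h) = (a - 1) * (h * (b - 1)) * h" by (simp only: mult.assoc)
        also have "h * (b - 1) = (b - 1) * h" using that by (simp add: algebra_simps)
        also have "(a - 1) * ((b - 1) * h) * h = (a * b - a - b + 1) * (h * h)" by (simp add: algebra_simps)
        finally have "(a - 1) * h * ((b - 1) * h) = (a * b - a - b + 1) * (h * h)" .
        then show ?thesis unfolding that hh by (simp add: algebra_simps mult_2)
      qed
      show "q * q' = - q - q'" "q' * q = - q - q'"
        unfolding q_def q'_def using *[OF wlj_inverse[OF I(6)] hw(2)] *[OF wlj_inverse[OF I(6)[symmetric]] hw(1)]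
        by simp_all
    qed
    have q'S: "q' \<in> Sn (- {i})" unfolding q'_def
      using iN hS(1) by (auto intro!: Sn_mult Sn_diff Sn_1 wlj_Sn intro: Sn_mono[of "I - {i}"])
    have xq: "X i * q' = q' * X i" "Y i * q' = q' * Y i"
      using Sn_commute[OF _ q'S, of _ "{i}"] by (auto intro: Sn_XY)
    have "1 + q * (1 - X i * Y i) * mx 0 0 \<in> Er P"
      by (rule absorb_idempotent_Er[OF P_idl qP qq _ _ YX(1) xq]) (auto intro: Sn_XY iN)
    also have "q * (1 - X i * Y i) = (wlj l j - 1) * eI I"
    proof -
      have "h * ee i = ee i * h" using Sn_commute[OF hS(1) Sn_ee[of i "{i}"]] by simp
      then show ?thesis unfolding q_def eI_remove[OF f c(3)] h_def ee_def[symmetric] by (simp add: mult.assoc)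
    qed
    finally show ?thesis unfolding theta_form[OF I] by (rule H.Er)
  qed
qed

lemma mu_GL:
  assumes I: "I \<subseteq> N'" "I \<inter> S \<noteq> {}" and c: "c \<noteq> 0"
  shows "mu (insert n I) c \<in> GL P" "uinv (mu (insert n I) c) = mu (insert n I) (inverse c)"
    "mu (insert n I) c * mu (insert n I) d = mu (insert n I) (c * d)"
proof -
  have f: "finite I" using I finite_subset[OF _ N_fin(2)] by auto
  have g: "eI I \<in> P" using eI_P I by blast
  define m where "m = (\<lambda>c. (scal c - 1) * (eI I :: 'k jac))"
  have mP: "m c \<in> P" for c unfolding m_def by (intro P_l g Sn_diff Sn_scal Sn_1)
  have mm: "m c + m d + m c * m d = m (c * d)" for c d
  proof -
    have "m c * m d = (scal c - 1) * (eI I * (scal d - 1)) * eI I" by (simp add: m_def mult.assoc)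
    also have "eI I * (scal d - 1) = (scal d - 1) * (eI I :: 'k jac)" using scal_commute[of d "eI I"] by (simp add: algebra_simps)
    also have "(scal c - 1) * ((scal d - 1) * eI I) * eI I = (scal c - 1) * (scal d - 1) * (eI I * (eI I :: 'k jac))" by (simp only: mult.assoc)
    finally have "m c * m d = (scal (c * d) - scal c - scal d + 1) * eI I"
      unfolding eI_idem[OF f] by (simp add: algebra_simps scal_hom(2)[symmetric])
    then show ?thesis unfolding m_def by (simp add: algebra_simps)
  qed
  have F: "mu (insert n I) c = 1 + m c * mx 0 0" for c unfolding m_def by (rule mu_form[OF I(1)])
  have "m 1 = 0" by (simp add: m_def scal_hom)
  then have i: "(1 + m c) * (1 + m (inverse c)) = 1" "(1 + m (inverse c)) * (1 + m c) = 1"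
    using mm[of c "inverse c"] mm[of "inverse c" c] c by (simp_all add: algebra_simps)
  show "mu (insert n I) c \<in> GL P" unfolding F by (rule diag_GL(1)[OF mP P_sub[OF mP] i])
  show "uinv (mu (insert n I) c) = mu (insert n I) (inverse c)" unfolding F by (rule diag_GL(2)[OF mP P_sub[OF mP] i])
  show "mu (insert n I) c * mu (insert n I) d = mu (insert n I) (c * d)"
    unfolding F diag_mult[OF P_sub[OF mP] P_sub[OF mP]] mm ..
qed

text \<open>One index of S suffices to have the coefficient in P; any further index i contributes
  the factor 1 - x_i y_i that \<open>absorb_idempotent_Er\<close> makes trivial. Only the sets {k,
  n} are left as generators.\<close>

lemma mu_H:
  assumes I: "I \<subseteq> N'" "I \<inter> S \<noteq> {}" and c: "c \<noteq> 0"
  shows "mu (insert n I) c \<in> H"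
proof -
  have f: "finite I" using I finite_subset[OF _ N_fin(2)] by auto
  obtain k where k: "k \<in> I" "k \<in> S" using I by blast
  show ?thesis
  proof (cases "I = {k}")
    case True
    then show ?thesis using H.mu[OF k(2) c] by (simp add: insert_commute)
  next
    case False
    then obtain i where i: "i \<in> I" "i \<noteq> k" using k by blast
    define h where "h = (eI (I - {i}) :: 'k jac)"
    have h: "h \<in> P" unfolding h_def using k i I by (intro eI_P[of k]) auto
    have hS: "h \<in> Sn (I - {i})" unfolding h_def using f by (auto intro!: eI_Sn)
    have hh: "h * h = h" unfolding h_def using f by simp
    define m where "m = (\<lambda>c. (scal c - 1) * h)"
    have mP: "m c \<in> P" for c unfolding m_def by (intro P_l h Sn_diff Sn_scal Sn_1)
    have mm: "m c * m d = - m c - m d" if "c * d = 1" for c d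
    proof -
      have "m c * m d = (scal c - 1) * (h * (scal d - 1)) * h" by (simp add: m_def mult.assoc)
      also have "h * (scal d - 1) = (scal d - 1) * h" using scal_commute[of d h] by (simp add: algebra_simps)
      also have "(scal c - 1) * ((scal d - 1) * h) * h = (scal c - 1) * (scal d - 1) * (h * h)" by (simp only: mult.assoc)
      finally have "m c * m d = (scal (c * d) - scal c - scal d + 1) * h"
        unfolding hh by (simp add: algebra_simps scal_hom(2)[symmetric])
      then show ?thesis unfolding that scal_hom unfolding m_def by (simp add: algebra_simps mult_2)
    qed
    have x: "X i * m (inverse c) = m (inverse c) * X i" "Y i * m (inverse c) = m (inverse c) * Y i"
      unfolding m_def
      by (rule Sn_commute[of _ "{i}" _ "I - {i}"]; auto intro!: Sn_XY Sn_mult Sn_diff Sn_scal Sn_1 hS)+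
    have iN: "i \<in> N'" using i I by blast
    have "m c * m (inverse c) = - m c - m (inverse c)" "m (inverse c) * m c = - m c - m (inverse c)"
      using mm[of c "inverse c"] mm[of "inverse c" c] c by simp_all
    then have "1 + m c * (1 - X i * Y i) * mx 0 0 \<in> Er P"
      by (rule absorb_idempotent_Er[OF P_idl mP mP _ _ _ _ YX(1) x]) (auto intro: Sn_XY iN)
    also have "m c * (1 - X i * Y i) = (scal c - 1) * eI I"
    proof -
      have "h * ee i = ee i * h" using Sn_commute[OF hS(1) Sn_ee[of i "{i}"]] by simp
      then show ?thesis unfolding m_def eI_remove[OF f i(1)] h_def ee_def[symmetric] by (simp add: mult.assoc)
    qed
    finally show ?thesis unfolding mu_form[OF I(1)] by (rule H.Er)
  qed
qed

lemma kn: "k \<in> S ==> {k, n} = insert n {k}" "k \<in> S ==> {k} \<subseteq> N' \<and> {k} \<inter> S \<noteq> {}"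
  using S_N' by auto

lemma H_GL: "h \<in> H ==> h \<in> GL P"
proof (induction h rule: H.induct)
  case (Er e)
  then show ?case by (rule Er_GL[OF P_idl])
next
  case (theta i j)
  then show ?case by (intro theta3) auto
next
  case (theta_inv i j)
  then show ?case by (intro GL_inv[OF P_idl] theta3) auto
next
  case (mu k c)
  then show ?case using mu_GL(1)[of "{k}" c] kn[of k] by simp
next
  case (mult u v)
  then show ?case by (intro GL_mult[OF P_idl])
qed

lemma H_inv: "h \<in> H ==> uinv h \<in> H"
proof (induction h rule: H.induct)
  case (Er e)
  then show ?case by (intro H.Er Er_inv[OF P_idl])
next
  case (theta i j)
  then show ?case by (intro H.theta_inv)
next
  case (theta_inv i j)
  then have "unt (theta i j {i, j, n} :: 'k jac)" using theta3(2)[of i j] GL_unt by blast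
  then show ?case using H.theta[OF theta_inv] by simp
next
  case (mu k c)
  then show ?case using mu_GL(2)[of "{k}" c] kn[of k] H.mu[of k "inverse c"] by simp
next
  case (mult u v)
  then show ?case using H_GL GL_unt by (metis H.mult uinv_mult)
qed

end

section \<open>Generation\<close>

text \<open>The Fredholm index is invariant under finite perturbations, and units have index zero.\<close>

lemma index_zero:
  fixes U W W' :: "'c::field rcf"
  assumes U: "unt U" and UW: "U - W \<in> ru.Fin (range sc)"
  shows "W' * W = 1 \<longleftrightarrow> W * W' = 1"
proof
  assume a: "W' * W = 1"
  have 1: "W' * U - 1 \<in> ru.Fin (range sc)" using Fin_ideal(1)[OF UW, of W'] a by (simp add: algebra_simps)
  have 2: "uinv U * W - 1 \<in> ru.Fin (range sc)"
    using ru.Fin_neg[OF ru.idl_C Fin_ideal(1)[OF UW, of "uinv U"]] U by (simp add: algebra_simps)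
  have "(W' * U) * (uinv U * W) = 1" using U a by (simp add: mult.assoc)
  then have 3: "uinv U * W * (W' * U) = 1" by (rule one_sided_inverse[OF 1 2])
  have "W * W' = U * (uinv U * W * (W' * U)) * uinv U" using U by (simp add: mult.assoc)
  then show "W * W' = 1" unfolding 3 using U by simp
next
  assume a: "W * W' = 1"
  have 1: "U * W' - 1 \<in> ru.Fin (range sc)" using Fin_ideal(2)[OF UW, of W'] a by (simp add: algebra_simps)
  have 2: "W * uinv U - 1 \<in> ru.Fin (range sc)"
    using ru.Fin_neg[OF ru.idl_C Fin_ideal(2)[OF UW, of "uinv U"]] U by (simp add: algebra_simps)
  have "(W * uinv U) * (U * W') = 1" using U a by (simp add: mult.assoc)
  then have 3: "U * W' * (W * uinv U) = 1" by (rule one_sided_inverse[OF 2 1])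
  have "W' * W = uinv U * (U * W' * (W * uinv U)) * U" using U by (simp add: mult.assoc)
  then show "W' * W = 1" unfolding 3 using U by simp
qed

definition dg :: "nat set \<Rightarrow> 'k::field om \<Rightarrow> 'k om rcf" where
  "dg J d = 1 + (sc d - 1) * rc.mx (enc J (\<lambda>_. 0)) (enc J (\<lambda>_. 0))"

lemma fixes c d :: "'k::field om"
  shows dg_mult: "dg J c * dg J d = dg J (c * d)" and dg_one [simp]: "dg J 1 = (1 :: 'k om rcf)" and dt_dg: "dt (dg J d) = d"
proof -
  let ?m = "rc.mx (enc J (\<lambda>_. 0)) (enc J (\<lambda>_. 0)) :: 'k om rcf"
  have m: "?m * ?m = ?m" "?m * (?m * u) = ?m * u" for u by (simp_all add: rc.mx_mult flip: mult.assoc)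
  have s: "?m * sc a = sc a * ?m" "?m * (sc a * u) = sc a * (?m * u)" for a u
    by (simp_all add: sc_commute flip: mult.assoc) (simp add: sc_commute mult.assoc)
  show "dg J c * dg J d = dg J (c * d)" unfolding dg_def sc_hom by (simp add: algebra_simps m s)
  show "dg J 1 = (1 :: 'k om rcf)" by (simp add: dg_def sc_hom)
  show "dt (dg J d) = d" unfolding dg_def by (rule dt_diag)
qed

lemma dg_Fin: assumes C: "subring C" "d \<in> C" shows "dg J d - 1 \<in> ru.Fin (sc ` C)"
proof -
  have "sc (d - 1) * rc.mx (enc J (\<lambda>_. 0)) (enc J (\<lambda>_. 0)) \<in> ru.Fin (sc ` C)"
    by (rule ru.Fin_mx, rule imageI, rule subringD(6)[OF C(1)]) (use C subringD(2)[OF C(1)] in auto)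
  then show ?thesis by (simp add: dg_def sc_hom)
qed

lemma rho_unt: assumes "idx J" "unt u" shows "unt (rho J u)" "uinv (rho J u) = rho J (uinv u)"
proof -
  have "rho J u * rho J (uinv u) = 1" "rho J (uinv u) * rho J u = 1"
    using assms by (simp_all flip: rho_mult[OF assms(1)])
  then show "unt (rho J u)" "uinv (rho J u) = rho J (uinv u)" by (rule untI, rule uinv_eq)
qed

text \<open>In the first factor y_l becomes the inverse of t_l on the corner e_J. The second factor
  becomes 1, since its idempotent contains e_l and l lies outside J.\<close>

lemma rho_theta:
  assumes J: "idx J" "l \<notin> J" "j \<in> J"
  shows "rho J (theta l j (insert l J)) = dg J (lmon (psingle l (-1)) :: 'k::field om)"
proof -
  have lj: "l \<noteq> j" and f: "finite (insert l J - {j})" using J by (auto simp: idx_def)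
  have "insert l J - {l} = J" using J by auto
  moreover have "rho J (eI (insert l J - {j})) = (0 :: 'k om rcf)" using J lj by (intro rho_eI_out[OF J(1) f, of l]) auto
  ultimately show ?thesis unfolding theta_def rho_mult[OF J(1)] rho_add rho_diff rho_one[OF J(1)] dg_def
    rho_eI[OF J(1)] rho_X[OF J(1,2)] by (simp add: rho_eI[OF J(1)])
qed

lemma theta_out:
  assumes B: "idx B" and J: "finite J" "l \<noteq> j" and "\<not> J - {l} \<subseteq> B" "\<not> J - {j} \<subseteq> B"
  shows "rho B (theta l j J) = (1 :: 'k::field om rcf)"
proof -
  obtain i i' where i: "i \<in> J - {l}" "i \<notin> B" "i' \<in> J - {j}" "i' \<notin> B" using assms by blast
  have "rho B (eI (J - {l})) = (0 :: 'k om rcf)" "rho B (eI (J - {j})) = (0 :: 'k om rcf)"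
    using rho_eI_out[OF B _ i(1,2)] rho_eI_out[OF B _ i(3,4)] J by auto
  then show ?thesis unfolding theta_def rho_mult[OF B] rho_add rho_diff rho_one[OF B] by simp
qed

lemma rho_scal: "idx J ==> rho J (scal c) = sc (embk c)"
  by (simp add: scal_def rho_single rmon_zero)

lemma rho_mu: assumes "idx J" shows "rho J (mu J c) = dg J (embk c)"
  unfolding mu_def rho_diff rho_add rho_mult[OF assms] rho_one[OF assms] rho_eI[OF assms] rho_scal[OF assms] dg_def
  by (simp add: algebra_simps)

lemma mu_out: assumes B: "idx B" "finite J" "\<not> J \<subseteq> B" shows "rho B (mu J c) = (1 :: 'k::field om rcf)"
proof -
  obtain i where "i \<in> J" "i \<notin> B" using assms by blast
  then have "rho B (eI J) = (0 :: 'k om rcf)" using rho_eI_out[OF B(1,2)] by blast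
  then show ?thesis unfolding mu_def rho_diff rho_add rho_mult[OF B(1)] rho_one[OF B(1)] by simp
qed

context jacobson_ideal begin

text \<open>If no J + l - j is in the family, then a and the explicit element 1 + (q - 1) e_J agree up to a
  finite matrix under the representation for J + l, and the exponent of t_l is an index.\<close>

lemma exponent_zero:
  fixes a :: "'k jac" and c :: 'k
  assumes J: "J \<in> J0" and l: "l \<in> N - J" and a: "a \<in> Sn N" "unt a" "rho J a = dg J (emb (psingle \<mu> c))"
    and c: "c \<noteq> 0" and mu: "pkeys \<mu> \<subseteq> N - J"
    and z: "\<And>j. j \<in> J ==> rho (insert l J - {j}) (a - 1) = 0"
  shows "plookup \<mu> l = 0"
proof (rule ccontr)
  assume nz: "plookup \<mu> l \<noteq> 0"
  define k where "k = plookup \<mu> l"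
  define K where "K = insert l J"
  have iJ: "idx J" using idx_J0[OF J] by simp
  have iK: "idx K" using iJ by (simp add: K_def idx_def)
  define \<mu>0 where "\<mu>0 = \<mu> - psingle l k"
  have keys0: "pkeys \<mu>0 \<subseteq> N - K"
  proof
    fix i assume "i \<in> pkeys \<mu>0"
    then have "plookup \<mu> i - plookup (psingle l k) i \<noteq> 0"
      by (simp add: \<mu>0_def in_keys_iff lookup_minus)
    then have "i \<noteq> l \<and> i \<in> pkeys \<mu>"
      by (auto simp: k_def lookup_single in_keys_iff when_def split: if_splits)
    then show "i \<in> N - K" using mu by (auto simp: K_def)
  qed
  define p p' where "p = lft (psingle \<mu>0 c)" and "p' = lft (psingle (- \<mu>0) (inverse c))"
  have Lp: "psingle \<mu>0 c \<in> Lp (N - K)" "psingle (- \<mu>0) (inverse c) \<in> Lp (N - K)"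
    using keys0 by (auto intro!: Lp_single simp: in_keys_iff)
  define s s' where "s = emb (psingle \<mu>0 c)" and "s' = emb (psingle (- \<mu>0) (inverse c))"
  have ss: "s * s' = 1" "s' * s = 1"
    unfolding s_def s'_def emb_hom(6)[symmetric] using c by (simp_all add: mult_single emb_hom)
  have pK: "rho K p = sc s" "rho K p' = sc s'" unfolding p_def p'_def s_def s'_def
    using rho_lft[OF iK Lp(1)] rho_lft[OF iK Lp(2)] by auto
  have pJ: "rho J p = sc s" unfolding p_def s_def
    by (rule rho_lft[OF iJ Lp(1)]) (auto simp: K_def)
  \<comment> \<open>x represents the k-th power of t_l for either sign of k, and y the opposite
    power; one of x y and y x is 1.\<close>
  define x y where "x = (X l ^ nat k * Y l ^ nat (- k) :: 'k jac)" and "y = (X l ^ nat (- k) * Y l ^ nat k :: 'k jac)"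
  have lJ: "l \<notin> J" using l by simp
  have "rho J x = sc (lmon (psingle l k))"
  proof -
    have pw: "rho J (u ^ m) = rho J u ^ m" for u :: "'k jac" and m
      by (induction m) (simp_all add: rho_mult[OF iJ] rho_one[OF iJ])
    have "lmon (psingle l (int m)) = (lmon (psingle l 1) ^ m :: 'k om)"
      "lmon (psingle l (- int m)) = (lmon (psingle l (-1)) ^ m :: 'k om)" for m
    proof -
      show "lmon (psingle l (int m)) = (lmon (psingle l 1) ^ m :: 'k om)" by (rule single_nat_power)
      have "lmon (psingle l (- int m)) = inverse (lmon (psingle l (int m)) :: 'k om)"
        "lmon (psingle l (-1)) = inverse (lmon (psingle l 1) :: 'k om)"
        unfolding mon_uminus[symmetric] by (simp_all add: single_uminus)
      then show "lmon (psingle l (- int m)) = (lmon (psingle l (-1)) ^ m :: 'k om)"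
        by (simp add: single_nat_power power_inverse)
    qed
    note e = this
    show ?thesis
    proof (cases "k \<ge> 0")
      case True
      then have "int (nat k) = k" "nat (- k) = 0" by auto
      then show ?thesis unfolding x_def rho_mult[OF iJ] pw rho_X[OF iJ lJ] using e(1)[of "nat k"] by (simp add: sc_power)
    next
      case False
      then have "- int (nat (- k)) = k" "nat k = 0" by auto
      then show ?thesis unfolding x_def rho_mult[OF iJ] pw rho_X[OF iJ lJ] using e(2)[of "nat (- k)"] by (simp add: sc_power)
    qed
  qed
  moreover have "emb (psingle \<mu> c) = s * lmon (psingle l k)"
    unfolding s_def lmon_def emb_hom(6)[symmetric] by (simp add: mult_single \<mu>0_def)
  ultimately have px: "rho J (p * x) = sc (emb (psingle \<mu> c))" by (simp add: rho_mult[OF iJ] pJ sc_hom)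
  \<comment> \<open>An explicit element with the same image as a under \<open>rho J\<close>; w' is
    its inverse up to the defect of x and y on the corner.\<close>
  define w w' where "w = 1 + (p * x - 1) * eI J" and "w' = 1 + (p' * y - 1) * eI J"
  have fJ: "finite J" using iJ by (simp add: idx_def)
  have "rho J w = rho J a" unfolding w_def rho_add rho_one[OF iJ] rho_mult[OF iJ, of "p * x - 1"] rho_diff px rho_eI[OF iJ] a(3) dg_def ..
  then have "rho J (a - w) = 0" by (simp add: rho_diff)
  have pS: "p \<in> Sn N" "p' \<in> Sn N" unfolding p_def p'_def using lft_Sn[OF Lp(1)] lft_Sn[OF Lp(2)] by (auto intro: Sn_mono[of "N - K"])
  have xS: "x \<in> Sn {l}" "y \<in> Sn {l}" unfolding x_def y_def by (auto intro!: Sn_mult Sn_pow Sn_XY)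
  have JN: "J \<subseteq> N" "l \<in> N" using J l by (auto simp: J0_def)
  have wS: "w \<in> Sn N" unfolding w_def using pS xS JN by (intro Sn_add Sn_1 Sn_mult Sn_diff eI_Sn fJ) (auto intro: Sn_mono[of "{l}"])
  have fin: "rho K (a - w) \<in> ru.Fin (sc ` Rn {} (N - K))"
  proof (rule rho_finite[OF iK])
    show "a - w \<in> Sn N" using a wS by (intro Sn_diff)
    fix i assume i: "i \<in> K"
    show "idx (K - {i}) \<and> rho (K - {i}) (a - w) = 0"
    proof (cases "i = l")
      case True
      then have "K - {i} = J" using lJ by (auto simp: K_def)
      then show ?thesis using iJ \<open>rho J (a - w) = 0\<close> by simp
    next
      case False
      then have iJ': "i \<in> J" using i by (simp add: K_def)
      have iB: "idx (K - {i})" using False fJ by (auto simp: idx_def K_def)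
      have "rho (K - {i}) (eI J) = (0 :: 'k om rcf)" by (rule rho_eI_out[OF iB fJ iJ']) simp
      then have "rho (K - {i}) w = 1" unfolding w_def by (simp add: rho_add rho_mult[OF iB] rho_one[OF iB])
      moreover have "rho (K - {i}) a = 1" using z[OF iJ'] by (simp add: rho_diff rho_one[OF iB] K_def[symmetric])
      ultimately show ?thesis using iB by (simp add: rho_diff)
    qed
  qed
  then have fin': "rho K a - rho K w \<in> ru.Fin (range sc)"
    using ru.Fin_mono[of "sc ` Rn {} (N - K)" "range sc"] by (auto simp: rho_diff)
  note ind = index_zero[OF rho_unt(1)[OF iK a(2)] fin', of "rho K w'"]
  define e where "e = (rho K (eI J) :: 'k om rcf)"
  define xx yy where "xx = (rho K x :: 'k om rcf)" and "yy = (rho K y :: 'k om rcf)"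
  have ee: "e * e = e" unfolding e_def rho_mult[OF iK, symmetric] using fJ by simp
  have "x * eI J = eI J * x" "y * eI J = eI J * y" using eI_commute[OF fJ xS(1)] eI_commute[OF fJ xS(2)] lJ by auto
  then have xe: "xx * e = e * xx" "yy * e = e * yy" unfolding xx_def yy_def e_def by (simp_all flip: rho_mult[OF iK])
  have W: "rho K w = 1 + (sc s * xx - 1) * e" "rho K w' = 1 + (sc s' * yy - 1) * e"
    unfolding w_def w'_def xx_def yy_def e_def by (simp_all add: rho_add rho_diff rho_mult[OF iK] rho_one[OF iK] pK)
  have prod: "(1 + (sc s * xx - 1) * e) * (1 + (sc s' * yy - 1) * e) = 1 + (sc (s * s') * (xx * yy) - 1) * e"
    if "yy * e = e * yy" "s * s' = 1" for s s' and xx yy :: "'k om rcf"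
  proof -
    have "(1 + (u - 1) * e) * (1 + (v - 1) * e) = 1 + (u * v - 1) * e" if "v * e = e * v" for u v :: "'k om rcf"
    proof -
      have "(1 + (u - 1) * e) * (1 + (v - 1) * e) = 1 + (u - 1) * e + (v - 1) * e + (u - 1) * (e * (v - 1)) * e"
        by (simp add: algebra_simps)
      also have "e * (v - 1) = (v - 1) * e" using that by (simp add: algebra_simps)
      also have "(u - 1) * ((v - 1) * e) * e = (u - 1) * (v - 1) * (e * e)" by (simp only: mult.assoc)
      finally show ?thesis unfolding ee by (simp add: algebra_simps)
    qed
    moreover have "sc s' * yy * e = e * (sc s' * yy)"
    proof -
      have "sc s' * yy * e = (sc s' * e) * yy" by (simp only: mult.assoc that(1))
      also have "sc s' * e = e * sc s'" by (rule sc_commute)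
      finally show ?thesis by (simp only: mult.assoc)
    qed
    moreover have "sc s * xx * (sc s' * yy) = sc (s * s') * (xx * yy)"
    proof -
      have "sc s * xx * (sc s' * yy) = sc s * (xx * sc s') * yy" by (simp only: mult.assoc)
      also have "xx * sc s' = sc s' * xx" by (rule sc_commute[symmetric])
      finally show ?thesis by (simp only: mult.assoc sc_hom)
    qed
    ultimately show ?thesis by simp
  qed
  have ww: "rho K w * rho K w' = 1 + (xx * yy - 1) * e" "rho K w' * rho K w = 1 + (yy * xx - 1) * e"
    unfolding W using prod[OF xe(2) ss(1)] prod[OF xe(1) ss(2)] by (simp_all add: ss sc_hom)
  define r where "r = nat \<bar>k\<bar>"
  have r: "r > 0" using nz by (simp add: r_def k_def)
  interpret sl: shift_pair "X l :: 'k jac" "Y l" by unfold_locales simp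
  \<comment> \<open>Index zero forces both products to act as 1 on e_J, in particular the one equal
    to x_l^r y_l^r. But e_l annihilates that product when r > 0, while e_l e_J has a nonzero
    image.\<close>
  have "(x * y = X l ^ r * Y l ^ r \<and> y * x = 1) \<or> (y * x = X l ^ r * Y l ^ r \<and> x * y = 1)"
    by (cases "k \<ge> 0") (auto simp: x_def y_def r_def)
  then have "rho K (X l ^ r * Y l ^ r) * e = e"
  proof
    assume h: "x * y = X l ^ r * Y l ^ r \<and> y * x = 1"
    then have "yy * xx = 1" "xx * yy = rho K (X l ^ r * Y l ^ r)" unfolding xx_def yy_def by (simp_all flip: rho_mult[OF iK] add: rho_one[OF iK])
    then have "1 + (rho K (X l ^ r * Y l ^ r) - 1) * e = 1" using ind ww by simp
    then show ?thesis by (simp add: algebra_simps)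
  next
    assume h: "y * x = X l ^ r * Y l ^ r \<and> x * y = 1"
    then have "xx * yy = 1" "yy * xx = rho K (X l ^ r * Y l ^ r)" unfolding xx_def yy_def by (simp_all flip: rho_mult[OF iK] add: rho_one[OF iK])
    then have "1 + (rho K (X l ^ r * Y l ^ r) - 1) * e = 1" using ind ww by simp
    then show ?thesis by (simp add: algebra_simps)
  qed
  then have "rho K (ee l) * (rho K (X l ^ r * Y l ^ r) * e) = rho K (ee l) * e" by simp
  moreover have "ee l * (X l ^ r * Y l ^ r) = (0 :: 'k jac)"
  proof -
    obtain r' where r': "r = Suc r'" using r gr0_conv_Suc by blast
    have "ee l * (X l ^ r * Y l ^ r) = ee l * X l * (X l ^ r' * (Y l ^ r :: 'k jac))" by (simp only: r' power_Suc mult.assoc)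
    also have "ee l * X l = (0 :: 'k jac)" by simp
    finally show ?thesis by simp
  qed
  ultimately have "rho K (ee l * eI J) = (0 :: 'k om rcf)"
    unfolding e_def by (simp flip: rho_mult[OF iK] mult.assoc)
  moreover have "ee l * eI J = (eI K :: 'k jac)" unfolding K_def by (rule eI_insert[OF fJ lJ, symmetric])
  ultimately have "ent (rho K (eI K) :: 'k om rcf) (enc K (\<lambda>_. 0)) (enc K (\<lambda>_. 0)) = 0" by simp
  then show False unfolding rho_eI[OF iK] by simp
qed

end

context jacobson_ideal begin

lemma Er_Sn: "w \<in> GL P ==> w \<in> Sn N" and GL_inv_Sn: "w \<in> GL P ==> uinv w \<in> Sn N"
  using GL_Sn GL_C[OF P_idl] GL_inv[OF P_idl] by blast+

text \<open>The two idempotents in theta belong to the sets J and J + l - j. A representation for B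
  sees theta only if B contains one of them, so upward closure keeps theta inside the
  family.\<close>

lemma theta_family:
  assumes J: "J \<in> J0" and l: "l \<in> N - J" and j: "j \<in> J" "insert l J - {j} \<in> J0"
    and \<J>: "\<And>B. B \<subseteq> N ==> J \<subseteq> B ==> B \<in> \<J>" "\<And>B. B \<subseteq> N ==> insert l J - {j} \<subseteq> B ==> B \<in> \<J>"
  shows "theta l j (insert l J) \<in> H" "theta l j (insert l J) - 1 \<in> IJ \<J>"
proof -
  have JN: "J \<subseteq> N" "n \<in> J" "finite J" using J by (auto simp: J0_def intro: finite_subset)
  have jn: "j \<noteq> n" using j(2) by (auto simp: J0_def)
  define I where "I = J - {j, n}"
  have Je: "insert l J = insert l (insert j (insert n I))" using j JN by (auto simp: I_def)
  \<comment> \<open>If I misses S, the element of S in J can only be j, and the one in J + l - j can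
    only be l.\<close>
  have "I \<inter> S \<noteq> {} \<or> l \<in> S \<and> j \<in> S"
  proof (rule ccontr)
    assume a: "\<not> (I \<inter> S \<noteq> {} \<or> l \<in> S \<and> j \<in> S)"
    have "J \<inter> S \<subseteq> {j}" "(insert l J - {j}) \<inter> S \<subseteq> {l}" using a S_N(2) by (auto simp: I_def)
    then have "j \<in> S" "l \<in> S" using J j(2) by (auto simp: J0_def)
    then show False using a by blast
  qed
  moreover have "I \<subseteq> N'" "l \<in> N'" "j \<in> N'" "l \<notin> I" "j \<notin> I" "l \<noteq> j"
    using JN l j jn N_eq by (auto simp: I_def)
  ultimately show t: "theta l j (insert l J) \<in> H" unfolding Je by (intro theta_H)
  show "theta l j (insert l J) - 1 \<in> IJ \<J>"
  proof (rule IJ_I)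
    show "theta l j (insert l J) - 1 \<in> (Sn N :: 'k jac set)" using Er_Sn[OF H_GL[OF t]] by (intro Sn_diff Sn_1)
    fix B assume B: "idx B" "B \<subseteq> N" "B \<notin> \<J>"
    have "rho B (theta l j (insert l J)) = (1 :: 'k om rcf)"
    proof (rule theta_out[OF B(1)])
      show "\<not> insert l J - {l} \<subseteq> B" using \<J>(1)[OF B(2)] B(3) l by auto
      show "\<not> insert l J - {j} \<subseteq> B" using \<J>(2)[OF B(2)] B(3) by auto
    qed (use JN l j in auto)
    then show "rho B (theta l j (insert l J) - 1) = (0 :: 'k om rcf)" by (simp add: rho_diff rho_one[OF B(1)])
  qed
qed

lemma mu_family:
  assumes J: "J \<in> J0" and c: "c \<noteq> 0" and \<J>: "\<And>B. B \<subseteq> N ==> J \<subseteq> B ==> B \<in> \<J>"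
  shows "mu J c \<in> H" "mu J c - 1 \<in> IJ \<J>"
proof -
  have JN: "J \<subseteq> N" "n \<in> J" "finite J" using J by (auto simp: J0_def intro: finite_subset)
  have Je: "insert n (J - {n}) = J" using JN by auto
  show t: "mu J c \<in> H" using mu_H[OF J0_split(2)[OF J] _ c] J0_split(3)[OF J] unfolding Je by blast
  show "mu J c - 1 \<in> IJ \<J>"
  proof (rule IJ_I)
    show "mu J c - 1 \<in> (Sn N :: 'k jac set)" using Er_Sn[OF H_GL[OF t]] by (intro Sn_diff Sn_1)
    fix B assume B: "idx B" "B \<subseteq> N" "B \<notin> \<J>"
    have "rho B (mu J c) = (1 :: 'k om rcf)" by (rule mu_out[OF B(1) JN(3)]) (use \<J> B in auto)
    then show "rho B (mu J c - 1) = (0 :: 'k om rcf)" by (simp add: rho_diff rho_one[OF B(1)])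
  qed
qed

text \<open>The set Q of diagonal values that can be realized within the family is closed under
  products and under inverses of nonzero elements. The elements mu give the scalars and the elements
  theta the inverses of the variables t_l, so every monomial supported on such l is reached.\<close>

lemma diag_lift:
  assumes J: "J \<in> J0" and c: "c \<noteq> 0"
    and \<J>: "\<And>B. B \<subseteq> N ==> J \<subseteq> B ==> B \<in> \<J>"
    and t: "\<And>l. l \<in> pkeys \<mu> ==> l \<in> N - J \<and> (\<exists>j\<in>J. insert l J - {j} \<in> J0 \<and> (\<forall>B. B \<subseteq> N \<longrightarrow> insert l J - {j} \<subseteq> B \<longrightarrow> B \<in> \<J>))"
  shows "\<exists>h\<in>H. h - 1 \<in> IJ \<J> \<and> rho J h = dg J (emb (psingle \<mu> c))"
proof -
  have iJ: "idx J" using idx_J0[OF J] by simp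
  define Q where "Q = {d. \<exists>h\<in>H. h - 1 \<in> IJ \<J> \<and> rho J h = dg J d}"
  have mult: "c * d \<in> Q" if cd: "c \<in> Q" "d \<in> Q" for c d
  proof -
    obtain g h where "g \<in> H" "g - 1 \<in> IJ \<J>" "rho J g = dg J c" "h \<in> H" "h - 1 \<in> IJ \<J>" "rho J h = dg J d"
      using cd by (auto simp: Q_def)
    then show ?thesis unfolding Q_def
      by (auto intro!: bexI[of _ "g * h"] simp: rho_mult[OF iJ] dg_mult intro: one_IJ_mult H.mult)
  qed
  have inv: "inverse d \<in> Q" if d: "d \<in> Q" "d \<noteq> 0" for d
  proof -
    obtain h where h: "h \<in> H" "h - 1 \<in> IJ \<J>" "rho J h = dg J d" using d by (auto simp: Q_def)
    have u: "unt h" using H_GL[OF h(1)] GL_unt by blast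
    have "rho J (uinv h) = dg J (inverse d)"
      using rho_unt(2)[OF iJ u] h(3) uinv_eq[of "dg J d" "dg J (inverse d)"] d(2) by (simp add: dg_mult)
    moreover have "uinv h - 1 \<in> IJ \<J>" using one_IJ_inv[OF h(2) u GL_inv_Sn[OF H_GL[OF h(1)]]] .
    ultimately show ?thesis unfolding Q_def using H_inv[OF h(1)] by blast
  qed
  have "1 \<in> Q" unfolding Q_def by (auto intro!: bexI[of _ 1] H.Er Er.one IJ_closed simp: rho_one[OF iJ])
  have mono: "lmon (psingle l k) \<in> Q" if l: "l \<in> pkeys \<mu>" for l k
  proof -
    obtain j where j: "j \<in> J" "insert l J - {j} \<in> J0" "\<And>B. B \<subseteq> N ==> insert l J - {j} \<subseteq> B ==> B \<in> \<J>" and lN: "l \<in> N - J"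
      using t[OF l] by blast
    have m1: "lmon (psingle l (-1)) \<in> Q"
      unfolding Q_def using theta_family[OF J lN j(1,2) \<J> j(3)] rho_theta[OF iJ _ j(1), of l] lN
      by (intro CollectI bexI[of _ "theta l j (insert l J)"]) auto
    have p1: "lmon (psingle l 1) \<in> Q"
      using inv[OF m1] by (simp add: mon_uminus[symmetric] single_uminus[symmetric])
    have "lmon (psingle l (int m)) \<in> Q \<and> lmon (psingle l (- int m)) \<in> Q" for m
    proof (induction m)
      case 0
      then show ?case using \<open>1 \<in> Q\<close> by simp
    next
      case (Suc m)
      have "lmon (psingle l (int (Suc m))) = lmon (psingle l 1) * (lmon (psingle l (int m)) :: 'k om)"
        "lmon (psingle l (- int (Suc m))) = lmon (psingle l (-1)) * (lmon (psingle l (- int m)) :: 'k om)"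
        by (simp_all flip: mon_add single_add)
      then show ?case using Suc mult m1 p1 by simp
    qed
    from this[of "nat \<bar>k\<bar>"] show ?thesis by (cases "k \<ge> 0") auto
  qed
  have "lmon (\<Sum>l\<in>K. psingle l (plookup \<mu> l)) \<in> Q" if "finite K" "K \<subseteq> pkeys \<mu>" for K
    using that
  proof (induction K rule: finite_induct)
    case (insert l K)
    then show ?case using mult[OF mono[of l]] by (simp add: mon_add)
  qed (simp add: \<open>1 \<in> Q\<close>)
  from this[OF finite_keys order_refl] have "lmon \<mu> \<in> Q" using poly_mapping_sum[of \<mu>] by simp
  moreover have "embk c \<in> Q"
    unfolding Q_def using mu_family[OF J c \<J>] rho_mu[OF iJ, of c] by (intro CollectI bexI[of _ "mu J c"]) auto
  ultimately have "embk c * lmon \<mu> \<in> Q" by (intro mult)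
  moreover have "embk c * lmon \<mu> = emb (psingle \<mu> c)"
    unfolding embk_def lmon_def emb_hom(6)[symmetric] by (simp add: mult_single)
  ultimately show ?thesis by (simp add: Q_def)
qed

theorem GL_sub_H:
  assumes "\<J> \<subseteq> J0" "\<And>J B. J \<in> \<J> ==> J \<subseteq> B ==> B \<subseteq> N ==> B \<in> \<J>"
    and "a \<in> GL P" "a - 1 \<in> IJ \<J>"
  shows "a \<in> H"
  using assms
proof (induction "card \<J>" arbitrary: \<J> a rule: less_induct)
  case less
  note sub = less.prems(1) and up = less.prems(2) and a = less.prems(3) and aI = less.prems(4)
  have fin: "finite \<J>" by (rule finite_subset[of _ "Pow N"]) (use sub in \<open>auto simp: J0_def\<close>)
  show ?case
  proof (cases "\<J> = {}")
    case True
    have "idx N" by (simp add: idx_def N_eq)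
    then have "rho N (a - 1) = 0" using IJ_D[OF aI, of N] True by simp
    then have "a - 1 = 0" using rho_faithful[OF \<open>idx N\<close> IJ_Sn[OF aI]] by blast
    then show ?thesis using H.Er[OF Er.one] by simp
  next
    case False
    define J where "J = arg_min_on card \<J>"
    have JJ: "J \<in> \<J>" and min: "\<And>B. B \<in> \<J> ==> card J \<le> card B"
      unfolding J_def using arg_min_if_finite[OF fin False] arg_min_least[OF fin False] by auto
    have J: "J \<in> J0" using JJ sub by blast
    have iJ: "idx J" using idx_J0[OF J] by simp
    have JN: "J \<subseteq> N" "finite J" using J by (auto simp: J0_def intro: finite_subset)
    define W where "W = N - J"
    define R where "R = (Rn {} W :: 'k om set)"
    have R: "subring R" unfolding R_def by (rule Rn_subring) simp
    interpret cr: coeff_ring sx sy "sc ` R" by (rule coeff_ring_sc[OF R])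
    \<comment> \<open>Minimal cardinality puts every J - {i} outside the family, which is what makes
      the image of a - 1 under \<open>rho J\<close> a finite matrix.\<close>
    have less: "J - {i} \<notin> \<J>" if "i \<in> J" for i
      using min[of "J - {i}"] card_Diff1_less[OF JN(2) that] by linarith
    have FR: "rho J u - 1 \<in> ru.Fin (sc ` R)" if u: "u - 1 \<in> IJ \<J>" for u
    proof -
      have "rho J (u - 1) \<in> ru.Fin (sc ` Rn {} (N - J))"
      proof (rule rho_finite[OF iJ IJ_Sn[OF u]])
        fix i assume i: "i \<in> J"
        show "idx (J - {i}) \<and> rho (J - {i}) (u - 1) = 0"
          using idx_J0(2)[OF J i] IJ_D[OF u idx_J0(2)[OF J i] _ less[OF i]] JN by blast
      qed
      then show ?thesis by (simp add: rho_diff rho_one[OF iJ] R_def W_def)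
    qed
    have ua: "unt a" using a GL_unt by blast
    have ia: "uinv a - 1 \<in> IJ \<J>" using one_IJ_inv[OF aI ua GL_inv_Sn[OF a]] .
    define U where "U = rho J a"
    have uU: "unt U" "uinv U = rho J (uinv a)" unfolding U_def using rho_unt[OF iJ ua] by auto
    have UF: "U - 1 \<in> ru.Fin (sc ` R)" "uinv U - 1 \<in> ru.Fin (sc ` R)" unfolding U_def
      using FR[OF aI] FR[OF ia] uU(2) unfolding U_def by auto
    have FU: "ru.Fin (sc ` R) \<subseteq> ru.Fin (range sc)" using ru.Fin_mono[of "sc ` R" "range sc"] by blast
    have dU: "dt U \<in> R" "dt (uinv U) \<in> R" using dt_subring[OF R] UF by auto
    have UGL: "U \<in> ru.GL (range sc)" using UF FU uU by (auto simp: ru.GL_def)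
    obtain p q where pq: "p \<in> Lp W" "dt U = emb p" "dt (uinv U) = emb q"
      using dU Rn_empty unfolding R_def by blast
    have "p * q = 1" using dt_inv(1)[OF UGL] unfolding pq emb_hom(6)[symmetric] emb_hom(2)[symmetric] by simp
    then obtain \<mu> c where c: "c \<noteq> 0" "p = psingle \<mu> c" using laurent_unit by blast
    have keys: "pkeys \<mu> \<subseteq> W" using pq(1) c by (auto simp: Lp_def)
    define d where "d = dt U"
    have dR: "d \<in> R" "inverse d \<in> R" "d \<noteq> 0"
    proof -
      have "d * dt (uinv U) = 1" using dt_inv(1)[OF UGL] by (simp add: d_def)
      then have "inverse d = dt (uinv U)" by (rule inverse_unique)
      then show "d \<in> R" "inverse d \<in> R" "d \<noteq> 0" using dU dt_inv(2)[OF UGL] by (auto simp: d_def)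
    qed
    define D D' where "D = dg J d" and "D' = dg J (inverse d)"
    have DD: "D * D' = 1" "D' * D = 1" unfolding D_def D'_def using dR(3) by (simp_all add: dg_mult)
    have DF: "D - 1 \<in> ru.Fin (sc ` R)" "D' - 1 \<in> ru.Fin (sc ` R)" unfolding D_def D'_def by (auto intro!: dg_Fin R dR)
    define e where "e = U * D'"
    have "e \<in> cr.GL (sc ` R)"
    proof (rule cr.GLI[of _ _ "D * uinv U"])
      show "e - 1 \<in> ru.Fin (sc ` R)" "D * uinv U - 1 \<in> ru.Fin (sc ` R)"
        unfolding e_def using UF DF by (auto intro!: cr.one_Fin_mult[OF cr.idl_C])
      show "e * (D * uinv U) = 1" "D * uinv U * e = 1"
      proof -
        have "e * (D * uinv U) = U * (D' * D) * uinv U" "D * uinv U * e = D * (uinv U * U) * D'"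
          by (simp_all add: e_def mult.assoc)
        then show "e * (D * uinv U) = 1" "D * uinv U * e = 1" using DD uU(1) by simp_all
      qed
    qed
    moreover have "dt e = 1"
      unfolding e_def using UF DF FU dR(3) by (subst dt_mult) (auto simp: D'_def dt_dg d_def[symmetric])
    ultimately have "e \<in> ru.El (sc ` Rn {} (N - J))"
      using SK1_Rn[of W "{}" e] by (simp add: R_def W_def)
    then obtain w where w: "w \<in> Er P" "rho J w = e" "w - 1 \<in> IJ {B. J \<subseteq> B}" using lift_elementary[OF J] by blast
    have IJsub: "u \<in> IJ \<J>" if "u \<in> IJ {B. J \<subseteq> B}" for u
      using that up[OF JJ] by (auto simp: IJ_def)
    have wG: "w \<in> GL P" using w Er_GL[OF P_idl] by blast
    have uw: "unt w" using wG GL_unt by blast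
    define a1 where "a1 = uinv w * a"
    have a1G: "a1 \<in> GL P" unfolding a1_def using a wG by (intro GL_mult[OF P_idl] GL_inv[OF P_idl])
    have a1I: "a1 - 1 \<in> IJ \<J>" unfolding a1_def
      using one_IJ_inv[OF IJsub[OF w(3)] uw GL_inv_Sn[OF wG]] aI by (rule one_IJ_mult)
    have "U = e * D" unfolding e_def using DD by (simp add: mult.assoc)
    have "rho J a1 = uinv e * U" unfolding a1_def rho_mult[OF iJ] rho_unt(2)[OF iJ uw, symmetric] w U_def ..
    also have "\<dots> = D" using rho_unt(1)[OF iJ uw] w(2) by (simp add: \<open>U = e * D\<close>)
    finally have r1: "rho J a1 = dg J (emb (psingle \<mu> c))" unfolding D_def d_def pq(2) c(2) .
    have t: "l \<in> N - J \<and> (\<exists>j\<in>J. insert l J - {j} \<in> J0 \<and> (\<forall>B. B \<subseteq> N \<longrightarrow> insert l J - {j} \<subseteq> B \<longrightarrow> B \<in> \<J>))"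
      if l: "l \<in> pkeys \<mu>" for l
    proof -
      have lN: "l \<in> N - J" using l keys by (auto simp: W_def)
      \<comment> \<open>A variable that really occurs in the determinant must have a theta available
        within the family; otherwise its exponent would be an index and vanish.\<close>
      have "\<exists>j\<in>J. insert l J - {j} \<in> \<J>"
      proof (rule ccontr)
        assume ne: "\<not> (\<exists>j\<in>J. insert l J - {j} \<in> \<J>)"
        have "plookup \<mu> l = 0"
        proof (rule exponent_zero[OF J lN Er_Sn[OF a1G] GL_unt[OF a1G] r1 c(1)])
          show "pkeys \<mu> \<subseteq> N - J" using keys by (simp add: W_def)
          fix j assume j: "j \<in> J"
          have "idx (insert l J - {j})" using j lN JN by (auto simp: idx_def)
          then show "rho (insert l J - {j}) (a1 - 1) = 0" using j ne lN JN by (intro IJ_D[OF a1I]) auto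
        qed
        then show False using l by (simp add: in_keys_iff)
      qed
      then show ?thesis using lN sub up by blast
    qed
    obtain h where h: "h \<in> H" "h - 1 \<in> IJ \<J>" "rho J h = dg J (emb (psingle \<mu> c))"
      using diag_lift[OF J c(1) up[OF JJ] t] by blast
    have hG: "h \<in> GL P" using H_GL h by blast
    have uh: "unt h" using hG GL_unt by blast
    define a2 where "a2 = uinv h * a1"
    have a2G: "a2 \<in> GL P" unfolding a2_def using a1G hG by (intro GL_mult[OF P_idl] GL_inv[OF P_idl])
    have a2I: "a2 - 1 \<in> IJ \<J>" unfolding a2_def
      using one_IJ_inv[OF h(2) uh GL_inv_Sn[OF hG]] a1I by (rule one_IJ_mult)
    have r2: "rho J a2 = 1" unfolding a2_def rho_mult[OF iJ] r1 h(3)[symmetric]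
      using uh by (simp flip: rho_mult[OF iJ] add: rho_one[OF iJ])
    have "a2 - 1 \<in> IJ (\<J> - {J})"
    proof (rule IJ_I)
      show "a2 - 1 \<in> Sn N" using IJ_Sn[OF a2I] .
      fix B assume B: "idx B" "B \<subseteq> N" "B \<notin> \<J> - {J}"
      show "rho B (a2 - 1) = 0"
      proof (cases "B = J")
        case True
        then show ?thesis using r2 by (simp add: rho_diff rho_one[OF iJ])
      next
        case False
        then show ?thesis using IJ_D[OF a2I B(1,2)] B(3) by blast
      qed
    qed
    moreover have "card (\<J> - {J}) < card \<J>" using card_Diff1_less[OF fin JJ] .
    \<comment> \<open>Removing J preserves upward closure: no other member of the family can lie
      inside a member of least cardinality.\<close>
    moreover have "B \<in> \<J> - {J}" if B: "K \<in> \<J> - {J}" "K \<subseteq> B" "B \<subseteq> N" for K B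
    proof -
      have "B \<noteq> J"
      proof
        assume "B = J"
        then have "card K < card J" using B JN by (intro psubset_card_mono) auto
        then show False using min[of K] B by auto
      qed
      then show ?thesis using up[of K B] B by blast
    qed
    ultimately have "a2 \<in> H" using less.hyps[of "\<J> - {J}" a2] sub a2G by blast
    then have "w * (h * a2) \<in> H" using h(1) H.Er[OF w(1)] by (intro H.mult)
    also have "w * (h * a2) = a" unfolding a2_def a1_def using uw uh by simp
    finally show ?thesis .
  qed
qed

corollary GL_eq_H: "GL P = H"
proof
  show "GL P \<subseteq> H"
  proof
    fix a assume a: "a \<in> GL P"
    show "a \<in> H" by (rule GL_sub_H[OF order_refl _ a]) (use a Fin_P_IJ in \<open>auto simp: J0_def GL_def\<close>)
  qed
qed (use H_GL in blast)

end

section \<open>Dual homomorphisms\<close>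

lemma single_eq: assumes "c \<noteq> 0" "psingle m c = (psingle m' c' :: 'a \<Rightarrow>\<^sub>0 'k::zero)" shows "m = m' \<and> c = c'"
  using assms by (metis lookup_single_eq lookup_single_not_eq)

text \<open>Exponent and coefficient of a monomial; the choice is harmless because both are
  determined (\<open>mc_eq\<close>).\<close>

definition mc :: "'k::field om \<Rightarrow> (nat \<Rightarrow>\<^sub>0 int) \<times> 'k" where
  "mc d = (SOME x. snd x \<noteq> 0 \<and> d = emb (psingle (fst x) (snd x)))"

lemma mc_eq: assumes "c \<noteq> 0" shows "mc (emb (psingle \<mu> c)) = (\<mu>, c)"
  unfolding mc_def
proof (rule some_equality)
  show "snd (\<mu>, c) \<noteq> 0 \<and> emb (psingle \<mu> c) = emb (psingle (fst (\<mu>, c)) (snd (\<mu>, c)))"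
    using assms by simp
  fix x :: "(nat \<Rightarrow>\<^sub>0 int) \<times> 'a"
  assume x: "snd x \<noteq> 0 \<and> emb (psingle \<mu> c) = emb (psingle (fst x) (snd x))"
  then have "\<mu> = fst x \<and> c = snd x" using single_eq[OF assms, of \<mu> "fst x" "snd x"] by simp
  then show "x = (\<mu>, c)" by auto
qed

lemma mc_mult:
  assumes "c \<noteq> 0" "d = emb (psingle \<mu> c)" "c' \<noteq> 0" "d' = emb (psingle \<mu>' c')"
  shows "mc (d * d') = (fst (mc d) + fst (mc d'), snd (mc d) * snd (mc d'))"
proof -
  have "d * d' = emb (psingle (\<mu> + \<mu>') (c * c'))"
    unfolding assms emb_hom(6)[symmetric] by (simp add: mult_single)
  then show ?thesis using mc_eq[of "c * c'" "\<mu> + \<mu>'"] mc_eq[OF assms(1), of \<mu>] mc_eq[OF assms(3), of \<mu>'] assms by simp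
qed

context jacobson_ideal begin

definition chi :: "nat \<Rightarrow> 'k jac \<Rightarrow> 'k om" where "chi k a = dt (rho {k, n} a)"

lemma kn_J0: "k \<in> S ==> {k, n} \<in> J0" and idx_kn: "idx {k, n}"
  using S_N by (auto simp: J0_def idx_def)

lemma chi_Fin:
  assumes k: "k \<in> S" and a: "a \<in> GL P"
  shows "rho {k, n} a - 1 \<in> ru.Fin (sc ` Rn {} (N - {k, n}))"
proof -
  have kn: "k \<noteq> n" using S_N k by auto
  have aI: "a - 1 \<in> IJ J0" using Fin_P_IJ a by (simp add: GL_def)
  have "rho {k, n} (a - 1) \<in> ru.Fin (sc ` Rn {} (N - {k, n}))"
  proof (rule rho_finite[OF idx_kn IJ_Sn[OF aI]])
    fix i assume i: "i \<in> {k, n}"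
    have ix: "idx ({k, n} - {i})" by (rule idx_J0(2)[OF kn_J0[OF k] i])
    have "{k, n} - {i} \<notin> J0" "{k, n} - {i} \<subseteq> N" using i kn k S_N by (auto simp: J0_def)
    then show "idx ({k, n} - {i}) \<and> rho ({k, n} - {i}) (a - 1) = 0" using ix IJ_D[OF aI ix] by simp
  qed
  then show ?thesis by (simp add: rho_diff rho_one[OF idx_kn])
qed

lemma Rn_W: "subring (Rn {} W)" by (rule Rn_subring) simp

lemma chi_GL:
  assumes k: "k \<in> S" and a: "a \<in> GL P" shows "rho {k, n} a \<in> ru.GL (range sc)"
proof (rule Fin_inverse)
  show "rho {k, n} a - 1 \<in> ru.Fin (range sc)" using ru.Fin_mono[OF _ chi_Fin[OF assms]] by blast
  show "unt (rho {k, n} a)" using rho_unt(1)[OF idx_kn GL_unt[OF a]] .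
qed

lemma chi_mult: assumes k: "k \<in> S" and "a \<in> GL P" "b \<in> GL P" shows "chi k (a * b) = chi k a * chi k b"
  unfolding chi_def rho_mult[OF idx_kn]
  using chi_GL[OF k assms(2)] chi_GL[OF k assms(3)] by (intro dt_mult) (auto simp: ru.GL_def)

lemma chi_one: "chi k 1 = 1" by (simp add: chi_def rho_one[OF idx_kn])

lemma chi_conj:
  assumes k: "k \<in> S" and a: "a \<in> GL P" and g: "unt g" shows "chi k (g * a * uinv g) = chi k a"
  unfolding chi_def rho_mult[OF idx_kn] rho_unt(2)[OF idx_kn g, symmetric]
  by (rule dt_conj(2)[OF chi_GL[OF k a] rho_unt(1)[OF idx_kn g]])

text \<open>A commutator through a third index with the matrix v = 1 + E_jq(n). The entry 1 of v is
  not in P and its image need not be a finite perturbation of 1, so invariance of the determinant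
  under conjugation by arbitrary units is used instead of multiplicativity.\<close>

lemma chi_elem:
  assumes k: "k \<in> S" and c: "c \<in> P" and pq: "p \<noteq> q" shows "chi k (1 + c * mx p q) = 1"
proof -
  define j where "j = Suc (p + q)"
  have j: "p \<noteq> j" "j \<noteq> q" by (auto simp: j_def)
  have cS: "c \<in> Sn N'" using P_sub c by blast
  define u v u' v' where "u = 1 + c * mx p j" and "v = 1 + 1 * mx j q" and "u' = 1 + - c * mx p j" and "v' = 1 + - 1 * mx j q"
  have uu: "u * u' = 1" "u' * u = 1" unfolding u_def u'_def using elem_inv[OF cS j(1)] by auto
  have vv: "v * v' = 1" "v' * v = 1" unfolding v_def v'_def using elem_inv[OF C_1 j(2)] by auto
  have uG: "u \<in> GL P" "u' \<in> GL P" unfolding u_def u'_def using elem_GL[OF P_idl c j(1)] elem_GL[OF P_idl idl_neg[OF P_idl c] j(1)] by auto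
  have vu: "unt v" "uinv v = v'" using untI[OF vv] uinv_eq[OF vv] by auto
  have vGC: "v \<in> GL (Sn N')" unfolding v_def using elem_GL[OF idl_C C_1 j(2)] .
  have "1 + c * mx p q = u * (v * u' * v')"
    unfolding u_def v_def u'_def v'_def using j pq
    by (simp add: algebra_simps mx_mult mx_mult_assoc mx_coeff[OF cS])
  moreover have "v * u' * v' \<in> GL P"
  proof -
    have "1 + c * mx p q \<in> GL P" using elem_GL[OF P_idl c pq] .
    then have "u' * (1 + c * mx p q) \<in> GL P" using GL_mult[OF P_idl uG(2)] by blast
    moreover have "u' * (1 + c * mx p q) = v * u' * v'"
      unfolding calculation(1) \<open>1 + c * mx p q = u * (v * u' * v')\<close> using uu(2) by (simp flip: mult.assoc)
    ultimately show ?thesis by simp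
  qed
  moreover have "chi k (v * u' * v') = chi k u'" using chi_conj[OF k uG(2) vu(1)] vu(2) by simp
  moreover have "chi k u * chi k u' = 1" using chi_mult[OF k uG] uu(1) chi_one by simp
  ultimately show ?thesis using chi_mult[OF k uG(1)] by simp
qed

lemma chi_Er: assumes k: "k \<in> S" and e: "e \<in> Er P" shows "chi k e = 1"
  using e
proof (induction e rule: Er.induct)
  case one
  show ?case by (rule chi_one)
next
  case (step g c p q h)
  have el: "1 + c * mx p q \<in> GL P" using elem_GL[OF P_idl step(2,3)] .
  have 1: "1 + c * mx p q \<in> Er P" by (rule Er_elem[OF step(2,3)])
  have "g * (1 + c * mx p q) * uinv g \<in> GL P" using Er_GL[OF P_idl Er_conj[OF step(1) 1]] .
  then show ?case using chi_mult[OF k _ Er_GL[OF P_idl step(4)]] chi_conj[OF k el El_unt[OF step(1)]] chi_elem[OF k step(2,3)] step(5)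
    by simp
qed

lemma chi_monomial:
  assumes k: "k \<in> S" and a: "a \<in> GL P" shows "\<exists>\<mu> c. c \<noteq> 0 \<and> chi k a = emb (psingle \<mu> c)"
proof -
  let ?W = "N - {k, n}"
  have "chi k a \<in> Rn {} ?W" "chi k (uinv a) \<in> Rn {} ?W"
    unfolding chi_def using dt_subring[OF Rn_W] chi_Fin[OF k a] chi_Fin[OF k GL_inv[OF P_idl a]] by auto
  then obtain p q where pq: "chi k a = emb p" "chi k (uinv a) = emb q" using Rn_empty by blast
  have "chi k a * chi k (uinv a) = 1"
    using chi_mult[OF k a GL_inv[OF P_idl a]] chi_one GL_unt[OF a] by simp
  then have "p * q = 1" unfolding pq emb_hom(6)[symmetric] emb_hom(2)[symmetric] by simp
  then show ?thesis using laurent_unit pq(1) by blast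
qed

text \<open>For i > j the determinant at {i, n} sends theta_ij to t_j, so the exponent of t_j there
  reads off n_ij. The determinant at {j, n} sees theta_ij as well, but as a power of t_i with i > j,
  and such exponents are not consulted for pairs in decreasing order.\<close>

definition zx :: "nat \<times> nat \<Rightarrow> 'k jac \<Rightarrow> int" where
  "zx p a = plookup (fst (mc (chi (fst p) a))) (snd p)"

definition lx :: "nat \<Rightarrow> 'k jac \<Rightarrow> 'k" where "lx k a = snd (mc (chi k a))"

lemma mc_chi_mult:
  assumes k: "k \<in> S" and "a \<in> GL P" "b \<in> GL P"
  shows "mc (chi k (a * b)) = (fst (mc (chi k a)) + fst (mc (chi k b)), snd (mc (chi k a)) * snd (mc (chi k b)))"
  using chi_monomial[OF k assms(2)] chi_monomial[OF k assms(3)] mc_mult unfolding chi_mult[OF assms] by blast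

lemma zx_mult: "fst p \<in> S ==> a \<in> GL P ==> b \<in> GL P ==> zx p (a * b) = zx p a + zx p b"
  and lx_mult: "k \<in> S ==> a \<in> GL P ==> b \<in> GL P ==> lx k (a * b) = lx k a * lx k b"
  by (simp_all add: zx_def lx_def mc_chi_mult lookup_add)

lemma lx_nz: assumes "k \<in> S" "a \<in> GL P" shows "lx k a \<noteq> 0"
  using chi_monomial[OF assms] mc_eq unfolding lx_def by fastforce

lemma mc_one: "mc 1 = (0, 1)" and mc_lmon: "mc (lmon \<mu>) = (\<mu>, 1)" and mc_embk: "c \<noteq> 0 ==> mc (embk c) = (0, c)"
  using mc_eq[of 1 0] mc_eq[of 1 \<mu>] mc_eq[of c 0] by (simp_all add: emb_hom lmon_def embk_def)

lemma zx_Er: "fst p \<in> S ==> e \<in> Er P ==> zx p e = 0" and lx_Er: "k \<in> S ==> e \<in> Er P ==> lx k e = 1"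
  by (simp_all add: zx_def lx_def chi_Er mc_one)

lemma chi_theta:
  assumes ij: "i \<in> S" "j \<in> S" "i \<noteq> j" and k: "k \<in> S"
  shows "chi k (theta i j {i, j, n}) = (if k = j then lmon (psingle i (-1)) else if k = i then lmon (psingle j 1) else 1)"
proof -
  have n: "i \<noteq> n" "j \<noteq> n" "k \<noteq> n" using S_N ij k by auto
  have A: "chi j (theta i j {i, j, n}) = lmon (psingle i (-1))" if ij: "i \<in> S" "j \<in> S" "i \<noteq> j" for i j
  proof -
    have 1: "i \<notin> {j, n}" "j \<in> {j, n}" using ij S_N by auto
    show ?thesis unfolding chi_def rho_theta[OF idx_kn 1] by (rule dt_dg)
  qed
  \<comment> \<open>\<open>rho_theta\<close> only treats the determinant at the second index; the
    other value follows because theta_ji is the inverse of theta_ij.\<close>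
  have B: "chi i (theta i j {i, j, n}) = lmon (psingle j 1)"
  proof -
    have "theta i j {i, j, n} * theta j i {j, i, n} = (1 :: 'k jac)"
      using theta3(3)[OF ij] unt_inv(1)[OF GL_unt[OF theta3(2)[OF ij]]] by simp
    then have "chi i (theta i j {i, j, n}) * chi i (theta j i {j, i, n}) = 1"
      using chi_mult[OF ij(1) theta3(2)[OF ij] theta3(2)[OF ij(2,1) ij(3)[symmetric]]] chi_one by simp
    moreover have "lmon (psingle j 1) * lmon (psingle j (-1)) = (1 :: 'k om)"
      unfolding mon_add[symmetric] single_add[symmetric] by simp
    ultimately show ?thesis unfolding A[OF ij(2,1) ij(3)[symmetric]]
      by (metis mult_right_cancel mon_nonzero)
  qed
  have D: "chi k (theta i j {i, j, n}) = 1" if "k \<noteq> i" "k \<noteq> j"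
  proof -
    have "rho {k, n} (theta i j {i, j, n}) = (1 :: 'k om rcf)"
      by (rule theta_out[OF idx_kn]) (use n ij that in auto)
    then show ?thesis by (simp add: chi_def)
  qed
  show ?thesis using A[OF ij] B D by auto
qed

lemma chi_mu:
  assumes "l \<in> S" "k \<in> S" "c \<noteq> 0" shows "chi k (mu {l, n} c) = (if k = l then embk c else 1)"
proof (cases "k = l")
  case True
  then show ?thesis by (simp add: chi_def rho_mu[OF idx_kn] dt_dg)
next
  case False
  have "l \<noteq> n" using assms S_N by auto
  then have "rho {k, n} (mu {l, n} c) = 1" using False by (intro mu_out[OF idx_kn]) auto
  then show ?thesis using False by (simp add: chi_def)
qed

lemma zx_theta:
  assumes "i \<in> S" "j \<in> S" "j < i" "a \<in> S" "b \<in> S" "b < a"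
  shows "zx (a, b) (theta i j {i, j, n}) = (if (a, b) = (i, j) then 1 else 0)"
  unfolding zx_def using assms
  by (auto simp: chi_theta mc_lmon mc_one lookup_single when_def)

lemma lx_theta: "i \<in> S ==> j \<in> S ==> i \<noteq> j ==> k \<in> S ==> lx k (theta i j {i, j, n}) = 1"
  unfolding lx_def by (auto simp: chi_theta mc_lmon mc_one)

lemma zx_mu: "fst p \<in> S ==> l \<in> S ==> c \<noteq> 0 ==> zx p (mu {l, n} c) = 0"
  and lx_mu: "k \<in> S ==> l \<in> S ==> c \<noteq> 0 ==> lx k (mu {l, n} c) = (if k = l then c else 1)"
  by (auto simp: zx_def lx_def chi_mu mc_one mc_embk)

end

section \<open>Groups generated modulo a normal subgroup by elements with dual homomorphisms\<close>

lemma Kstar_group: "comm_group (Kstar :: 'k::field monoid)"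
  unfolding Kstar_def
  by (rule comm_groupI) (auto simp: mult.commute intro: exI[of _ "inverse _"] bexI[of _ "inverse _"])

text \<open>The group theory separated from the algebra: \<open>zz\<close> and \<open>ll\<close> are
  coordinates that are trivial on E and take the values of a dual basis on the generators. With
  commutators in E, generation then yields unique normal forms and the quotient at once.\<close>

locale dual_generators = group G for G (structure) +
  fixes E :: "'g set" and T :: "'p set" and S :: "'s set" and th :: "'p \<Rightarrow> 'g" and mk :: "'s \<Rightarrow> 'k::field \<Rightarrow> 'g"
    and zz :: "'p \<Rightarrow> 'g \<Rightarrow> int" and ll :: "'s \<Rightarrow> 'g \<Rightarrow> 'k"
  assumes T: "finite T" and S: "finite S" and E: "E \<lhd> G"
    and comm: "a \<in> carrier G ==> b \<in> carrier G ==> a \<otimes> b \<otimes> inv a \<otimes> inv b \<in> E"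
    and th: "p \<in> T ==> th p \<in> carrier G" and mk: "k \<in> S ==> c \<noteq> 0 ==> mk k c \<in> carrier G"
    and mk_mult: "k \<in> S ==> c \<noteq> 0 ==> d \<noteq> 0 ==> mk k (c * d) = mk k c \<otimes> mk k d"
    and zz_mult: "p \<in> T ==> a \<in> carrier G ==> b \<in> carrier G ==> zz p (a \<otimes> b) = zz p a + zz p b"
    and ll_mult: "k \<in> S ==> a \<in> carrier G ==> b \<in> carrier G ==> ll k (a \<otimes> b) = ll k a * ll k b"
    and ll_nz: "k \<in> S ==> a \<in> carrier G ==> ll k a \<noteq> 0"
    and zz_E: "p \<in> T ==> e \<in> E ==> zz p e = 0" and ll_E: "k \<in> S ==> e \<in> E ==> ll k e = 1"
    and zz_th: "p \<in> T ==> q \<in> T ==> zz p (th q) = (if p = q then 1 else 0)"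
    and ll_th: "k \<in> S ==> q \<in> T ==> ll k (th q) = 1"
    and zz_mk: "p \<in> T ==> k \<in> S ==> c \<noteq> 0 ==> zz p (mk k c) = 0"
    and ll_mk: "k \<in> S ==> l \<in> S ==> c \<noteq> 0 ==> ll k (mk l c) = (if k = l then c else 1)"
    and gen: "carrier G = generate G (th ` T \<union> (\<Union>k\<in>S. mk k ` {c. c \<noteq> 0}) \<union> E)"
begin

lemma E_sub: "e \<in> E ==> e \<in> carrier G"
  using normal_imp_subgroup[OF E] subgroup.mem_carrier by metis

lemma zz_hom: "p \<in> T ==> group_hom G integer_group (zz p)"
  unfolding group_hom_def group_hom_axioms_def hom_def integer_group_def[symmetric]
  using zz_mult group_integer_group by (auto simp: integer_group_def)

lemma ll_hom: "k \<in> S ==> group_hom G Kstar (ll k)"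
  unfolding group_hom_def group_hom_axioms_def hom_def
  using ll_mult ll_nz comm_group.axioms(2)[OF Kstar_group] by (auto simp: Kstar_def)

lemma zz_one: "p \<in> T ==> zz p \<one> = 0" and ll_one: "k \<in> S ==> ll k \<one> = 1"
  using group_hom.hom_one[OF zz_hom] group_hom.hom_one[OF ll_hom] by (auto simp: integer_group_def Kstar_def)

lemma int_pow_integer: "(x :: int) [^]\<^bsub>integer_group\<^esub> (i :: int) = i * x"
proof -
  interpret I: group integer_group by (rule group_integer_group)
  have n: "(x :: int) [^]\<^bsub>integer_group\<^esub> (m :: nat) = int m * x" for m x
    by (induction m) (auto simp: algebra_simps integer_group_def)
  have i: "inv\<^bsub>integer_group\<^esub> x = - x" for x :: int by (rule I.inv_equality) (auto simp: integer_group_def)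
  show ?thesis
  proof (cases "i \<ge> 0")
    case True
    then obtain m where "i = int m" using nonneg_int_cases by blast
    then show ?thesis using n by (simp add: int_pow_int)
  next
    case False
    then obtain m where "i = - int m" by (metis nle_le int_cases2 of_nat_0_le_iff)
    then show ?thesis using I.int_pow_neg_int[of x m] n i by simp
  qed
qed

lemma zz_pow: "p \<in> T ==> a \<in> carrier G ==> zz p (a [^] (i :: int)) = i * zz p a"
  using group_hom.hom_int_pow[OF zz_hom] int_pow_integer by metis

lemma ll_pow: assumes k: "k \<in> S" and a: "a \<in> carrier G" and 1: "ll k a = 1" shows "ll k (a [^] (i :: int)) = 1"
proof -
  interpret K: group "Kstar :: 'k monoid" using comm_group.axioms(2)[OF Kstar_group] .
  have "ll k (a [^] i) = \<one>\<^bsub>Kstar\<^esub> [^]\<^bsub>Kstar\<^esub> i" using group_hom.hom_int_pow[OF ll_hom[OF k] a] 1 by (simp add: Kstar_def)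
  also have "\<dots> = \<one>\<^bsub>Kstar\<^esub>" by (rule K.int_pow_one)
  finally show ?thesis by (simp add: Kstar_def)
qed

definition tp :: "'p list \<Rightarrow> ('p \<Rightarrow> int) \<Rightarrow> 'g" where
  "tp ps z = foldr (\<lambda>p acc. (th p [^] z p) \<otimes> acc) ps \<one>"

definition mp :: "'s list \<Rightarrow> ('s \<Rightarrow> 'k) \<Rightarrow> 'g" where
  "mp ks lam = foldr (\<lambda>k acc. mk k (lam k) \<otimes> acc) ks \<one>"

lemma tp_simps: "tp [] z = \<one>" "tp (p # ps) z = (th p [^] z p) \<otimes> tp ps z"
  and mp_simps: "mp [] lam = \<one>" "mp (k # ks) lam = mk k (lam k) \<otimes> mp ks lam"
  by (simp_all add: tp_def mp_def)

lemma tp_closed: "set ps \<subseteq> T ==> tp ps z \<in> carrier G"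
  by (induction ps) (auto simp: tp_simps th)

lemma mp_closed: "set ks \<subseteq> S ==> (\<And>k. k \<in> S ==> lam k \<noteq> 0) ==> mp ks lam \<in> carrier G"
  by (induction ks) (auto simp: mp_simps mk)

lemma zz_tp: "set ps \<subseteq> T ==> distinct ps ==> q \<in> T ==> zz q (tp ps z) = (if q \<in> set ps then z q else 0)"
  by (induction ps) (auto simp: tp_simps zz_one zz_mult th tp_closed zz_pow zz_th)

lemma ll_tp: "set ps \<subseteq> T ==> k \<in> S ==> ll k (tp ps z) = 1"
  by (induction ps) (auto simp: tp_simps ll_one ll_mult th tp_closed ll_pow ll_th)

lemma zz_mp: "set ks \<subseteq> S ==> (\<And>k. k \<in> S ==> lam k \<noteq> 0) ==> q \<in> T ==> zz q (mp ks lam) = 0"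
  by (induction ks) (auto simp: mp_simps zz_one zz_mult mk mp_closed zz_mk)

lemma ll_mp: "set ks \<subseteq> S ==> (\<And>k. k \<in> S ==> lam k \<noteq> 0) ==> distinct ks ==> l \<in> S
   ==> ll l (mp ks lam) = (if l \<in> set ks then lam l else 1)"
  by (induction ks) (auto simp: mp_simps ll_one ll_mult mk mp_closed ll_mk)

lemma mk_one: assumes "k \<in> S" shows "mk k 1 = \<one>"
proof -
  have "mk k 1 \<otimes> mk k 1 = mk k 1" using mk_mult[OF assms, of 1 1] by simp
  then show ?thesis using mk[OF assms, of 1] by (metis l_cancel_one one_neq_zero)
qed

abbreviation "Q \<equiv> G Mod E"

lemma Q_group: "group Q" using normal.factorgroup_is_group[OF E] .

lemma proj_hom: "(\<lambda>a. E #> a) \<in> hom G Q" using normal.r_coset_hom_Mod[OF E] .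

lemma proj_E: "e \<in> E ==> E #> e = \<one>\<^bsub>Q\<^esub>" and proj_E': "a \<in> carrier G ==> E #> a = \<one>\<^bsub>Q\<^esub> ==> a \<in> E"
  using coset_join2[OF E_sub normal_imp_subgroup[OF E]] coset_join1[OF _ _ normal_imp_subgroup[OF E]] E_sub
  by (auto simp: FactGroup_def subsetI)

lemma Q_comm: "comm_group Q"
proof (rule group.group_comm_groupI[OF Q_group])
  fix x y assume "x \<in> carrier Q" "y \<in> carrier Q"
  then obtain a b where ab: "a \<in> carrier G" "b \<in> carrier G" "x = E #> a" "y = E #> b"
    by (auto simp: FactGroup_def RCOSETS_def)
  have "inv b \<otimes> (b \<otimes> a) = a" using ab by (simp add: m_assoc[symmetric])
  then have "a \<otimes> b = (a \<otimes> b \<otimes> inv a \<otimes> inv b) \<otimes> (b \<otimes> a)" using ab by (simp add: m_assoc)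
  then have "E #> (a \<otimes> b) = E #> (b \<otimes> a)"
    using comm[OF ab(1,2)] ab hom_mult[OF proj_hom, of "a \<otimes> b \<otimes> inv a \<otimes> inv b" "b \<otimes> a"] proj_E
      group.is_monoid[OF Q_group] monoid.l_one[of Q] hom_in_carrier[OF proj_hom, of "b \<otimes> a"] by simp
  then show "x \<otimes>\<^bsub>Q\<^esub> y = y \<otimes>\<^bsub>Q\<^esub> x" using hom_mult[OF proj_hom] ab by simp
qed

lemma proj_tp: assumes "set ps \<subseteq> T" shows "E #> tp ps (\<lambda>p. z p + z' p) = (E #> tp ps z) \<otimes>\<^bsub>Q\<^esub> (E #> tp ps z')"
  using assms
proof (induction ps)
  interpret Q: comm_group Q by (rule Q_comm)
  case Nil
  show ?case unfolding tp_simps proj_E[OF subgroup.one_closed[OF normal_imp_subgroup[OF E]]]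
    by (rule Q.l_one[OF Q.one_closed, symmetric])
next
  interpret Q: comm_group Q by (rule Q_comm)
  case (Cons p ps)
  have c: "th p \<in> carrier G" "tp ps w \<in> carrier G" for w using Cons.prems th tp_closed by auto
  have h: "E #> (a \<otimes> b) = (E #> a) \<otimes>\<^bsub>Q\<^esub> (E #> b)" if "a \<in> carrier G" "b \<in> carrier G" for a b
    using hom_mult[OF proj_hom that] .
  have m: "E #> a \<in> carrier Q" if "a \<in> carrier G" for a using hom_in_carrier[OF proj_hom that] .
  show ?case unfolding tp_simps using Cons c h m by (simp add: int_pow_mult Q.m_ac del: mult_FactGroup)
qed

lemma proj_mp:
  assumes "set ks \<subseteq> S" "\<And>k. k \<in> S ==> lam k \<noteq> 0" "\<And>k. k \<in> S ==> lam' k \<noteq> 0"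
  shows "E #> mp ks (\<lambda>k. lam k * lam' k) = (E #> mp ks lam) \<otimes>\<^bsub>Q\<^esub> (E #> mp ks lam')"
  using assms(1)
proof (induction ks)
  interpret Q: comm_group Q by (rule Q_comm)
  case Nil
  show ?case unfolding mp_simps proj_E[OF subgroup.one_closed[OF normal_imp_subgroup[OF E]]]
    by (rule Q.l_one[OF Q.one_closed, symmetric])
next
  interpret Q: comm_group Q by (rule Q_comm)
  case (Cons k ks)
  have kS: "k \<in> S" using Cons.prems by simp
  have c: "mk k (lam k) \<in> carrier G" "mk k (lam' k) \<in> carrier G" "mp ks lam \<in> carrier G" "mp ks lam' \<in> carrier G"
      "mp ks (\<lambda>k. lam k * lam' k) \<in> carrier G"
    using Cons.prems mk mp_closed assms(2,3) by auto
  have h: "E #> (a \<otimes> b) = (E #> a) \<otimes>\<^bsub>Q\<^esub> (E #> b)" if "a \<in> carrier G" "b \<in> carrier G" for a b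
    using hom_mult[OF proj_hom that] .
  have m: "E #> a \<in> carrier Q" if "a \<in> carrier G" for a using hom_in_carrier[OF proj_hom that] .
  show ?case unfolding mp_simps using Cons c h m kS assms(2,3) by (simp add: mk_mult Q.m_ac del: mult_FactGroup)
qed

text \<open>Both sides, as functions of a, are homomorphisms into the abelian group Q, so they need
  only be compared on the generators, where the coordinates are known.\<close>

lemma proj_normal_form:
  assumes a: "a \<in> carrier G" and ps: "distinct ps" "set ps = T" and ks: "distinct ks" "set ks = S"
  shows "E #> a = E #> (tp ps (\<lambda>p. zz p a) \<otimes> mp ks (\<lambda>k. ll k a))"
proof -
  interpret Q: comm_group Q by (rule Q_comm)
  define f where "f = (\<lambda>a. E #> (tp ps (\<lambda>p. zz p a) \<otimes> mp ks (\<lambda>k. ll k a)))"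
  have c: "tp ps z \<in> carrier G" for z using tp_closed ps by simp
  have d: "mp ks (\<lambda>k. ll k a) \<in> carrier G" if "a \<in> carrier G" for a using mp_closed[of ks "\<lambda>k. ll k a"] ll_nz that ks by simp
  have h: "E #> (a \<otimes> b) = (E #> a) \<otimes>\<^bsub>Q\<^esub> (E #> b)" if "a \<in> carrier G" "b \<in> carrier G" for a b
    using hom_mult[OF proj_hom that] .
  have m: "E #> a \<in> carrier Q" if "a \<in> carrier G" for a using hom_in_carrier[OF proj_hom that] .
  have tp_cong: "tp qs z = tp qs z'" if "\<And>p. p \<in> set qs ==> z p = z' p" for qs z z'
    using that by (induction qs) (auto simp: tp_simps)
  have mp_cong: "mp qs z = mp qs z'" if "\<And>p. p \<in> set qs ==> z p = z' p" for qs z z'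
    using that by (induction qs) (auto simp: mp_simps)
  have f_mult: "f (a \<otimes> b) = f a \<otimes>\<^bsub>Q\<^esub> f b" if ab: "a \<in> carrier G" "b \<in> carrier G" for a b
  proof -
    have "tp ps (\<lambda>p. zz p (a \<otimes> b)) = tp ps (\<lambda>p. zz p a + zz p b)" using zz_mult ab ps by (intro tp_cong) auto
    moreover have "mp ks (\<lambda>k. ll k (a \<otimes> b)) = mp ks (\<lambda>k. ll k a * ll k b)" using ll_mult ab ks by (intro mp_cong) auto
    ultimately have "f (a \<otimes> b) = (E #> tp ps (\<lambda>p. zz p a + zz p b)) \<otimes>\<^bsub>Q\<^esub> (E #> mp ks (\<lambda>k. ll k a * ll k b))"
      unfolding f_def using h[OF c mp_closed[of ks "\<lambda>k. ll k a * ll k b"]] ab ks ll_nz by simp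
    also have "\<dots> = f a \<otimes>\<^bsub>Q\<^esub> f b" unfolding f_def
      using proj_tp[of ps "\<lambda>p. zz p a" "\<lambda>p. zz p b"] proj_mp[of ks "\<lambda>k. ll k a" "\<lambda>k. ll k b"] ps ks ll_nz ab
      by (simp add: h c d m Q.m_ac del: mult_FactGroup)
    finally show ?thesis .
  qed
  have tp0: "tp qs (\<lambda>p. 0) = \<one>" if "set qs \<subseteq> T" for qs using that by (induction qs) (auto simp: tp_simps)
  have mp1: "mp qs (\<lambda>p. 1) = \<one>" if "set qs \<subseteq> S" for qs using that by (induction qs) (auto simp: mp_simps mk_one)
  have tpz: "tp ps (\<lambda>p. zz p a) = \<one>" if "\<And>p. p \<in> T ==> zz p a = 0" for a
    using tp_cong[of ps "\<lambda>p. zz p a" "\<lambda>_. 0"] tp0[of ps] that ps by simp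
  have mpz: "mp ks (\<lambda>k. ll k a) = \<one>" if "\<And>k. k \<in> S ==> ll k a = 1" for a
    using mp_cong[of ks "\<lambda>k. ll k a" "\<lambda>_. 1"] mp1[of ks] that ks by simp
  have tp_delta: "tp qs (\<lambda>p. if p = q then 1 else 0) = (if q \<in> set qs then th q else \<one>)" if "set qs \<subseteq> T" "distinct qs" for q qs
    using that by (induction qs) (auto simp: tp_simps th)
  have mp_delta: "mp qs (\<lambda>p. if p = q then c' else 1) = (if q \<in> set qs then mk q c' else \<one>)"
    if "set qs \<subseteq> S" "distinct qs" "c' \<noteq> 0" for q qs c'
    using that by (induction qs) (auto simp: mp_simps mk mk_one)
  have fE: "f e = E #> e" if "e \<in> E" for e
    unfolding f_def using tpz[of e] mpz[of e] zz_E ll_E that proj_E[OF that] proj_E[of \<one>] subgroup.one_closed[OF normal_imp_subgroup[OF E]]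
    by simp
  have fth: "f (th q) = E #> th q" if q: "q \<in> T" for q
  proof -
    have "tp ps (\<lambda>p. zz p (th q)) = th q"
      using tp_cong[of ps "\<lambda>p. zz p (th q)" "\<lambda>p. if p = q then 1 else 0"] tp_delta[of ps q] q ps zz_th by simp
    then show ?thesis unfolding f_def using mpz[of "th q"] ll_th q th by simp
  qed
  have fmk: "f (mk q c') = E #> mk q c'" if q: "q \<in> S" "c' \<noteq> 0" for q c'
  proof -
    have "mp ks (\<lambda>k. ll k (mk q c')) = mk q c'"
      using mp_cong[of ks "\<lambda>k. ll k (mk q c')" "\<lambda>k. if k = q then c' else 1"] mp_delta[of ks c' q] q ks ll_mk by simp
    then show ?thesis unfolding f_def using tpz[of "mk q c'"] zz_mk q mk by simp
  qed
  have f_hom: "f \<in> hom G Q" unfolding hom_def using f_mult c d m by (auto simp: f_def)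
  interpret f: group_hom G Q f unfolding group_hom_def group_hom_axioms_def using f_hom group_axioms Q_group by blast
  interpret p: group_hom G Q "\<lambda>a. E #> a" unfolding group_hom_def group_hom_axioms_def using proj_hom group_axioms Q_group by blast
  have base: "f h = E #> h \<and> h \<in> carrier G" if "h \<in> th ` T \<union> (\<Union>k\<in>S. mk k ` {c. c \<noteq> 0}) \<union> E" for h
    using that fE fth fmk th mk E_sub by auto
  have "f a = E #> a \<and> a \<in> carrier G" if "a \<in> generate G (th ` T \<union> (\<Union>k\<in>S. mk k ` {c. c \<noteq> 0}) \<union> E)" for a
    using that
  proof (induction a rule: generate.induct)
    case one
    then show ?case using fE subgroup.one_closed[OF normal_imp_subgroup[OF E]] by simp
  next
    case (incl h)
    then show ?case using base by blast
  next
    case (inv h)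
    then show ?case using base[OF inv] f.hom_inv[of h] p.hom_inv[of h] by simp
  next
    case (eng h1 h2)
    then show ?case using f_mult h by simp
  qed
  then show ?thesis using a gen unfolding f_def by auto
qed

lemma kernel_E:
  assumes a: "a \<in> carrier G" and z: "\<And>p. p \<in> T ==> zz p a = 0" and l: "\<And>k. k \<in> S ==> ll k a = 1"
  shows "a \<in> E"
proof -
  obtain ps ks where l': "distinct ps" "set ps = T" "distinct ks" "set ks = S"
    using finite_distinct_list[OF T] finite_distinct_list[OF S] by blast
  have "tp qs (\<lambda>p. zz p a) = \<one>" if "set qs \<subseteq> T" for qs using that z by (induction qs) (auto simp: tp_simps)
  moreover have "mp qs (\<lambda>k. ll k a) = \<one>" if "set qs \<subseteq> S" for qs using that l by (induction qs) (auto simp: mp_simps mk_one)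
  ultimately have "E #> a = E #> \<one>" using proj_normal_form[OF a l'] l' by simp
  then show ?thesis using proj_E'[OF a] proj_E[of \<one>] subgroup.one_closed[OF normal_imp_subgroup[OF E]] by simp
qed

text \<open>The coordinates of a give the first two factors, and the rest has trivial coordinates,
  hence lies in E by \<open>kernel_E\<close>. Conversely the coordinates recover z and lam from any
  such product, and then e is determined.\<close>

theorem normal_form:
  assumes ps: "distinct ps" "set ps = T" and ks: "distinct ks" "set ks = S" and a: "a \<in> carrier G"
  shows "\<exists>!(z, lam, e). (\<forall>p. p \<notin> T \<longrightarrow> z p = (0::int))
            \<and> (\<forall>k\<in>S. lam k \<noteq> (0::'k)) \<and> (\<forall>k. k \<notin> S \<longrightarrow> lam k = 1) \<and> e \<in> E
            \<and> a = tp ps z \<otimes> mp ks lam \<otimes> e" (is "\<exists>!x. ?R x")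
proof -
  have vals1: "zz p (tp ps z \<otimes> mp ks lam \<otimes> e) = z p" if "\<forall>k\<in>S. lam k \<noteq> 0" "e \<in> E" "p \<in> T" for z lam e p
    using that E_sub ps ks by (simp add: zz_mult tp_closed mp_closed zz_tp zz_mp zz_E)
  have vals2: "ll k (tp ps z \<otimes> mp ks lam \<otimes> e) = lam k" if "\<forall>k\<in>S. lam k \<noteq> 0" "e \<in> E" "k \<in> S" for z lam e k
    using that E_sub ps ks by (simp add: ll_mult tp_closed mp_closed ll_tp ll_mp ll_E)
  \<comment> \<open>The values 0 and 1 outside T and S are the prescribed defaults, without which
    the functions themselves would not be unique.\<close>
  define z where "z = (\<lambda>p. if p \<in> T then zz p a else 0)"
  define lam where "lam = (\<lambda>k. if k \<in> S then ll k a else 1)"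
  define b where "b = tp ps z \<otimes> mp ks lam"
  have lam0: "\<forall>k\<in>S. lam k \<noteq> 0" using ll_nz a by (simp add: lam_def)
  have c: "tp ps z \<in> carrier G" "mp ks lam \<in> carrier G" using tp_closed mp_closed ps ks lam0 by auto
  then have bc: "b \<in> carrier G" by (simp add: b_def)
  have "inv b \<otimes> a \<in> E"
  proof (rule kernel_E)
    show "inv b \<otimes> a \<in> carrier G" using bc a by simp
    have ab: "b \<otimes> (inv b \<otimes> a) = a" using bc a by (simp add: m_assoc[symmetric])
    have 1: "zz p b = zz p a" if "p \<in> T" for p unfolding b_def using that c ps ks lam0
      by (simp add: zz_mult zz_tp zz_mp z_def)
    have 2: "ll k b = ll k a" if "k \<in> S" for k unfolding b_def using that c ps ks lam0
      by (simp add: ll_mult ll_tp ll_mp) (simp add: lam_def)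
    show "zz p (inv b \<otimes> a) = 0" if "p \<in> T" for p
      using zz_mult[OF that bc, of "inv b \<otimes> a"] 1[OF that] ab bc a by simp
    show "ll k (inv b \<otimes> a) = 1" if "k \<in> S" for k
      using ll_mult[OF that bc, of "inv b \<otimes> a"] 2[OF that] ab bc a ll_nz[OF that a] by simp
  qed
  moreover have "a = tp ps z \<otimes> mp ks lam \<otimes> (inv b \<otimes> a)"
    unfolding b_def[symmetric] using bc a by (simp add: m_assoc[symmetric])
  moreover have "\<forall>p. p \<notin> T \<longrightarrow> z p = 0" "\<forall>k. k \<notin> S \<longrightarrow> lam k = 1" by (simp_all add: z_def lam_def)
  ultimately have ex: "?R (z, lam, inv b \<otimes> a)" using lam0 by simp
  show ?thesis
  proof (rule ex1I[of _ "(z, lam, inv b \<otimes> a)"])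
    show "?R (z, lam, inv b \<otimes> a)" by (rule ex)
    fix x assume x: "?R x"
    obtain z' lam' e' where x': "x = (z', lam', e')" by (cases x)
    have r: "\<forall>p. p \<notin> T \<longrightarrow> z' p = 0" "\<forall>k\<in>S. lam' k \<noteq> 0" "\<forall>k. k \<notin> S \<longrightarrow> lam' k = 1" "e' \<in> E" "a = tp ps z' \<otimes> mp ks lam' \<otimes> e'"
      using x unfolding x' by auto
    have zz': "z' = z"
    proof
      fix p show "z' p = z p"
        using r(1) vals1[OF r(2,4), of p z'] unfolding r(5)[symmetric] by (cases "p \<in> T") (simp_all add: z_def)
    qed
    have ll': "lam' = lam"
    proof
      fix k show "lam' k = lam k"
        using r(3) vals2[OF r(2,4), of k z'] unfolding r(5)[symmetric] by (cases "k \<in> S") (simp_all add: lam_def)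
    qed
    from zz' ll' have "a = b \<otimes> e'" using r(5) by (simp add: b_def)
    then have "e' = inv b \<otimes> a" using bc E_sub[OF r(4)] by (simp add: m_assoc[symmetric])
    then show "x = (z, lam, inv b \<otimes> a)" using x' zz' ll' by simp
  qed
qed

lemma surj_dual:
  obtains a where "a \<in> carrier G" "\<And>p. p \<in> T ==> zz p a = z p" "\<And>k. k \<in> S ==> lam k \<noteq> 0 ==> ll k a = lam k"
proof -
  obtain ps ks where l: "distinct ps" "set ps = T" "distinct ks" "set ks = S"
    using finite_distinct_list[OF T] finite_distinct_list[OF S] by blast
  define lam' where "lam' = (\<lambda>k. if lam k = 0 then 1 else lam k)"
  have n: "\<And>k. k \<in> S ==> lam' k \<noteq> 0" by (simp add: lam'_def)
  have c: "tp ps z \<in> carrier G" "mp ks lam' \<in> carrier G" using tp_closed mp_closed l n by auto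
  show thesis
    by (rule that[of "tp ps z \<otimes> mp ks lam'"])
      (use l n c in \<open>auto simp: zz_mult ll_mult zz_tp zz_mp ll_tp ll_mp lam'_def\<close>)
qed

text \<open>A homomorphism that is trivial exactly where all coordinates are has kernel E, so every
  description of the quotient reduces to arranging the coordinates suitably.\<close>

lemma quotient_iso:
  assumes H: "group H" and h: "h \<in> hom G H" "h ` carrier G = carrier H"
    and k: "\<And>a. a \<in> carrier G ==> h a = \<one>\<^bsub>H\<^esub> \<longleftrightarrow> (\<forall>p\<in>T. zz p a = 0) \<and> (\<forall>k\<in>S. ll k a = 1)"
  shows "Q \<cong> H"
proof -
  interpret h: group_hom G H h unfolding group_hom_def group_hom_axioms_def using H h group_axioms by blast
  have "kernel G H h = E"
  proof
    show "kernel G H h \<subseteq> E"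
    proof
      fix a assume "a \<in> kernel G H h"
      then have a: "a \<in> carrier G" "h a = \<one>\<^bsub>H\<^esub>" by (simp_all add: kernel_def)
      show "a \<in> E" using k[OF a(1)] a(2) by (intro kernel_E[OF a(1)]) simp_all
    qed
    show "E \<subseteq> kernel G H h"
    proof
      fix a assume a: "a \<in> E"
      show "a \<in> kernel G H h" using k[OF E_sub[OF a]] zz_E[OF _ a] ll_E[OF _ a] E_sub[OF a] by (simp add: kernel_def)
    qed
  qed
  then show ?thesis using h.FactGroup_iso[OF h(2)] by simp
qed

lemma mk_subgroup: assumes "k \<in> S" shows "subgroup (mk k ` {c. c \<noteq> 0}) G"
proof (rule subgroupI)
  show "mk k ` {c. c \<noteq> 0} \<subseteq> carrier G" using mk assms by auto
  show "mk k ` {c. c \<noteq> 0} \<noteq> {}" by (auto intro: exI[of _ 1])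
  fix a b assume "a \<in> mk k ` {c. c \<noteq> 0}" "b \<in> mk k ` {c. c \<noteq> 0}"
  then obtain c d where cd: "c \<noteq> 0" "d \<noteq> 0" "a = mk k c" "b = mk k d" by auto
  have "a \<otimes> b = mk k (c * d)" using mk_mult[OF assms cd(1,2)] cd by simp
  then show "a \<otimes> b \<in> mk k ` {c. c \<noteq> 0}" using cd by auto
  have "mk k (inverse c) \<otimes> mk k c = \<one>" using mk_mult[OF assms, of "inverse c" c] cd mk_one[OF assms] by simp
  then have "inv a = mk k (inverse c)" using inv_equality mk[OF assms] cd by simp
  then show "inv a \<in> mk k ` {c. c \<noteq> 0}" using cd by auto
qed

theorem quotient_internal:
  "Q \<cong> product_group T (\<lambda>p. G\<lparr>carrier := generate G {th p}\<rparr>) \<times>\<times> product_group S (\<lambda>k. G\<lparr>carrier := mk k ` {c. c \<noteq> 0}\<rparr>)"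
    (is "_ \<cong> product_group T ?A \<times>\<times> product_group S ?B")
proof (rule quotient_iso)
  have A: "group (?A p)" if "p \<in> T" for p
    using subgroup.subgroup_is_group[OF generate_is_subgroup group_axioms, of "{th p}"] th that by simp
  have B: "group (?B k)" if "k \<in> S" for k
    using subgroup.subgroup_is_group[OF mk_subgroup[OF that] group_axioms] .
  show "group (product_group T ?A \<times>\<times> product_group S ?B)"
    by (intro DirProd_group product_group A B)
  define h where "h = (\<lambda>a. (\<lambda>p\<in>T. th p [^] zz p a, \<lambda>k\<in>S. mk k (ll k a)))"
  have gp: "generate G {th p} = {th p [^] (i :: int) | i. i \<in> UNIV}" if "p \<in> T" for p
    using generate_pow[OF th[OF that]] by simp
  have hc: "h a \<in> carrier (product_group T ?A \<times>\<times> product_group S ?B)" if "a \<in> carrier G" for a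
    unfolding h_def using gp ll_nz that by (auto simp: DirProd_def)
  show "h \<in> hom G (product_group T ?A \<times>\<times> product_group S ?B)"
    unfolding hom_def
  proof (intro CollectI conjI ballI)
    show "h \<in> carrier G \<rightarrow> carrier (product_group T ?A \<times>\<times> product_group S ?B)" using hc by blast
    fix a b assume ab: "a \<in> carrier G" "b \<in> carrier G"
    show "h (a \<otimes> b) = h a \<otimes>\<^bsub>product_group T ?A \<times>\<times> product_group S ?B\<^esub> h b"
      unfolding h_def using ab
      by (auto simp: DirProd_def zz_mult ll_mult int_pow_mult th mk_mult ll_nz intro!: restrict_ext)
  qed
  show "h ` carrier G = carrier (product_group T ?A \<times>\<times> product_group S ?B)"
  proof
    show "h ` carrier G \<subseteq> carrier (product_group T ?A \<times>\<times> product_group S ?B)" using hc by blast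
    show "carrier (product_group T ?A \<times>\<times> product_group S ?B) \<subseteq> h ` carrier G"
    proof
      fix x assume "x \<in> carrier (product_group T ?A \<times>\<times> product_group S ?B)"
      then obtain u v where x: "x = (u, v)" "u \<in> (\<Pi>\<^sub>E p\<in>T. generate G {th p})" "v \<in> (\<Pi>\<^sub>E k\<in>S. mk k ` {c. c \<noteq> 0})"
        by (auto simp: DirProd_def)
      have "\<forall>p\<in>T. \<exists>i :: int. u p = th p [^] i" using x(2) gp by (fastforce simp: PiE_iff)
      then obtain z where z: "\<And>p. p \<in> T ==> u p = th p [^] (z p :: int)" by metis
      have "\<forall>k\<in>S. \<exists>c. c \<noteq> 0 \<and> v k = mk k c" using x(3) by (fastforce simp: PiE_iff)
      then obtain lam where lam: "\<And>k. k \<in> S ==> lam k \<noteq> 0 \<and> v k = mk k (lam k)" by metis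
      obtain a where a: "a \<in> carrier G" "\<And>p. p \<in> T ==> zz p a = z p" "\<And>k. k \<in> S ==> lam k \<noteq> 0 ==> ll k a = lam k"
        using surj_dual[of z lam] by blast
      have "u = (\<lambda>p\<in>T. th p [^] zz p a)" "v = (\<lambda>k\<in>S. mk k (ll k a))"
        using x(2,3) z a lam by (auto simp: PiE_iff extensional_def intro!: ext)
      then show "x \<in> h ` carrier G" using a(1) x(1) by (auto simp: h_def)
    qed
  qed
  fix a assume a: "a \<in> carrier G"
  have zt: "th p [^] zz p a = \<one> \<longleftrightarrow> zz p a = 0" if "p \<in> T" for p
    using zz_pow[OF that th[OF that], of "zz p a"] zz_th[OF that that] zz_one[OF that] by auto
  have lt: "mk k (ll k a) = \<one> \<longleftrightarrow> ll k a = 1" if "k \<in> S" for k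
    using ll_mk[OF that that ll_nz[OF that a]] ll_one[OF that] mk_one[OF that] by auto
  have "h a = \<one>\<^bsub>product_group T ?A \<times>\<times> product_group S ?B\<^esub> \<longleftrightarrow> (\<forall>p\<in>T. th p [^] zz p a = \<one>) \<and> (\<forall>k\<in>S. mk k (ll k a) = \<one>)"
    unfolding h_def by (auto simp: DirProd_def restrict_def fun_eq_iff)
  then show "h a = \<one>\<^bsub>product_group T ?A \<times>\<times> product_group S ?B\<^esub> \<longleftrightarrow> (\<forall>p\<in>T. zz p a = 0) \<and> (\<forall>k\<in>S. ll k a = 1)"
    using zt lt by auto
qed

theorem quotient_external:
  assumes f: "bij_betw f I T" and g: "bij_betw g J S"
  shows "Q \<cong> product_group I (\<lambda>_. integer_group) \<times>\<times> product_group J (\<lambda>_. (Kstar :: 'k monoid))"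
    (is "_ \<cong> ?A \<times>\<times> ?B")
proof (rule quotient_iso)
  have K: "group (Kstar :: 'k monoid)" using comm_group.axioms(2)[OF Kstar_group] .
  show "group (?A \<times>\<times> ?B)" by (intro DirProd_group product_group K group_integer_group)
  define h where "h = (\<lambda>a. (\<lambda>i\<in>I. zz (f i) a, \<lambda>j\<in>J. ll (g j) a))"
  have fT: "f i \<in> T" if "i \<in> I" for i using f that by (auto simp: bij_betw_def)
  have gS: "g j \<in> S" if "j \<in> J" for j using g that by (auto simp: bij_betw_def)
  have hc: "h a \<in> carrier (?A \<times>\<times> ?B)" if "a \<in> carrier G" for a
    unfolding h_def using ll_nz gS that by (auto simp: DirProd_def integer_group_def Kstar_def)
  show "h \<in> hom G (?A \<times>\<times> ?B)"
    unfolding hom_def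
  proof (intro CollectI conjI ballI)
    show "h \<in> carrier G \<rightarrow> carrier (?A \<times>\<times> ?B)" using hc by blast
    fix a b assume ab: "a \<in> carrier G" "b \<in> carrier G"
    show "h (a \<otimes> b) = h a \<otimes>\<^bsub>?A \<times>\<times> ?B\<^esub> h b"
      unfolding h_def using ab fT gS
      by (auto simp: DirProd_def zz_mult ll_mult integer_group_def Kstar_def intro!: restrict_ext)
  qed
  show "h ` carrier G = carrier (?A \<times>\<times> ?B)"
  proof
    show "h ` carrier G \<subseteq> carrier (?A \<times>\<times> ?B)" using hc by blast
    show "carrier (?A \<times>\<times> ?B) \<subseteq> h ` carrier G"
    proof
      fix x assume "x \<in> carrier (?A \<times>\<times> ?B)"
      then obtain u v where x: "x = (u, v)" "u \<in> (\<Pi>\<^sub>E i\<in>I. UNIV)" "v \<in> (\<Pi>\<^sub>E j\<in>J. {c. c \<noteq> 0})"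
        by (auto simp: DirProd_def integer_group_def Kstar_def)
      define f' g' where "f' = the_inv_into I f" and "g' = the_inv_into J g"
      have inv: "f' (f i) = i" if "i \<in> I" for i using f that by (auto simp: f'_def bij_betw_def the_inv_into_f_f)
      have inv': "g' (g j) = j" if "j \<in> J" for j using g that by (auto simp: g'_def bij_betw_def the_inv_into_f_f)
      obtain a where a: "a \<in> carrier G" "\<And>p. p \<in> T ==> zz p a = u (f' p)"
          "\<And>k. k \<in> S ==> v (g' k) \<noteq> 0 ==> ll k a = v (g' k)"
        using surj_dual[of "\<lambda>p. u (f' p)" "\<lambda>k. v (g' k)"] by blast
      have "u = (\<lambda>i\<in>I. zz (f i) a)" using x(2) a(2)[OF fT] inv by (auto simp: PiE_iff extensional_def intro!: ext)
      moreover have "v = (\<lambda>j\<in>J. ll (g j) a)"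
      proof
        fix j show "v j = (\<lambda>j\<in>J. ll (g j) a) j"
          using x(3) a(3)[OF gS, of j] inv'[of j] by (auto simp: PiE_iff extensional_def)
      qed
      ultimately show "x \<in> h ` carrier G" using a(1) x(1) by (auto simp: h_def)
    qed
  qed
  fix a assume a: "a \<in> carrier G"
  have "h a = \<one>\<^bsub>?A \<times>\<times> ?B\<^esub> \<longleftrightarrow> (\<forall>i\<in>I. zz (f i) a = 0) \<and> (\<forall>j\<in>J. ll (g j) a = 1)"
    unfolding h_def by (auto simp: DirProd_def restrict_def fun_eq_iff integer_group_def Kstar_def)
  also have "\<dots> \<longleftrightarrow> (\<forall>p\<in>T. zz p a = 0) \<and> (\<forall>k\<in>S. ll k a = 1)"
    using f g unfolding bij_betw_def by auto
  finally show "h a = \<one>\<^bsub>?A \<times>\<times> ?B\<^esub> \<longleftrightarrow> (\<forall>p\<in>T. zz p a = 0) \<and> (\<forall>k\<in>S. ll k a = 1)" .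
qed

theorem quotient_single:
  assumes T: "T = {}" and S: "S = {k}"
  shows "Q \<cong> (Kstar :: 'k monoid)"
proof (rule quotient_iso[of _ "ll k"])
  have k: "k \<in> S" using S by simp
  show "group (Kstar :: 'k monoid)" using comm_group.axioms(2)[OF Kstar_group] .
  show "ll k \<in> hom G Kstar" using group_hom.homh[OF ll_hom[OF k]] .
  have "c \<in> ll k ` carrier G" if "c \<noteq> 0" for c using ll_mk[OF k k that] mk[OF k that] by (metis image_eqI)
  then show "ll k ` carrier G = carrier Kstar" using ll_nz[OF k] by (auto simp: Kstar_def)
  show "ll k a = \<one>\<^bsub>Kstar\<^esub> \<longleftrightarrow> (\<forall>p\<in>T. zz p a = 0) \<and> (\<forall>k\<in>S. ll k a = 1)" for a using T S by (simp add: Kstar_def)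
qed

end

section \<open>The identification with matrices\<close>

definition bnd :: "nat \<Rightarrow> 'k::field mat \<Rightarrow> bool" where
  "bnd r M \<longleftrightarrow> (\<forall>k l. k \<ge> r \<or> l \<ge> r \<longrightarrow> M k l = idm k l)"

lemma bnd_le: "bnd r M ==> r \<le> s ==> bnd s M"
  unfolding bnd_def by (meson order_trans)

lemma fin_dev_bnd: "fin_dev M \<longleftrightarrow> (\<exists>r. bnd r M)"
proof
  assume f: "fin_dev M"
  define r where "r = Suc (Max (insert 0 (fst ` {(k,l). M k l \<noteq> idm k l} \<union> snd ` {(k,l). M k l \<noteq> idm k l})))"
  have "k < r \<and> l < r" if "M k l \<noteq> idm k l" for k l
  proof -
    have "k \<in> fst ` {(k,l). M k l \<noteq> idm k l}" "l \<in> snd ` {(k,l). M k l \<noteq> idm k l}" using that by force+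
    then show ?thesis using f unfolding fin_dev_def r_def less_Suc_eq_le by (intro conjI Max_ge) auto
  qed
  then have "bnd r M" unfolding bnd_def by (meson linorder_not_less)
  then show "\<exists>r. bnd r M" ..
next
  assume "\<exists>r. bnd r M"
  then obtain r where "bnd r M" ..
  then have "{(k,l). M k l \<noteq> idm k l} \<subseteq> {..<r} \<times> {..<r}" unfolding bnd_def by (auto simp: not_le[symmetric])
  then show "fin_dev M" unfolding fin_dev_def by (rule finite_subset) simp
qed

lemma bnd_common: "fin_dev M ==> fin_dev M' ==> \<exists>r. bnd r M \<and> bnd r M'"
  unfolding fin_dev_bnd by (meson bnd_le linorder_linear)

lemma mmult_bnd:
  assumes M: "bnd r M"
  shows "k < r ==> mmult M M' k l = (\<Sum>j<r. M k j * M' j l)" "k \<ge> r ==> mmult M M' k l = M' k l"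
proof -
  assume k: "k < r"
  have "{j. M k j \<noteq> 0} \<subseteq> {..<r}" using M k by (auto simp: bnd_def idm_def not_le[symmetric])
  then show "mmult M M' k l = (\<Sum>j<r. M k j * M' j l)"
    unfolding mmult_def by (intro sum.mono_neutral_left) auto
next
  assume "k \<ge> r"
  then have "M k j = idm k j" for j using M by (auto simp: bnd_def)
  then have "mmult M M' k l = (\<Sum>j\<in>{k}. M k j * M' j l)" unfolding mmult_def by (intro sum.cong) (auto simp: idm_def)
  then show "mmult M M' k l = M' k l" using \<open>\<And>j. M k j = idm k j\<close> by (simp add: idm_def)
qed

lemma bnd_mmult: assumes "bnd r M" "bnd r M'" shows "bnd r (mmult M M')"
  unfolding bnd_def
proof (intro allI impI)
  fix k l assume kl: "r \<le> k \<or> r \<le> l"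
  show "mmult M M' k l = idm k l"
  proof (cases "k < r")
    case True
    then have "r \<le> l" using kl by simp
    then have "mmult M M' k l = (\<Sum>j<r. M k j * idm j l)" using mmult_bnd(1)[OF assms(1) True] assms(2) by (simp add: bnd_def)
    also have "\<dots> = 0" using \<open>r \<le> l\<close> by (intro sum.neutral) (auto simp: idm_def)
    finally show ?thesis using True \<open>r \<le> l\<close> by (simp add: idm_def)
  next
    case False
    then show ?thesis using mmult_bnd(2)[OF assms(1)] assms(2) by (simp add: bnd_def)
  qed
qed

context jacobson_ideal begin

abbreviation "CC \<equiv> Sn N' :: 'k jac set"

definition tm :: "nat \<Rightarrow> 'k mat \<Rightarrow> 'k jac" where
  "tm r F = (\<Sum>i<r. \<Sum>j<r. F i j * mx i j)"

definition mats :: "'k mat set" where "mats = {M. fin_dev M \<and> (\<forall>k l. M k l \<in> CC)}"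

lemma iota_tm: assumes "bnd r M" shows "iota n M = 1 + tm r (\<lambda>i j. M i j - idm i j)"
proof -
  have "(\<Sum>(k,l)\<in>{(k,l). M k l \<noteq> idm k l}. (M k l - idm k l) * Est k l n)
     = (\<Sum>(k,l)\<in>{..<r} \<times> {..<r}. (M k l - idm k l) * Est k l n)"
    by (rule sum.mono_neutral_left) (use assms in \<open>auto simp: bnd_def not_le[symmetric]\<close>)
  then show ?thesis unfolding iota_def tm_def mx_Est by (simp add: sum.cartesian_product)
qed

lemma tm_add: "tm r (\<lambda>i j. F i j + F' i j) = tm r F + tm r F'"
  by (simp add: tm_def distrib_right sum.distrib)

lemma tm_mult:
  assumes "\<And>i j. F' i j \<in> CC"
  shows "tm r F * tm r F' = tm r (\<lambda>i l. \<Sum>j<r. F i j * F' j l)"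
proof -
  have e: "F i j * mx i j * (F' k l * mx k l) = (if j = k then F i j * F' j l * mx i l else 0)" for i j k l
  proof -
    have "F i j * mx i j * (F' k l * mx k l) = F i j * (mx i j * F' k l) * mx k l" by (simp only: mult.assoc)
    also have "mx i j * F' k l = F' k l * mx i j" using C_mx[OF assms] by simp
    also have "F i j * (F' k l * mx i j) * mx k l = F i j * F' k l * (mx i j * mx k l)" by (simp only: mult.assoc)
    finally show ?thesis unfolding mx_mult by simp
  qed
  have "tm r F * tm r F' = (\<Sum>i<r. \<Sum>j<r. \<Sum>k<r. \<Sum>l<r. F i j * mx i j * (F' k l * mx k l))"
    unfolding tm_def by (simp add: sum_distrib_right) (simp add: sum_distrib_left)
  also have "\<dots> = (\<Sum>i<r. \<Sum>j<r. \<Sum>l<r. F i j * F' j l * mx i l)"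
  proof (rule sum.cong[OF refl], rule sum.cong[OF refl])
    fix i j assume "j \<in> {..<r}"
    have "(\<Sum>k<r. \<Sum>l<r. F i j * mx i j * (F' k l * mx k l)) = (\<Sum>k<r. if j = k then (\<Sum>l<r. F i j * F' j l * mx i l) else 0)"
      unfolding e by (intro sum.cong refl) simp
    then show "(\<Sum>k<r. \<Sum>l<r. F i j * mx i j * (F' k l * mx k l)) = (\<Sum>l<r. F i j * F' j l * mx i l)"
      using \<open>j \<in> {..<r}\<close> by simp
  qed
  also have "\<dots> = (\<Sum>i<r. \<Sum>l<r. \<Sum>j<r. F i j * F' j l * mx i l)"
    by (rule sum.cong[OF refl], rule sum.swap)
  also have "\<dots> = tm r (\<lambda>i l. \<Sum>j<r. F i j * F' j l)" unfolding tm_def by (simp add: sum_distrib_right)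
  finally show ?thesis .
qed

lemma idm_Sn: "idm k l \<in> Sn V" by (simp add: idm_def Sn_0 Sn_1)

lemma iota_mult:
  assumes "M \<in> mats" "M' \<in> mats" shows "iota n (mmult M M') = iota n M * iota n M'"
proof -
  obtain r where r: "bnd r M" "bnd r M'" using bnd_common[of M M'] assms by (auto simp: mats_def)
  have S': "M' i j - idm i j \<in> CC" for i j using assms by (auto simp: mats_def intro!: Sn_diff idm_Sn)
  have e: "mmult M M' i l - idm i l = (M i l - idm i l) + ((M' i l - idm i l) + (\<Sum>j<r. (M i j - idm i j) * (M' j l - idm j l)))"
    if il: "i < r" "l < r" for i l
  proof -
    have d: "(\<Sum>j<r. idm i j * M' j l) = M' i l" "(\<Sum>j<r. M i j * idm j l) = M i l" "(\<Sum>j<r. idm i j * idm j l) = (idm i l :: 'k jac)"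
      using il by (simp_all add: idm_def if_distrib[of "\<lambda>x. x * _"] if_distrib[of "\<lambda>x. _ * x"] cong: if_cong)
    have "(\<Sum>j<r. (M i j - idm i j) * (M' j l - idm j l)) = (\<Sum>j<r. M i j * M' j l) - M' i l - M i l + idm i l"
      by (simp add: algebra_simps sum.distrib sum_subtractf d)
    then show ?thesis using mmult_bnd(1)[OF r(1) il(1), of M' l] by simp
  qed
  have "iota n (mmult M M') = 1 + tm r (\<lambda>i l. (M i l - idm i l) + ((M' i l - idm i l) + (\<Sum>j<r. (M i j - idm i j) * (M' j l - idm j l))))"
    unfolding iota_tm[OF bnd_mmult[OF r]] tm_def by (intro arg_cong2[of _ _ _ _ "(+)"] sum.cong refl) (simp only: e lessThan_iff)
  also have "\<dots> = iota n M * iota n M'"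
    unfolding tm_add tm_mult[OF S', symmetric] iota_tm[OF r(1)] iota_tm[OF r(2)] by (simp add: algebra_simps)
  finally show ?thesis .
qed

lemma mats_mult: assumes "M \<in> mats" "M' \<in> mats" shows "mmult M M' \<in> mats"
proof -
  obtain r where r: "bnd r M" "bnd r M'" using bnd_common[of M M'] assms by (auto simp: mats_def)
  have "mmult M M' k l \<in> CC" for k l
    unfolding mmult_def using assms by (auto simp: mats_def intro!: Sn_sum Sn_mult)
  then show ?thesis using bnd_mmult[OF r] fin_dev_bnd[of "mmult M M'"] by (auto simp: mats_def)
qed

lemma bnd_idm: "bnd 0 (idm :: 'k mat)" by (simp add: bnd_def)

lemma idm_mats: "idm \<in> mats" using bnd_idm fin_dev_bnd[of "idm :: 'k mat"] by (auto simp: mats_def intro: idm_Sn)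

lemma iota_idm: "iota n idm = (1 :: 'k jac)" using iota_tm[OF bnd_idm] by (simp add: tm_def)

text \<open>c e_n = 0 means c = c x_n y_n; all monomials on the right involve x_n, while those of c
  do not.\<close>

lemma coeff_zero: assumes c: "c \<in> CC" and z: "c * mx 0 0 = 0" shows "c = 0"
proof (rule ccontr)
  assume "c \<noteq> 0"
  then obtain m where m: "m \<in> pkeys c" by (metis keys_eq_empty ex_in_conv)
  have "c = c * (X n * Y n)" using z unfolding ee_mx[symmetric] ee_def by (simp add: algebra_simps)
  also have "X n * Y n = psingle (mono_at n (1,0) + mono_at n (0,1)) (1 :: 'k)"
    by (simp add: X_def Y_def mult_single)
  finally have "c = c * psingle (mono_at n (1,0) + mono_at n (0,1)) 1" .
  then have "m \<in> pkeys (c * psingle (mono_at n (1,0) + mono_at n (0,1)) 1)" using m by simp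
  then obtain a b where ab: "a \<in> pkeys c" "b \<in> pkeys (psingle (mono_at n (1,0) + mono_at n (0,1)) (1 :: 'k))" "m = a + b"
    using keys_mult by blast
  have "ea m n = 0" "ea a n = 0" "eb a n = 0" using c m ab(1) n_notin unfolding Sn_def by auto
  moreover have "ea b n = 1" using ab(2) by (simp add: ea_add e_mono_at split: if_splits)
  ultimately show False using ab(3) by (simp add: ea_add)
qed

text \<open>Multiplication by matrix units on both sides isolates one entry, so that
  \<open>coeff_zero\<close> can recover a matrix from its image under \<open>iota\<close>.\<close>

lemma mx_tm_mx: assumes F: "\<And>i j. F i j \<in> CC" and kl: "k < r" "l < r" shows "mx 0 k * tm r F * mx l 0 = F k l * mx 0 0"
proof -
  have "mx 0 k * (F i j * mx i j) * mx l 0 = (if i = k then if j = l then F i j * mx 0 0 else 0 else 0)" for i j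
  proof -
    have "mx 0 k * (F i j * mx i j) * mx l 0 = (mx 0 k * F i j) * (mx i j * mx l 0)" by (simp only: mult.assoc)
    also have "mx 0 k * F i j = F i j * mx 0 k" using C_mx[OF F] by simp
    finally show ?thesis by (simp add: mx_mult mult.assoc)
  qed
  then have "mx 0 k * tm r F * mx l 0 = (\<Sum>i<r. \<Sum>j<r. if i = k then if j = l then F i j * mx 0 0 else 0 else 0)"
    unfolding tm_def by (simp add: sum_distrib_left sum_distrib_right)
  also have "\<dots> = (\<Sum>i<r. if i = k then F i l * mx 0 0 else 0)" using kl by (intro sum.cong refl) auto
  finally show ?thesis using kl by simp
qed

lemma iota_inj: assumes "M \<in> mats" "M' \<in> mats" "iota n M = iota n M'" shows "M = M'"
proof (intro ext)
  fix k l
  obtain r where r: "bnd r M" "bnd r M'" using bnd_common[of M M'] assms by (auto simp: mats_def)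
  have S': "M i j - idm i j \<in> CC" "M' i j - idm i j \<in> CC" for i j using assms by (auto simp: mats_def intro!: Sn_diff idm_Sn)
  show "M k l = M' k l"
  proof (cases "k < r \<and> l < r")
    case True
    then have kl: "k < r" "l < r" by auto
    have "tm r (\<lambda>i j. M i j - idm i j) = tm r (\<lambda>i j. M' i j - idm i j)"
      using assms(3) unfolding iota_tm[OF r(1)] iota_tm[OF r(2)] by simp
    then have "(M k l - idm k l) * mx 0 0 = (M' k l - idm k l) * mx 0 0"
      using mx_tm_mx[of "\<lambda>i j. M i j - idm i j", OF S'(1) kl] mx_tm_mx[of "\<lambda>i j. M' i j - idm i j", OF S'(2) kl] by simp
    then have "((M k l - idm k l) - (M' k l - idm k l)) * mx 0 0 = 0" by (simp add: left_diff_distrib)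
    then have "(M k l - idm k l) - (M' k l - idm k l) = 0" by (rule coeff_zero[OF Sn_diff[OF S']])
    then show ?thesis by simp
  next
    case False
    then show ?thesis using r by (auto simp: bnd_def not_less)
  qed
qed

lemma iota_Fin: assumes D: "idl D" and M: "fin_dev M" "\<And>k l. M k l - idm k l \<in> D" shows "iota n M - 1 \<in> Fin D"
proof -
  obtain r where r: "bnd r M" using M fin_dev_bnd[of M] by blast
  have s: "sum f I \<in> Fin D" if "\<And>i. i \<in> I ==> f i \<in> Fin D" for f :: "nat \<Rightarrow> 'k jac" and I
    using that by (induction I rule: infinite_finite_induct) (auto intro: Fin.zero Fin_add)
  show ?thesis unfolding iota_tm[OF r] tm_def using M by (auto intro!: s Fin_mx)
qed

lemma Fin_iota:
  assumes D: "idl D" and u: "u \<in> Fin D"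
  shows "\<exists>M\<in>mats. (\<forall>k l. M k l - idm k l \<in> D) \<and> iota n M = 1 + u"
  using u
proof (induction u rule: Fin.induct)
  case zero
  show ?case using idm_mats iota_idm D by (intro bexI[of _ idm]) (auto simp: idl_def)
next
  case (step c u k l)
  then obtain M where M: "M \<in> mats" "\<And>k l. M k l - idm k l \<in> D" "iota n M = 1 + u" by blast
  obtain r0 where "bnd r0 M" using M fin_dev_bnd[of M] by (auto simp: mats_def)
  define r where "r = Suc (r0 + k + l)"
  have r: "bnd r M" "k < r" "l < r" using bnd_le[OF \<open>bnd r0 M\<close>, of r] by (auto simp: r_def)
  define F where "F = (\<lambda>i j. if i = k \<and> j = l then c else 0)"
  define M' where "M' = (\<lambda>i j. M i j + F i j)"
  have D': "c \<in> CC" "0 \<in> D" "\<And>a b. a \<in> D ==> b \<in> D ==> a + b \<in> D" using D step(1) by (auto simp: idl_def)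
  have r': "bnd r M'" using r by (auto simp: bnd_def M'_def F_def)
  have "M' \<in> mats" using M(1) D' r' fin_dev_bnd[of M'] by (auto simp: mats_def M'_def F_def intro!: Sn_add Sn_0)
  moreover have "M' i j - idm i j \<in> D" for i j
    using D'(3)[OF M(2)[of i j], of "F i j"] step(1) D'(2) by (simp add: M'_def F_def algebra_simps)
  moreover have "iota n M' = 1 + (c * mx k l + u)"
  proof -
    have "tm r F = (\<Sum>i<r. if i = k then c * mx k l else 0)"
      unfolding tm_def F_def using r by (intro sum.cong refl) (auto simp: if_distrib[of "\<lambda>x. x * _"] cong: if_cong)
    then have "tm r F = c * mx k l" using r by simp
    moreover have "tm r (\<lambda>i j. M' i j - idm i j) = tm r (\<lambda>i j. M i j - idm i j) + tm r F"
      unfolding tm_add[symmetric] M'_def by (simp add: algebra_simps)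
    ultimately show ?thesis using M(3) unfolding iota_tm[OF r'] iota_tm[OF r(1)] by (simp add: algebra_simps)
  qed
  ultimately show ?case by blast
qed

lemma GLset_iff: "M \<in> GLset CC \<longleftrightarrow> M \<in> mats \<and> iota n M \<in> GL CC"
proof
  assume "M \<in> GLset CC"
  then obtain M' where M: "M \<in> mats" "M' \<in> mats" "mmult M M' = idm" "mmult M' M = idm" by (auto simp: GLset_def mats_def)
  have i: "iota n M * iota n M' = 1" "iota n M' * iota n M = 1"
    unfolding iota_mult[OF M(1,2), symmetric] iota_mult[OF M(2,1), symmetric] M(3,4) iota_idm by simp_all
  have F: "iota n M - 1 \<in> Fin CC" if "M \<in> mats" for M
    using that by (intro iota_Fin[OF idl_C]) (auto simp: mats_def intro!: Sn_diff idm_Sn)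
  show "M \<in> mats \<and> iota n M \<in> GL CC" using GLI[OF F[OF M(1)] F[OF M(2)] i] M(1) by blast
next
  assume M: "M \<in> mats \<and> iota n M \<in> GL CC"
  then obtain M' where M': "M' \<in> mats" "iota n M' = uinv (iota n M)"
    using Fin_iota[OF idl_C, of "uinv (iota n M) - 1"] by (auto simp: GL_def)
  have u: "unt (iota n M)" using M GL_unt by blast
  have "mmult M M' = idm" "mmult M' M = idm"
    using M M' u by (auto intro!: iota_inj mats_mult idm_mats simp: iota_mult iota_idm)
  then show "M \<in> GLset CC" using M M' by (auto simp: GLset_def mats_def)
qed

lemma GLrel_iff: "M \<in> GLrel CC P \<longleftrightarrow> M \<in> mats \<and> iota n M \<in> GL P"
proof
  assume M: "M \<in> GLrel CC P"
  then have "M \<in> mats" "iota n M \<in> GL CC" using GLset_iff by (auto simp: GLrel_def)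
  moreover have "iota n M - 1 \<in> Fin P" using M \<open>M \<in> mats\<close> by (intro iota_Fin[OF P_idl]) (auto simp: GLrel_def mats_def)
  ultimately show "M \<in> mats \<and> iota n M \<in> GL P" by (auto simp: GL_def)
next
  assume M: "M \<in> mats \<and> iota n M \<in> GL P"
  then obtain M' where M': "M' \<in> mats" "\<And>k l. M' k l - idm k l \<in> P" "iota n M' = iota n M"
    using Fin_iota[OF P_idl, of "iota n M - 1"] by (auto simp: GL_def)
  then have "M' = M" using iota_inj M by blast
  then show "M \<in> GLrel CC P" using M' M GLset_iff GL_C[OF P_idl] by (auto simp: GLrel_def)
qed

lemma GL_onto: assumes D: "idl D" and u: "u \<in> GL D" shows "\<exists>M\<in>mats. iota n M = u"
  using Fin_iota[OF D, of "u - 1"] u by (auto simp: GL_def)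

abbreviation "GG \<equiv> GLinf CC :: 'k mat monoid"

lemma GG_simps: "carrier GG = GLset CC" "a \<otimes>\<^bsub>GG\<^esub> b = mmult a b" "\<one>\<^bsub>GG\<^esub> = idm"
  by (simp_all add: GLinf_def)

lemma GG_mult: assumes "M \<in> GLset CC" "M' \<in> GLset CC" shows "mmult M M' \<in> GLset CC"
  using assms unfolding GLset_iff by (auto simp: iota_mult mats_mult intro: GL_mult[OF idl_C])

text \<open>The group laws are pulled back from the algebra along the injective multiplicative map
  \<open>iota\<close>, which avoids manipulating the sums in \<open>mmult\<close>.\<close>

lemma GG_group: "group GG"
proof (rule groupI; unfold GG_simps)
  show "idm \<in> GLset CC" unfolding GLset_iff using idm_mats iota_idm GL_1 by simp
  show "mmult x y \<in> GLset CC" if "x \<in> GLset CC" "y \<in> GLset CC" for x y using GG_mult that .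
  show "mmult (mmult x y) z = mmult x (mmult y z)" if "x \<in> GLset CC" "y \<in> GLset CC" "z \<in> GLset CC" for x y z
    using that unfolding GLset_iff by (intro iota_inj) (auto simp: iota_mult mats_mult mult.assoc)
  show "mmult idm x = x" if "x \<in> GLset CC" for x
    using that unfolding GLset_iff by (intro iota_inj) (auto simp: iota_mult mats_mult idm_mats iota_idm)
  show "\<exists>y\<in>GLset CC. mmult y x = idm" if x: "x \<in> GLset CC" for x
  proof -
    have x: "x \<in> mats" "iota n x \<in> GL CC" using x GLset_iff by auto
    then obtain y where y: "y \<in> mats" "iota n y = uinv (iota n x)" using GL_onto[OF idl_C GL_inv[OF idl_C]] by blast
    have "mmult y x = idm" using x y GL_unt[OF x(2)] by (intro iota_inj) (auto simp: iota_mult mats_mult idm_mats iota_idm)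
    moreover have "y \<in> GLset CC" unfolding GLset_iff using y GL_inv[OF idl_C x(2)] by simp
    ultimately show ?thesis by blast
  qed
qed

lemma iota_inv: assumes "M \<in> GLset CC" shows "iota n (inv\<^bsub>GG\<^esub> M) = uinv (iota n M)"
proof -
  have i: "inv\<^bsub>GG\<^esub> M \<in> GLset CC" using group.inv_closed[OF GG_group] assms by (simp add: GG_simps)
  have "mmult (inv\<^bsub>GG\<^esub> M) M = idm" "mmult M (inv\<^bsub>GG\<^esub> M) = idm"
    using group.l_inv[OF GG_group] group.r_inv[OF GG_group] assms by (simp_all add: GG_simps)
  then have "iota n (inv\<^bsub>GG\<^esub> M) * iota n M = 1" "iota n M * iota n (inv\<^bsub>GG\<^esub> M) = 1"
    using iota_mult i assms iota_idm GLset_iff by metis+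
  then show ?thesis using uinv_eq by metis
qed

lemma elem_GLset: assumes "c \<in> CC" "k \<noteq> l" shows "elem k l c \<in> GLset CC" "iota n (elem k l c) = 1 + c * mx k l"
proof -
  obtain M where M: "M \<in> mats" "iota n M = 1 + c * mx k l" using GL_onto[OF idl_C elem_GL[OF idl_C assms]] by blast
  define r where "r = Suc (k + l)"
  have r: "bnd r (elem k l c)" by (auto simp: bnd_def elem_def r_def)
  have e: "elem k l c \<in> mats" using r fin_dev_bnd[of "elem k l c"] assms(1)
    by (auto simp: mats_def elem_def intro!: Sn_add idm_Sn Sn_0)
  have "tm r (\<lambda>i j. elem k l c i j - idm i j) = (\<Sum>i<r. if i = k then c * mx k l else 0)"
    unfolding tm_def elem_def by (intro sum.cong refl) (auto simp: r_def if_distrib[of "\<lambda>x. x * _"] cong: if_cong)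
  then show i: "iota n (elem k l c) = 1 + c * mx k l" unfolding iota_tm[OF r] by (simp add: r_def)
  show "elem k l c \<in> GLset CC" unfolding GLset_iff i using e elem_GL[OF idl_C assms] by simp
qed

lemma Einf_iff: "M \<in> Einf CC \<longleftrightarrow> M \<in> mats \<and> iota n M \<in> El CC"
proof
  assume "M \<in> Einf CC"
  then show "M \<in> mats \<and> iota n M \<in> El CC" unfolding Einf_def
  proof (induction M rule: generate.induct)
    case one
    then show ?case by (simp add: GG_simps idm_mats iota_idm El.one)
  next
    case (incl h)
    then obtain k l c where "h = elem k l c" "k \<noteq> l" "c \<in> CC" by blast
    then show ?case using elem_GLset GLset_iff El_elem by simp
  next
    case (inv h)
    then obtain k l c where h: "h = elem k l c" "k \<noteq> l" "c \<in> CC" by blast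
    then have "h \<in> GLset CC" "iota n h \<in> El CC" using elem_GLset El_elem by auto
    then show ?case using iota_inv El_inv[OF idl_C] group.inv_closed[OF GG_group] GLset_iff by (simp add: GG_simps)
  next
    case (eng h1 h2)
    then show ?case by (simp add: GG_simps iota_mult mats_mult El_mult)
  qed
next
  assume M: "M \<in> mats \<and> iota n M \<in> El CC"
  have "\<forall>M\<in>mats. iota n M = g \<longrightarrow> M \<in> Einf CC" if "g \<in> El CC" for g
    using that
  proof (induction g rule: El.induct)
    case one
    show ?case
    proof (intro ballI impI)
      fix M assume "M \<in> mats" "iota n M = 1"
      then have M1: "M = \<one>\<^bsub>GG\<^esub>" using iota_inj[OF _ idm_mats] iota_idm by (simp add: GG_simps)
      show "M \<in> Einf CC" unfolding M1 Einf_def by (rule generate.one)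
    qed
  next
    case (step c k l g)
    show ?case
    proof (intro ballI impI)
      fix M assume M: "M \<in> mats" "iota n M = (1 + c * mx k l) * g"
      obtain M' where M': "M' \<in> mats" "iota n M' = g" using GL_onto[OF idl_C El_GL[OF idl_C step(3)]] by blast
      have mM: "M = mmult (elem k l c) M'"
        using M M' elem_GLset[OF step(1,2)] GLset_iff by (intro iota_inj) (auto simp: iota_mult mats_mult)
      have e1: "elem k l c \<in> Einf CC" unfolding Einf_def using step(1,2) by (intro generate.incl) blast
      have e2: "M' \<in> Einf CC" using step(4) M' by blast
      show "M \<in> Einf CC" unfolding mM Einf_def GG_simps(2)[symmetric]
        by (rule generate.eng[OF e1[unfolded Einf_def] e2[unfolded Einf_def]])
    qed
  qed
  then show "M \<in> Einf CC" using M by blast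
qed

lemma conj_elem:
  assumes "g \<in> Einf CC" "k \<noteq> l" "c \<in> CC"
  shows "mmult (mmult g (elem k l c)) (inv\<^bsub>GG\<^esub> g) \<in> GLset CC"
    "iota n (mmult (mmult g (elem k l c)) (inv\<^bsub>GG\<^esub> g)) = iota n g * (1 + c * mx k l) * uinv (iota n g)"
proof -
  have g: "g \<in> GLset CC" using assms(1) Einf_iff GLset_iff El_GL[OF idl_C] by blast
  have i: "inv\<^bsub>GG\<^esub> g \<in> GLset CC" using group.inv_closed[OF GG_group] g by (simp add: GG_simps)
  note e = elem_GLset[OF assms(3,2)]
  show "mmult (mmult g (elem k l c)) (inv\<^bsub>GG\<^esub> g) \<in> GLset CC" by (intro GG_mult g e i)
  have "g \<in> mats" "inv\<^bsub>GG\<^esub> g \<in> mats" "elem k l c \<in> mats" using g i e GLset_iff by auto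
  then show "iota n (mmult (mmult g (elem k l c)) (inv\<^bsub>GG\<^esub> g)) = iota n g * (1 + c * mx k l) * uinv (iota n g)"
    by (simp add: iota_mult mats_mult iota_inv[OF g] e)
qed

lemma Erel_iff: "M \<in> Erel CC P \<longleftrightarrow> M \<in> mats \<and> iota n M \<in> Er P"
proof
  let ?G = "{g \<otimes>\<^bsub>GG\<^esub> elem k l c \<otimes>\<^bsub>GG\<^esub> inv\<^bsub>GG\<^esub> g | g k l c. g \<in> Einf CC \<and> k \<noteq> l \<and> c \<in> P}"
  have base: "h \<in> GLset CC \<and> iota n h \<in> Er P" if h: "h \<in> ?G" for h
  proof -
    obtain g k l c where g: "h = mmult (mmult g (elem k l c)) (inv\<^bsub>GG\<^esub> g)" "g \<in> Einf CC" "k \<noteq> l" "c \<in> P"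
      using h by (auto simp: GG_simps)
    have gE: "iota n g \<in> El CC" using g(2) Einf_iff by blast
    show ?thesis unfolding g(1) using conj_elem[OF g(2,3) P_sub[OF g(4)]] Er_conj[OF gE Er_elem[OF g(4,3)]] by simp
  qed
  assume "M \<in> Erel CC P"
  then show "M \<in> mats \<and> iota n M \<in> Er P" unfolding Erel_def
  proof (induction M rule: generate.induct)
    case one
    then show ?case by (simp add: GG_simps idm_mats iota_idm Er.one)
  next
    case (incl h)
    then show ?case using base GLset_iff by blast
  next
    case (inv h)
    then show ?case using base[OF inv] iota_inv[of h] Er_inv[OF P_idl] group.inv_closed[OF GG_group, of h] GLset_iff by (simp add: GG_simps)
  next
    case (eng h1 h2)
    then show ?case by (simp add: GG_simps iota_mult mats_mult Er_mult)
  qed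
next
  assume M: "M \<in> mats \<and> iota n M \<in> Er P"
  have "\<forall>M\<in>mats. iota n M = g \<longrightarrow> M \<in> Erel CC P" if "g \<in> Er P" for g
    using that
  proof (induction g rule: Er.induct)
    case one
    show ?case
    proof (intro ballI impI)
      fix M assume "M \<in> mats" "iota n M = 1"
      then have M1: "M = \<one>\<^bsub>GG\<^esub>" using iota_inj[OF _ idm_mats] iota_idm by (simp add: GG_simps)
      show "M \<in> Erel CC P" unfolding M1 Erel_def by (rule generate.one)
    qed
  next
    case (step g c k l h)
    show ?case
    proof (intro ballI impI)
      fix M assume M: "M \<in> mats" "iota n M = g * (1 + c * mx k l) * uinv g * h"
      obtain M' where M': "M' \<in> mats" "iota n M' = h" using GL_onto[OF P_idl Er_GL[OF P_idl step(4)]] by blast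
      obtain L where L: "L \<in> mats" "iota n L = g" using GL_onto[OF idl_C El_GL[OF idl_C step(1)]] by blast
      have LE: "L \<in> Einf CC" using L step(1) Einf_iff by blast
      note ce = conj_elem[OF LE step(3) P_sub[OF step(2)]]
      define K where "K = mmult (mmult L (elem k l c)) (inv\<^bsub>GG\<^esub> L)"
      have mM: "M = mmult K M'"
        using M M' ce L GLset_iff unfolding K_def by (intro iota_inj) (auto simp: iota_mult mats_mult)
      have e1: "K \<in> Erel CC P" unfolding Erel_def K_def
        using step(2,3) LE by (intro generate.incl) (auto simp: GG_simps)
      have e2: "M' \<in> Erel CC P" using step(5) M' by blast
      show "M \<in> Erel CC P" unfolding mM Erel_def GG_simps(2)[symmetric]
        by (rule generate.eng[OF e1[unfolded Erel_def] e2[unfolded Erel_def]])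
    qed
  qed
  then show "M \<in> Erel CC P" using M by blast
qed

end

context jacobson_ideal begin

abbreviation "GP \<equiv> GLrel_grp CC P"

lemma GP_simps: "carrier GP = GLrel CC P" "a \<otimes>\<^bsub>GP\<^esub> b = mmult a b" "\<one>\<^bsub>GP\<^esub> = (idm :: 'k mat)"
  by (simp_all add: GLrel_grp_def GLinf_def)

lemma GP_group: "group GP"
proof -
  interpret GG: group GG by (rule GG_group)
  have "subgroup (GLrel CC P) GG"
  proof (rule GG.subgroupI; (unfold GG_simps)?)
    show "GLrel CC P \<subseteq> GLset CC" by (auto simp: GLrel_def)
    have "idm \<in> GLrel CC P" unfolding GLrel_iff using idm_mats iota_idm GL_1 by simp
    then show "GLrel CC P \<noteq> {}" by blast
    fix a assume a: "a \<in> GLrel CC P"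
    then have aS: "a \<in> GLset CC" by (simp add: GLrel_def)
    show "inv\<^bsub>GG\<^esub> a \<in> GLrel CC P"
      using a iota_inv[OF aS] GG.inv_closed[of a] aS GLset_iff GL_inv[OF P_idl] unfolding GLrel_iff by (simp add: GG_simps)
    fix b assume "b \<in> GLrel CC P"
    then show "mmult a b \<in> GLrel CC P" using a unfolding GLrel_iff by (auto simp: iota_mult mats_mult intro: GL_mult[OF P_idl])
  qed
  then show ?thesis unfolding GLrel_grp_def using subgroup.subgroup_is_group GG_group by blast
qed

lemma GP_iota:
  assumes "M \<in> carrier GP"
  shows "M \<in> mats" "iota n M \<in> GL P" "unt (iota n M)" "iota n (inv\<^bsub>GP\<^esub> M) = uinv (iota n M)"
proof -
  interpret GP: group GP by (rule GP_group)
  show M: "M \<in> mats" "iota n M \<in> GL P" "unt (iota n M)" using assms GL_unt by (auto simp: GP_simps GLrel_iff)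
  have i: "inv\<^bsub>GP\<^esub> M \<in> mats" using GP.inv_closed[OF assms] by (simp add: GP_simps GLrel_iff)
  have "mmult (inv\<^bsub>GP\<^esub> M) M = idm" "mmult M (inv\<^bsub>GP\<^esub> M) = idm"
    using GP.l_inv[OF assms] GP.r_inv[OF assms] by (simp_all add: GP_simps)
  then have "iota n (inv\<^bsub>GP\<^esub> M) * iota n M = 1" "iota n M * iota n (inv\<^bsub>GP\<^esub> M) = 1"
    unfolding iota_mult[OF i M(1), symmetric] iota_mult[OF M(1) i, symmetric] using iota_idm by simp_all
  then show "iota n (inv\<^bsub>GP\<^esub> M) = uinv (iota n M)" using uinv_eq by metis
qed

lemma GP_I: "M \<in> mats ==> iota n M \<in> GL P ==> M \<in> carrier GP"
  by (simp add: GP_simps GLrel_iff)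

lemma Erel_sub: "M \<in> Erel CC P ==> M \<in> carrier GP"
  using Erel_iff Er_GL[OF P_idl] GP_I by blast

lemma pre_GP: assumes u: "u \<in> GL P" shows "pre n u \<in> carrier GP" "iota n (pre n u) = u"
proof -
  obtain M where M: "M \<in> mats" "iota n M = u" using GL_onto[OF P_idl u] by blast
  have "M \<in> GLset CC" unfolding GLset_iff using M GL_C[OF P_idl u] by simp
  then have im: "u \<in> iota n ` GLset CC" using M by blast
  show i: "iota n (pre n u) = u" unfolding pre_def Salg_N' by (rule f_inv_into_f[OF im])
  have "pre n u \<in> GLset CC" unfolding pre_def Salg_N' by (rule inv_into_into[OF im])
  then show "pre n u \<in> carrier GP" using i u GLset_iff by (intro GP_I) auto
qed

lemma pre_eqI: assumes "M \<in> carrier GP" "u \<in> GL P" "iota n M = u" shows "M = pre n u"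
  by (rule iota_inj) (use assms pre_GP[OF assms(2)] GP_iota in auto)

lemma Erel_normal: "Erel CC P \<lhd> GP"
proof -
  interpret GP: group GP by (rule GP_group)
  have "subgroup (Erel CC P) GP"
  proof (rule GP.subgroupI)
    show "Erel CC P \<subseteq> carrier GP" using Erel_sub by blast
    have "idm \<in> Erel CC P" unfolding Erel_iff using idm_mats iota_idm Er.one by simp
    then show "Erel CC P \<noteq> {}" by blast
    fix a b assume a: "a \<in> Erel CC P" and b: "b \<in> Erel CC P"
    have ac: "a \<in> carrier GP" using Erel_sub a .
    show "inv\<^bsub>GP\<^esub> a \<in> Erel CC P"
      unfolding Erel_iff using GP_iota[OF GP.inv_closed[OF ac]] GP_iota(4)[OF ac] a Er_inv[OF P_idl] by (simp add: Erel_iff)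
    show "a \<otimes>\<^bsub>GP\<^esub> b \<in> Erel CC P" using a b unfolding GP_simps Erel_iff by (simp add: iota_mult mats_mult Er_mult)
  qed
  then show ?thesis
  proof (rule GP.normal_invI)
    fix x h assume x: "x \<in> carrier GP" and h: "h \<in> Erel CC P"
    have i: "inv\<^bsub>GP\<^esub> x \<in> mats" using GP_iota(1)[OF GP.inv_closed[OF x]] .
    show "x \<otimes>\<^bsub>GP\<^esub> h \<otimes>\<^bsub>GP\<^esub> inv\<^bsub>GP\<^esub> x \<in> Erel CC P"
      using GP_iota[OF x] h i Er_normal[OF P_idl GL_C[OF P_idl]] unfolding GP_simps Erel_iff
      by (simp add: iota_mult mats_mult)
  qed
qed

definition TT :: "(nat \<times> nat) set" where "TT = {(i,j). i \<in> S \<and> j \<in> S \<and> j < i}"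

definition thp :: "nat \<times> nat \<Rightarrow> 'k jac" where "thp p = theta (fst p) (snd p) {fst p, snd p, n}"

lemma thp_GL: "p \<in> TT ==> thp p \<in> GL P"
  unfolding thp_def by (rule theta3(2)) (auto simp: TT_def)

lemma mu_kn: "k \<in> S ==> c \<noteq> 0 ==> mu {k, n} c \<in> GL P" "k \<in> S ==> c \<noteq> 0 ==> mu {k, n} c * mu {k, n} d = mu {k, n} (c * d)"
  using mu_GL(1)[of "{k}" c] mu_GL(3)[of "{k}" c d] kn[of k] by auto

text \<open>\<open>GL_eq_H\<close> expressed through matrices: an induction over H shows that the
  preimage of each of its elements is a word in the preimages of the generators.\<close>

lemma GP_generated:
  "carrier GP = generate GP ((\<lambda>p. pre n (thp p)) ` TT \<union> (\<Union>k\<in>S. (\<lambda>c. pre n (mu {k, n} c)) ` {c. c \<noteq> 0}) \<union> Erel CC P)"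
    (is "_ = generate GP ?B")
proof
  interpret GP: group GP by (rule GP_group)
  have B: "?B \<subseteq> carrier GP" using pre_GP(1)[OF thp_GL] pre_GP(1)[OF mu_kn(1)] Erel_sub by auto
  show "generate GP ?B \<subseteq> carrier GP" by (rule GP.generate_incl[OF B])
  have "\<forall>M\<in>mats. iota n M = u \<longrightarrow> M \<in> generate GP ?B" if "u \<in> H" for u
    using that
  proof (induction u rule: H.induct)
    case (Er e)
    show ?case
    proof (intro ballI impI)
      fix M assume M: "M \<in> mats" "iota n M = e"
      then have "M \<in> Erel CC P" unfolding Erel_iff using Er by simp
      then show "M \<in> generate GP ?B" by (intro generate.incl) blast
    qed
  next
    case (theta i j)
    have p: "(i, j) \<in> TT" using theta by (simp add: TT_def)
    show ?case
    proof (intro ballI impI)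
      fix M assume M: "M \<in> mats" "iota n M = theta i j {i, j, n}"
      have "M = pre n (thp (i, j))" using M thp_GL[OF p] by (intro pre_eqI GP_I) (auto simp: thp_def)
      then show "M \<in> generate GP ?B" using p by (intro generate.incl) blast
    qed
  next
    case (theta_inv i j)
    have p: "(i, j) \<in> TT" using theta_inv by (simp add: TT_def)
    note t = pre_GP[OF thp_GL[OF p]]
    show ?case
    proof (intro ballI impI)
      fix M assume M: "M \<in> mats" "iota n M = uinv (theta i j {i, j, n})"
      have "M = inv\<^bsub>GP\<^esub> (pre n (thp (i, j)))"
        using M GP_iota(1)[OF GP.inv_closed[OF t(1)]] GP_iota(4)[OF t(1)] t(2) by (intro iota_inj) (auto simp: thp_def)
      moreover have "inv\<^bsub>GP\<^esub> (pre n (thp (i, j))) \<in> generate GP ?B" using p by (intro generate.inv) blast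
      ultimately show "M \<in> generate GP ?B" by simp
    qed
  next
    case (mu k c)
    show ?case
    proof (intro ballI impI)
      fix M assume M: "M \<in> mats" "iota n M = mu {k, n} c"
      have "M = pre n (mu {k, n} c)" using M mu_kn(1)[OF mu] by (intro pre_eqI GP_I) auto
      then show "M \<in> generate GP ?B" using mu by (intro generate.incl) blast
    qed
  next
    case (mult u v)
    show ?case
    proof (intro ballI impI)
      fix M assume M: "M \<in> mats" "iota n M = u * v"
      note p = pre_GP[OF H_GL[OF mult(1)]] pre_GP[OF H_GL[OF mult(2)]]
      have m: "pre n u \<in> mats" "pre n v \<in> mats" using GP_iota p by auto
      have eq: "M = pre n u \<otimes>\<^bsub>GP\<^esub> pre n v"
        unfolding GP_simps using M m p by (intro iota_inj) (auto simp: iota_mult mats_mult)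
      have "pre n u \<in> generate GP ?B" "pre n v \<in> generate GP ?B" using mult(3,4) m p by auto
      then show "M \<in> generate GP ?B" unfolding eq by (rule generate.eng)
    qed
  qed
  then show "carrier GP \<subseteq> generate GP ?B" using GP_iota GL_eq_H by blast
qed

lemma dual: "dual_generators GP (Erel CC P) TT S (\<lambda>p. pre n (thp p)) (\<lambda>k c. pre n (mu {k, n} c)) (\<lambda>p M. zx p (iota n M)) (\<lambda>k M. lx k (iota n M))"
proof -
  interpret GP: group GP by (rule GP_group)
  have T: "fst p \<in> S" if "p \<in> TT" for p using that by (auto simp: TT_def)
  show ?thesis
  proof (intro dual_generators.intro dual_generators_axioms.intro GP_group)
    show "finite TT" by (rule finite_subset[of _ "S \<times> S"]) (auto simp: TT_def S_fin)
    show "finite S" by (rule S_fin)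
    show "Erel CC P \<lhd> GP" by (rule Erel_normal)
    fix a b assume a: "a \<in> carrier GP" and b: "b \<in> carrier GP"
    have i: "inv\<^bsub>GP\<^esub> a \<in> mats" "inv\<^bsub>GP\<^esub> b \<in> mats" using GP_iota(1)[OF GP.inv_closed] a b by auto
    show "a \<otimes>\<^bsub>GP\<^esub> b \<otimes>\<^bsub>GP\<^esub> inv\<^bsub>GP\<^esub> a \<otimes>\<^bsub>GP\<^esub> inv\<^bsub>GP\<^esub> b \<in> Erel CC P"
      using commutator_Er[OF P_idl GL_C[OF P_idl GP_iota(2)[OF a]] GP_iota(2)[OF b]] GP_iota[OF a] GP_iota[OF b] i
      unfolding GP_simps Erel_iff by (simp add: iota_mult mats_mult)
    show "p \<in> TT ==> zx p (iota n (a \<otimes>\<^bsub>GP\<^esub> b)) = zx p (iota n a) + zx p (iota n b)" for p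
      using zx_mult[OF T GP_iota(2)[OF a] GP_iota(2)[OF b]] GP_iota(1)[OF a] GP_iota(1)[OF b] by (simp add: GP_simps iota_mult)
    show "k \<in> S ==> lx k (iota n (a \<otimes>\<^bsub>GP\<^esub> b)) = lx k (iota n a) * lx k (iota n b)" for k
      using lx_mult[OF _ GP_iota(2)[OF a] GP_iota(2)[OF b]] GP_iota(1)[OF a] GP_iota(1)[OF b] by (simp add: GP_simps iota_mult)
    show "k \<in> S ==> lx k (iota n a) \<noteq> 0" for k using lx_nz[OF _ GP_iota(2)[OF a]] .
  next
    show "p \<in> TT ==> pre n (thp p) \<in> carrier GP" for p using pre_GP(1)[OF thp_GL] .
    show "k \<in> S ==> c \<noteq> 0 ==> pre n (mu {k, n} c) \<in> carrier GP" for k c using pre_GP(1)[OF mu_kn(1)] .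
    show "pre n (mu {k, n} (c * d)) = pre n (mu {k, n} c) \<otimes>\<^bsub>GP\<^esub> pre n (mu {k, n} d)" if k: "k \<in> S" "c \<noteq> 0" "d \<noteq> 0" for k c d
    proof -
      note p = pre_GP[OF mu_kn(1)[OF k(1,2)]] pre_GP[OF mu_kn(1)[OF k(1,3)]]
      have cd: "mu {k, n} (c * d) \<in> GL P" using k by (intro mu_kn(1)) auto
      have "pre n (mu {k, n} c) \<otimes>\<^bsub>GP\<^esub> pre n (mu {k, n} d) = pre n (mu {k, n} (c * d))"
        using p cd k GP_iota(1)[OF p(1)] GP_iota(1)[OF p(3)]
        by (intro pre_eqI GP.m_closed) (simp_all add: GP_simps iota_mult mu_kn)
      then show ?thesis by simp
    qed
    show "p \<in> TT ==> e \<in> Erel CC P ==> zx p (iota n e) = 0" for p e using zx_Er[OF T] Erel_iff by blast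
    show "k \<in> S ==> e \<in> Erel CC P ==> lx k (iota n e) = 1" for k e using lx_Er Erel_iff by blast
    show "zx p (iota n (pre n (thp q))) = (if p = q then 1 else 0)" if pq: "p \<in> TT" "q \<in> TT" for p q
      unfolding pre_GP(2)[OF thp_GL[OF pq(2)]] using pq zx_theta[of "fst q" "snd q" "fst p" "snd p"]
      by (cases p; cases q) (auto simp: thp_def TT_def)
    show "lx k (iota n (pre n (thp q))) = 1" if kq: "k \<in> S" "q \<in> TT" for k q
      unfolding pre_GP(2)[OF thp_GL[OF kq(2)]] unfolding thp_def using kq by (intro lx_theta) (auto simp: TT_def)
    show "zx p (iota n (pre n (mu {k, n} c))) = 0" if "p \<in> TT" "k \<in> S" "c \<noteq> 0" for p k c
      unfolding pre_GP(2)[OF mu_kn(1)[OF that(2,3)]] using zx_mu[OF T[OF that(1)] that(2,3)] .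
    show "lx k (iota n (pre n (mu {l, n} c))) = (if k = l then c else 1)" if "k \<in> S" "l \<in> S" "c \<noteq> 0" for k l c
      unfolding pre_GP(2)[OF mu_kn(1)[OF that(2,3)]] using lx_mu[OF that] .
    show "carrier GP = generate GP ((\<lambda>p. pre n (thp p)) ` TT \<union> (\<Union>k\<in>S. (\<lambda>c. pre n (mu {k, n} c)) ` {c. c \<noteq> 0}) \<union> Erel CC P)"
      by (rule GP_generated)
  qed
qed

end

lemma card_pairs:
  assumes "finite (S :: nat set)" shows "card {(i,j). i \<in> S \<and> j \<in> S \<and> j < i} = card S choose 2"
proof -
  have "bij_betw (\<lambda>(i,j). {i,j}) {(i,j). i \<in> S \<and> j \<in> S \<and> j < i} {B. B \<subseteq> S \<and> card B = 2}"
  proof (rule bij_betwI')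
    fix p q assume "p \<in> {(i,j). i \<in> S \<and> j \<in> S \<and> j < i}" "q \<in> {(i,j). i \<in> S \<and> j \<in> S \<and> j < i}"
    then show "((case p of (i,j) \<Rightarrow> {i,j}) = (case q of (i,j) \<Rightarrow> {i,j})) = (p = q)"
      by (auto simp: doubleton_eq_iff)
  next
    fix p assume "p \<in> {(i,j). i \<in> S \<and> j \<in> S \<and> j < i}"
    then show "(case p of (i,j) \<Rightarrow> {i,j}) \<in> {B. B \<subseteq> S \<and> card B = 2}" by auto
  next
    fix B assume B: "B \<in> {B. B \<subseteq> S \<and> card B = 2}"
    then obtain x y where xy: "B = {x, y}" "x \<noteq> y" by (auto simp: card_2_iff)
    show "\<exists>p\<in>{(i,j). i \<in> S \<and> j \<in> S \<and> j < i}. B = (case p of (i,j) \<Rightarrow> {i,j})"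
    proof (cases "y < x")
      case True
      then show ?thesis using xy B by (intro bexI[of _ "(x, y)"]) auto
    next
      case False
      then show ?thesis using xy B by (intro bexI[of _ "(y, x)"]) auto
    qed
  qed
  then show ?thesis using bij_betw_same_card n_subsets[OF assms, of 2] by fastforce
qed

theorem theorem5p8:
  fixes n :: nat and S :: "nat set" and m :: nat
    and A :: "'k::field jac set" and P :: "'k jac set"
    and G :: "'k mat monoid" and E :: "'k mat set"
    and Pairs :: "(nat \<times> nat) set" and th :: "nat \<times> nat \<Rightarrow> 'k jac"
  assumes n2: "n \<ge> 2"
    and S_sub: "S \<subseteq> {1..n-1}" and S_ne: "S \<noteq> {}"
    and m_def: "m = card S"
    and A_def: "A = Salg (n - 1)"
    and P_def: "P = ideal_gen A (\<Union>i\<in>S. ideal_gen A {ee i})"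
    and G_def: "G = GLrel_grp A P"
    and E_def: "E = Erel A P"
    and Pairs_def: "Pairs = {(i,j). i \<in> S \<and> j \<in> S \<and> i > j}"
    and th_def: "\<And>i j. th (i,j) = theta i j {i, j, n}"
  shows
    \<comment> \<open>(1) generation\<close>
    "carrier G = generate G ((\<lambda>p. pre n (th p)) ` Pairs \<union> (\<Union>k\<in>S. pre n ` UI {k, n}) \<union> E)
   \<and> \<comment> \<open>(2) unique normal form, for every fixed order of the factors\<close>
     (\<forall>ps ks. distinct ps \<and> set ps = Pairs \<and> distinct ks \<and> set ks = S \<longrightarrow>
        (\<forall>a\<in>carrier G. \<exists>!(z, lam, e). (\<forall>p. p \<notin> Pairs \<longrightarrow> z p = (0::int))
            \<and> (\<forall>k\<in>S. lam k \<noteq> (0::'k)) \<and> (\<forall>k. k \<notin> S \<longrightarrow> lam k = 1) \<and> e \<in> E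
            \<and> a = foldr (\<lambda>p acc. (pre n (th p) [^]\<^bsub>G\<^esub> z p) \<otimes>\<^bsub>G\<^esub> acc) ps \<one>\<^bsub>G\<^esub>
                  \<otimes>\<^bsub>G\<^esub> foldr (\<lambda>k acc. pre n (mu {k, n} (lam k)) \<otimes>\<^bsub>G\<^esub> acc) ks \<one>\<^bsub>G\<^esub>
                  \<otimes>\<^bsub>G\<^esub> e))
   \<and> \<comment> \<open>(3) structure of K_1(S_{n-1}, p)\<close>
     K1rel A P \<cong> product_group Pairs (\<lambda>p. G\<lparr>carrier := generate G {pre n (th p)}\<rparr>)
                 \<times>\<times> product_group S (\<lambda>k. G\<lparr>carrier := pre n ` UI {k, n}\<rparr>)
   \<and> (m = 1 \<longrightarrow> K1rel A P \<cong> (Kstar :: 'k monoid))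
   \<and> (m > 1 \<longrightarrow> K1rel A P \<cong> product_group {..<m choose 2} (\<lambda>_. integer_group)
                              \<times>\<times> product_group {..<m} (\<lambda>_. (Kstar :: 'k monoid)))"
proof -
  interpret J: jacobson_ideal n S P
    by unfold_locales (use n2 S_sub S_ne P_def A_def in auto)
  have A: "A = Sn J.N'" unfolding A_def J.Salg_N' ..
  have G: "G = J.GP" and E: "E = Erel (Sn J.N') P" and T: "Pairs = J.TT" and K1: "K1rel A P = J.GP Mod Erel (Sn J.N') P"
    by (simp_all add: G_def E_def A Pairs_def J.TT_def K1rel_def)
  have th: "th = J.thp" by (rule ext) (auto simp: J.thp_def th_def)
  have U: "pre n ` UI {k, n} = (\<lambda>c. pre n (mu {k, n} c)) ` {c :: 'k. c \<noteq> 0}" for k by (auto simp: UI_def)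
  interpret D: dual_generators J.GP "Erel (Sn J.N') P" J.TT S "\<lambda>p. pre n (J.thp p)" "\<lambda>k c. pre n (mu {k, n} c)"
      "\<lambda>p M. J.zx p (iota n M)" "\<lambda>k M. J.lx k (iota n M)"
    by (rule J.dual)
  have cT: "card J.TT = m choose 2" unfolding J.TT_def m_def by (rule card_pairs[OF J.S_fin])
  \<comment> \<open>Any enumerations of the pairs and of S will do: the coordinates are merely
    relabelled to match the stated products.\<close>
  obtain f where f: "bij_betw f {..<m choose 2} J.TT"
    using ex_bij_betw_nat_finite[OF D.T] unfolding cT lessThan_atLeast0 by blast
  obtain g where g: "bij_betw g {..<m} S"
    using ex_bij_betw_nat_finite[OF J.S_fin] unfolding m_def lessThan_atLeast0 by blast
  show ?thesis
    unfolding K1 G E T th U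
  proof (intro conjI allI impI ballI)
    show "carrier J.GP = generate J.GP ((\<lambda>p. pre n (J.thp p)) ` J.TT \<union> (\<Union>k\<in>S. (\<lambda>c. pre n (mu {k, n} c)) ` {c. c \<noteq> 0}) \<union> Erel (Sn J.N') P)"
      by (rule J.GP_generated)
  next
    fix ps ks a
    assume l: "distinct ps \<and> set ps = J.TT \<and> distinct ks \<and> set ks = S" and a: "a \<in> carrier J.GP"
    show "\<exists>!(z, lam, e). (\<forall>p. p \<notin> J.TT \<longrightarrow> z p = (0::int))
            \<and> (\<forall>k\<in>S. lam k \<noteq> (0::'k)) \<and> (\<forall>k. k \<notin> S \<longrightarrow> lam k = 1) \<and> e \<in> Erel (Sn J.N') P
            \<and> a = foldr (\<lambda>p acc. (pre n (J.thp p) [^]\<^bsub>J.GP\<^esub> z p) \<otimes>\<^bsub>J.GP\<^esub> acc) ps \<one>\<^bsub>J.GP\<^esub>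
                  \<otimes>\<^bsub>J.GP\<^esub> foldr (\<lambda>k acc. pre n (mu {k, n} (lam k)) \<otimes>\<^bsub>J.GP\<^esub> acc) ks \<one>\<^bsub>J.GP\<^esub>
                  \<otimes>\<^bsub>J.GP\<^esub> e"
      using D.normal_form[of ps ks a] l a unfolding D.tp_def D.mp_def by blast
  next
    show "J.GP Mod Erel (Sn J.N') P \<cong> product_group J.TT (\<lambda>p. J.GP\<lparr>carrier := generate J.GP {pre n (J.thp p)}\<rparr>)
                 \<times>\<times> product_group S (\<lambda>k. J.GP\<lparr>carrier := (\<lambda>c. pre n (mu {k, n} c)) ` {c. c \<noteq> 0}\<rparr>)"
      by (rule D.quotient_internal)
  next
    assume "m = 1"
    then obtain k where k: "S = {k}" unfolding m_def by (metis card_1_singletonE)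
    have "J.TT = {}" unfolding J.TT_def using k by auto
    then show "J.GP Mod Erel (Sn J.N') P \<cong> (Kstar :: 'k monoid)" using D.quotient_single k by blast
  next
    show "J.GP Mod Erel (Sn J.N') P \<cong> product_group {..<m choose 2} (\<lambda>_. integer_group)
        \<times>\<times> product_group {..<m} (\<lambda>_. (Kstar :: 'k monoid))"
      by (rule D.quotient_external[OF f g])
  qed
qed

end
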